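(* Let $d\ge2$ and consider the Berkson errors-in-variables model $U=h(Z+\delta)+\epsilon$, where $\epsilon,\delta,Z$ are independent, $Z,\delta$ are $\mathbb{R}^d$-valued, and $\epsilon$ is real-valued, centered and square-integrable, under Assumption (B) stated in the context; i.i.d. copies $(U_j,Z_j)$, $j=1,\dots,n$, of $(U,Z)$ are observed. Suppose that the regression function $h$ fulfills the Sobolev condition $$\sum_{\mathbf{j}\in\mathbb{Z}^d}|h^{\mathrm{ft}}(\mathbf{j})|^2\,(1+\|\mathbf{j}\|^{2\alpha})\le C_\alpha^*\qquad(\ast)$$ for constants $\alpha,C_\alpha^*>0$, where $\alpha$ is sufficiently large such that $$4(\alpha-1)(\alpha+\gamma)\ge d(2\alpha+2\gamma+d).$$ Then with the choice $J_n\asymp n^{1/(2\alpha+2\gamma+d)}$, $L=\lceil\alpha\rceil-1$ and a fixed integer $K\ge2+(2D+1)K^*$ in the construction of the estimator $\hat h$, one has, uniformly over the class of $h$ satisfying $(\ast)$, $$\mathbb{E}\Big[\int_{[-\pi,\pi]^d}|\hat h(x)-h(x)|^2\,dx\Big]\lesssim n^{-2\alpha/(2\alpha+2\gamma+d)},$$ i.e. the left side is bounded by a constant not depending on $n$ or $h$ times $n^{-2\alpha/(2\alpha+2\gamma+d)}$.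
   Context: Notation. For $\mathbf{j}\in\mathbb{Z}^d$, $\phi_{\mathbf{j}}(\mathbf{x})=\exp(i\sum_{k=1}^dj_kx_k)$, and for a function $f$ the Fourier coefficients are $f^{\mathrm{ft}}(\mathbf{j})=\langle f,\phi_{\mathbf{j}}\rangle_\lambda=\int f(x)\phi_{\mathbf{j}}(x)\,dx$. $f_\delta$ is the (known) Lebesgue density of $\delta$, $\tilde f_\delta$ is the density of $-\delta$, $f_Z$ the density of $Z$, $*$ denotes convolution. Assumption (B). $h$ and $f_\delta$ are supported on some fixed compact subset of $(-\pi,\pi)^d$; the support of $h*\tilde f_\delta$ is included in some fixed compact set $S^*$, which is contained in the interior of the compact and convex support $S$ of $f_Z$; $f_Z$ is bounded away from zero on $S$ (such that the following hold: $f_Z$ is bounded away from zero by some $\rho>0$ on $S$ and bounded from above by some $\bar\rho$, and there is $\rho'>0$ such that the Euclidean balls $B_d(z,\rho')$, $z\in S^*$, are contained in $S$); the known error density is ordinary smooth, i.e. $c_\delta(1+\|\mathbf{j}\|)^{-\gamma}\le|f_\delta^{\mathrm{ft}}(\mathbf{j})|\le C_\delta(1+\|\mathbf{j}\|)^{-\gamma}$ for all $\mathbf{j}\in\mathbb{Z}^d$ and some constants $0<c_\delta<C_\delta$ and $\gamma>d/2$ (which guarantees that $f_\delta$ is square-integrable on $\mathbb{R}^d$). Constants: $\mathcal{K}=\{\kappa\in\mathbb{N}_0^d:|\kappa|\le L\}$ with $|\kappa|=\kappa_1+\dots+\kappa_d$, $K^*=\#\mathcal{K}=\binom{d+L}{L}$,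 $D=\sum_{\ell=1}^L\ell\binom{d+\ell-1}{\ell}$. Estimator. $\mathcal{J}_K$ is the collection of all subsets of $\{1,\dots,n\}$ with exactly $K$ elements ($n\ge K$). For $J\in\mathcal{J}_K$ let $C(J)=\{z\in S^*:\|z-Z_j\|<\|z-Z_k\|\ \forall j\in J,\ k\in\{1,\dots,n\}\setminus J\}$; for almost every $z\in S^*$ let $J(z)$ be the $J\in\mathcal{J}_K$ with $z\in C(J)$. Let $\xi(z,w)=\big(\prod_{k=1}^d(w_k-z_k)^{\kappa_k}\big)_{\kappa\in\mathcal{K}}$, $\mathcal{M}(z)=\sum_{j\in J(z)}\xi(z,Z_j)\xi(z,Z_j)^\top$ (invertible almost surely for the $K$ considered), and $\mathbf{e}_0\in\mathbb{R}^{\mathcal{K}}$ the unit vector whose component for $\kappa=\mathbf{0}$ is $1$. With $g_{\mathbf{j}}(u,z)=u\,\phi_{\mathbf{j}}(z)$ put $$\hat\Psi_{\mathbf{j}}=\sum_{J\in\mathcal{J}_K}\int_{C(J)}\sum_{i\in J}g_{\mathbf{j}}(U_i,Z_i)\,\mathbf{e}_0^\top\mathcal{M}(z)^{-1}\xi(z,Z_i)\,dz,$$ and, for a smoothing parameter $J_n$ and $\mathbf{J}^{(n)}=\{-J_n,\dots,J_n\}^d$, $$\hat h=(2\pi)^{-d}\sum_{\mathbf{j}\in\mathbf{J}^{(n)}}\hat\Psi_{\mathbf{j}}\,\phi_{-\mathbf{j}}/f_\delta^{\mathrm{ft}}(-\mathbf{j}).$$ *)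

theory Defs
  imports "HOL-Probability.Probability" "HOL-Library.Landau_Symbols"
begin

section \<open>Fourier coefficients, supports, convolution\<close>

definition fchar :: "int ^ 'd \<Rightarrow> real ^ 'd \<Rightarrow> complex" where
  "fchar j x = exp (\<i> * complex_of_real (\<Sum>k\<in>UNIV. real_of_int (j $ k) * x $ k))"

text \<open>The sign convention is that of the source: the character is not conjugated, so a function
  \<open>f\<close> supported in \<open>(-pi, pi)^d\<close> has the Fourier series with terms \<open>ft f j * fchar (-j)\<close>.\<close>

definition ft :: "(real ^ 'd \<Rightarrow> real) \<Rightarrow> int ^ 'd \<Rightarrow> complex" where
  "ft f j = (LINT x|lborel. complex_of_real (f x) * fchar j x)"

definition lnorm :: "int ^ 'd \<Rightarrow> real" where
  "lnorm j = norm ((\<chi> k. real_of_int (j $ k)) :: real ^ 'd)"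

definition supp :: "(real ^ 'd \<Rightarrow> real) \<Rightarrow> (real ^ 'd) set" where
  "supp f = closure {x. f x \<noteq> 0}"

definition conv :: "(real ^ 'd \<Rightarrow> real) \<Rightarrow> (real ^ 'd \<Rightarrow> real) \<Rightarrow> real ^ 'd \<Rightarrow> real" where
  "conv f g x = (LINT y|lborel. f y * g (x - y))"

definition sobolev :: "real \<Rightarrow> real \<Rightarrow> (real ^ 'd \<Rightarrow> real) \<Rightarrow> bool" where
  "sobolev \<alpha> C h \<longleftrightarrow>
     (\<lambda>j. (cmod (ft h j))\<^sup>2 * (1 + lnorm j powr (2 * \<alpha>))) summable_on UNIV \<and>
     (\<Sum>\<^sub>\<infinity>j. (cmod (ft h j))\<^sup>2 * (1 + lnorm j powr (2 * \<alpha>))) \<le> C"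

definition ordinary_smooth :: "real \<Rightarrow> real \<Rightarrow> real \<Rightarrow> (real ^ 'd \<Rightarrow> real) \<Rightarrow> bool" where
  "ordinary_smooth c C \<gamma> f \<longleftrightarrow>
     (\<forall>j. c * (1 + lnorm j) powr (- \<gamma>) \<le> cmod (ft f j) \<and>
          cmod (ft f j) \<le> C * (1 + lnorm j) powr (- \<gamma>))"

section \<open>The sampling model\<close>

text \<open>As \<open>\<epsilon>\<close> has a different type from \<open>\<delta>\<close> and \<open>Z\<close>, mutual independence is stated for the
  three generated sigma-algebras.\<close>

definition berkson_errors ::
  "'a measure \<Rightarrow> ('a \<Rightarrow> real ^ 'd) \<Rightarrow> ('a \<Rightarrow> real ^ 'd) \<Rightarrow> ('a \<Rightarrow> real)
    \<Rightarrow> (real ^ 'd \<Rightarrow> real) \<Rightarrow> (real ^ 'd \<Rightarrow> real) \<Rightarrow> bool" where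
  "berkson_errors M Z \<delta> \<epsilon> fZ f\<delta> \<longleftrightarrow>
     prob_space M \<and>
     (\<forall>x. 0 \<le> fZ x) \<and> distributed M lborel Z (\<lambda>x. ennreal (fZ x)) \<and>
     (\<forall>x. 0 \<le> f\<delta> x) \<and> distributed M lborel \<delta> (\<lambda>x. ennreal (f\<delta> x)) \<and>
     \<epsilon> \<in> borel_measurable M \<and> integrable M (\<lambda>\<omega>. (\<epsilon> \<omega>)\<^sup>2) \<and> integral\<^sup>L M \<epsilon> = 0 \<and>
     prob_space.indep_sets M
       (\<lambda>i. [sets (vimage_algebra (space M) Z borel),
             sets (vimage_algebra (space M) \<delta> borel),
             sets (vimage_algebra (space M) \<epsilon> borel)] ! i) {..<3}"

definition iid_copies ::
  "'b measure \<Rightarrow> nat \<Rightarrow> (nat \<Rightarrow> 'b \<Rightarrow> real) \<Rightarrow> (nat \<Rightarrow> 'b \<Rightarrow> real ^ 'd)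
    \<Rightarrow> 'a measure \<Rightarrow> ('a \<Rightarrow> real) \<Rightarrow> ('a \<Rightarrow> real ^ 'd) \<Rightarrow> bool" where
  "iid_copies N n Us Zs M U Z \<longleftrightarrow>
     prob_space N \<and>
     prob_space.indep_vars N (\<lambda>_. borel) (\<lambda>i \<omega>. (Us i \<omega>, Zs i \<omega>)) {1..n} \<and>
     (\<forall>i\<in>{1..n}. distr N borel (\<lambda>\<omega>. (Us i \<omega>, Zs i \<omega>)) = distr M borel (\<lambda>\<omega>. (U \<omega>, Z \<omega>)))"

section \<open>The estimator\<close>

definition multi_indices :: "nat \<Rightarrow> (nat ^ 'd) set" where
  "multi_indices L = {\<kappa>. (\<Sum>k\<in>UNIV. \<kappa> $ k) \<le> L}"

definition degree_sum :: "nat \<Rightarrow> nat \<Rightarrow> nat" where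
  "degree_sum d L = (\<Sum>l=1..L. l * ((d + l - 1) choose l))"

definition k_subsets :: "nat \<Rightarrow> nat \<Rightarrow> nat set set" where
  "k_subsets n K = {J. J \<subseteq> {1..n} \<and> card J = K}"

text \<open>In what follows \<open>u\<close> and \<open>w\<close> are the realised samples \<open>U\<^sub>1, \<dots>, U\<^sub>n\<close> and \<open>Z\<^sub>1, \<dots>, Z\<^sub>n\<close>;
  \<open>T\<close> is the set \<open>S\<^sup>*\<close>.\<close>

definition cell ::
  "(real ^ 'd) set \<Rightarrow> nat \<Rightarrow> (nat \<Rightarrow> real ^ 'd) \<Rightarrow> nat set \<Rightarrow> (real ^ 'd) set" where
  "cell T n w J = {z \<in> T. \<forall>j\<in>J. \<forall>k\<in>{1..n} - J. norm (z - w j) < norm (z - w k)}"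

definition neighbours ::
  "(real ^ 'd) set \<Rightarrow> nat \<Rightarrow> nat \<Rightarrow> (nat \<Rightarrow> real ^ 'd) \<Rightarrow> real ^ 'd \<Rightarrow> nat set" where
  "neighbours T n K w z = (THE J. J \<in> k_subsets n K \<and> z \<in> cell T n w J)"

definition xi :: "real ^ 'd \<Rightarrow> real ^ 'd \<Rightarrow> nat ^ 'd \<Rightarrow> real" where
  "xi z v \<kappa> = (\<Prod>k\<in>UNIV. (v $ k - z $ k) ^ (\<kappa> $ k))"

definition local_matrix ::
  "(real ^ 'd) set \<Rightarrow> nat \<Rightarrow> nat \<Rightarrow> (nat \<Rightarrow> real ^ 'd) \<Rightarrow> real ^ 'd \<Rightarrow> nat ^ 'd \<Rightarrow> nat ^ 'd \<Rightarrow> real" where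
  "local_matrix T n K w z \<kappa> \<kappa>' = (\<Sum>j\<in>neighbours T n K w z. xi z (w j) \<kappa> * xi z (w j) \<kappa>')"

text \<open>Inverse of a square matrix whose rows and columns are indexed by the finite set \<open>I\<close>, in the
  style of \<^const>\<open>matrix_inv\<close>. Only the entries in \<open>I \<times> I\<close> are meaningful (and unique); the
  value for a singular matrix is arbitrary.\<close>

definition matrix_inv_on :: "'i set \<Rightarrow> ('i \<Rightarrow> 'i \<Rightarrow> real) \<Rightarrow> 'i \<Rightarrow> 'i \<Rightarrow> real" where
  "matrix_inv_on I A = (SOME B. \<forall>i\<in>I. \<forall>j\<in>I.
     (\<Sum>k\<in>I. A i k * B k j) = (if i = j then 1 else 0) \<and>
     (\<Sum>k\<in>I. B i k * A k j) = (if i = j then 1 else 0))"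

text \<open>The weight \<open>e\<^sub>0\<^sup>T M(z)\<^sup>-\<^sup>1 xi(z, v)\<close>.\<close>

definition lp_weight ::
  "(real ^ 'd) set \<Rightarrow> nat \<Rightarrow> nat \<Rightarrow> nat \<Rightarrow> (nat \<Rightarrow> real ^ 'd) \<Rightarrow> real ^ 'd \<Rightarrow> real ^ 'd \<Rightarrow> real" where
  "lp_weight T n K L w z v =
     (\<Sum>\<kappa>\<in>multi_indices L. matrix_inv_on (multi_indices L) (local_matrix T n K w z) 0 \<kappa> * xi z v \<kappa>)"

definition Psi_hat ::
  "(real ^ 'd) set \<Rightarrow> nat \<Rightarrow> nat \<Rightarrow> nat \<Rightarrow> (nat \<Rightarrow> real) \<Rightarrow> (nat \<Rightarrow> real ^ 'd) \<Rightarrow> int ^ 'd \<Rightarrow> complex" where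
  "Psi_hat T n K L u w j =
     (\<Sum>J\<in>k_subsets n K. LINT z:cell T n w J|lborel.
        (\<Sum>i\<in>J. (complex_of_real (u i) * fchar j (w i)) * complex_of_real (lp_weight T n K L w z (w i))))"

definition freq_box :: "nat \<Rightarrow> (int ^ 'd) set" where
  "freq_box m = {j. \<forall>k. j $ k \<in> {- int m..int m}}"

definition h_hat ::
  "(real ^ 'd \<Rightarrow> real) \<Rightarrow> (real ^ 'd) set \<Rightarrow> nat \<Rightarrow> nat \<Rightarrow> nat \<Rightarrow> nat
    \<Rightarrow> (nat \<Rightarrow> real) \<Rightarrow> (nat \<Rightarrow> real ^ 'd) \<Rightarrow> real ^ 'd \<Rightarrow> complex" where
  "h_hat f\<delta> T n K L m u w x =
     (\<Sum>j\<in>freq_box m. Psi_hat T n K L u w j * fchar (- j) x / ft f\<delta> (- j))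
       / complex_of_real ((2 * pi) ^ CARD('d))"

end

(* Let g(z) = E h(z + delta). Then Psi_j = int g phi_j = h^ft(j) f_delta^ft(-j), so by Bessel's
   inequality the risk is at most the sum of |Psi_hat_j - Psi_j|^2 / |f_delta^ft(-j)|^2 over the
   frequency box plus the Sobolev tail of h outside it. Exchanging sum and integral gives
   Psi_hat_j = sum_i U_i phi_j(Z_i) A_i, where A_i is the integral over z of the local polynomial weight
   of Z_i at z. The noise part has variance at most a constant times E sum_i A_i^2. The weights at z
   reproduce polynomials of degree at most L, so the bias at z is at most
   C (1 + |j|)^L R(z)^L sum_i |weight_i(z)|, where R(z) is the distance from z to its K-th nearest
   design point. Both parts are controlled by the integral over z of
   sum_i weight_i(z)^2 (1 + n^(1/d) R(z))^q, which has bounded expectation: if the weights at z are large,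
   then some polynomial with coefficients of size one is small at all K neighbours, and since a small
   negative power of a polynomial is integrable, for large K this is unlikely enough for second moments
   of the weights to exist. The condition on alpha makes the bias negligible against the noise. *)
theory Submission
  imports "Jordan_Normal_Form.Determinant" "HOL-Computational_Algebra.Fundamental_Theorem_Algebra" Defs
begin

text \<open>A polynomial of degree at most L has a power -1 / (2 * L) whose integral is controlled
  by any single one of its coefficients. This replaces a lower bound on the determinant of the Gram
  matrix. That the squared weights at z sum to m^2 or more is covered by about m^N grid polynomials,
  N being the number of multi-indices, and each of them is of order 1/m at all K neighbours only
  with probability of order m^(-K / (2 * L)). Second moments follow once K is at least 6 * L * N,
  and the assumed K is that large because \<open>degree_sum d L\<close> is at least L * (L + 1) and
  L is at least 2.

  The regression function g = \<open>reg h\<close> lives on S*, which need not lie in the cube, so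
  one Fourier series does not describe it; its smoothness enters through local expansions whose
  coefficients are summable against the L-th power of the frequency.

  The condition on \<alpha> acts twice. It forces 2 * \<alpha> > d + 2, so that h is bounded and L
  is at least 2, and it makes J_n^(2L) n^(-2L/d) of order at most 1/n, which is the order of the
  noise.\<close>

no_notation vec_index (infixl \<open>$\<close> 100)
no_notation scalar_prod (infix \<open>\<bullet>\<close> 70)

section \<open>Linear algebra over finite index sets\<close>

hide_const (open) Determinant.det Matrix.mat Matrix.vec Matrix.row Matrix.col

text \<open>The matrices of the estimator are functions on the set of multi-indices. An arbitrary
  enumeration turns them into matrices with numerical indices, so that determinants and adjugates
  apply.\<close>

definition enum_of :: "'i set \<Rightarrow> nat \<Rightarrow> 'i" where
  "enum_of I = (SOME e. bij_betw e {0..<card I} I)"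

definition mat_of :: "'i set \<Rightarrow> ('i \<Rightarrow> 'i \<Rightarrow> real) \<Rightarrow> real Matrix.mat" where
  "mat_of I A = Matrix.mat (card I) (card I) (\<lambda>(i, j). A (enum_of I i) (enum_of I j))"

definition det_on :: "'i set \<Rightarrow> ('i \<Rightarrow> 'i \<Rightarrow> real) \<Rightarrow> real" where
  "det_on I A = Determinant.det (mat_of I A)"

text \<open>The adjugate divided by the determinant. The explicit rational formula is the purpose:
  it shows that the inverse depends measurably on the entries, which the choice operator in
  \<open>matrix_inv_on\<close> does not reveal.\<close>

definition inv_on :: "'i set \<Rightarrow> ('i \<Rightarrow> 'i \<Rightarrow> real) \<Rightarrow> 'i \<Rightarrow> 'i \<Rightarrow> real" where
  "inv_on I A i j = adj_mat (mat_of I A) $$ (the_inv_into {0..<card I} (enum_of I) i,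
      the_inv_into {0..<card I} (enum_of I) j) / det_on I A"

lemma bij_enum_of: "finite I \<Longrightarrow> bij_betw (enum_of I) {0..<card I} I"
  unfolding enum_of_def using ex_bij_betw_nat_finite by (metis someI_ex)

lemma mat_of_carrier: "mat_of I A \<in> carrier_mat (card I) (card I)"
  by (simp add: mat_of_def)

lemma inv_on_inverse:
  assumes I: "finite I" and d: "det_on I A \<noteq> 0" and ij: "i \<in> I" "j \<in> I"
  shows "(\<Sum>k\<in>I. A i k * inv_on I A k j) = (if i = j then 1 else 0)"
    and "(\<Sum>k\<in>I. inv_on I A i k * A k j) = (if i = j then 1 else 0)"
proof -
  let ?e = "enum_of I" and ?n = "card I"
  let ?M = "mat_of I A"
  note bij = bij_enum_of[OF I]
  define x where "x = the_inv_into {0..<?n} ?e"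
  have inj: "inj_on ?e {0..<?n}" using bij by (rule bij_betw_imp_inj_on)
  have ex: "?e (x i) = i" "x i < ?n" if "i \<in> I" for i
    using that bij f_the_inv_into_f[OF inj, of i] the_inv_into_into[OF inj, of i "{0..<?n}"]
    by (auto simp: x_def bij_betw_def)
  have xe: "x (?e k) = k" if "k < ?n" for k
    unfolding x_def using that inj by (simp add: the_inv_into_f_f)
  have M: "?M \<in> carrier_mat ?n ?n" by (rule mat_of_carrier)
  note adj = adj_mat[OF M]
  have dd: "Determinant.det ?M = det_on I A" by (simp add: det_on_def)
  have eq: "(x i = x j) = (i = j)" using ex ij by metis
  have "(\<Sum>k\<in>I. A i k * inv_on I A k j) = (\<Sum>k<?n. A i (?e k) * inv_on I A (?e k) j)"
    by (subst sum.reindex_bij_betw[OF bij, symmetric]) (simp add: lessThan_atLeast0)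
  also have "\<dots> = (\<Sum>k<?n. ?M $$ (x i, k) * adj_mat ?M $$ (k, x j)) / det_on I A"
    unfolding sum_divide_distrib
    by (intro sum.cong refl) (simp add: mat_of_def inv_on_def x_def[symmetric] ex ij xe)
  also have "(\<Sum>k<?n. ?M $$ (x i, k) * adj_mat ?M $$ (k, x j)) = (?M * adj_mat ?M) $$ (x i, x j)"
    using M adj(1) ex[OF ij(1)] ex[OF ij(2)] by (simp add: scalar_prod_def lessThan_atLeast0)
  also have "\<dots> = det_on I A * (if i = j then 1 else 0)"
    unfolding adj(2) dd using ex[OF ij(1)] ex[OF ij(2)] eq by (auto simp: smult_mat_def one_mat_def)
  finally show "(\<Sum>k\<in>I. A i k * inv_on I A k j) = (if i = j then 1 else 0)" using d by simp
  have "(\<Sum>k\<in>I. inv_on I A i k * A k j) = (\<Sum>k<?n. inv_on I A i (?e k) * A (?e k) j)"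
    by (subst sum.reindex_bij_betw[OF bij, symmetric]) (simp add: lessThan_atLeast0)
  also have "\<dots> = (\<Sum>k<?n. adj_mat ?M $$ (x i, k) * ?M $$ (k, x j)) / det_on I A"
    unfolding sum_divide_distrib
    by (intro sum.cong refl) (simp add: mat_of_def inv_on_def x_def[symmetric] ex ij xe)
  also have "(\<Sum>k<?n. adj_mat ?M $$ (x i, k) * ?M $$ (k, x j)) = (adj_mat ?M * ?M) $$ (x i, x j)"
    using M adj(1) ex[OF ij(1)] ex[OF ij(2)] by (simp add: scalar_prod_def lessThan_atLeast0)
  also have "\<dots> = det_on I A * (if i = j then 1 else 0)"
    unfolding adj(3) dd using ex[OF ij(1)] ex[OF ij(2)] eq by (auto simp: smult_mat_def one_mat_def)
  finally show "(\<Sum>k\<in>I. inv_on I A i k * A k j) = (if i = j then 1 else 0)" using d by simp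
qed

text \<open>A two-sided inverse B satisfies B = B (A A^-1) = (B A) A^-1 = A^-1, so on I x I the
  choice operator has only one possible value.\<close>

lemma matrix_inv_on_eq:
  assumes I: "finite I" and d: "det_on I A \<noteq> 0" and ij: "i \<in> I" "j \<in> I"
  shows "matrix_inv_on I A i j = inv_on I A i j"
proof -
  let ?B = "matrix_inv_on I A"
  have "\<forall>i\<in>I. \<forall>j\<in>I. (\<Sum>k\<in>I. A i k * ?B k j) = (if i = j then 1 else 0) \<and>
     (\<Sum>k\<in>I. ?B i k * A k j) = (if i = j then 1 else 0)"
    unfolding matrix_inv_on_def
    by (rule someI[where x="inv_on I A"]) (use inv_on_inverse[OF I d] in auto)
  then have B: "(\<Sum>k\<in>I. ?B i k * A k j) = (if i = j then 1 else 0)" if "i \<in> I" "j \<in> I" for i j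
    using that by blast
  have "?B i j = (\<Sum>k\<in>I. ?B i k * (if k = j then 1 else 0))"
    using I ij by (simp add: sum.delta if_distrib cong: if_cong)
  also have "\<dots> = (\<Sum>k\<in>I. ?B i k * (\<Sum>l\<in>I. A k l * inv_on I A l j))"
    by (intro sum.cong refl) (simp add: inv_on_inverse[OF I d _ ij(2)])
  also have "\<dots> = (\<Sum>l\<in>I. (\<Sum>k\<in>I. ?B i k * A k l) * inv_on I A l j)"
    unfolding sum_distrib_left sum_distrib_right by (subst sum.swap) (simp add: mult_ac)
  also have "\<dots> = (\<Sum>l\<in>I. (if i = l then 1 else 0) * inv_on I A l j)"
    by (intro sum.cong refl) (simp add: B ij)
  also have "\<dots> = inv_on I A i j"
    using I ij by (simp add: sum.delta if_distrib if_distribR cong: if_cong)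
  finally show ?thesis .
qed

lemma det_on_zero_kernel:
  assumes I: "finite I" and d: "det_on I A = 0"
  shows "\<exists>v. (\<exists>i\<in>I. v i \<noteq> 0) \<and> (\<forall>i\<in>I. (\<Sum>k\<in>I. A i k * v k) = 0)"
proof -
  let ?e = "enum_of I" and ?n = "card I"
  let ?M = "mat_of I A"
  note bij = bij_enum_of[OF I]
  have inj: "inj_on ?e {0..<?n}" using bij by (rule bij_betw_imp_inj_on)
  define x where "x = the_inv_into {0..<?n} ?e"
  have xe: "x (?e k) = k" if "k < ?n" for k
    unfolding x_def using that inj by (simp add: the_inv_into_f_f)
  have M: "?M \<in> carrier_mat ?n ?n" by (rule mat_of_carrier)
  obtain v where v: "v \<in> carrier_vec ?n" "v \<noteq> 0\<^sub>v ?n" "?M *\<^sub>v v = 0\<^sub>v ?n"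
    using det_0_iff_vec_prod_zero_field[OF M] d unfolding det_on_def by blast
  define u where "u i = vec_index v (x i)" for i
  obtain k where k: "k < ?n" "vec_index v k \<noteq> 0"
    using v(1,2) by (metis carrier_vecD eq_vecI index_zero_vec(1) index_zero_vec(2))
  have "\<exists>i\<in>I. u i \<noteq> 0"
    using k bij by (intro bexI[of _ "?e k"]) (auto simp: u_def xe bij_betw_def)
  moreover have "(\<Sum>k\<in>I. A i k * u k) = 0" if i: "i \<in> I" for i
  proof -
    obtain a where a: "a < ?n" "i = ?e a"
      using i bij unfolding bij_betw_def by (metis atLeastLessThan_iff imageE)
    have "(\<Sum>k\<in>I. A i k * u k) = (\<Sum>k<?n. A i (?e k) * u (?e k))"
      by (subst sum.reindex_bij_betw[OF bij, symmetric]) (simp add: lessThan_atLeast0)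
    also have "\<dots> = (\<Sum>k<?n. ?M $$ (a, k) * vec_index v k)"
      using a by (intro sum.cong refl) (simp add: mat_of_def u_def xe)
    also have "\<dots> = vec_index (?M *\<^sub>v v) a"
      using a v(1) M by (simp add: scalar_prod_def lessThan_atLeast0)
    finally show ?thesis using a v(3) by simp
  qed
  ultimately show ?thesis by blast
qed

section \<open>Measurability of determinants and inverses\<close>

lemma measurable_det:
  assumes "\<And>i j. i < n \<Longrightarrow> j < n \<Longrightarrow> (\<lambda>x. f x i j) \<in> borel_measurable M"
  shows "(\<lambda>x. Determinant.det (Matrix.mat n n (\<lambda>(i, j). f x i j :: real))) \<in> borel_measurable M"
proof -
  have "Determinant.det (Matrix.mat n n (\<lambda>(i, j). f x i j)) = (\<Sum>p | p permutes {0..<n}. signof p * (\<Prod>i = 0..<n. f x i (p i)))" for x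
    unfolding Determinant.det_def by (auto intro!: sum.cong arg_cong2[where f="(*)"] prod.cong simp: permutes_in_image)
  then show ?thesis
    using assms by (auto intro!: borel_measurable_sum borel_measurable_times borel_measurable_prod simp: permutes_in_image)
qed

lemma enum_of_mem: "finite I \<Longrightarrow> i < card I \<Longrightarrow> enum_of I i \<in> I"
  using bij_enum_of[of I] by (auto simp: bij_betw_def)

lemma measurable_det_on:
  assumes "finite I" "\<And>i j. i \<in> I \<Longrightarrow> j \<in> I \<Longrightarrow> (\<lambda>x. A x i j) \<in> borel_measurable M"
  shows "(\<lambda>x. det_on I (A x)) \<in> borel_measurable M"
  unfolding det_on_def mat_of_def using assms by (intro measurable_det) (auto simp: enum_of_mem)

lemma measurable_inv_on:
  assumes I: "finite I" and A: "\<And>i j. i \<in> I \<Longrightarrow> j \<in> I \<Longrightarrow> (\<lambda>x. A x i j) \<in> borel_measurable M"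
    and ij: "i \<in> I" "j \<in> I"
  shows "(\<lambda>x. inv_on I (A x) i j) \<in> borel_measurable M"
proof -
  let ?n = "card I"
  note bij = bij_enum_of[OF I]
  have inj: "inj_on (enum_of I) {0..<?n}" using bij by (rule bij_betw_imp_inj_on)
  define x where "x = the_inv_into {0..<?n} (enum_of I)"
  have ex: "x i < ?n" if "i \<in> I" for i
    using that bij the_inv_into_into[OF inj, of i "{0..<?n}"]
    by (auto simp: x_def bij_betw_def)
  \<comment> \<open>\<open>sh a\<close> enumerates the indices other than a in increasing order;
    with it a minor is again a matrix given by a formula in the entries of A.\<close>
  define sh where "sh a i = (if i < a then i else Suc i)" for a i :: nat
  have del: "mat_delete (mat_of I (A w)) a b = Matrix.mat (?n - 1) (?n - 1)
     (\<lambda>(i, j). A w (enum_of I (sh a i)) (enum_of I (sh b j)))" for w a b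
    unfolding mat_delete_def by (rule eq_matI) (auto simp: mat_of_def sh_def)
  have "(\<lambda>w. Determinant.det (mat_delete (mat_of I (A w)) (x j) (x i))) \<in> borel_measurable M"
    unfolding del using I by (intro measurable_det A enum_of_mem) (auto simp: sh_def)
  moreover have "adj_mat (mat_of I (A w)) $$ (x i, x j) = (-1) ^ (x j + x i) * Determinant.det (mat_delete (mat_of I (A w)) (x j) (x i))" for w
    using ex ij by (simp add: adj_mat_def cofactor_def mat_of_def)
  ultimately show ?thesis
    unfolding inv_on_def x_def[symmetric] using measurable_det_on[OF I A] by simp
qed

section \<open>Negative powers of polynomials\<close>

text \<open>The power -s of the modulus of x, with value infinity at 0. Real \<open>powr\<close>
  would give 0 there, and a bound through it would lose exactly the zeros of the polynomials in
  question.\<close>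

definition rpow :: "real \<Rightarrow> real \<Rightarrow> ennreal" where
  "rpow s x = inverse (ennreal (\<bar>x\<bar> powr s))"

lemma rpow_measurable [measurable]: "rpow s \<in> borel_measurable borel"
  unfolding rpow_def by measurable

text \<open>Roots are split off one at a time. A root z with |z| at most 2 may be replaced by its
  real part, as |t - Re z| is at most |t - z|. A root with |z| > 2 stays away from [-1, 1] and is
  absorbed into the constant. The list rs thus consists of real parts of the near roots.\<close>

lemma poly_root_bound:
  fixes p :: "complex poly"
  shows "\<exists>rs::real list. length rs \<le> degree p \<and> (\<forall>l. \<forall>t\<in>{-1..1}.
    cmod (coeff p l) * (\<Prod>r\<leftarrow>rs. \<bar>t - r\<bar>) \<le> 3 ^ degree p * cmod (poly p (complex_of_real t)))"
proof (induction "degree p" arbitrary: p)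
  case 0
  then obtain a where "p = [:a:]"
    using degree_eq_zeroE by metis
  then show ?case
    by (intro exI[of _ "[]"]) (auto simp: coeff_pCons split: nat.splits)
next
  case (Suc n)
  have "\<not> constant (poly p)"
    using Suc(2) by (metis constant_degree nat.distinct(1))
  then obtain z where "poly p z = 0"
    using fundamental_theorem_of_algebra by blast
  then obtain q where q: "p = [:-z, 1:] * q"
    using poly_eq_0_iff_dvd by (metis dvdE)
  have "q \<noteq> 0" using q Suc(2) by auto
  then have dq: "degree q = n"
    using Suc(2) q by (simp add: degree_mult_eq del: mult_pCons_left)
  obtain rs where rs: "length rs \<le> n"
    "\<And>l t. t\<in>{-1..1} \<Longrightarrow> cmod (coeff q l) * (\<Prod>r\<leftarrow>rs. \<bar>t - r\<bar>) \<le> 3 ^ n * cmod (poly q (complex_of_real t))"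
    using Suc(1)[of q] dq by metis
  have pt: "cmod (poly p (complex_of_real t)) = cmod (complex_of_real t - z) * cmod (poly q (complex_of_real t))" for t
    by (simp add: q norm_mult[symmetric] algebra_simps)
  \<comment> \<open>Multiplication by X - z enlarges a common bound on the coefficients by at most
    the factor 1 + |z|.\<close>
  have cf: "cmod (coeff p l) * c \<le> (1 + cmod z) * b"
    if "c \<ge> 0" "\<And>l. cmod (coeff q l) * c \<le> b" for l c b
  proof -
    have b: "b \<ge> 0" using that(1) that(2)[of 0] by (smt (verit) mult_nonneg_nonneg norm_ge_zero)
    show ?thesis
    proof (cases l)
      case 0
      have "cmod (coeff p l) * c = cmod z * (cmod (coeff q 0) * c)"
        by (simp add: q 0 norm_mult)
      also have "\<dots> \<le> cmod z * b" using that by (intro mult_left_mono) auto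
      finally show ?thesis using b by (simp add: algebra_simps)
    next
      case (Suc k)
      have "cmod (coeff p l) * c \<le> (cmod z * cmod (coeff q (Suc k)) + cmod (coeff q k)) * c"
        using norm_triangle_ineq4[of "coeff q k" "z * coeff q (Suc k)"] that(1)
        by (intro mult_right_mono) (auto simp: q Suc norm_mult)
      also have "\<dots> = cmod z * (cmod (coeff q (Suc k)) * c) + cmod (coeff q k) * c"
        by (simp add: algebra_simps)
      also have "\<dots> \<le> cmod z * b + b" using that by (intro add_mono mult_left_mono) auto
      finally show ?thesis by (simp add: algebra_simps)
    qed
  qed
  have nn: "(\<Prod>r\<leftarrow>rs. \<bar>t - r\<bar>) \<ge> 0" for t by (induction rs) auto
  show ?case
  proof (cases "cmod z \<le> 2")
    case True
    show ?thesis
    proof (intro exI[of _ "Re z # rs"] conjI allI ballI)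
      show "length (Re z # rs) \<le> degree p" using rs Suc(2) by simp
      fix l and t :: real assume t: "t \<in> {-1..1}"
      have "cmod (coeff p l) * (\<Prod>r\<leftarrow>Re z # rs. \<bar>t - r\<bar>)
         = \<bar>t - Re z\<bar> * (cmod (coeff p l) * (\<Prod>r\<leftarrow>rs. \<bar>t - r\<bar>))" by simp
      also have "\<dots> \<le> cmod (complex_of_real t - z) * ((1 + cmod z) * (3 ^ n * cmod (poly q (complex_of_real t))))"
        using abs_Re_le_cmod[of "complex_of_real t - z"] rs(2)[OF t] nn[of t]
        by (intro mult_mono[OF _ cf] mult_nonneg_nonneg) auto
      also have "\<dots> \<le> cmod (complex_of_real t - z) * (3 * (3 ^ n * cmod (poly q (complex_of_real t))))"
        using True by (intro mult_left_mono mult_right_mono) auto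
      also have "\<dots> = 3 ^ degree p * cmod (poly p (complex_of_real t))"
        unfolding pt Suc(2)[symmetric] by simp
      finally show "cmod (coeff p l) * (\<Prod>r\<leftarrow>Re z # rs. \<bar>t - r\<bar>) \<le> 3 ^ degree p * cmod (poly p (complex_of_real t))" .
    qed
  next
    case False
    show ?thesis
    proof (intro exI[of _ rs] conjI allI ballI)
      show "length rs \<le> degree p" using rs Suc(2) by simp
      fix l and t :: real assume t: "t \<in> {-1..1}"
      have "cmod z - 1 \<le> cmod (complex_of_real t - z)"
        using norm_triangle_ineq2[of z "complex_of_real t"] t by (simp add: norm_minus_commute abs_if split: if_splits)
      \<comment> \<open>This cancels the growth 1 + |z| of the coefficients against the factor |t -
        z| of the value, at the price of a factor 3.\<close>
      then have 1: "1 + cmod z \<le> 3 * cmod (complex_of_real t - z)" using False by linarith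
      have "cmod (coeff p l) * (\<Prod>r\<leftarrow>rs. \<bar>t - r\<bar>) \<le> (1 + cmod z) * (3 ^ n * cmod (poly q (complex_of_real t)))"
        using rs(2)[OF t] nn by (intro cf) auto
      also have "\<dots> \<le> (3 * cmod (complex_of_real t - z)) * (3 ^ n * cmod (poly q (complex_of_real t)))"
        using 1 by (intro mult_right_mono) auto
      also have "\<dots> = 3 ^ degree p * cmod (poly p (complex_of_real t))"
        unfolding pt Suc(2)[symmetric] by simp
      finally show "cmod (coeff p l) * (\<Prod>r\<leftarrow>rs. \<bar>t - r\<bar>) \<le> 3 ^ degree p * cmod (poly p (complex_of_real t))" .
    qed
  qed
qed

text \<open>The bound is uniform in r. Where t is at distance at least 1 from r the integrand is at
  most 1, which contributes at most the length 2 of the interval; the singularity contributes 2 on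
  each side of r.\<close>

lemma nn_integral_rpow_half:
  "(\<integral>\<^sup>+t\<in>{-1..1}. rpow (1/2) (t - r) \<partial>lborel) \<le> 6"
proof -
  have I: "(\<integral>\<^sup>+t. rpow (1/2) t * indicator {0..1} t \<partial>lborel) = 2"
  proof -
    have "((\<lambda>t. t powr (-1/2)) has_integral (1 powr (-1/2+1) / (-1/2+1))) {0..1::real}"
      by (rule has_integral_powr_from_0) auto
    then have "((\<lambda>t. t powr (-1/2)) has_integral 2) {0..1::real}" by simp
    then have *: "(\<integral>\<^sup>+t. ennreal (indicator {0..1} t * t powr (-1/2)) \<partial>lborel) = 2"
      by (subst nn_integral_has_integral_lebesgue[where f="\<lambda>t. t powr (-1/2)" and I=2 and \<Omega>="{0..1}"]) auto
    have "(\<integral>\<^sup>+t. rpow (1/2) t * indicator {0..1} t \<partial>lborel) = (\<integral>\<^sup>+t. ennreal (indicator {0..1} t * t powr (-1/2)) \<partial>lborel)"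
    proof (rule nn_integral_cong_AE, rule AE_mp[OF AE_lborel_singleton[of "0::real"]], rule AE_I2, rule impI)
      fix t :: real assume t: "t \<noteq> 0"
      show "rpow (1/2) t * indicator {0..1} t = ennreal (indicator {0..1} t * t powr (-1/2))"
      proof (cases "t \<in> {0..1}")
        case True
        then have "t > 0" using t by simp
        then show ?thesis using True by (simp add: rpow_def powr_minus_divide inverse_ennreal inverse_eq_divide)
      qed simp
    qed
    then show ?thesis using * by simp
  qed
  have I1: "(\<integral>\<^sup>+t. rpow (1/2) (t - r) * indicator {0..1} (t - r) \<partial>lborel) = 2"
    using nn_integral_real_affine[of "\<lambda>t. rpow (1/2) t * indicator {0..1} t" 1 "-r"] I
    by simp
  have I2: "(\<integral>\<^sup>+t. rpow (1/2) (r - t) * indicator {0..1} (r - t) \<partial>lborel) = 2"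
    using nn_integral_real_affine[of "\<lambda>t. rpow (1/2) t * indicator {0..1} t" "-1" "r"] I
    by simp
  have "(\<integral>\<^sup>+t\<in>{-1..1}. rpow (1/2) (t - r) \<partial>lborel) \<le>
    (\<integral>\<^sup>+t. indicator {-1..1} t + (rpow (1/2) (t - r) * indicator {0..1} (t - r) + rpow (1/2) (r - t) * indicator {0..1} (r - t)) \<partial>lborel)"
  proof (rule nn_integral_mono)
    fix t :: real
    consider "0 \<le> t - r" "t - r \<le> 1" | "0 \<le> r - t" "r - t \<le> 1" | "\<bar>t - r\<bar> \<ge> 1" by linarith
    then show "rpow (1/2) (t - r) * indicator {-1..1} t \<le> indicator {-1..1} t + (rpow (1/2) (t - r) * indicator {0..1} (t - r) + rpow (1/2) (r - t) * indicator {0..1} (r - t))"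
    proof cases
      case 3
      then have "\<bar>t - r\<bar> powr (1/2) \<ge> 1" by (intro ge_one_powr_ge_zero) auto
      then have "inverse (ennreal (\<bar>t - r\<bar> powr (1/2))) \<le> 1"
        by (subst inverse_ennreal) (auto intro!: inverse_le_1_iff[THEN iffD2])
      then have "rpow (1/2) (t - r) * indicator {-1..1} t \<le> indicator {-1..1} t"
        unfolding rpow_def by (auto split: split_indicator)
      then show ?thesis by (rule order_trans) simp
    qed (auto simp: rpow_def abs_minus_commute add_increasing add_increasing2 split: split_indicator)
  qed
  also have "\<dots> = 2 + (2 + 2)"
    using I1 I2 by (subst nn_integral_add, simp, simp)+ simp
  finally show ?thesis by simp
qed

text \<open>Put Y = 1 + sum of |t - r|^(-1/2). Every factor |t - r| is at least Y^(-2), hence the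
  product of at most L of them is at least Y^(-2L). The power -1 / (2 * L) turns this into a bound
  linear in Y, that is, into a sum of integrable singularities. This is the origin of the
  exponent.\<close>

lemma rpow_poly_pointwise:
  fixes rs :: "real list" and a P Y :: real
  assumes "L \<ge> 1" "length rs \<le> L" "\<bar>a\<bar> * (\<Prod>r\<leftarrow>rs. \<bar>t - r\<bar>) \<le> 3 ^ L * \<bar>P\<bar>"
  shows "rpow (1 / (2 * real L)) P \<le> 3 * rpow (1 / (2 * real L)) a * (1 + (\<Sum>r\<leftarrow>rs. rpow (1/2) (t - r)))"
proof (cases "a = 0 \<or> t \<in> set rs")
  case True
  \<comment> \<open>If a = 0 or t is one of the points r, then the right-hand side is
    infinite.\<close>
  have pos: "1 + (\<Sum>r\<leftarrow>rs. rpow (1/2) (t - r)) \<noteq> 0" by simp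
  show ?thesis
  proof (cases "a = 0")
    case True
    then have "rpow (1 / (2 * real L)) a = \<infinity>" using assms by (simp add: rpow_def)
    then show ?thesis using pos by (simp add: ennreal_mult_top ennreal_top_mult)
  next
    case False
    then have t: "t \<in> set rs" using True by simp
    then have "(\<Sum>r\<leftarrow>rs. rpow (1/2) (t - r)) = \<infinity>"
      by (induction rs) (auto simp: rpow_def)
    moreover have "rpow (1 / (2 * real L)) a \<noteq> 0" by (simp add: rpow_def)
    ultimately show ?thesis by (simp add: ennreal_mult_top)
  qed
next
  case False
  define Y where "Y = 1 + (\<Sum>r\<leftarrow>rs. \<bar>t - r\<bar> powr (-1/2))"
  have s0: "0 \<le> (\<Sum>r\<leftarrow>rs. \<bar>t - r\<bar> powr (-1/2))" for rs by (induction rs) auto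
  have Y: "Y \<ge> 1" using s0[of rs] by (simp add: Y_def)
  have E: "1 + (\<Sum>r\<leftarrow>rs. rpow (1/2) (t - r)) = ennreal Y"
  proof -
    have "(\<Sum>r\<leftarrow>rs. rpow (1/2) (t - r)) = ennreal (\<Sum>r\<leftarrow>rs. \<bar>t - r\<bar> powr (-1/2))"
      using False
    proof (induction rs)
      case (Cons r rs)
      then have "rpow (1/2) (t - r) = ennreal (\<bar>t - r\<bar> powr (-1/2))"
        by (auto simp: rpow_def powr_minus inverse_ennreal)
      with Cons show ?case using s0[of rs] by simp
    qed simp
    then show ?thesis using s0[of rs] by (simp add: Y_def)
  qed
  have lb: "1 / Y\<^sup>2 \<le> \<bar>t - r\<bar>" if "r \<in> set rs" for r
  proof -
    have "\<bar>t - r\<bar> powr (-1/2) \<le> (\<Sum>r\<leftarrow>rs. \<bar>t - r\<bar> powr (-1/2))"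
      using that s0 by (induction rs) (auto simp: add_increasing add_increasing2)
    then have "\<bar>t - r\<bar> powr (-1/2) \<le> Y" by (simp add: Y_def)
    then have "(\<bar>t - r\<bar> powr (-1/2))\<^sup>2 \<le> Y\<^sup>2" by (intro power_mono) auto
    moreover have "(\<bar>t - r\<bar> powr (-1/2))\<^sup>2 = 1 / \<bar>t - r\<bar>"
    proof -
      have "(\<bar>t - r\<bar> powr (-1/2))\<^sup>2 = \<bar>t - r\<bar> powr (-1)"
        unfolding power2_eq_square powr_add[symmetric] by simp
      then show ?thesis by (simp add: powr_minus_divide)
    qed
    ultimately have "1 / \<bar>t - r\<bar> \<le> Y\<^sup>2" by simp
    moreover have "0 < \<bar>t - r\<bar>" using that False by auto
    ultimately show ?thesis using Y by (simp add: field_simps)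
  qed
  have pr: "1 / (Y\<^sup>2) ^ L \<le> (\<Prod>r\<leftarrow>rs. \<bar>t - r\<bar>)"
  proof -
    have "1 / (Y\<^sup>2) ^ L \<le> (1 / Y\<^sup>2) ^ length rs"
      using Y assms(2) by (simp add: power_one_over field_simps power_increasing)
    also have "\<dots> \<le> (\<Prod>r\<leftarrow>rs. \<bar>t - r\<bar>)"
      using lb
    proof (induction rs)
      case (Cons r rs)
      then have "1 / Y\<^sup>2 * (1 / Y\<^sup>2) ^ length rs \<le> \<bar>t - r\<bar> * (\<Prod>r\<leftarrow>rs. \<bar>t - r\<bar>)"
        by (intro mult_mono) auto
      then show ?case by simp
    qed simp
    finally show ?thesis .
  qed
  have a: "a \<noteq> 0" using False by simp
  have "\<bar>a\<bar> * (1 / (Y\<^sup>2) ^ L) \<le> \<bar>a\<bar> * (\<Prod>r\<leftarrow>rs. \<bar>t - r\<bar>)"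
    by (intro mult_left_mono pr) auto
  then have "\<bar>a\<bar> * (1 / (Y\<^sup>2) ^ L) \<le> 3 ^ L * \<bar>P\<bar>" using assms(3) by linarith
  then have Pb: "\<bar>a\<bar> / (3 * Y\<^sup>2) ^ L \<le> \<bar>P\<bar>" using Y by (simp add: field_simps power_mult_distrib)
  have lhs_pos: "0 < \<bar>a\<bar> / (3 * Y\<^sup>2) ^ L" using a Y by simp
  then have P0: "P \<noteq> 0" using Pb by auto
  have "(\<bar>a\<bar> / (3 * Y\<^sup>2) ^ L) powr (1 / (2 * real L)) \<le> \<bar>P\<bar> powr (1 / (2 * real L))"
    using Pb lhs_pos by (intro powr_mono2) auto
  moreover have "(\<bar>a\<bar> / (3 * Y\<^sup>2) ^ L) powr (1 / (2 * real L)) = \<bar>a\<bar> powr (1 / (2 * real L)) / (sqrt 3 * Y)"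
  proof -
    have "((3 * Y\<^sup>2) ^ L) powr (1 / (2 * real L)) = (3 * Y\<^sup>2) powr (1/2)"
    proof -
      have "(3 * Y\<^sup>2) ^ L = (3 * Y\<^sup>2) powr real L" using Y by (subst powr_realpow) auto
      then have "((3 * Y\<^sup>2) ^ L) powr (1 / (2 * real L)) = (3 * Y\<^sup>2) powr (real L * (1 / (2 * real L)))"
        by (simp only: powr_powr)
      also have "real L * (1 / (2 * real L)) = 1 / 2" using assms(1) by simp
      finally show ?thesis .
    qed
    also have "\<dots> = sqrt (3 * Y\<^sup>2)" using Y by (simp add: powr_half_sqrt)
    also have "\<dots> = sqrt 3 * Y" using Y by (simp add: real_sqrt_mult)
    finally show ?thesis by (simp add: powr_divide)
  qed
  ultimately have "\<bar>a\<bar> powr (1 / (2 * real L)) / (sqrt 3 * Y) \<le> \<bar>P\<bar> powr (1 / (2 * real L))" by simp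
  then have "inverse (\<bar>P\<bar> powr (1 / (2 * real L))) \<le> inverse (\<bar>a\<bar> powr (1 / (2 * real L)) / (sqrt 3 * Y))"
    using Y a by (intro le_imp_inverse_le) auto
  also have "\<dots> = sqrt 3 * inverse (\<bar>a\<bar> powr (1 / (2 * real L))) * Y" by (simp add: field_simps)
  also have "\<dots> \<le> 3 * inverse (\<bar>a\<bar> powr (1 / (2 * real L))) * Y"
    using Y by (intro mult_right_mono) (auto simp: real_le_lsqrt)
  finally have R: "inverse (\<bar>P\<bar> powr (1 / (2 * real L))) \<le> 3 * inverse (\<bar>a\<bar> powr (1 / (2 * real L))) * Y" .
  have "rpow (1 / (2 * real L)) P = ennreal (inverse (\<bar>P\<bar> powr (1 / (2 * real L))))"
    using P0 by (simp add: rpow_def inverse_ennreal)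
  also have "\<dots> \<le> ennreal (3 * inverse (\<bar>a\<bar> powr (1 / (2 * real L))) * Y)"
    using R by (rule ennreal_leI)
  also have "\<dots> = 3 * rpow (1 / (2 * real L)) a * ennreal Y"
    using a Y by (simp add: rpow_def inverse_ennreal ennreal_mult)
  finally show ?thesis unfolding E .
qed

text \<open>The constant is 3 * (2 + 6 * L): the pointwise factor 3, the length of the interval, and
  at most L singularities of mass at most 6. The index l is free, and this freedom drives the
  induction on the number of variables.\<close>

lemma nn_integral_rpow_poly:
  assumes L: "L \<ge> 1" and l: "l \<le> L"
  shows "(\<integral>\<^sup>+t\<in>{-1..1}. rpow (1 / (2 * real L)) (\<Sum>l\<le>L. a l * t ^ l) \<partial>lborel)
    \<le> of_nat (6 + 18 * L) * rpow (1 / (2 * real L)) (a l)"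
proof -
  define p where "p = (\<Sum>l\<le>L. monom (complex_of_real (a l)) l)"
  have pt: "poly p (complex_of_real t) = complex_of_real (\<Sum>l\<le>L. a l * t ^ l)" for t
    by (simp add: p_def poly_sum poly_monom)
  have pl: "coeff p l = complex_of_real (a l)"
    using l by (simp add: p_def coeff_sum)
  have dp: "degree p \<le> L"
    unfolding p_def by (intro degree_sum_le) (auto intro: order_trans[OF degree_monom_le])
  obtain rs :: "real list" where rs: "length rs \<le> degree p"
    "\<And>l t. t\<in>{-1..1} \<Longrightarrow> cmod (coeff p l) * (\<Prod>r\<leftarrow>rs. \<bar>t - r\<bar>) \<le> 3 ^ degree p * cmod (poly p (complex_of_real t))"
    using poly_root_bound[of p] by metis
  have b: "\<bar>a l\<bar> * (\<Prod>r\<leftarrow>rs. \<bar>t - r\<bar>) \<le> 3 ^ L * \<bar>\<Sum>l\<le>L. a l * t ^ l\<bar>" if "t \<in> {-1..1}" for t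
  proof -
    have "\<bar>a l\<bar> * (\<Prod>r\<leftarrow>rs. \<bar>t - r\<bar>) \<le> 3 ^ degree p * \<bar>\<Sum>l\<le>L. a l * t ^ l\<bar>"
      using rs(2)[OF that, of l] unfolding pl pt norm_of_real .
    also have "\<dots> \<le> 3 ^ L * \<bar>\<Sum>l\<le>L. a l * t ^ l\<bar>"
      using dp by (intro mult_right_mono power_increasing) auto
    finally show ?thesis .
  qed
  have "(\<integral>\<^sup>+t\<in>{-1..1}. rpow (1 / (2 * real L)) (\<Sum>l\<le>L. a l * t ^ l) \<partial>lborel)
    \<le> (\<integral>\<^sup>+t. 3 * rpow (1 / (2 * real L)) (a l) * (indicator {-1..1} t + (\<Sum>r\<leftarrow>rs. rpow (1/2) (t - r) * indicator {-1..1} t)) \<partial>lborel)"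
  proof (rule nn_integral_mono)
    fix t :: real
    have "rpow (1 / (2 * real L)) (\<Sum>l\<le>L. a l * t ^ l) \<le> 3 * rpow (1 / (2 * real L)) (a l) * (1 + (\<Sum>r\<leftarrow>rs. rpow (1/2) (t - r)))"
      if "t \<in> {-1..1}"
      using rs dp L b[OF that] by (intro rpow_poly_pointwise) auto
    then show "rpow (1 / (2 * real L)) (\<Sum>l\<le>L. a l * t ^ l) * indicator {-1..1} t
      \<le> 3 * rpow (1 / (2 * real L)) (a l) * (indicator {-1..1} t + (\<Sum>r\<leftarrow>rs. rpow (1/2) (t - r) * indicator {-1..1} t))"
      by (cases "t \<in> {-1..1}") auto
  qed
  also have "\<dots> = 3 * rpow (1 / (2 * real L)) (a l) * (2 + (\<Sum>r\<leftarrow>rs. \<integral>\<^sup>+t\<in>{-1..1}. rpow (1/2) (t - r) \<partial>lborel))"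
  proof -
    have "(\<lambda>t. \<Sum>r\<leftarrow>rs. rpow (1/2) (t - r) * indicator {-1..1::real} t) \<in> borel_measurable lborel
      \<and> (\<integral>\<^sup>+t. (\<Sum>r\<leftarrow>rs. rpow (1/2) (t - r) * indicator {-1..1} t) \<partial>lborel) = (\<Sum>r\<leftarrow>rs. \<integral>\<^sup>+t\<in>{-1..1}. rpow (1/2) (t - r) \<partial>lborel)"
      by (induction rs) (auto simp: nn_integral_add)
    then show ?thesis
      by (subst nn_integral_cmult, simp) (subst nn_integral_add, auto)
  qed
  also have "(\<Sum>r\<leftarrow>rs. \<integral>\<^sup>+t\<in>{-1..1}. rpow (1/2) (t - r) \<partial>lborel) \<le> of_nat (6 * length rs)"
  proof (induction rs)
    case (Cons r rs)
    then show ?case using nn_integral_rpow_half[of r] by (simp add: add_mono)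
  qed simp
  also have "of_nat (6 * length rs) \<le> (of_nat (6 * L) :: ennreal)"
    using rs dp by (intro of_nat_mono) auto
  also have "3 * rpow (1 / (2 * real L)) (a l) * (2 + of_nat (6 * L)) = of_nat (6 + 18 * L) * rpow (1 / (2 * real L)) (a l)"
    by (simp add: algebra_simps)
  finally show ?thesis by (simp add: mult_left_mono add_left_mono)
qed

text \<open>The variable x i is integrated first. As a polynomial in x i alone it has coefficients
  that are polynomials in the other variables, and the one-variable bound passes from the whole
  polynomial to its coefficient at the power \<open>\<kappa> i\<close>. Repeating this isolates the
  single number \<open>c \<kappa>\<close>.\<close>

lemma nn_integral_rpow_multi:
  fixes c :: "('k \<Rightarrow> nat) \<Rightarrow> real"
  assumes L: "L \<ge> 1" and I: "finite I" and \<kappa>: "\<kappa> \<in> PiE I (\<lambda>_. {..L})"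
  shows "(\<integral>\<^sup>+x. (\<Prod>k\<in>I. indicator {-1..1} (x k)) *
        rpow (1 / (2 * real L)) (\<Sum>\<kappa>\<in>PiE I (\<lambda>_. {..L}). c \<kappa> * (\<Prod>k\<in>I. x k ^ \<kappa> k)) \<partial>PiM I (\<lambda>_. lborel))
    \<le> of_nat (6 + 18 * L) ^ card I * rpow (1 / (2 * real L)) (c \<kappa>)"
  using I \<kappa>
proof (induction I arbitrary: c \<kappa>)
  case empty
  interpret product_sigma_finite "\<lambda>_::'k. lborel :: real measure" ..
  from empty have "\<kappa> = (\<lambda>_. undefined)" by simp
  then show ?case by (simp add: PiM_empty nn_integral_count_space_finite)
next
  case (insert i I)
  interpret product_sigma_finite "\<lambda>_::'k. lborel :: real measure" ..
  define s where "s = 1 / (2 * real L)"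
  \<comment> \<open>\<open>q l\<close> is the coefficient of the l-th power of the variable that is
    integrated out.\<close>
  define q where "q l x = (\<Sum>\<kappa>\<in>PiE I (\<lambda>_. {..L}). c (\<kappa>(i := l)) * (\<Prod>k\<in>I. x k ^ \<kappa> k))" for l and x :: "'k \<Rightarrow> real"
  have meas [measurable]: "(\<lambda>x. (\<Prod>k\<in>I. indicator {-1..1} (x k)) *
        rpow s (\<Sum>\<kappa>\<in>PiE I (\<lambda>_. {..L}). c \<kappa> * (\<Prod>k\<in>I. x k ^ \<kappa> k))) \<in> borel_measurable (PiM I (\<lambda>_. lborel))" for I :: "'k set" and c
  proof -
    have m0: "(\<lambda>x. x k) \<in> borel_measurable (PiM I (\<lambda>_. lborel :: real measure))" if "k \<in> I" for k :: 'k
      using measurable_component_singleton[OF that, of "\<lambda>_. lborel :: real measure"] by simp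
    have m1: "(\<lambda>x. indicator {-1..1} (x k) :: ennreal) \<in> borel_measurable (PiM I (\<lambda>_. lborel :: real measure))" if "k \<in> I" for k :: 'k
      using m0[OF that] by measurable
    have m2: "(\<lambda>x. x k ^ e) \<in> borel_measurable (PiM I (\<lambda>_. lborel :: real measure))" if "k \<in> I" for k :: 'k and e
      using m0[OF that] by measurable
    show ?thesis
      by (intro borel_measurable_times_ennreal borel_measurable_prod_ennreal measurable_compose[OF _ rpow_measurable]
        borel_measurable_sum borel_measurable_times borel_measurable_prod borel_measurable_const m1 m2)
  qed
  have split: "(\<Sum>\<kappa>\<in>PiE (insert i I) (\<lambda>_. {..L}). c \<kappa> * (\<Prod>k\<in>insert i I. (x(i := t)) k ^ \<kappa> k)) = (\<Sum>l\<le>L. q l x * t ^ l)" for x t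
  proof -
    have "(\<Sum>\<kappa>\<in>PiE (insert i I) (\<lambda>_. {..L}). c \<kappa> * (\<Prod>k\<in>insert i I. (x(i := t)) k ^ \<kappa> k))
      = (\<Sum>(l, \<kappa>)\<in>{..L} \<times> PiE I (\<lambda>_. {..L}). c (\<kappa>(i := l)) * (\<Prod>k\<in>insert i I. (x(i := t)) k ^ (\<kappa>(i := l)) k))"
      unfolding PiE_insert_eq using inj_combinator[OF insert(2), of "\<lambda>_. {..L}"]
      by (subst sum.reindex) (auto simp: case_prod_beta intro!: sum.cong)
    also have "\<dots> = (\<Sum>l\<le>L. \<Sum>\<kappa>\<in>PiE I (\<lambda>_. {..L}). c (\<kappa>(i := l)) * (t ^ l * (\<Prod>k\<in>I. x k ^ \<kappa> k)))"
      unfolding sum.cartesian_product[symmetric]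
    proof (intro sum.cong refl arg_cong2[where f="(*)"])
      fix l \<kappa>
      have "(\<Prod>k\<in>I. (x(i := t)) k ^ (\<kappa>(i := l)) k) = (\<Prod>k\<in>I. x k ^ \<kappa> k)"
        using insert by (intro prod.cong) auto
      then show "(\<Prod>k\<in>insert i I. (x(i := t)) k ^ (\<kappa>(i := l)) k) = t ^ l * (\<Prod>k\<in>I. x k ^ \<kappa> k)"
        using insert by (subst prod.insert) auto
    qed
    also have "\<dots> = (\<Sum>l\<le>L. q l x * t ^ l)"
      by (simp add: q_def sum_distrib_left sum_distrib_right mult_ac)
    finally show ?thesis .
  qed
  have ki: "\<kappa> i \<le> L" using insert.prems by auto
  \<comment> \<open>The exponents of the remaining variables, made extensional on I by resetting the
    value at i.\<close>
  have kr: "(\<kappa>(i := undefined)) \<in> PiE I (\<lambda>_. {..L})" using insert.prems insert.hyps(2) by (auto simp: PiE_def extensional_def)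
  have ind: "(\<Prod>k\<in>insert i I. indicator {-1..1} ((x(i := t)) k)) = indicator {-1..1} t * (\<Prod>k\<in>I. indicator {-1..1} (x k) :: ennreal)" for x :: "'k \<Rightarrow> real" and t
  proof -
    have "(\<Prod>k\<in>I. indicator {-1..1} ((x(i := t)) k)) = (\<Prod>k\<in>I. indicator {-1..1} (x k) :: ennreal)"
      using insert by (intro prod.cong) auto
    then show ?thesis using insert by (subst prod.insert) auto
  qed
  have "(\<integral>\<^sup>+x. (\<Prod>k\<in>insert i I. indicator {-1..1} (x k)) *
        rpow s (\<Sum>\<kappa>\<in>PiE (insert i I) (\<lambda>_. {..L}). c \<kappa> * (\<Prod>k\<in>insert i I. x k ^ \<kappa> k)) \<partial>PiM (insert i I) (\<lambda>_. lborel))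
    = (\<integral>\<^sup>+x. \<integral>\<^sup>+t. (\<Prod>k\<in>I. indicator {-1..1} (x k)) * (rpow s (\<Sum>l\<le>L. q l x * t ^ l) * indicator {-1..1} t) \<partial>lborel \<partial>PiM I (\<lambda>_. lborel))"
    by (subst product_nn_integral_insert[OF insert(1,2) meas]) (simp only: split ind mult_ac)
  also have "\<dots> = (\<integral>\<^sup>+x. (\<Prod>k\<in>I. indicator {-1..1} (x k)) * (\<integral>\<^sup>+t\<in>{-1..1}. rpow s (\<Sum>l\<le>L. q l x * t ^ l) \<partial>lborel) \<partial>PiM I (\<lambda>_. lborel))"
    by (intro nn_integral_cong nn_integral_cmult) measurable
  also have "\<dots> \<le> (\<integral>\<^sup>+x. (\<Prod>k\<in>I. indicator {-1..1} (x k)) * (of_nat (6 + 18 * L) * rpow s (q (\<kappa> i) x)) \<partial>PiM I (\<lambda>_. lborel))"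
    unfolding s_def using nn_integral_rpow_poly[OF L ki] by (intro nn_integral_mono mult_left_mono) auto
  also have "\<dots> = of_nat (6 + 18 * L) * (\<integral>\<^sup>+x. (\<Prod>k\<in>I. indicator {-1..1} (x k)) * rpow s (q (\<kappa> i) x) \<partial>PiM I (\<lambda>_. lborel))"
    unfolding q_def by (subst nn_integral_cmult[symmetric]) (rule meas, simp add: mult_ac)
  also have "\<dots> \<le> of_nat (6 + 18 * L) * (of_nat (6 + 18 * L) ^ card I * rpow s (c ((\<kappa>(i := undefined))(i := \<kappa> i))))"
    unfolding s_def q_def by (intro mult_left_mono insert.IH[OF kr]) auto
  also have "\<dots> = of_nat (6 + 18 * L) ^ card (insert i I) * rpow s (c \<kappa>)"
    using insert(1,2) by (simp add: mult_ac)
  finally show ?case by (simp add: s_def)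
qed

section \<open>Polynomials on the Euclidean space\<close>

lemma finite_multi_indices: "finite (multi_indices L :: (nat ^ 'd) set)"
proof -
  have "multi_indices L \<subseteq> (\<lambda>f. \<chi> k. f k) ` (PiE UNIV (\<lambda>_::'d. {..L}))"
  proof
    fix \<kappa> :: "nat ^ 'd" assume "\<kappa> \<in> multi_indices L"
    then have "\<kappa> $ k \<le> L" for k
      using member_le_sum[of k UNIV "\<lambda>k. \<kappa> $ k"] by (auto simp: multi_indices_def)
    then show "\<kappa> \<in> (\<lambda>f. \<chi> k. f k) ` (PiE UNIV (\<lambda>_::'d. {..L}))"
      by (intro image_eqI[of _ _ "\<lambda>k. \<kappa> $ k"]) auto
  qed
  then show ?thesis by (rule finite_subset) (intro finite_imageI finite_PiE, auto)
qed

definition mpoly_at :: "nat \<Rightarrow> (nat ^ 'd \<Rightarrow> real) \<Rightarrow> real ^ 'd \<Rightarrow> real" where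
  "mpoly_at L v x = (\<Sum>\<kappa>\<in>multi_indices L. v \<kappa> * (\<Prod>k\<in>UNIV. x $ k ^ (\<kappa> $ k)))"

lemma mpoly_at_measurable [measurable]: "mpoly_at L v \<in> borel_measurable borel"
proof -
  have "continuous_on UNIV (mpoly_at L v)" unfolding mpoly_at_def by (intro continuous_intros)
  then show ?thesis by (rule borel_measurable_continuous_onI)
qed

text \<open>The substitution x = z + r y has Jacobian r^d and maps the unit ball onto the given
  ball; the unit ball lies in the cube on which the bound in coordinates holds. The polynomial is
  written in the rescaled variable so that the constant does not depend on z or r.\<close>

lemma nn_integral_rpow_mpoly:
  fixes z :: "real ^ 'd"
  assumes L: "L \<ge> 1" and \<kappa>: "\<kappa> \<in> multi_indices L" and r: "r > 0"
  shows "(\<integral>\<^sup>+x\<in>cball z r. rpow (1 / (2 * real L)) (mpoly_at L v ((1 / r) *\<^sub>R (x - z))) \<partial>lborel)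
    \<le> ennreal (r ^ CARD('d)) * (of_nat (6 + 18 * L) ^ CARD('d) * rpow (1 / (2 * real L)) (v \<kappa>))"
proof -
  define s where "s = 1 / (2 * real L)"
  let ?B = "Basis :: (real ^ 'd) set"
  have bij: "bij_betw (\<lambda>k. axis k 1) (UNIV :: 'd set) ?B"
    unfolding bij_betw_def by (auto simp: inj_on_def axis_eq_axis Basis_vec_def)
  \<comment> \<open>\<open>U\<close> and, below, \<open>T\<close> translate between multi-indices
    over the component type and exponent functions on the basis vectors, over which Lebesgue measure
    is a product.\<close>
  define U where "U f = (\<chi> k. f (axis k 1 :: real ^ 'd))" for f :: "real ^ 'd \<Rightarrow> nat"
  \<comment> \<open>The exponent functions with values up to L form a box larger than the simplex of
    multi-indices; the polynomial is padded with zero coefficients.\<close>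
  define c where "c f = (if U f \<in> multi_indices L then v (U f) else 0)" for f
  have cardB: "card ?B = CARD('d)" by simp
  define T where "T \<kappa> = restrict (\<lambda>b. \<kappa> $ (the_inv_into UNIV (\<lambda>k. axis k (1::real)) b)) ?B" for \<kappa> :: "nat ^ 'd"
  have inv: "the_inv_into UNIV (\<lambda>k. axis k (1::real)) (axis k 1) = k" for k :: 'd
    by (rule the_inv_into_f_f) (auto simp: inj_on_def axis_eq_axis)
  have UT: "U (T \<kappa>) = \<kappa>" for \<kappa>
    by (simp add: U_def T_def inv vec_eq_iff)
  have TU: "T (U f) = f" if "f \<in> PiE ?B (\<lambda>_. {..L})" for f
  proof
    fix b show "T (U f) b = f b"
    proof (cases "b \<in> ?B")
      case True
      then obtain k where "b = axis k 1" using bij by (metis bij_betw_imp_surj_on imageE)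
      then show ?thesis by (simp add: T_def U_def inv)
    next
      case False
      then show ?thesis using that by (auto simp: T_def)
    qed
  qed
  have Tin: "T \<kappa> \<in> PiE ?B (\<lambda>_. {..L})" if "\<kappa> \<in> multi_indices L" for \<kappa>
    using that member_le_sum[of _ UNIV "\<lambda>k. \<kappa> $ k"]
    by (fastforce simp: T_def multi_indices_def intro: order_trans)
  have poly: "mpoly_at L v (\<Sum>b\<in>?B. x b *\<^sub>R b) = (\<Sum>f\<in>PiE ?B (\<lambda>_. {..L}). c f * (\<Prod>b\<in>?B. x b ^ f b))" for x
  proof -
    have comp: "(\<Sum>b\<in>?B. x b *\<^sub>R b) $ k = x (axis k 1)" for k
      by (subst sum.reindex_bij_betw[OF bij, symmetric])
         (simp add: axis_def if_distrib sum.delta cong: if_cong)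
    have "(\<Sum>f\<in>PiE ?B (\<lambda>_. {..L}). c f * (\<Prod>b\<in>?B. x b ^ f b)) =
      (\<Sum>f\<in>{f\<in>PiE ?B (\<lambda>_. {..L}). U f \<in> multi_indices L}. v (U f) * (\<Prod>b\<in>?B. x b ^ f b))"
      by (intro sum.mono_neutral_cong_right) (auto simp: c_def finite_PiE)
    also have "\<dots> = (\<Sum>\<kappa>\<in>multi_indices L. v \<kappa> * (\<Prod>b\<in>?B. x b ^ T \<kappa> b))"
      by (rule sum.reindex_bij_witness[of _ T U]) (auto simp: UT TU Tin)
    also have "\<dots> = mpoly_at L v (\<Sum>b\<in>?B. x b *\<^sub>R b)"
      unfolding mpoly_at_def comp
      by (intro sum.cong refl arg_cong2[where f="(*)"], subst prod.reindex_bij_betw[OF bij, symmetric])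
         (auto simp: T_def inv)
    finally show ?thesis by simp
  qed
  have "(\<integral>\<^sup>+x\<in>cball z r. rpow s (mpoly_at L v ((1 / r) *\<^sub>R (x - z))) \<partial>lborel)
    = ennreal (r ^ CARD('d)) * (\<integral>\<^sup>+x. rpow s (mpoly_at L v x) * indicator (cball z r) (z + r *\<^sub>R x) \<partial>lborel)"
  proof -
    define F where "F x = rpow s (mpoly_at L v ((1 / r) *\<^sub>R (x - z))) * indicator (cball z r) x" for x
    have [measurable]: "cball z r \<in> sets borel" by simp
    have [measurable]: "F \<in> borel_measurable borel" unfolding F_def by measurable
    have "(\<integral>\<^sup>+x. F x \<partial>lborel) = (\<integral>\<^sup>+x. F x \<partial>density (distr lborel borel (\<lambda>x. z + r *\<^sub>R x)) (\<lambda>_. ennreal (\<bar>r\<bar> ^ DIM(real ^ 'd))))"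
      using r by (subst lborel_affine[of r z, symmetric]) auto
    also have "\<dots> = ennreal (r ^ CARD('d)) * (\<integral>\<^sup>+x. F (z + r *\<^sub>R x) \<partial>lborel)"
      using r by (subst nn_integral_density) (simp_all add: nn_integral_distr nn_integral_cmult)
    finally have fin: "(\<integral>\<^sup>+x. F x \<partial>lborel) = ennreal (r ^ CARD('d)) * (\<integral>\<^sup>+x. F (z + r *\<^sub>R x) \<partial>lborel)" .
    have eqF: "F (z + r *\<^sub>R x) = rpow s (mpoly_at L v x) * indicator (cball z r) (z + r *\<^sub>R x)" for x
      using r by (simp add: F_def)
    show ?thesis using fin unfolding eqF unfolding F_def .
  qed
  also have "(\<integral>\<^sup>+x. rpow s (mpoly_at L v x) * indicator (cball z r) (z + r *\<^sub>R x) \<partial>lborel)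
    \<le> (\<integral>\<^sup>+x. rpow s (mpoly_at L v x) * (\<Prod>b\<in>?B. indicator {-1..1} (x \<bullet> b)) \<partial>lborel)"
  proof (intro nn_integral_mono mult_left_mono)
    fix x :: "real ^ 'd"
    have "x \<bullet> b \<in> {-1..1}" if "z + r *\<^sub>R x \<in> cball z r" "b \<in> ?B" for b
    proof -
      have "norm x \<le> 1" using that r by (simp add: dist_norm)
      then show ?thesis using Basis_le_norm[OF that(2), of x] by auto
    qed
    then show "indicator (cball z r) (z + r *\<^sub>R x) \<le> (\<Prod>b\<in>?B. indicator {-1..1} (x \<bullet> b) :: ennreal)"
      by (auto simp: indicator_def split: if_splits)
  qed auto
  also have "\<dots> = (\<integral>\<^sup>+x. rpow s (mpoly_at L v (\<Sum>b\<in>?B. x b *\<^sub>R b)) * (\<Prod>b\<in>?B. indicator {-1..1} ((\<Sum>b\<in>?B. x b *\<^sub>R b) \<bullet> b)) \<partial>PiM ?B (\<lambda>_. lborel))"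
    by (subst lborel_eq) (subst nn_integral_distr, simp_all)
  also have "\<dots> = (\<integral>\<^sup>+x. (\<Prod>b\<in>?B. indicator {-1..1} (x b)) * rpow s (\<Sum>f\<in>PiE ?B (\<lambda>_. {..L}). c f * (\<Prod>b\<in>?B. x b ^ f b)) \<partial>PiM ?B (\<lambda>_. lborel))"
    by (intro nn_integral_cong) (simp add: poly mult_ac inner_sum_left_Basis cong: prod.cong)
  also have "\<dots> \<le> of_nat (6 + 18 * L) ^ card ?B * rpow s (c (T \<kappa>))"
    unfolding s_def by (intro nn_integral_rpow_multi L Tin \<kappa>) auto
  also have "c (T \<kappa>) = v \<kappa>" using \<kappa> by (simp add: c_def UT)
  finally show ?thesis unfolding s_def cardB by (simp add: mult_left_mono)
qed

section \<open>Local polynomial weights\<close>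

definition gram :: "nat set \<Rightarrow> real ^ 'd \<Rightarrow> (nat \<Rightarrow> real ^ 'd) \<Rightarrow> nat ^ 'd \<Rightarrow> nat ^ 'd \<Rightarrow> real" where
  "gram J z y \<kappa> \<kappa>' = (\<Sum>j\<in>J. xi z (y j) \<kappa> * xi z (y j) \<kappa>')"

definition wgt :: "nat \<Rightarrow> nat set \<Rightarrow> real ^ 'd \<Rightarrow> (nat \<Rightarrow> real ^ 'd) \<Rightarrow> real ^ 'd \<Rightarrow> real" where
  "wgt L J z y v = (\<Sum>\<kappa>\<in>multi_indices L. inv_on (multi_indices L) (gram J z y) 0 \<kappa> * xi z v \<kappa>)"

text \<open>The value infinity on singular configurations makes every finite moment of
  \<open>wnorm\<close> also a proof that the local matrix is invertible almost everywhere.\<close>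

definition wnorm :: "nat \<Rightarrow> nat set \<Rightarrow> real ^ 'd \<Rightarrow> (nat \<Rightarrow> real ^ 'd) \<Rightarrow> ennreal" where
  "wnorm L J z y = (if det_on (multi_indices L) (gram J z y) = 0 then \<infinity>
     else ennreal (\<Sum>j\<in>J. (wgt L J z y (y j))\<^sup>2))"

lemma zero_multi_indices: "0 \<in> (multi_indices L :: (nat ^ 'd) set)"
  by (simp add: multi_indices_def)

text \<open>This is the row identity e_0^T M^-1 M = e_0^T: the weights integrate every centred
  monomial of degree at most L as evaluation at z does.\<close>

lemma wgt_reproduce:
  assumes d: "det_on (multi_indices L) (gram J z y) \<noteq> 0" and \<kappa>: "\<kappa> \<in> multi_indices L"
  shows "(\<Sum>j\<in>J. wgt L J z y (y j) * xi z (y j) \<kappa>) = (if \<kappa> = 0 then 1 else 0)"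
proof -
  let ?I = "multi_indices L"
  have "(\<Sum>j\<in>J. wgt L J z y (y j) * xi z (y j) \<kappa>)
    = (\<Sum>\<kappa>'\<in>?I. inv_on ?I (gram J z y) 0 \<kappa>' * gram J z y \<kappa>' \<kappa>)"
    unfolding wgt_def gram_def sum_distrib_left sum_distrib_right
    by (subst sum.swap) (simp add: mult_ac)
  also have "\<dots> = (if 0 = \<kappa> then 1 else 0)"
    by (rule inv_on_inverse(2)[OF finite_multi_indices d zero_multi_indices \<kappa>])
  finally show ?thesis by auto
qed

text \<open>Expanding one factor of each square into monomials leaves sums that the reproducing
  property evaluates. The resulting entry of M^-1 has two roles: it measures the size of the weights
  and it is the constant coefficient of the polynomial that sends v to the weight of v.\<close>

lemma wgt_sum_squares:
  fixes z :: "real ^ 'd"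
  assumes d: "det_on (multi_indices L) (gram J z y) \<noteq> 0"
  shows "(\<Sum>j\<in>J. (wgt L J z y (y j))\<^sup>2) = inv_on (multi_indices L) (gram J z y) 0 0"
proof -
  let ?I = "multi_indices L" and ?b = "inv_on (multi_indices L) (gram J z y) 0"
  have "(\<Sum>j\<in>J. (wgt L J z y (y j))\<^sup>2) = (\<Sum>\<kappa>\<in>?I. ?b \<kappa> * (\<Sum>j\<in>J. wgt L J z y (y j) * xi z (y j) \<kappa>))"
  proof -
    have "(\<Sum>j\<in>J. (wgt L J z y (y j))\<^sup>2) = (\<Sum>j\<in>J. \<Sum>\<kappa>\<in>?I. ?b \<kappa> * (wgt L J z y (y j) * xi z (y j) \<kappa>))"
    proof (rule sum.cong[OF refl])
      fix j
      have "(wgt L J z y (y j))\<^sup>2 = wgt L J z y (y j) * (\<Sum>\<kappa>\<in>?I. ?b \<kappa> * xi z (y j) \<kappa>)"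
        by (simp add: power2_eq_square wgt_def)
      then show "(wgt L J z y (y j))\<^sup>2 = (\<Sum>\<kappa>\<in>?I. ?b \<kappa> * (wgt L J z y (y j) * xi z (y j) \<kappa>))"
        by (simp add: sum_distrib_left mult_ac)
    qed
    then show ?thesis by (subst (asm) sum.swap) (simp add: sum_distrib_left)
  qed
  also have "\<dots> = (\<Sum>\<kappa>\<in>?I. ?b \<kappa> * (if \<kappa> = 0 then 1 else 0))"
    by (intro sum.cong refl) (simp add: wgt_reproduce[OF d])
  also have "\<dots> = ?b 0"
    using zero_multi_indices[of L, where 'd='d] finite_multi_indices[of L, where 'd='d]
    by (simp add: if_distrib sum.delta cong: if_cong)
  finally show ?thesis .
qed

lemma xi_scaled:
  assumes "r \<noteq> 0"
  shows "xi z y \<kappa> = r ^ (\<Sum>k\<in>UNIV. \<kappa> $ k) * (\<Prod>k\<in>UNIV. ((1 / r) *\<^sub>R (y - z)) $ k ^ (\<kappa> $ k))"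
  unfolding xi_def power_sum prod.distrib[symmetric]
  using assms by (intro prod.cong refl) (simp add: power_mult_distrib[symmetric])

text \<open>Divided by m, these are the points of a grid of mesh 1/m on the unit sphere of the
  maximum norm. A coefficient of modulus exactly m becomes one of modulus 1, and the integral bound
  is applied to that coefficient.\<close>

definition int_grid :: "nat \<Rightarrow> nat \<Rightarrow> (nat ^ 'd \<Rightarrow> int) set" where
  "int_grid L m = {f \<in> PiE (multi_indices L) (\<lambda>_. {-int m..int m}). \<exists>\<kappa>\<in>multi_indices L. \<bar>f \<kappa>\<bar> = int m}"

text \<open>Rounding the coefficients to a grid of mesh \<open>1/m\<close> leaves polynomially many polynomials in \<open>m\<close>,
  so that a union bound applies.\<close>

lemma wnorm_net:
  fixes y :: "nat \<Rightarrow> real ^ 'd"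
  assumes r: "r > 0" and m: "m \<ge> 1" and W: "of_nat (m\<^sup>2) \<le> wnorm L J z y"
    and J: "finite J" "\<And>j. j \<in> J \<Longrightarrow> y j \<in> cball z r"
  shows "\<exists>f\<in>int_grid L m. \<forall>j\<in>J. \<bar>mpoly_at L (\<lambda>\<kappa>. real_of_int (f \<kappa>) / real m) ((1 / r) *\<^sub>R (y j - z))\<bar>
      \<le> (1 + real (card (multi_indices L :: (nat ^ 'd) set))) / real m"
proof -
  let ?I = "multi_indices L :: (nat ^ 'd) set"
  let ?N = "card ?I"
  let ?x = "\<lambda>j. (1 / r) *\<^sub>R (y j - z)"
  have fin: "finite ?I" by (rule finite_multi_indices)
  have mp: "mpoly_at L (\<lambda>\<kappa>. v \<kappa> * r ^ (\<Sum>k\<in>UNIV. \<kappa> $ k)) (?x j) = (\<Sum>\<kappa>\<in>?I. v \<kappa> * xi z (y j) \<kappa>)" for v j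
    unfolding mpoly_at_def using r by (intro sum.cong refl) (simp add: xi_scaled[of r])
  \<comment> \<open>The vector u holds the coefficients, in the rescaled variable, of a nonzero
    polynomial whose values at the neighbours are smaller than its largest coefficient by a factor
    m.\<close>
  obtain u where u: "\<exists>\<kappa>\<in>?I. u \<kappa> \<noteq> 0" "\<And>j U. j \<in> J \<Longrightarrow> (\<And>\<kappa>. \<kappa> \<in> ?I \<Longrightarrow> \<bar>u \<kappa>\<bar> \<le> U) \<Longrightarrow> real m * \<bar>mpoly_at L u (?x j)\<bar> \<le> U"
  proof (cases "det_on ?I (gram J z y) = 0")
    case True
    then obtain v where v: "\<exists>i\<in>?I. v i \<noteq> 0" "\<forall>i\<in>?I. (\<Sum>k\<in>?I. gram J z y i k * v k) = 0"
      using det_on_zero_kernel[OF fin] by blast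
    define P where "P j = (\<Sum>\<kappa>\<in>?I. v \<kappa> * xi z (y j) \<kappa>)" for j
    \<comment> \<open>The quadratic form of the Gram matrix is the sum of the squared values of the
      polynomial, so a kernel vector gives a polynomial vanishing at all neighbours.\<close>
    have "(\<Sum>j\<in>J. (P j)\<^sup>2) = (\<Sum>i\<in>?I. v i * (\<Sum>k\<in>?I. gram J z y i k * v k))"
    proof -
      have "(\<Sum>i\<in>?I. v i * (\<Sum>k\<in>?I. gram J z y i k * v k))
        = (\<Sum>i\<in>?I. \<Sum>k\<in>?I. \<Sum>j\<in>J. (v i * xi z (y j) i) * (v k * xi z (y j) k))"
        by (simp add: gram_def sum_distrib_left sum_distrib_right mult_ac)
      also have "\<dots> = (\<Sum>i\<in>?I. \<Sum>j\<in>J. \<Sum>k\<in>?I. (v i * xi z (y j) i) * (v k * xi z (y j) k))"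
        by (intro sum.cong refl, rule sum.swap)
      also have "\<dots> = (\<Sum>j\<in>J. \<Sum>i\<in>?I. \<Sum>k\<in>?I. (v i * xi z (y j) i) * (v k * xi z (y j) k))"
        by (rule sum.swap)
      also have "\<dots> = (\<Sum>j\<in>J. (P j)\<^sup>2)"
        by (simp add: P_def power2_eq_square sum_product)
      finally show ?thesis by simp
    qed
    also have "\<dots> = 0" using v(2) by simp
    finally have P0: "P j = 0" if "j \<in> J" for j
      using that J(1) by (simp add: sum_nonneg_eq_0_iff)
    show thesis
    proof (rule that[of "\<lambda>\<kappa>. v \<kappa> * r ^ (\<Sum>k\<in>UNIV. \<kappa> $ k)"])
      show "\<exists>\<kappa>\<in>?I. v \<kappa> * r ^ (\<Sum>k\<in>UNIV. \<kappa> $ k) \<noteq> 0" using v(1) r by auto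
      fix j U assume j: "j \<in> J" and U: "\<And>\<kappa>. \<kappa> \<in> ?I \<Longrightarrow> \<bar>v \<kappa> * r ^ (\<Sum>k\<in>UNIV. \<kappa> $ k)\<bar> \<le> U"
      have "0 \<le> U" using U[OF zero_multi_indices] by linarith
      then show "real m * \<bar>mpoly_at L (\<lambda>\<kappa>. v \<kappa> * r ^ (\<Sum>k\<in>UNIV. \<kappa> $ k)) (?x j)\<bar> \<le> U"
        using P0[OF j] unfolding mp P_def by simp
    qed
  next
    case False
    define b where "b = inv_on ?I (gram J z y) 0"
    have sq: "(\<Sum>j\<in>J. (wgt L J z y (y j))\<^sup>2) = b 0" unfolding b_def by (rule wgt_sum_squares[OF False])
    have "ennreal ((real m)\<^sup>2) \<le> ennreal (b 0)"
      using W False sq by (simp add: wnorm_def ennreal_of_nat_eq_real_of_nat)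
    moreover have b0: "b 0 \<ge> 0" unfolding sq[symmetric] by (intro sum_nonneg) auto
    ultimately have mb: "(real m)\<^sup>2 \<le> b 0" by (simp add: ennreal_le_iff)
    have bpos: "b 0 \<ge> 1"
    proof -
      have "1 \<le> (real m)\<^sup>2" using m by simp
      then show ?thesis using mb by linarith
    qed
    \<comment> \<open>The polynomial is the weight as a function of the design point. Its values at
      the neighbours have squares summing to \<open>b 0\<close>, so each is at most the root of
      \<open>b 0\<close>, which is at most \<open>b 0\<close> / m because \<open>b 0\<close> is at
      least m^2. Moreover \<open>b 0\<close> is the constant coefficient, which scaling leaves
      unchanged.\<close>
    show thesis
    proof (rule that[of "\<lambda>\<kappa>. b \<kappa> * r ^ (\<Sum>k\<in>UNIV. \<kappa> $ k)"])
      show "\<exists>\<kappa>\<in>?I. b \<kappa> * r ^ (\<Sum>k\<in>UNIV. \<kappa> $ k) \<noteq> 0"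
        using bpos zero_multi_indices r by (intro bexI[of _ 0]) auto
      fix j U assume j: "j \<in> J" and U: "\<And>\<kappa>. \<kappa> \<in> ?I \<Longrightarrow> \<bar>b \<kappa> * r ^ (\<Sum>k\<in>UNIV. \<kappa> $ k)\<bar> \<le> U"
      have U0: "b 0 \<le> U" using U[OF zero_multi_indices] by simp
      have e: "mpoly_at L (\<lambda>\<kappa>. b \<kappa> * r ^ (\<Sum>k\<in>UNIV. \<kappa> $ k)) (?x j) = wgt L J z y (y j)"
        unfolding mp by (simp add: wgt_def b_def)
      have "(wgt L J z y (y j))\<^sup>2 \<le> b 0"
        unfolding sq[symmetric] using j J(1) by (intro member_le_sum) auto
      then have "(real m)\<^sup>2 * (wgt L J z y (y j))\<^sup>2 \<le> b 0 * b 0"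
        using mb b0 by (intro mult_mono) auto
      then have "(real m * \<bar>wgt L J z y (y j)\<bar>)\<^sup>2 \<le> (b 0)\<^sup>2"
        by (simp add: power_mult_distrib power2_eq_square[of "b 0"])
      then have "real m * \<bar>wgt L J z y (y j)\<bar> \<le> b 0" using b0 by (rule power2_le_imp_le)
      then show "real m * \<bar>mpoly_at L (\<lambda>\<kappa>. b \<kappa> * r ^ (\<Sum>k\<in>UNIV. \<kappa> $ k)) (?x j)\<bar> \<le> U"
        unfolding e using U0 by linarith
    qed
  qed
  define U where "U = Max ((\<lambda>\<kappa>. \<bar>u \<kappa>\<bar>) ` ?I)"
  have Ule: "\<bar>u \<kappa>\<bar> \<le> U" if "\<kappa> \<in> ?I" for \<kappa> unfolding U_def using that fin by (intro Max_ge) auto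
  have "U \<in> (\<lambda>\<kappa>. \<bar>u \<kappa>\<bar>) ` ?I" unfolding U_def using fin zero_multi_indices by (intro Max_in) auto
  then obtain \<kappa>0 where \<kappa>0: "\<kappa>0 \<in> ?I" "U = \<bar>u \<kappa>0\<bar>" by blast
  have Upos: "U > 0" using u(1) Ule by (smt (verit))
  define f where "f = restrict (\<lambda>\<kappa>. \<lfloor>real m * (u \<kappa> / U)\<rfloor>) ?I"
  have bound1: "\<bar>u \<kappa> / U\<bar> \<le> 1" if "\<kappa> \<in> ?I" for \<kappa> using Ule[OF that] Upos by simp
  have "f \<in> int_grid L m"
  proof -
    have "\<lfloor>real m * (u \<kappa> / U)\<rfloor> \<in> {-int m..int m}" if "\<kappa> \<in> ?I" for \<kappa>
    proof -
      have "real m * (u \<kappa> / U) \<le> real m * 1" "real m * (-1) \<le> real m * (u \<kappa> / U)"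
        using bound1[OF that] unfolding abs_le_iff by (intro mult_left_mono; linarith)+
      then show ?thesis by (auto simp: floor_le_iff le_floor_iff)
    qed
    \<comment> \<open>At the largest coefficient the quotient is exactly 1 or -1, so rounding down
      does not change the multiple of m.\<close>
    moreover have "\<bar>f \<kappa>0\<bar> = int m"
    proof -
      have "u \<kappa>0 / U = 1 \<or> u \<kappa>0 / U = -1"
      proof -
        have "u \<kappa>0 = U \<or> u \<kappa>0 = - U" using \<kappa>0(2) by linarith
        then show ?thesis using Upos by auto
      qed
      then have "real m * (u \<kappa>0 / U) = real m \<or> real m * (u \<kappa>0 / U) = - real m"
        by (metis mult.right_neutral mult_minus_right)
      moreover have "f \<kappa>0 = \<lfloor>real m * (u \<kappa>0 / U)\<rfloor>" using \<kappa>0(1) by (simp add: f_def)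
      moreover have "\<lfloor>- real m\<rfloor> = - int m" by (metis floor_of_int of_int_minus of_int_of_nat_eq)
      ultimately show ?thesis by (auto simp del: times_divide_eq_right)
    qed
    ultimately show ?thesis using \<kappa>0 by (auto simp: int_grid_def f_def)
  qed
  moreover have "\<bar>mpoly_at L (\<lambda>\<kappa>. real_of_int (f \<kappa>) / real m) (?x j)\<bar> \<le> (1 + real ?N) / real m" if j: "j \<in> J" for j
  proof -
    define X where "X \<kappa> = (\<Prod>k\<in>UNIV. ?x j $ k ^ (\<kappa> $ k))" for \<kappa> :: "nat ^ 'd"
    have nx: "norm (?x j) \<le> 1"
    proof -
      have "norm (?x j) = dist z (y j) / r" using r by (simp add: dist_norm norm_minus_commute)
      then show ?thesis using J(2)[OF j] r by simp
    qed
    have X1: "\<bar>X \<kappa>\<bar> \<le> 1" for \<kappa>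
    proof -
      have "\<bar>?x j $ k\<bar> \<le> 1" for k
        using component_le_norm_cart[of "?x j" k] nx by linarith
      then have "\<bar>?x j $ k ^ (\<kappa> $ k)\<bar> \<le> 1" for k by (simp add: power_abs power_le_one)
      then show ?thesis unfolding X_def abs_prod by (intro prod_le_1) auto
    qed
    have d1: "\<bar>real_of_int (f \<kappa>) / real m - u \<kappa> / U\<bar> \<le> 1 / real m" if "\<kappa> \<in> ?I" for \<kappa>
    proof -
      define a where "a = real_of_int \<lfloor>real m * (u \<kappa> / U)\<rfloor>"
      have a1: "\<bar>a - real m * (u \<kappa> / U)\<bar> \<le> 1" unfolding a_def by linarith
      have "a / real m - u \<kappa> / U = (a - real m * (u \<kappa> / U)) / real m"
        using m by (simp add: diff_divide_distrib)
      then have "\<bar>a / real m - u \<kappa> / U\<bar> = \<bar>a - real m * (u \<kappa> / U)\<bar> / real m" by simp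
      also have "\<dots> \<le> 1 / real m" by (intro divide_right_mono a1) auto
      finally show ?thesis using that by (simp add: f_def a_def)
    qed
    \<comment> \<open>The first summand is at most 1/m by the choice of u. The second is the
      rounding error, at most 1/m for each of the N monomials, which are bounded by 1 on the unit
      ball.\<close>
    have A: "mpoly_at L (\<lambda>\<kappa>. real_of_int (f \<kappa>) / real m) (?x j)
      = mpoly_at L u (?x j) / U + (\<Sum>\<kappa>\<in>?I. (real_of_int (f \<kappa>) / real m - u \<kappa> / U) * X \<kappa>)"
      unfolding mpoly_at_def X_def[symmetric] sum_divide_distrib sum.distrib[symmetric]
      by (intro sum.cong refl) (simp add: algebra_simps)
    have B: "\<bar>mpoly_at L u (?x j) / U\<bar> \<le> 1 / real m"
      using u(2)[OF j Ule] Upos m by (simp add: abs_divide field_simps)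
    have "\<bar>\<Sum>\<kappa>\<in>?I. (real_of_int (f \<kappa>) / real m - u \<kappa> / U) * X \<kappa>\<bar> \<le> (\<Sum>\<kappa>\<in>?I. 1 / real m * 1)"
      by (rule order_trans[OF sum_abs], intro sum_mono, subst abs_mult, intro mult_mono d1 X1) auto
    also have "\<dots> = real ?N / real m" by simp
    finally have Bn: "\<bar>\<Sum>\<kappa>\<in>?I. (real_of_int (f \<kappa>) / real m - u \<kappa> / U) * X \<kappa>\<bar> \<le> real ?N / real m" .
    show ?thesis
      unfolding A add_divide_distrib by (rule order_trans[OF abs_triangle_ineq add_mono[OF B Bn]])
  qed
  ultimately show ?thesis by blast
qed

lemma card_int_grid:
  "finite (int_grid L m :: (nat ^ 'd \<Rightarrow> int) set)"
  "card (int_grid L m :: (nat ^ 'd \<Rightarrow> int) set) \<le> (2 * m + 1) ^ card (multi_indices L :: (nat ^ 'd) set)"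
proof -
  let ?P = "PiE (multi_indices L :: (nat ^ 'd) set) (\<lambda>_. {-int m..int m})"
  have sub: "int_grid L m \<subseteq> ?P" by (auto simp: int_grid_def)
  have f: "finite ?P" by (intro finite_PiE finite_multi_indices) auto
  show "finite (int_grid L m :: (nat ^ 'd \<Rightarrow> int) set)" by (rule finite_subset[OF sub f])
  have "card ?P = (2 * m + 1) ^ card (multi_indices L :: (nat ^ 'd) set)"
    by (subst card_PiE[OF finite_multi_indices]) (simp add: nat_add_distrib nat_mult_distrib)
  then show "card (int_grid L m :: (nat ^ 'd \<Rightarrow> int) set) \<le> (2 * m + 1) ^ card (multi_indices L :: (nat ^ 'd) set)"
    using card_mono[OF f sub] by simp
qed

text \<open>A layer-cake bound along the squares: the first n + 1 odd numbers sum to (n + 1)^2. The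
  levels m^2 are those at which \<open>wnorm_net\<close> supplies a grid of mesh 1/m.\<close>

lemma ennreal_le_sum_squares:
  fixes W :: ennreal
  shows "W \<le> (\<Sum>m. of_nat (2 * m + 1) * (if of_nat (m\<^sup>2) \<le> W then 1 else 0))"
proof -
  have part: "of_nat ((n + 1)\<^sup>2) \<le> (\<Sum>m. of_nat (2 * m + 1) * (if of_nat (m\<^sup>2) \<le> W then 1 else 0 :: ennreal))"
    if "of_nat (n\<^sup>2) \<le> W" for n
  proof -
    have "(of_nat ((n + 1)\<^sup>2) :: ennreal) = of_nat (\<Sum>m<n+1. 2 * m + 1)"
    proof -
      have "(\<Sum>m<k. 2 * m + 1) = k\<^sup>2" for k :: nat by (induction k) (auto simp: power2_eq_square)
      then show ?thesis by presburger
    qed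
    also have "\<dots> = (\<Sum>m<n+1. of_nat (2 * m + 1) * (if of_nat (m\<^sup>2) \<le> W then 1 else 0))"
      unfolding of_nat_sum
    proof (intro sum.cong refl)
      fix m assume "m \<in> {..<n+1}"
      then have "m\<^sup>2 \<le> n\<^sup>2" by (intro power_mono) auto
      then have "(of_nat (m\<^sup>2) :: ennreal) \<le> of_nat (n\<^sup>2)" by (rule of_nat_mono)
      then have "of_nat (m\<^sup>2) \<le> W" using that by (rule order_trans)
      then show "of_nat (2 * m + 1) = of_nat (2 * m + 1) * (if of_nat (m\<^sup>2) \<le> W then 1 else (0::ennreal))" by simp
    qed
    also have "\<dots> \<le> (\<Sum>m. of_nat (2 * m + 1) * (if of_nat (m\<^sup>2) \<le> W then 1 else 0))"
      by (rule sum_le_suminf) auto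
    finally show ?thesis .
  qed
  show ?thesis
  proof (cases W)
    case (real w)
    define n where "n = nat \<lfloor>sqrt w\<rfloor>"
    have n: "real n \<le> sqrt w" "sqrt w \<le> real n + 1" using real by (auto simp: n_def)
    have "(real n)\<^sup>2 \<le> (sqrt w)\<^sup>2" "(sqrt w)\<^sup>2 \<le> (real n + 1)\<^sup>2"
      using n real by (intro power_mono; simp)+
    then have "(real n)\<^sup>2 \<le> w" "w \<le> (real n + 1)\<^sup>2" using real by auto
    then have "of_nat (n\<^sup>2) \<le> W" "W \<le> of_nat ((n + 1)\<^sup>2)"
      unfolding real ennreal_of_nat_eq_real_of_nat by (auto intro!: ennreal_leI simp: add.commute)
    then show ?thesis using part[of n] by (meson order_trans)
  next
    case top
    define S :: ennreal where "S = (\<Sum>m. of_nat (2 * m + 1) * (if of_nat (m\<^sup>2) \<le> W then 1 else 0))"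
    have "S = \<top>"
    proof (rule ccontr)
      assume "S \<noteq> \<top>"
      then have "S < \<top>" by (simp add: top.not_eq_extremum)
      then obtain n where "S < of_nat n"
        using ennreal_Ex_less_of_nat by blast
      also have "(of_nat n :: ennreal) \<le> of_nat ((n + 1)\<^sup>2)" by (intro of_nat_mono) (simp add: power2_eq_square)
      also have "\<dots> \<le> S"
        unfolding S_def using top by (intro part) simp
      finally show False by simp
    qed
    then have "W \<le> S" by simp
    then show ?thesis unfolding S_def .
  qed
qed

text \<open>A union bound over the grid and Markov's inequality for negative powers of each grid
  polynomial. Integrals over the K points factor, so the exponent s = 1 / (2 * L) is multiplied by
  K. The power of r is the volume scaling of K balls.\<close>

lemma wnorm_nn_integral:
  assumes L: "L \<ge> 1"
    and N: "card (multi_indices L :: (nat ^ 'd) set) \<ge> 2"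
    and K: "K \<ge> 6 * L * card (multi_indices L :: (nat ^ 'd) set)"
  shows "\<exists>C\<ge>0. \<forall>J (z :: real ^ 'd) r. card J = K \<longrightarrow> r > 0 \<longrightarrow>
    (\<integral>\<^sup>+y. (\<Prod>j\<in>J. indicator (cball z r) (y j)) * wnorm L J z y \<partial>PiM J (\<lambda>_. lborel)) \<le> ennreal (C * r ^ (CARD('d) * K))"
proof -
  let ?I = "multi_indices L :: (nat ^ 'd) set"
  define N where "N = card ?I"
  define s where "s = 1 / (2 * real L)"
  define c1 :: real where "c1 = real (6 + 18 * L) ^ CARD('d)"
  define V :: real where "V = unit_ball_vol (real CARD('d))"
  define c2 where "c2 = 3 ^ (N + 1) * ((1 + real N) powr (s * real K) * c1 ^ K)"
  define S :: real where "S = (\<Sum>m. 1 / real (Suc m) ^ 2)"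
  have K0: "K > 0" using K L N by (intro gr0I) (auto)
  \<comment> \<open>The factor 6 in the lower bound on K is twice the 3 needed here, the 2 coming
    from s = 1 / (2 * L).\<close>
  have sK: "s * real K \<ge> 3 * real N"
  proof -
    have "6 * real L * real N \<le> real K" using K unfolding N_def by (metis of_nat_le_iff of_nat_mult of_nat_numeral)
    then have "s * (6 * real L * real N) \<le> s * real K" by (intro mult_left_mono) (auto simp: s_def)
    moreover have "s * (6 * real L * real N) = 3 * real N" using L by (simp add: s_def)
    ultimately show ?thesis by simp
  qed
  have c1: "c1 \<ge> 0" by (simp add: c1_def)
  have V: "V \<ge> 0" by (simp add: V_def)
  have c2: "c2 \<ge> 0" using c1 by (simp add: c2_def)
  have sm: "summable (\<lambda>m. 1 / real (Suc m) ^ 2)"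
    using inverse_power_summable[of 2, where ?'a=real] by (subst summable_Suc_iff) (simp add: divide_inverse)
  have S: "S \<ge> 0" unfolding S_def by (intro suminf_nonneg sm) auto
  have main: "(\<integral>\<^sup>+y. (\<Prod>j\<in>J. indicator (cball z r) (y j)) * wnorm L J z y \<partial>PiM J (\<lambda>_. lborel)) \<le> ennreal ((V ^ K + c2 * S) * r ^ (CARD('d) * K))"
    if J: "card J = K" and r: "r > 0" for J and z :: "real ^ 'd" and r :: real
  proof -
    interpret product_sigma_finite "\<lambda>_::nat. lborel :: (real ^ 'd) measure" ..
    have finJ: "finite J" using J K0 by (metis card.infinite less_irrefl)
    define B where "B y = (\<Prod>j\<in>J. indicator (cball z r) (y j) :: ennreal)" for y :: "nat \<Rightarrow> real ^ 'd"
    \<comment> \<open>On the ball \<open>g m f\<close> is at least 1 wherever the grid polynomial is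
      at most (1 + N) / m, so its product over J dominates the indicator of the event in
      \<open>wnorm_net\<close>.\<close>
    define g where "g m f x = indicator (cball z r) x * (ennreal (((1 + real N) / real m) powr s) *
        rpow s (mpoly_at L (\<lambda>\<kappa>. real_of_int (f \<kappa>) / real m) ((1 / r) *\<^sub>R (x - z))))" for m f and x :: "real ^ 'd"
    define T where "T m y = of_nat (2 * m + 1) * (\<Sum>f\<in>int_grid L m. \<Prod>j\<in>J. g m f (y j))" for m y
    have cb [measurable]: "cball z r \<in> sets borel" by simp
    have gm [measurable]: "g m f \<in> borel_measurable borel" for m f unfolding g_def by measurable
    have comp: "(\<lambda>y. h (y j)) \<in> borel_measurable (PiM J (\<lambda>_. lborel))" if "h \<in> borel_measurable borel" "j \<in> J" for j and h :: "real ^ 'd \<Rightarrow> ennreal"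
      by (rule measurable_compose[OF measurable_component_singleton[OF that(2)]]) (simp add: that)
    have compB: "(\<lambda>y. indicator (cball z r) (y j) :: ennreal) \<in> borel_measurable (PiM J (\<lambda>_. lborel))" if "j \<in> J" for j
      using that by (intro comp) auto
    have compg: "(\<lambda>y. \<Prod>j\<in>J. g m f (y j)) \<in> borel_measurable (PiM J (\<lambda>_. lborel))" for m f
      by (intro borel_measurable_prod_ennreal comp gm)
    have Bm [measurable]: "B \<in> borel_measurable (PiM J (\<lambda>_. lborel))"
      unfolding B_def by (intro borel_measurable_prod_ennreal compB)
    have Tm [measurable]: "T m \<in> borel_measurable (PiM J (\<lambda>_. lborel))" for m
      unfolding T_def by (intro borel_measurable_times_ennreal borel_measurable_const borel_measurable_sum compg)
    have point: "B y * wnorm L J z y \<le> B y + (\<Sum>m. T (Suc m) y)" for y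
    proof (cases "\<forall>j\<in>J. y j \<in> cball z r")
      case True
      then have B1: "B y = 1" by (simp add: B_def)
      let ?W = "wnorm L J z y"
      let ?h = "\<lambda>m. of_nat (2 * m + 1) * (if of_nat (m\<^sup>2) \<le> ?W then 1 else 0) :: ennreal"
      have hT: "?h (Suc m) \<le> T (Suc m) y" for m
      proof (cases "of_nat ((Suc m)\<^sup>2) \<le> ?W")
        case w: True
        obtain f where f: "f \<in> int_grid L (Suc m)" "\<And>j. j \<in> J \<Longrightarrow> \<bar>mpoly_at L (\<lambda>\<kappa>. real_of_int (f \<kappa>) / real (Suc m)) ((1 / r) *\<^sub>R (y j - z))\<bar>
            \<le> (1 + real N) / real (Suc m)"
          using wnorm_net[OF r _ w finJ] True unfolding N_def by (metis One_nat_def Suc_le_mono le0)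
        have "1 \<le> g (Suc m) f (y j)" if j: "j \<in> J" for j
        proof -
          define p where "p = mpoly_at L (\<lambda>\<kappa>. real_of_int (f \<kappa>) / real (Suc m)) ((1 / r) *\<^sub>R (y j - z))"
          have pb: "\<bar>p\<bar> powr s \<le> ((1 + real N) / real (Suc m)) powr s"
            using f(2)[OF j] by (intro powr_mono2) (auto simp: p_def s_def)
          have pos: "((1 + real N) / real (Suc m)) powr s > 0" by simp
          have "1 \<le> ennreal (((1 + real N) / real (Suc m)) powr s) * inverse (ennreal (\<bar>p\<bar> powr s))"
          proof (cases "p = 0")
            case True
            then show ?thesis using pos by (simp add: ennreal_mult_top)
          next
            case False
            then have "1 \<le> ((1 + real N) / real (Suc m)) powr s * inverse (\<bar>p\<bar> powr s)"
              using pb by (simp add: field_simps)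
            then have "ennreal 1 \<le> ennreal (((1 + real N) / real (Suc m)) powr s * inverse (\<bar>p\<bar> powr s))" by (rule ennreal_leI)
            then show ?thesis using False by (simp add: ennreal_mult inverse_ennreal)
          qed
          then show ?thesis using True j unfolding g_def rpow_def p_def by simp
        qed
        then have "1 \<le> (\<Prod>j\<in>J. g (Suc m) f (y j))" by (rule prod_ge_1)
        also have "\<dots> \<le> (\<Sum>f\<in>int_grid L (Suc m). \<Prod>j\<in>J. g (Suc m) f (y j))"
          using f(1) card_int_grid(1) by (intro member_le_sum) auto
        finally have "of_nat (2 * Suc m + 1) * 1 \<le> T (Suc m) y" unfolding T_def by (intro mult_left_mono) auto
        then show ?thesis using w by simp
      qed simp
      have "?W \<le> (\<Sum>m. ?h m)" by (rule ennreal_le_sum_squares)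
      \<comment> \<open>The level m = 0 has no grid; its term is 1 and accounts for the volume
        B.\<close>
      also have "\<dots> = ?h 0 + (\<Sum>m. ?h (Suc m))"
        by (subst suminf_offset[of _ 1]) auto
      also have "\<dots> \<le> 1 + (\<Sum>m. T (Suc m) y)"
        by (intro add_mono suminf_le hT) auto
      finally show ?thesis using B1 by simp
    next
      case False
      then have "B y = 0" unfolding B_def using finJ by (intro prod_zero) (auto simp: indicator_def)
      then show ?thesis by simp
    qed
    have IB: "(\<integral>\<^sup>+y. B y \<partial>PiM J (\<lambda>_. lborel)) = ennreal (V ^ K * r ^ (CARD('d) * K))"
    proof -
      have "(\<integral>\<^sup>+y. B y \<partial>PiM J (\<lambda>_. lborel)) = (\<Prod>j\<in>J. \<integral>\<^sup>+x. indicator (cball z r) x \<partial>lborel)"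
        unfolding B_def by (rule product_nn_integral_prod[OF finJ]) auto
      also have "\<dots> = ennreal (V * r ^ CARD('d)) ^ K"
        using r J by (simp add: emeasure_cball V_def)
      also have "\<dots> = ennreal (V ^ K * r ^ (CARD('d) * K))"
        using V r by (simp add: ennreal_power power_mult_distrib power_mult)
      finally show ?thesis .
    qed
    have IT: "(\<integral>\<^sup>+y. T (Suc m) y \<partial>PiM J (\<lambda>_. lborel)) \<le> ennreal (c2 * r ^ (CARD('d) * K) * (1 / real (Suc m) ^ 2))" for m
    proof -
      define M where "M = Suc m"
      have M: "real M \<ge> 1" by (simp add: M_def)
      define q where "q = ((1 + real N) / real M) powr s * (r ^ CARD('d) * c1)"
      have q: "q \<ge> 0" using r c1 by (simp add: q_def)
      have one: "(\<integral>\<^sup>+x. g M f x \<partial>lborel) \<le> ennreal q" if f: "f \<in> int_grid L M" for f :: "nat ^ 'd \<Rightarrow> int"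
      proof -
        obtain \<kappa> where \<kappa>: "\<kappa> \<in> ?I" "\<bar>f \<kappa>\<bar> = int M" using f by (auto simp: int_grid_def)
        have "\<bar>real_of_int (f \<kappa>)\<bar> = real M" using \<kappa>(2) by (metis of_int_abs of_int_of_nat_eq)
        then have r1: "rpow s (real_of_int (f \<kappa>) / real M) = 1"
          using M by (simp add: rpow_def abs_divide)
        have "(\<integral>\<^sup>+x. g M f x \<partial>lborel) = ennreal (((1 + real N) / real M) powr s) *
           (\<integral>\<^sup>+x\<in>cball z r. rpow s (mpoly_at L (\<lambda>\<kappa>. real_of_int (f \<kappa>) / real M) ((1 / r) *\<^sub>R (x - z))) \<partial>lborel)"
          unfolding g_def by (subst nn_integral_cmult[symmetric]) (auto simp: mult_ac)
        also have "\<dots> \<le> ennreal (((1 + real N) / real M) powr s) * (ennreal (r ^ CARD('d)) *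
            (of_nat (6 + 18 * L) ^ CARD('d) * rpow s (real_of_int (f \<kappa>) / real M)))"
          unfolding s_def by (intro mult_left_mono nn_integral_rpow_mpoly L \<kappa>(1) r) auto
        also have "\<dots> = ennreal q"
        proof -
          have "(of_nat (6 + 18 * L) :: ennreal) ^ CARD('d) = ennreal c1"
            unfolding c1_def ennreal_of_nat_eq_real_of_nat by (subst ennreal_power) auto
          then show ?thesis unfolding r1 q_def using r c1 by (simp add: ennreal_mult)
        qed
        finally show ?thesis .
      qed
      have "(\<integral>\<^sup>+y. T M y \<partial>PiM J (\<lambda>_. lborel)) = of_nat (2 * M + 1) * (\<Sum>f\<in>int_grid L M. \<Prod>j\<in>J. \<integral>\<^sup>+x. g M f x \<partial>lborel)"
        unfolding T_def
        by (subst nn_integral_cmult, intro borel_measurable_sum compg,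
            subst nn_integral_sum, rule compg,
            subst product_nn_integral_prod[OF finJ]) auto
      also have "\<dots> \<le> of_nat (2 * M + 1) * (\<Sum>f\<in>(int_grid L M :: (nat ^ 'd \<Rightarrow> int) set). \<Prod>j\<in>J. ennreal q)"
        by (intro mult_left_mono sum_mono prod_mono_ennreal one) auto
      also have "\<dots> = of_nat (2 * M + 1) * (of_nat (card (int_grid L M :: (nat ^ 'd \<Rightarrow> int) set)) * ennreal q ^ K)"
        using J by simp
      also have "\<dots> \<le> of_nat (2 * M + 1) * (of_nat ((2 * M + 1) ^ N) * ennreal q ^ K)"
        unfolding N_def by (intro mult_left_mono mult_right_mono of_nat_mono card_int_grid) auto
      also have "\<dots> = ennreal (real (2 * M + 1) ^ (N + 1) * q ^ K)"
        unfolding ennreal_of_nat_eq_real_of_nat using q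
        by (simp add: ennreal_mult[symmetric] ennreal_power mult_ac del: of_nat_Suc of_nat_add of_nat_mult)
      also have "\<dots> \<le> ennreal (c2 * r ^ (CARD('d) * K) * (1 / real M ^ 2))"
      proof (rule ennreal_leI)
        have q1: "q ^ K = ((1 + real N) / real M) powr (s * real K) * (r ^ CARD('d) * c1) ^ K"
        proof -
          have "(((1 + real N) / real M) powr s) ^ K = (((1 + real N) / real M) powr s) powr real K"
            using M by (subst powr_realpow) auto
          then have "(((1 + real N) / real M) powr s) ^ K = ((1 + real N) / real M) powr (s * real K)"
            by (simp only: powr_powr)
          then show ?thesis unfolding q_def power_mult_distrib by simp
        qed
        have "((1 + real N) / real M) powr (s * real K) = (1 + real N) powr (s * real K) * (1 / real M powr (s * real K))"
          by (simp add: powr_divide)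
        also have "1 / real M powr (s * real K) \<le> 1 / real M powr (3 * real N)"
          using M sK by (intro divide_left_mono powr_mono) auto
        also have "1 / real M powr (3 * real N) = 1 / real M ^ (3 * N)"
          using M powr_realpow[of "real M" "3 * N"] by simp
        finally have q2: "((1 + real N) / real M) powr (s * real K) \<le> (1 + real N) powr (s * real K) * (1 / real M ^ (3 * N))"
          by (simp add: mult_left_mono)
        have q3: "real (2 * M + 1) ^ (N + 1) \<le> (3 * real M) ^ (N + 1)"
          using M by (intro power_mono) auto
        have "real (2 * M + 1) ^ (N + 1) * q ^ K \<le> (3 * real M) ^ (N + 1) * (((1 + real N) powr (s * real K) * (1 / real M ^ (3 * N))) * (r ^ CARD('d) * c1) ^ K)"
          unfolding q1 using c1 r by (intro mult_mono q3 q2) auto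
        also have "\<dots> = c2 * r ^ (CARD('d) * K) * (real M ^ (N + 1) / real M ^ (3 * N))"
          by (simp add: c2_def power_mult_distrib power_mult)
        \<comment> \<open>The level contributes the power 1, the grid the power N, and the K factors
          give back 3 * N. As N is at least 2, a summable 1 / M^2 remains.\<close>
        also have "real M ^ (N + 1) / real M ^ (3 * N) \<le> 1 / real M ^ 2"
        proof -
          have "real M ^ (N + 1) * real M ^ 2 \<le> real M ^ (3 * N)"
            unfolding power_add[symmetric] using M N unfolding N_def by (intro power_increasing) auto
          then show ?thesis using M by (simp add: field_simps)
        qed
        finally show "real (2 * M + 1) ^ (N + 1) * q ^ K \<le> c2 * r ^ (CARD('d) * K) * (1 / real M ^ 2)"
          using c2 r by (simp add: mult_left_mono)
      qed
      finally show ?thesis unfolding M_def .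
    qed
    have "(\<integral>\<^sup>+y. B y * wnorm L J z y \<partial>PiM J (\<lambda>_. lborel)) \<le> (\<integral>\<^sup>+y. B y + (\<Sum>m. T (Suc m) y) \<partial>PiM J (\<lambda>_. lborel))"
      by (intro nn_integral_mono point)
    also have "\<dots> = (\<integral>\<^sup>+y. B y \<partial>PiM J (\<lambda>_. lborel)) + (\<Sum>m. \<integral>\<^sup>+y. T (Suc m) y \<partial>PiM J (\<lambda>_. lborel))"
      by (subst nn_integral_add, simp, simp) (subst nn_integral_suminf, auto)
    also have "\<dots> \<le> ennreal (V ^ K * r ^ (CARD('d) * K)) + (\<Sum>m. ennreal (c2 * r ^ (CARD('d) * K) * (1 / real (Suc m) ^ 2)))"
      unfolding IB by (intro add_mono suminf_le IT) auto
    also have "(\<Sum>m. ennreal (c2 * r ^ (CARD('d) * K) * (1 / real (Suc m) ^ 2))) = ennreal (c2 * r ^ (CARD('d) * K) * S)"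
    proof -
      have "(\<Sum>m. ennreal (c2 * r ^ (CARD('d) * K) * (1 / real (Suc m) ^ 2))) = ennreal (\<Sum>m. c2 * r ^ (CARD('d) * K) * (1 / real (Suc m) ^ 2))"
        using c2 r by (intro suminf_ennreal2 summable_mult sm) simp
      then show ?thesis unfolding S_def suminf_mult[OF sm] .
    qed
    also have "ennreal (V ^ K * r ^ (CARD('d) * K)) + ennreal (c2 * r ^ (CARD('d) * K) * S) = ennreal ((V ^ K + c2 * S) * r ^ (CARD('d) * K))"
      using V c2 S r by (subst ennreal_plus[symmetric]) (auto simp: algebra_simps)
    finally show ?thesis unfolding B_def .
  qed
  show ?thesis
    by (rule exI[of _ "V ^ K + c2 * S"]) (use main V c2 S in auto)
qed

section \<open>Measurable dependence of the weights on the evaluation point and the design\<close>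

lemma measurable_vec_nth:
  assumes [measurable]: "f \<in> borel_measurable M"
  shows "(\<lambda>x. (f x :: real ^ 'd) $ k) \<in> borel_measurable M"
proof -
  have "(\<lambda>x. f x \<bullet> axis k 1) \<in> borel_measurable M" by measurable
  then show ?thesis by (simp add: inner_axis)
qed

lemma measurable_xi:
  assumes "f \<in> borel_measurable M" "g \<in> borel_measurable M"
  shows "(\<lambda>x. xi (f x) (g x) \<kappa>) \<in> borel_measurable M"
  unfolding xi_def by (intro borel_measurable_prod borel_measurable_power borel_measurable_diff measurable_vec_nth assms)

lemma measurable_gram:
  assumes "f \<in> borel_measurable M" "\<And>j. j \<in> J \<Longrightarrow> (\<lambda>x. y x j) \<in> borel_measurable M"
  shows "(\<lambda>x. gram J (f x) (y x) \<kappa> \<kappa>') \<in> borel_measurable M"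
  unfolding gram_def by (intro borel_measurable_sum borel_measurable_times measurable_xi assms)

lemma measurable_wgt:
  assumes "f \<in> borel_measurable M" "\<And>j. j \<in> J \<Longrightarrow> (\<lambda>x. y x j) \<in> borel_measurable M" "v \<in> borel_measurable M"
  shows "(\<lambda>x. wgt L J (f x) (y x) (v x)) \<in> borel_measurable M"
  unfolding wgt_def
  by (intro borel_measurable_sum borel_measurable_times measurable_xi measurable_inv_on measurable_gram assms
      finite_multi_indices zero_multi_indices) auto

lemma measurable_wnorm:
  assumes f: "f \<in> borel_measurable M" and y: "\<And>j. j \<in> J \<Longrightarrow> (\<lambda>x. y x j) \<in> borel_measurable M"
  shows "(\<lambda>x. wnorm L J (f x) (y x)) \<in> borel_measurable M"
proof -
  have [measurable]: "(\<lambda>x. det_on (multi_indices L) (gram J (f x) (y x))) \<in> borel_measurable M"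
    by (intro measurable_det_on finite_multi_indices measurable_gram f y)
  have [measurable]: "(\<lambda>x. \<Sum>j\<in>J. (wgt L J (f x) (y x) (y x j))\<^sup>2) \<in> borel_measurable M"
    by (intro borel_measurable_sum borel_measurable_power measurable_wgt f y)
  show ?thesis unfolding wnorm_def by measurable
qed

section \<open>Nearest neighbour moments\<close>

definition rad :: "nat set \<Rightarrow> real ^ 'd \<Rightarrow> (nat \<Rightarrow> real ^ 'd) \<Rightarrow> real" where
  "rad J z w = Max ((\<lambda>j. norm (z - w j)) ` J)"

text \<open>At most one cell contains z, so the sum has at most one nonzero term; written as a sum
  over J it can be integrated over the design term by term. The radius is measured in units of
  n^(-1/d), the typical distance of a neighbour.\<close>

definition nbr_moment :: "(real ^ 'd) set \<Rightarrow> nat \<Rightarrow> nat \<Rightarrow> nat \<Rightarrow> nat \<Rightarrow> real ^ 'd \<Rightarrow> (nat \<Rightarrow> real ^ 'd) \<Rightarrow> ennreal" where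
  "nbr_moment T n K L q z w = (\<Sum>J\<in>k_subsets n K. indicator (cell T n w J) z *
     (wnorm L J z w * ennreal ((1 + real n powr (1 / real CARD('d)) * rad J z w) ^ q)))"

section \<open>Subsets, radii and cells\<close>

lemma finite_k_subsets: "finite (k_subsets n K)"
  unfolding k_subsets_def by (rule finite_subset[of _ "Pow {1..n}"]) auto

lemma card_k_subsets: "card (k_subsets n K) \<le> n ^ K"
proof -
  have "card (k_subsets n K) = n choose K"
    unfolding k_subsets_def using n_subsets[of "{1..n}" K] by simp
  then show ?thesis using binomial_le_pow2 binomial_le_pow by (metis binomial_eq_0 le0 not_le)
qed

lemma k_subsetsD:
  assumes "J \<in> k_subsets n K" "K > 0"
  shows "finite J" "J \<noteq> {}" "J \<subseteq> {1..n}" "card J = K"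
proof -
  show "card J = K" "J \<subseteq> {1..n}" using assms by (auto simp: k_subsets_def)
  then show "finite J" "J \<noteq> {}" using assms(2) by (auto intro: finite_subset)
qed

lemma rad_ge: "finite J \<Longrightarrow> j \<in> J \<Longrightarrow> norm (z - w j) \<le> rad J z w"
  unfolding rad_def by (intro Max_ge) auto

lemma rad_attained: "finite J \<Longrightarrow> J \<noteq> {} \<Longrightarrow> \<exists>j\<in>J. rad J z w = norm (z - w j)"
proof -
  assume "finite J" "J \<noteq> {}"
  then have "Max ((\<lambda>j. norm (z - w j)) ` J) \<in> (\<lambda>j. norm (z - w j)) ` J" by (intro Max_in) auto
  then obtain j where "Max ((\<lambda>j. norm (z - w j)) ` J) = norm (z - w j)" "j \<in> J" by (rule imageE)
  then show ?thesis unfolding rad_def by (intro bexI[of _ j])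
qed

lemma rad_nonneg: "finite J \<Longrightarrow> J \<noteq> {} \<Longrightarrow> rad J z w \<ge> 0"
  using rad_attained[of J z w] by auto

lemma measurable_rad:
  assumes J: "finite J" and [measurable]: "f \<in> borel_measurable M" and y: "\<And>j. j \<in> J \<Longrightarrow> (\<lambda>x. y x j) \<in> borel_measurable M"
  shows "(\<lambda>x. rad J (f x) (y x)) \<in> borel_measurable M"
  unfolding rad_def
proof (rule borel_measurable_Max[OF J])
  fix j assume "j \<in> J"
  note y[OF this, measurable]
  show "(\<lambda>x. norm (f x - y x j)) \<in> borel_measurable M" by measurable
qed

lemma measurable_cell:
  fixes T :: "(real ^ 'd) set"
  assumes T [measurable]: "T \<in> sets borel" and J: "J \<subseteq> {1..n}"
    and f [measurable]: "f \<in> borel_measurable M" and y: "\<And>j. j \<in> {1..n} \<Longrightarrow> (\<lambda>x. y x j) \<in> borel_measurable M"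
  shows "{x \<in> space M. f x \<in> cell T n (y x) J} \<in> sets M"
proof -
  have fin: "finite J" "finite ({1..n} - J)" using J by (auto intro: finite_subset)
  have eq: "f x \<in> cell T n (y x) J \<longleftrightarrow> f x \<in> T \<and> (\<forall>j\<in>J. \<forall>k\<in>{1..n} - J. norm (f x - y x j) < norm (f x - y x k))" for x
    by (simp add: cell_def)
  have jk: "{x \<in> space M. norm (f x - y x j) < norm (f x - y x k)} \<in> sets M" if "j \<in> J" "k \<in> {1..n} - J" for j k
  proof -
    have [measurable]: "(\<lambda>x. y x j) \<in> borel_measurable M" "(\<lambda>x. y x k) \<in> borel_measurable M" using y that J by auto
    show ?thesis by measurable
  qed
  have "{x \<in> space M. f x \<in> T} \<in> sets M" by measurable
  moreover have "{x \<in> space M. \<forall>j\<in>J. \<forall>k\<in>{1..n} - J. norm (f x - y x j) < norm (f x - y x k)} \<in> sets M"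
    by (rule sets.sets_Collect_finite_All[OF sets.sets_Collect_finite_All[OF jk fin(2)] fin(1)])
  ultimately show ?thesis unfolding eq by (intro sets.sets_Collect_conj)
qed

lemma measurable_indicator_cell:
  fixes T :: "(real ^ 'd) set"
  assumes "T \<in> sets borel" "J \<subseteq> {1..n}" "f \<in> borel_measurable M" "\<And>j. j \<in> {1..n} \<Longrightarrow> (\<lambda>x. y x j) \<in> borel_measurable M"
  shows "(\<lambda>x. indicator (cell T n (y x) J) (f x) :: ennreal) \<in> borel_measurable M"
proof -
  have "(\<lambda>x. indicator (cell T n (y x) J) (f x) :: ennreal) \<in> borel_measurable M \<longleftrightarrow>
      (\<lambda>x. indicator {x \<in> space M. f x \<in> cell T n (y x) J} x :: ennreal) \<in> borel_measurable M"
    by (rule measurable_cong) (simp add: indicator_def)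
  moreover have "(\<lambda>x. indicator {x \<in> space M. f x \<in> cell T n (y x) J} x :: ennreal) \<in> borel_measurable M"
    by (rule borel_measurable_indicator, rule measurable_cell[OF assms])
  ultimately show ?thesis by simp
qed

lemma measurable_nbr_moment:
  fixes T :: "(real ^ 'd) set"
  assumes T: "T \<in> sets borel" and K: "K > 0"
    and f: "f \<in> borel_measurable M" and y: "\<And>j. j \<in> {1..n} \<Longrightarrow> (\<lambda>x. y x j) \<in> borel_measurable M"
  shows "(\<lambda>x. nbr_moment T n K L q (f x) (y x)) \<in> borel_measurable M"
  unfolding nbr_moment_def
proof (rule borel_measurable_sum)
  fix J assume J: "J \<in> k_subsets n K"
  note Jd = k_subsetsD[OF J K]
  have [measurable]: "(\<lambda>x. indicator (cell T n (y x) J) (f x) :: ennreal) \<in> borel_measurable M"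
    by (rule measurable_indicator_cell[OF T Jd(3) f y])
  have [measurable]: "(\<lambda>x. wnorm L J (f x) (y x)) \<in> borel_measurable M"
    using Jd y by (intro measurable_wnorm f) auto
  have [measurable]: "(\<lambda>x. rad J (f x) (y x)) \<in> borel_measurable M"
    using Jd y by (intro measurable_rad f) auto
  show "(\<lambda>x. indicator (cell T n (y x) J) (f x) * (wnorm L J (f x) (y x) * ennreal ((1 + real n powr (1 / real CARD('d)) * rad J (f x) (y x)) ^ q))) \<in> borel_measurable M"
    by measurable
qed

lemma wnorm_cong:
  assumes "\<And>j. j \<in> J \<Longrightarrow> y j = y' j"
  shows "wnorm L J z y = wnorm L J z y'"
proof -
  have g: "gram J z y = gram J z y'"
    unfolding gram_def using assms by (intro ext sum.cong) auto
  have w: "wgt L J z y = wgt L J z y'" unfolding wgt_def g ..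
  have "(\<Sum>j\<in>J. (wgt L J z y (y j))\<^sup>2) = (\<Sum>j\<in>J. (wgt L J z y' (y' j))\<^sup>2)"
    unfolding w using assms by (intro sum.cong) auto
  then show ?thesis unfolding wnorm_def g by simp
qed

lemma rad_cong: "(\<And>j. j \<in> J \<Longrightarrow> y j = y' j) \<Longrightarrow> rad J z y = rad J z y'"
  unfolding rad_def by (metis (no_types, lifting) image_cong)

text \<open>As t^d is at least t - 1, the exponential decays at least at a linear rate in t, and exp
  x is at least (x / b)^b.\<close>

lemma power_exp_decay:
  fixes c :: real
  assumes c: "c > 0" and d: "d \<ge> 1"
  shows "\<exists>C\<ge>0. \<forall>t\<ge>0. (1 + t) ^ a * exp (- c * t ^ d) \<le> C"
proof -
  \<comment> \<open>A successor, so that division by b is legitimate also for a = 0.\<close>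
  define b where "b = Suc a"
  have "(1 + t) ^ a * exp (- c * t ^ d) \<le> (real b / c) ^ b * exp (2 * c)" if t: "t \<ge> 0" for t :: real
  proof -
    have td: "t ^ d \<ge> t - 1"
    proof (cases "t \<ge> 1")
      case True
      then have "t ^ 1 \<le> t ^ d" using d by (intro power_increasing) auto
      then show ?thesis by simp
    next
      case False
      then show ?thesis using t by (smt (verit) zero_le_power)
    qed
    have "exp (- c * t ^ d) \<le> exp (2 * c) * exp (- (c * (1 + t)))"
    proof -
      have "- c * t ^ d \<le> 2 * c + - (c * (1 + t))" using mult_left_mono[OF td, of c] c by (simp add: algebra_simps)
      then show ?thesis unfolding exp_add[symmetric] by (simp only: exp_le_cancel_iff)
    qed
    moreover have "(1 + t) ^ a \<le> (1 + t) ^ b" using t by (intro power_increasing) (auto simp: b_def)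
    ultimately have "(1 + t) ^ a * exp (- c * t ^ d) \<le> (1 + t) ^ b * (exp (2 * c) * exp (- (c * (1 + t))))"
      using t by (intro mult_mono) auto
    moreover have "(1 + t) ^ b * exp (- (c * (1 + t))) \<le> (real b / c) ^ b"
    proof -
      have "(c * (1 + t) / real b) ^ b \<le> (1 + c * (1 + t) / real b) ^ b"
        using c t by (intro power_mono) (auto simp: b_def)
      also have "\<dots> \<le> exp (c * (1 + t))"
        using c t by (intro exp_ge_one_plus_x_over_n_power_n) (auto simp: b_def intro: order_trans[of _ 0])
      finally have "(c * (1 + t) / real b) ^ b \<le> exp (c * (1 + t))" .
      then have u: "(1 + t) ^ b * (c / real b) ^ b \<le> exp (c * (1 + t))"
        by (simp only: power_mult_distrib[symmetric] times_divide_eq_right mult.commute)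
      have cb: "(c / real b) ^ b > 0" using c by (simp add: b_def)
      have "(1 + t) ^ b * exp (- (c * (1 + t))) \<le> exp (c * (1 + t)) / (c / real b) ^ b * exp (- (c * (1 + t)))"
        using u cb by (intro mult_right_mono) (auto simp: pos_le_divide_eq)
      also have "\<dots> = 1 / (c / real b) ^ b" by (simp add: exp_minus)
      also have "\<dots> = (real b / c) ^ b" by (simp add: power_divide)
      finally show ?thesis .
    qed
    ultimately show ?thesis by (smt (verit) exp_gt_zero mult.assoc mult.commute mult_right_mono)
  qed
  then show ?thesis using c by (intro exI[of _ "(real b / c) ^ b * exp (2 * c)"]) auto
qed

text \<open>The coordinates are changed one at a time. The upper bound on the density turns the law
  of the K neighbours into Lebesgue measure on S, for which the integrals of \<open>wnorm\<close>
  are known.\<close>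

lemma nn_integral_PiM_density_le:
  fixes f :: "'b::euclidean_space \<Rightarrow> real"
  assumes f [measurable]: "f \<in> borel_measurable borel" and rb: "rb \<ge> 0" "\<And>x. f x \<le> rb * indicator S x"
    and S [measurable]: "S \<in> sets borel" and pr: "prob_space (density lborel (\<lambda>x. ennreal (f x)))"
    and J: "finite J" and F: "F \<in> borel_measurable (PiM J (\<lambda>_. lborel))"
  shows "(\<integral>\<^sup>+x. F x \<partial>PiM J (\<lambda>_. density lborel (\<lambda>x. ennreal (f x))))
      \<le> ennreal rb ^ card J * (\<integral>\<^sup>+x. (\<Prod>j\<in>J. indicator S (x j)) * F x \<partial>PiM J (\<lambda>_::'i. lborel))"
  using J F
proof (induction J arbitrary: F)
  case empty
  then show ?case by (simp add: PiM_empty nn_integral_count_space_finite)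
next
  case (insert i I)
  define \<nu> where "\<nu> = density lborel (\<lambda>x. ennreal (f x))"
  interpret prob_space \<nu> using pr unfolding \<nu>_def .
  interpret N: product_sigma_finite "\<lambda>_::'i. \<nu>" by unfold_locales
  interpret P: product_sigma_finite "\<lambda>_::'i. lborel :: 'b measure" by unfold_locales
  interpret PI: finite_product_sigma_finite "\<lambda>_::'i. lborel :: 'b measure" I by unfold_locales fact
  have sN: "sets (PiM A (\<lambda>_. \<nu>)) = sets (PiM A (\<lambda>_. lborel))" for A :: "'i set"
    by (intro sets_PiM_cong refl) (simp add: \<nu>_def)
  note insert.prems [measurable]
  have upd: "(\<lambda>(x, y). F (x(i := y))) \<in> borel_measurable (PiM I (\<lambda>_. lborel) \<Otimes>\<^sub>M lborel)"
    using measurable_compose[OF measurable_add_dim insert.prems] by (simp add: case_prod_beta)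
  define g where "g x = (\<integral>\<^sup>+y. indicator S y * F (x(i := y)) \<partial>lborel)" for x
  have gm: "g \<in> borel_measurable (PiM I (\<lambda>_. lborel))"
    unfolding g_def using upd by (intro lborel.borel_measurable_nn_integral) (simp add: case_prod_beta, measurable)
  have upd1: "(\<lambda>y. F (x(i := y))) \<in> borel_measurable borel" if "x \<in> space (PiM I (\<lambda>_. lborel))" for x
    using measurable_compose[OF measurable_Pair1'[OF that] upd] by simp
  have "(\<integral>\<^sup>+x. F x \<partial>PiM (insert i I) (\<lambda>_. \<nu>)) = (\<integral>\<^sup>+x. \<integral>\<^sup>+y. F (x(i := y)) \<partial>\<nu> \<partial>PiM I (\<lambda>_. \<nu>))"
    by (rule N.product_nn_integral_insert[OF insert.hyps(1,2)]) (simp add: measurable_cong_sets[OF sN refl] insert.prems)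
  also have "\<dots> \<le> (\<integral>\<^sup>+x. ennreal rb * g x \<partial>PiM I (\<lambda>_. \<nu>))"
  proof (rule nn_integral_mono)
    fix x assume "x \<in> space (PiM I (\<lambda>_. \<nu>))"
    then have x: "x \<in> space (PiM I (\<lambda>_. lborel))" using sets_eq_imp_space_eq[OF sN] by simp
    note [measurable] = upd1[OF x]
    have "(\<integral>\<^sup>+y. F (x(i := y)) \<partial>\<nu>) = (\<integral>\<^sup>+y. ennreal (f y) * F (x(i := y)) \<partial>lborel)"
      unfolding \<nu>_def by (subst nn_integral_density) auto
    also have "\<dots> \<le> (\<integral>\<^sup>+y. ennreal rb * (indicator S y * F (x(i := y))) \<partial>lborel)"
    proof (rule nn_integral_mono)
      fix y
      have "ennreal (f y) \<le> ennreal rb * indicator S y"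
        using rb(2)[of y] by (cases "y \<in> S") (auto intro: ennreal_leI simp: ennreal_neg)
      then show "ennreal (f y) * F (x(i := y)) \<le> ennreal rb * (indicator S y * F (x(i := y)))"
        by (metis mult.assoc mult_right_mono zero_le)
    qed
    also have "\<dots> = ennreal rb * g x" unfolding g_def by (rule nn_integral_cmult) measurable
    finally show "(\<integral>\<^sup>+y. F (x(i := y)) \<partial>\<nu>) \<le> ennreal rb * g x" .
  qed
  also have "\<dots> = ennreal rb * (\<integral>\<^sup>+x. g x \<partial>PiM I (\<lambda>_. \<nu>))"
    by (rule nn_integral_cmult) (simp add: measurable_cong_sets[OF sN refl] gm)
  also have "\<dots> \<le> ennreal rb * (ennreal rb ^ card I * (\<integral>\<^sup>+x. (\<Prod>j\<in>I. indicator S (x j)) * g x \<partial>PiM I (\<lambda>_. lborel)))"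
    using insert.IH[OF gm] unfolding \<nu>_def by (intro mult_left_mono) auto
  also have "(\<integral>\<^sup>+x. (\<Prod>j\<in>I. indicator S (x j)) * g x \<partial>PiM I (\<lambda>_. lborel))
     = (\<integral>\<^sup>+x. \<integral>\<^sup>+y. (\<Prod>j\<in>insert i I. indicator S ((x(i := y)) j)) * F (x(i := y)) \<partial>lborel \<partial>PiM I (\<lambda>_. lborel))"
  proof (rule nn_integral_cong)
    fix x assume x: "x \<in> space (PiM I (\<lambda>_. lborel :: 'b measure))"
    note [measurable] = upd1[OF x]
    have pr: "(\<Prod>j\<in>insert i I. indicator S ((x(i := y)) j)) = indicator S y * (\<Prod>j\<in>I. indicator S (x j) :: ennreal)" for y
    proof -
      have "(\<Prod>j\<in>I. indicator S ((x(i := y)) j)) = (\<Prod>j\<in>I. indicator S (x j) :: ennreal)"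
        using insert.hyps by (intro prod.cong) auto
      then show ?thesis using insert.hyps by (subst prod.insert) auto
    qed
    show "(\<Prod>j\<in>I. indicator S (x j)) * g x = (\<integral>\<^sup>+y. (\<Prod>j\<in>insert i I. indicator S ((x(i := y)) j)) * F (x(i := y)) \<partial>lborel)"
      unfolding g_def pr by (subst nn_integral_cmult[symmetric]) (auto simp: mult_ac)
  qed
  also have "\<dots> = (\<integral>\<^sup>+x. (\<Prod>j\<in>insert i I. indicator S (x j)) * F x \<partial>PiM (insert i I) (\<lambda>_. lborel))"
  proof (rule P.product_nn_integral_insert[OF insert.hyps(1,2), symmetric])
    have "(\<lambda>x. indicator S (x j) :: ennreal) \<in> borel_measurable (PiM (insert i I) (\<lambda>_. lborel :: 'b measure))" if "j \<in> insert i I" for j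
      by (rule measurable_compose[OF measurable_component_singleton[OF that]]) simp
    then show "(\<lambda>x. (\<Prod>j\<in>insert i I. indicator S (x j)) * F x) \<in> borel_measurable (PiM (insert i I) (\<lambda>_. lborel))"
      by (intro borel_measurable_times_ennreal borel_measurable_prod_ennreal insert.prems) auto
  qed
  finally show ?case using insert.hyps unfolding \<nu>_def by (simp add: mult_ac)
qed

lemma exp_le_one_minus: "1 - x \<le> exp (- x :: real)"
  using exp_ge_add_one_self[of "- x"] by simp

text \<open>A sample point avoids a ball of mass p with probability 1 - p, at most exp (-p). Balls
  about z are known to lie in S only up to radius \<rho>, whereas R may be as large as \<Delta>; the
  radius is therefore shrunk proportionally.\<close>

lemma ball_mass:
  fixes f :: "real ^ 'd \<Rightarrow> real"
  assumes f [measurable]: "f \<in> borel_measurable borel" and pr: "prob_space (density lborel (\<lambda>x. ennreal (f x)))"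
    and ra: "ra > 0" "\<And>x. x \<in> S \<Longrightarrow> ra \<le> f x"
    and \<rho>: "\<rho> > 0" "ball z \<rho> \<subseteq> S" and \<Delta>: "\<rho> \<le> \<Delta>" and R: "0 \<le> R" "R \<le> \<Delta>"
  shows "emeasure (density lborel (\<lambda>x. ennreal (f x))) {v. R < norm (z - v)}
    \<le> ennreal (exp (- (ra * unit_ball_vol (real CARD('d)) * (\<rho> / \<Delta>) ^ CARD('d) * R ^ CARD('d))))"
proof -
  define \<nu> where "\<nu> = density lborel (\<lambda>x. ennreal (f x))"
  interpret prob_space \<nu> using pr unfolding \<nu>_def .
  have sp: "space \<nu> = UNIV" "sets \<nu> = sets borel" by (auto simp: \<nu>_def)
  \<comment> \<open>With this factor r is at most R and at most \<rho> at the same time, and its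
    d-th power is still a fixed multiple of that of R.\<close>
  define r where "r = R * (\<rho> / \<Delta>)"
  have \<Delta>0: "\<Delta> > 0" using \<rho> \<Delta> by simp
  have r: "0 \<le> r" "r \<le> \<rho>" "r \<le> R"
  proof -
    show "0 \<le> r" using R \<rho> \<Delta>0 by (simp add: r_def)
    have "R * \<rho> \<le> \<Delta> * \<rho>" using R \<rho> by (intro mult_right_mono) auto
    then show "r \<le> \<rho>" using \<Delta>0 by (simp add: r_def field_simps)
    have "R * (\<rho> / \<Delta>) \<le> R * 1" using R \<Delta> \<Delta>0 by (intro mult_left_mono) auto
    then show "r \<le> R" by (simp add: r_def)
  qed
  have b [measurable]: "ball z r \<in> sets borel" by simp
  have "ennreal (ra * (unit_ball_vol (real CARD('d)) * r ^ CARD('d))) = ennreal ra * emeasure lborel (ball z r)"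
    using ra r by (simp add: emeasure_ball ennreal_mult)
  also have "\<dots> = (\<integral>\<^sup>+v. ennreal ra * indicator (ball z r) v \<partial>lborel)"
    by (subst nn_integral_cmult_indicator) auto
  also have "\<dots> \<le> (\<integral>\<^sup>+v. ennreal (f v) * indicator (ball z r) v \<partial>lborel)"
  proof (rule nn_integral_mono)
    fix v
    show "ennreal ra * indicator (ball z r) v \<le> ennreal (f v) * indicator (ball z r) v"
    proof (cases "v \<in> ball z r")
      case True
      then have "v \<in> S" using \<rho>(2) r(2) by auto
      then show ?thesis using ra(2)[of v] by (intro mult_right_mono ennreal_leI) auto
    qed simp
  qed
  also have "\<dots> = emeasure \<nu> (ball z r)" unfolding \<nu>_def by (subst emeasure_density) auto
  finally have lo: "ra * (unit_ball_vol (real CARD('d)) * r ^ CARD('d)) \<le> prob (ball z r)"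
    unfolding emeasure_eq_measure using ra r by (simp add: ennreal_le_iff)
  have "{v. R < norm (z - v)} \<subseteq> space \<nu> - ball z r" using r(3) by (auto simp: sp dist_norm)
  then have "emeasure \<nu> {v. R < norm (z - v)} \<le> emeasure \<nu> (space \<nu> - ball z r)"
    by (rule emeasure_mono) (simp add: sp)
  also have "\<dots> = ennreal (1 - prob (ball z r))"
    unfolding emeasure_eq_measure using b sp(2) by (subst prob_compl) auto
  also have "\<dots> \<le> ennreal (exp (- (ra * (unit_ball_vol (real CARD('d)) * r ^ CARD('d)))))"
    using lo exp_le_one_minus[of "ra * (unit_ball_vol (real CARD('d)) * r ^ CARD('d))"] by (intro ennreal_leI) linarith
  also have "ra * (unit_ball_vol (real CARD('d)) * r ^ CARD('d)) = ra * unit_ball_vol (real CARD('d)) * (\<rho> / \<Delta>) ^ CARD('d) * R ^ CARD('d)"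
    unfolding r_def power_mult_distrib by (simp only: mult_ac)
  finally show ?thesis unfolding \<nu>_def .
qed

text \<open>If \<open>J\<close> is the set of neighbours of \<open>z\<close>, then the other \<open>n - K\<close> points avoid the ball of radius
  \<open>rad J z w\<close>; this event has exponentially small probability on the scale \<open>n powr (- 1 / d)\<close>, which
  outweighs the number of choices of \<open>J\<close>.\<close>

lemma nbr_moment_bound:
  fixes f :: "real ^ 'd \<Rightarrow> real"
  assumes L: "L \<ge> 1"
    and N: "card (multi_indices L :: (nat ^ 'd) set) \<ge> 2"
    and K: "K \<ge> 6 * L * card (multi_indices L :: (nat ^ 'd) set)"
    and f [measurable]: "f \<in> borel_measurable borel" and pr: "prob_space (density lborel (\<lambda>x. ennreal (f x)))"
    and rb: "rb \<ge> 0" "\<And>x. f x \<le> rb * indicator S x"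
    and ra: "ra > 0" "\<And>x. x \<in> S \<Longrightarrow> ra \<le> f x"
    and S [measurable]: "S \<in> sets borel" and bS: "bounded S"
    and T: "T \<in> sets borel" "T \<subseteq> S" and \<rho>: "\<rho> > 0" "\<And>z. z \<in> T \<Longrightarrow> ball z \<rho> \<subseteq> S"
  shows "\<exists>C\<ge>0. \<forall>n\<ge>K. \<forall>z\<in>T.
    (\<integral>\<^sup>+w. nbr_moment T n K L q z w \<partial>PiM {1..n} (\<lambda>_. density lborel (\<lambda>x. ennreal (f x)))) \<le> ennreal C"
proof -
  let ?d = "CARD('d)"
  define \<nu> where "\<nu> = density lborel (\<lambda>x. ennreal (f x))"
  interpret prob_space \<nu> using pr unfolding \<nu>_def .
  interpret P: product_sigma_finite "\<lambda>_::nat. \<nu>" by unfold_locales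
  have s\<nu>: "sets \<nu> = sets borel" by (simp add: \<nu>_def)
  have K0: "K > 0" using K L N by (intro gr0I) auto
  obtain D where D: "\<And>x y. x \<in> S \<Longrightarrow> y \<in> S \<Longrightarrow> dist x y \<le> D"
    using bS bounded_any_center bounded_two_points by (metis bounded_two_points)
  \<comment> \<open>Bounds the diameter of S, enlarged if necessary so that the shrinking factor
    \<rho> / \<Delta> is at most 1.\<close>
  define \<Delta> where "\<Delta> = max D \<rho>"
  have \<Delta>: "\<rho> \<le> \<Delta>" "\<And>x y. x \<in> S \<Longrightarrow> y \<in> S \<Longrightarrow> dist x y \<le> \<Delta>"
    using D by (auto simp: \<Delta>_def le_max_iff_disj)
  have \<Delta>0: "\<Delta> > 0" using \<Delta>(1) \<rho>(1) by simp
  define c where "c = ra * unit_ball_vol (real ?d) * (\<rho> / \<Delta>) ^ ?d"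
  have c: "c > 0" using ra \<rho> \<Delta>0 by (simp add: c_def)
  \<comment> \<open>The part d * K pays for the volume factor of K neighbours in a ball of growing
    radius, and the extra 2 leaves a summable series over the shells.\<close>
  define p where "p = ?d * K + 2"
  obtain C2 where C2: "C2 \<ge> 0" "\<And>t. t \<ge> 0 \<Longrightarrow> (1 + t) ^ (q + p) * exp (- c * t ^ ?d) \<le> C2"
    using power_exp_decay[OF c, of ?d "q + p"] by (auto simp: Suc_le_eq)
  obtain C1 where C1: "C1 \<ge> 0" "\<And>J (z :: real ^ 'd) r. card J = K \<Longrightarrow> r > 0 \<Longrightarrow>
    (\<integral>\<^sup>+y. (\<Prod>j\<in>J. indicator (cball z r) (y j)) * wnorm L J z y \<partial>PiM J (\<lambda>_. lborel)) \<le> ennreal (C1 * r ^ (?d * K))"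
    using wnorm_nn_integral[OF L N K] by blast
  define Q where "Q = (\<Sum>m. 1 / real (Suc m) ^ 2)"
  have sm: "summable (\<lambda>m. 1 / real (Suc m) ^ 2)"
    using inverse_power_summable[of 2, where ?'a=real] by (subst summable_Suc_iff) (simp add: divide_inverse)
  have Q: "Q \<ge> 0" unfolding Q_def by (intro suminf_nonneg sm) auto
  \<comment> \<open>The price for replacing the number n - K of remaining points by n in the
    exponent; radii are at most \<Delta>.\<close>
  define E where "E = exp (c * real K * \<Delta> ^ ?d)"
  define C where "C = rb ^ K * (E * C2 * C1 * Q)"
  have C: "C \<ge> 0" using rb C1 C2 Q by (simp add: C_def E_def)
  have main: "(\<integral>\<^sup>+w. nbr_moment T n K L q z w \<partial>PiM {1..n} (\<lambda>_. \<nu>)) \<le> ennreal C"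
    if n: "n \<ge> K" and z: "z \<in> T" for n z
  proof -
    define h where "h = real n powr (1 / real ?d)"
    have n0: "n > 0" using n K0 by simp
    have h: "h > 0" using n0 by (simp add: h_def)
    have hd: "h ^ ?d = real n"
      unfolding h_def using n0 by (simp add: powr_power)
    have zS: "z \<in> S" using z T by blast
    have one: "(\<integral>\<^sup>+w. indicator (cell T n w J) z * (wnorm L J z w * ennreal ((1 + h * rad J z w) ^ q)) \<partial>PiM {1..n} (\<lambda>_. \<nu>))
       \<le> ennreal (C / real n ^ K)" if J: "J \<in> k_subsets n K" for J
    proof -
      note Jd = k_subsetsD[OF J K0]
      define R where "R = {1..n} - J"
      have R: "finite R" "J \<inter> R = {}" "{1..n} = J \<union> R" "card R = n - K"
        using Jd by (auto simp: R_def card_Diff_subset)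
      define F where "F w = wnorm L J z w * ennreal ((1 + h * rad J z w) ^ q)" for w
      have comp: "(\<lambda>w. w j) \<in> borel_measurable (PiM A (\<lambda>_. \<nu>))" if "j \<in> A" for A j
        using measurable_component_singleton[OF that, of "\<lambda>_. \<nu>"] measurable_cong_sets[OF refl s\<nu>] by blast
      have compL: "(\<lambda>w. w j) \<in> borel_measurable (PiM A (\<lambda>_. lborel :: (real ^ 'd) measure))" if "j \<in> A" for A and j :: nat
        using measurable_component_singleton[OF that, of "\<lambda>_. lborel :: (real ^ 'd) measure"] by simp
      have Fm: "F \<in> borel_measurable M" if "\<And>j. j \<in> J \<Longrightarrow> (\<lambda>w. w j) \<in> borel_measurable M" for M
      proof -
        have [measurable]: "wnorm L J z \<in> borel_measurable M" "rad J z \<in> borel_measurable M"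
          using measurable_wnorm[of "\<lambda>_. z" M J "\<lambda>w. w" L] measurable_rad[OF Jd(1), of "\<lambda>_. z" M "\<lambda>w. w"] that by auto
        show ?thesis unfolding F_def by measurable
      qed
      have radm: "rad J z \<in> borel_measurable M" if "\<And>j. j \<in> J \<Longrightarrow> (\<lambda>w. w j) \<in> borel_measurable M" for M
        using measurable_rad[OF Jd(1), of "\<lambda>_. z" M "\<lambda>w. w"] that by auto
      \<comment> \<open>The cell event is enlarged to: all points outside J are farther from z than
        the radius. Given the points of J, the other n - K points are independent of it, so after
        splitting the product measure the probability is a power.\<close>
      have "(\<integral>\<^sup>+w. indicator (cell T n w J) z * F w \<partial>PiM {1..n} (\<lambda>_. \<nu>))
         \<le> (\<integral>\<^sup>+w. F w * (\<Prod>k\<in>R. indicator {v. rad J z w < norm (z - v)} (w k)) \<partial>PiM (J \<union> R) (\<lambda>_. \<nu>))"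
        unfolding R(3)
      proof (rule nn_integral_mono)
        fix w
        have "indicator (cell T n w J) z \<le> (\<Prod>k\<in>R. indicator {v. rad J z w < norm (z - v)} (w k) :: ennreal)"
        proof (cases "z \<in> cell T n w J")
          case True
          obtain j where "j \<in> J" "rad J z w = norm (z - w j)" using rad_attained[OF Jd(1,2)] by blast
          then have "rad J z w < norm (z - w k)" if "k \<in> R" for k
            using True that by (auto simp: cell_def R_def)
          then have "(\<Prod>k\<in>R. indicator {v. rad J z w < norm (z - v)} (w k) :: ennreal) = 1"
            by (intro prod.neutral) simp
          then show ?thesis by (simp add: indicator_def)
        qed simp
        then show "indicator (cell T n w J) z * F w \<le> F w * (\<Prod>k\<in>R. indicator {v. rad J z w < norm (z - v)} (w k))"
          by (metis mult.commute mult_left_mono zero_le)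
      qed
      also have "\<dots> = (\<integral>\<^sup>+x. \<integral>\<^sup>+y. F (merge J R (x, y)) * (\<Prod>k\<in>R. indicator {v. rad J z (merge J R (x, y)) < norm (z - v)} (merge J R (x, y) k)) \<partial>PiM R (\<lambda>_. \<nu>) \<partial>PiM J (\<lambda>_. \<nu>))"
      proof (rule P.product_nn_integral_fold[OF R(2) Jd(1) R(1)])
        have cJ: "(\<lambda>w. w j) \<in> borel_measurable (PiM (J \<union> R) (\<lambda>_. \<nu>))" if "j \<in> J" for j using that by (intro comp) auto
        have m1: "F \<in> borel_measurable (PiM (J \<union> R) (\<lambda>_. \<nu>))" by (rule Fm[OF cJ])
        have [measurable]: "rad J z \<in> borel_measurable (PiM (J \<union> R) (\<lambda>_. \<nu>))" by (rule radm[OF cJ])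
        have m2: "(\<lambda>w. indicator {v. rad J z w < norm (z - v)} (w k) :: ennreal) \<in> borel_measurable (PiM (J \<union> R) (\<lambda>_. \<nu>))" if "k \<in> R" for k
        proof -
          have [measurable]: "(\<lambda>w. w k) \<in> borel_measurable (PiM (J \<union> R) (\<lambda>_. \<nu>))" using that by (intro comp) auto
          have "(\<lambda>w. if rad J z w < norm (z - w k) then 1 else 0 :: ennreal) \<in> borel_measurable (PiM (J \<union> R) (\<lambda>_. \<nu>))" by measurable
          then show ?thesis by (simp add: indicator_def)
        qed
        show "(\<lambda>w. F w * (\<Prod>k\<in>R. indicator {v. rad J z w < norm (z - v)} (w k))) \<in> borel_measurable (PiM (J \<union> R) (\<lambda>_. \<nu>))"
          by (intro borel_measurable_times_ennreal borel_measurable_prod_ennreal m1 m2)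
      qed
      also have "\<dots> = (\<integral>\<^sup>+x. F x * emeasure \<nu> {v. rad J z x < norm (z - v)} ^ (n - K) \<partial>PiM J (\<lambda>_. \<nu>))"
      proof (rule nn_integral_cong)
        fix x
        have mJ: "merge J R (x, y) j = x j" if "j \<in> J" for j and y :: "nat \<Rightarrow> real ^ 'd" using that by (simp add: merge_def)
        have mR: "merge J R (x, y) k = y k" if "k \<in> R" for k and y :: "nat \<Rightarrow> real ^ 'd" using that R(2) by (auto simp: merge_def)
        have w: "wnorm L J z (merge J R (x, y)) = wnorm L J z x" "rad J z (merge J R (x, y)) = rad J z x" for y
          using wnorm_cong[of J "merge J R (x, y)" x] rad_cong[of J "merge J R (x, y)" x] mJ by auto
        have [measurable]: "{v. rad J z x < norm (z - v)} \<in> sets borel" by measurable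
        have ms: "{v. rad J z x < norm (z - v)} \<in> sets \<nu>" unfolding s\<nu> by measurable
        have "(\<integral>\<^sup>+y. F (merge J R (x, y)) * (\<Prod>k\<in>R. indicator {v. rad J z (merge J R (x, y)) < norm (z - v)} (merge J R (x, y) k)) \<partial>PiM R (\<lambda>_. \<nu>))
           = (\<integral>\<^sup>+y. F x * (\<Prod>k\<in>R. indicator {v. rad J z x < norm (z - v)} (y k)) \<partial>PiM R (\<lambda>_. \<nu>))"
          unfolding F_def w by (intro nn_integral_cong arg_cong2[where f="(*)"] refl prod.cong) (simp add: mR)
        also have "\<dots> = F x * (\<integral>\<^sup>+y. (\<Prod>k\<in>R. indicator {v. rad J z x < norm (z - v)} (y k)) \<partial>PiM R (\<lambda>_. \<nu>))"
        proof (rule nn_integral_cmult, rule borel_measurable_prod_ennreal)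
          fix k assume "k \<in> R"
          then show "(\<lambda>y. indicator {v. rad J z x < norm (z - v)} (y k) :: ennreal) \<in> borel_measurable (PiM R (\<lambda>_. \<nu>))"
            by (intro measurable_compose[OF comp]) auto
        qed
        also have "(\<integral>\<^sup>+y. (\<Prod>k\<in>R. indicator {v. rad J z x < norm (z - v)} (y k)) \<partial>PiM R (\<lambda>_. \<nu>)) = (\<Prod>k\<in>R. \<integral>\<^sup>+v. indicator {v. rad J z x < norm (z - v)} v \<partial>\<nu>)"
          using ms by (intro P.product_nn_integral_prod R(1)) auto
        also have "\<dots> = emeasure \<nu> {v. rad J z x < norm (z - v)} ^ (n - K)"
          using ms R(4) by simp
        finally show "(\<integral>\<^sup>+y. F (merge J R (x, y)) * (\<Prod>k\<in>R. indicator {v. rad J z (merge J R (x, y)) < norm (z - v)} (merge J R (x, y) k)) \<partial>PiM R (\<lambda>_. \<nu>))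
           = F x * emeasure \<nu> {v. rad J z x < norm (z - v)} ^ (n - K)" .
      qed
      \<comment> \<open>The mass is written as an integral over v, which is visibly measurable in
        the configuration x.\<close>
      also have "\<dots> \<le> (\<integral>\<^sup>+x. F x * (\<integral>\<^sup>+v. indicator {v. rad J z x < norm (z - v)} v \<partial>\<nu>) ^ (n - K) \<partial>PiM J (\<lambda>_. \<nu>))"
      proof (rule nn_integral_mono)
        fix x
        have ms: "{v. rad J z x < norm (z - v)} \<in> sets \<nu>" unfolding s\<nu> by measurable
        show "F x * emeasure \<nu> {v. rad J z x < norm (z - v)} ^ (n - K) \<le> F x * (\<integral>\<^sup>+v. indicator {v. rad J z x < norm (z - v)} v \<partial>\<nu>) ^ (n - K)"
          using ms by simp
      qed
      also have "\<dots> \<le> ennreal rb ^ card J * (\<integral>\<^sup>+x. (\<Prod>j\<in>J. indicator S (x j)) * (F x * (\<integral>\<^sup>+v. indicator {v. rad J z x < norm (z - v)} v \<partial>\<nu>) ^ (n - K)) \<partial>PiM J (\<lambda>_. lborel))"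
      proof -
        have [measurable]: "rad J z \<in> borel_measurable (PiM J (\<lambda>_. lborel))" by (rule radm[OF compL])
        have m1: "F \<in> borel_measurable (PiM J (\<lambda>_. lborel))" by (rule Fm[OF compL])
        have "(\<lambda>(x, v). if rad J z x < norm (z - v) then 1 else 0 :: ennreal) \<in> borel_measurable (PiM J (\<lambda>_. lborel) \<Otimes>\<^sub>M borel)" by measurable
        then have "(\<lambda>(x, v). if rad J z x < norm (z - v) then 1 else 0 :: ennreal) \<in> borel_measurable (PiM J (\<lambda>_. lborel) \<Otimes>\<^sub>M \<nu>)"
          using measurable_cong_sets[OF sets_pair_measure_cong[OF refl s\<nu>] refl] by blast
        then have "(\<lambda>x. \<integral>\<^sup>+v. (if rad J z x < norm (z - v) then 1 else 0) \<partial>\<nu>) \<in> borel_measurable (PiM J (\<lambda>_. lborel))"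
          by (rule borel_measurable_nn_integral)
        moreover have "(if rad J z x < norm (z - v) then 1 else 0) = (indicator {v. rad J z x < norm (z - v)} v :: ennreal)" for x v
          by (simp add: indicator_def)
        ultimately have m2: "(\<lambda>x. \<integral>\<^sup>+v. indicator {v. rad J z x < norm (z - v)} v \<partial>\<nu>) \<in> borel_measurable (PiM J (\<lambda>_. lborel))"
          by (simp only:)
        have "(\<lambda>x. F x * (\<integral>\<^sup>+v. indicator {v. rad J z x < norm (z - v)} v \<partial>\<nu>) ^ (n - K)) \<in> borel_measurable (PiM J (\<lambda>_. lborel))"
          using m1 m2 by measurable
        then show ?thesis
          unfolding \<nu>_def by (intro nn_integral_PiM_density_le f rb S pr Jd(1)) auto
      qed
      \<comment> \<open>The radius lies in one shell, from m / h to (m + 1) / h. There the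
        exponential and the power are bounded by a constant depending on m only, and all neighbours
        lie in the ball of radius (m + 1) / h; the sum over all m dominates the single term.\<close>
      also have "(\<integral>\<^sup>+x. (\<Prod>j\<in>J. indicator S (x j)) * (F x * (\<integral>\<^sup>+v. indicator {v. rad J z x < norm (z - v)} v \<partial>\<nu>) ^ (n - K)) \<partial>PiM J (\<lambda>_. lborel))
        \<le> (\<integral>\<^sup>+x. (\<Sum>m. ennreal (E * C2 / real (Suc m) ^ p) * ((\<Prod>j\<in>J. indicator (cball z (real (Suc m) / h)) (x j)) * wnorm L J z x)) \<partial>PiM J (\<lambda>_. lborel))"
      proof (rule nn_integral_mono)
        fix x
        show "(\<Prod>j\<in>J. indicator S (x j)) * (F x * (\<integral>\<^sup>+v. indicator {v. rad J z x < norm (z - v)} v \<partial>\<nu>) ^ (n - K))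
          \<le> (\<Sum>m. ennreal (E * C2 / real (Suc m) ^ p) * ((\<Prod>j\<in>J. indicator (cball z (real (Suc m) / h)) (x j)) * wnorm L J z x))"
        proof (cases "\<forall>j\<in>J. x j \<in> S")
          case True
          define t where "t = h * rad J z x"
          have r0: "0 \<le> rad J z x" by (rule rad_nonneg[OF Jd(1,2)])
          have r\<Delta>: "rad J z x \<le> \<Delta>"
          proof -
            obtain j where "j \<in> J" "rad J z x = norm (z - x j)" using rad_attained[OF Jd(1,2)] by blast
            then show ?thesis using \<Delta>(2)[OF zS] True by (auto simp: dist_norm)
          qed
          have t0: "t \<ge> 0" using r0 h by (simp add: t_def)
          have ms: "{v. rad J z x < norm (z - v)} \<in> sets \<nu>" unfolding s\<nu> by measurable
          have "(\<integral>\<^sup>+v. indicator {v. rad J z x < norm (z - v)} v \<partial>\<nu>) = emeasure \<nu> {v. rad J z x < norm (z - v)}"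
            using ms by simp
          also have "\<dots> \<le> ennreal (exp (- (c * rad J z x ^ ?d)))"
            unfolding \<nu>_def c_def by (rule ball_mass[OF f pr ra \<rho>(1) \<rho>(2)[OF z] \<Delta>(1) r0 r\<Delta>])
          finally have "(\<integral>\<^sup>+v. indicator {v. rad J z x < norm (z - v)} v \<partial>\<nu>) ^ (n - K) \<le> ennreal (exp (- (c * rad J z x ^ ?d))) ^ (n - K)"
            by (intro power_mono) auto
          also have "\<dots> = ennreal (exp (- (real (n - K) * (c * rad J z x ^ ?d))))"
            by (simp add: ennreal_power exp_of_nat_mult[symmetric])
          also have "\<dots> \<le> ennreal (E * exp (- c * t ^ ?d))"
          proof (rule ennreal_leI)
            have "rad J z x ^ ?d \<le> \<Delta> ^ ?d" using r0 r\<Delta> by (intro power_mono)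
            then have "c * real K * rad J z x ^ ?d \<le> c * real K * \<Delta> ^ ?d" using c by (intro mult_left_mono) auto
            moreover have "c * t ^ ?d = c * real n * rad J z x ^ ?d" by (simp add: t_def power_mult_distrib hd)
            moreover have "real (n - K) * (c * rad J z x ^ ?d) = c * real n * rad J z x ^ ?d - c * real K * rad J z x ^ ?d"
              using n by (simp add: of_nat_diff algebra_simps)
            ultimately have "- (real (n - K) * (c * rad J z x ^ ?d)) \<le> c * real K * \<Delta> ^ ?d + - c * t ^ ?d"
              unfolding mult_minus_left by linarith
            then show "exp (- (real (n - K) * (c * rad J z x ^ ?d))) \<le> E * exp (- c * t ^ ?d)"
              unfolding E_def exp_add[symmetric] by (simp only: exp_le_cancel_iff)
          qed
          finally have b1: "(\<integral>\<^sup>+v. indicator {v. rad J z x < norm (z - v)} v \<partial>\<nu>) ^ (n - K) \<le> ennreal (E * exp (- c * t ^ ?d))" .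
          define m where "m = nat \<lfloor>t\<rfloor>"
          have "real m = real_of_int \<lfloor>t\<rfloor>" using t0 by (simp add: m_def)
          then have m: "real m \<le> t" "t \<le> real (Suc m)" by linarith+
          have "(1 + t) ^ q * exp (- c * t ^ ?d) \<le> C2 / real (Suc m) ^ p"
          proof -
            have "real (Suc m) ^ p \<le> (1 + t) ^ p" using m by (intro power_mono) auto
            then have "(1 + t) ^ q * exp (- c * t ^ ?d) * real (Suc m) ^ p \<le> (1 + t) ^ q * exp (- c * t ^ ?d) * (1 + t) ^ p"
              using t0 by (intro mult_left_mono) auto
            also have "\<dots> = (1 + t) ^ (q + p) * exp (- c * t ^ ?d)" by (simp add: power_add)
            also have "\<dots> \<le> C2" by (rule C2(2)[OF t0])
            finally show ?thesis by (simp add: field_simps)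
          qed
          then have "E * ((1 + t) ^ q * exp (- c * t ^ ?d)) \<le> E * (C2 / real (Suc m) ^ p)"
            by (intro mult_left_mono) (auto simp: E_def)
          then have b2: "(1 + t) ^ q * (E * exp (- c * t ^ ?d)) \<le> E * C2 / real (Suc m) ^ p" by (simp add: mult_ac)
          have b3: "(\<Prod>j\<in>J. indicator (cball z (real (Suc m) / h)) (x j)) = (1 :: ennreal)"
          proof (intro prod.neutral ballI)
            fix j assume "j \<in> J"
            then have "h * norm (z - x j) \<le> real (Suc m)"
              using rad_ge[OF Jd(1), of j z x] m(2) h unfolding t_def by (meson mult_left_mono less_imp_le order_trans)
            then show "indicator (cball z (real (Suc m) / h)) (x j) = (1 :: ennreal)"
              using h by (simp add: dist_norm field_simps)
          qed
          have "(\<Prod>j\<in>J. indicator S (x j)) * (F x * (\<integral>\<^sup>+v. indicator {v. rad J z x < norm (z - v)} v \<partial>\<nu>) ^ (n - K))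
            \<le> 1 * (F x * ennreal (E * exp (- c * t ^ ?d)))"
            using True by (intro mult_mono b1) auto
          also have "\<dots> = ennreal ((1 + t) ^ q * (E * exp (- c * t ^ ?d))) * wnorm L J z x"
          proof -
            have "ennreal ((1 + t) ^ q * (E * exp (- c * t ^ ?d))) = ennreal ((1 + t) ^ q) * ennreal (E * exp (- c * t ^ ?d))"
              using t0 by (intro ennreal_mult) (auto simp: E_def)
            then show ?thesis by (simp add: F_def t_def[symmetric] mult_ac)
          qed
          also have "\<dots> \<le> ennreal (E * C2 / real (Suc m) ^ p) * ((\<Prod>j\<in>J. indicator (cball z (real (Suc m) / h)) (x j)) * wnorm L J z x)"
            unfolding b3 mult_1 by (intro mult_right_mono ennreal_leI b2) auto
          also have "\<dots> = (\<Sum>m\<in>{m}. ennreal (E * C2 / real (Suc m) ^ p) * ((\<Prod>j\<in>J. indicator (cball z (real (Suc m) / h)) (x j)) * wnorm L J z x))"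
            by simp
          also have "\<dots> \<le> (\<Sum>m. ennreal (E * C2 / real (Suc m) ^ p) * ((\<Prod>j\<in>J. indicator (cball z (real (Suc m) / h)) (x j)) * wnorm L J z x))"
            by (rule sum_le_suminf) auto
          finally show ?thesis .
        next
          case False
          then have "(\<Prod>j\<in>J. indicator S (x j)) = (0 :: ennreal)" using Jd(1) by (intro prod_zero) (auto simp: indicator_def)
          then show ?thesis by (simp only: mult_zero_left zero_le)
        qed
      qed
      also have "\<dots> = (\<Sum>m. ennreal (E * C2 / real (Suc m) ^ p) * (\<integral>\<^sup>+x. (\<Prod>j\<in>J. indicator (cball z (real (Suc m) / h)) (x j)) * wnorm L J z x \<partial>PiM J (\<lambda>_. lborel)))"
      proof -
        have m1: "(\<lambda>x. indicator (cball z (real (Suc m) / h)) (x j) :: ennreal) \<in> borel_measurable (PiM J (\<lambda>_. lborel))" if "j \<in> J" for j m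
          by (rule measurable_compose[OF compL[OF that]], rule borel_measurable_indicator) simp
        have m2: "wnorm L J z \<in> borel_measurable (PiM J (\<lambda>_. lborel))"
          using measurable_wnorm[of "\<lambda>_. z" _ J "\<lambda>w. w" L] compL by auto
        have m3: "(\<lambda>x. (\<Prod>j\<in>J. indicator (cball z (real (Suc m) / h)) (x j)) * wnorm L J z x) \<in> borel_measurable (PiM J (\<lambda>_. lborel))" for m
          by (intro borel_measurable_times_ennreal borel_measurable_prod_ennreal m1 m2)
        show ?thesis
          by (subst nn_integral_suminf, intro borel_measurable_times_ennreal borel_measurable_const m3,
              subst nn_integral_cmult, rule m3, rule refl)
      qed
      also have "\<dots> \<le> (\<Sum>m. ennreal (E * C2 * C1 / real n ^ K * (1 / real (Suc m) ^ 2)))"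
      proof (rule suminf_le)
        fix m
        have "(\<integral>\<^sup>+x. (\<Prod>j\<in>J. indicator (cball z (real (Suc m) / h)) (x j)) * wnorm L J z x \<partial>PiM J (\<lambda>_. lborel)) \<le> ennreal (C1 * (real (Suc m) / h) ^ (?d * K))"
          using h Jd(4) by (intro C1(2)) auto
        then have "ennreal (E * C2 / real (Suc m) ^ p) * (\<integral>\<^sup>+x. (\<Prod>j\<in>J. indicator (cball z (real (Suc m) / h)) (x j)) * wnorm L J z x \<partial>PiM J (\<lambda>_. lborel))
          \<le> ennreal (E * C2 / real (Suc m) ^ p) * ennreal (C1 * (real (Suc m) / h) ^ (?d * K))"
          by (intro mult_left_mono) auto
        also have "\<dots> = ennreal (E * C2 / real (Suc m) ^ p * (C1 * (real (Suc m) / h) ^ (?d * K)))"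
          using C1(1) C2(1) h by (intro ennreal_mult[symmetric]) (auto simp: E_def)
        also have "E * C2 / real (Suc m) ^ p * (C1 * (real (Suc m) / h) ^ (?d * K)) = E * C2 * C1 / real n ^ K * (1 / real (Suc m) ^ 2)"
        proof -
          \<comment> \<open>The units are chosen for this: the volume of K small balls produces
            n^(-K).\<close>
          have "h ^ (?d * K) = real n ^ K" by (simp add: power_mult hd)
          moreover have "real (Suc m) ^ p = real (Suc m) ^ (?d * K) * real (Suc m) ^ 2" by (simp only: p_def power_add)
          ultimately show ?thesis by (simp add: power_divide mult_ac del: of_nat_Suc)
        qed
        finally show "ennreal (E * C2 / real (Suc m) ^ p) * (\<integral>\<^sup>+x. (\<Prod>j\<in>J. indicator (cball z (real (Suc m) / h)) (x j)) * wnorm L J z x \<partial>PiM J (\<lambda>_. lborel))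
          \<le> ennreal (E * C2 * C1 / real n ^ K * (1 / real (Suc m) ^ 2))" .
      qed auto
      also have "\<dots> = ennreal (E * C2 * C1 / real n ^ K * Q)"
      proof -
        have "(\<Sum>m. ennreal (E * C2 * C1 / real n ^ K * (1 / real (Suc m) ^ 2))) = ennreal (\<Sum>m. E * C2 * C1 / real n ^ K * (1 / real (Suc m) ^ 2))"
          using C1(1) C2(1) by (intro suminf_ennreal2 summable_mult sm) (simp add: E_def)
        then show ?thesis unfolding Q_def suminf_mult[OF sm] .
      qed
      also have "ennreal rb ^ card J * ennreal (E * C2 * C1 / real n ^ K * Q) = ennreal (C / real n ^ K)"
      proof -
        have "ennreal rb ^ card J * ennreal (E * C2 * C1 / real n ^ K * Q) = ennreal (rb ^ K * (E * C2 * C1 / real n ^ K * Q))"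
          using rb(1) C1(1) C2(1) Q Jd(4) by (subst ennreal_mult) (auto simp: ennreal_power E_def)
        then show ?thesis by (simp add: C_def mult_ac)
      qed
      finally show ?thesis unfolding F_def by (simp add: mult_left_mono)
    qed
    have "(\<integral>\<^sup>+w. nbr_moment T n K L q z w \<partial>PiM {1..n} (\<lambda>_. \<nu>))
      = (\<Sum>J\<in>k_subsets n K. \<integral>\<^sup>+w. indicator (cell T n w J) z * (wnorm L J z w * ennreal ((1 + h * rad J z w) ^ q)) \<partial>PiM {1..n} (\<lambda>_. \<nu>))"
      unfolding nbr_moment_def h_def[symmetric]
    proof (rule nn_integral_sum)
      fix J assume J: "J \<in> k_subsets n K"
      note Jd = k_subsetsD[OF J K0]
      have comp: "(\<lambda>w. w j) \<in> borel_measurable (PiM {1..n} (\<lambda>_. \<nu>))" if "j \<in> {1..n}" for j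
        using measurable_component_singleton[OF that, of "\<lambda>_. \<nu>"] measurable_cong_sets[OF refl s\<nu>] by blast
      have compJ: "(\<lambda>w. w j) \<in> borel_measurable (PiM {1..n} (\<lambda>_. \<nu>))" if "j \<in> J" for j
        using that Jd(3) by (intro comp) auto
      have [measurable]: "(\<lambda>w. indicator (cell T n w J) z :: ennreal) \<in> borel_measurable (PiM {1..n} (\<lambda>_. \<nu>))"
        by (rule measurable_indicator_cell[OF T(1) Jd(3) _ comp]) auto
      have [measurable]: "wnorm L J z \<in> borel_measurable (PiM {1..n} (\<lambda>_. \<nu>))" "rad J z \<in> borel_measurable (PiM {1..n} (\<lambda>_. \<nu>))"
        using measurable_wnorm[of "\<lambda>_. z" _ J "\<lambda>w. w" L] measurable_rad[OF Jd(1), of "\<lambda>_. z" _ "\<lambda>w. w"] compJ by auto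
      show "(\<lambda>w. indicator (cell T n w J) z * (wnorm L J z w * ennreal ((1 + h * rad J z w) ^ q))) \<in> borel_measurable (PiM {1..n} (\<lambda>_. \<nu>))"
        by measurable
    qed
    also have "\<dots> \<le> (\<Sum>J\<in>k_subsets n K. ennreal (C / real n ^ K))"
      by (intro sum_mono one)
    also have "\<dots> = ennreal (real (card (k_subsets n K)) * (C / real n ^ K))"
      using C by (simp add: ennreal_of_nat_eq_real_of_nat ennreal_mult[symmetric])
    also have "\<dots> \<le> ennreal C"
    proof (rule ennreal_leI)
      \<comment> \<open>The n^K choices of J cancel the factor n^(-K) that each of them
        carries.\<close>
      have "real (card (k_subsets n K)) \<le> real n ^ K" using card_k_subsets[of n K] by (metis of_nat_le_iff of_nat_power)
      then have "real (card (k_subsets n K)) * (C / real n ^ K) \<le> real n ^ K * (C / real n ^ K)" using C by (intro mult_right_mono) auto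
      then show "real (card (k_subsets n K)) * (C / real n ^ K) \<le> C" using n0 by simp
    qed
    finally show ?thesis .
  qed
  show ?thesis using main C unfolding \<nu>_def by (intro exI[of _ C]) auto
qed

section \<open>Fourier series on the cube\<close>

definition cube :: "(real ^ 'd) set" where
  "cube = cbox (\<chi> k. - pi) (\<chi> k. pi)"

definition open_cube :: "(real ^ 'd) set" where
  "open_cube = box (\<chi> k. - pi) (\<chi> k. pi)"

lemma cube_iff: "x \<in> cube \<longleftrightarrow> (\<forall>k. - pi \<le> x $ k \<and> x $ k \<le> pi)"
  by (simp add: cube_def mem_box_cart)

lemma open_cube_iff: "x \<in> open_cube \<longleftrightarrow> (\<forall>k. - pi < x $ k \<and> x $ k < pi)"
  by (simp add: open_cube_def mem_box_cart)

lemma open_cube_subset: "open_cube \<subseteq> cube"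
  by (auto simp: cube_iff open_cube_iff less_imp_le)

lemma cube_sets [measurable]: "cube \<in> sets borel"
  by (simp add: cube_def)

lemma open_cube_sets [measurable]: "open_cube \<in> sets borel"
  by (simp add: open_cube_def)

lemma compact_cube: "compact (cube :: (real ^ 'd) set)"
  by (simp add: cube_def)

lemma emeasure_cube: "emeasure lborel (cube :: (real ^ 'd) set) = ennreal ((2 * pi) ^ CARD('d))"
proof -
  have "emeasure lborel (cube :: (real ^ 'd) set) = (\<Prod>b\<in>Basis. ((\<chi> k. pi) - (\<chi> k. - pi) :: real ^ 'd) \<bullet> b)"
    unfolding cube_def by (rule emeasure_lborel_cbox) (auto simp: Basis_vec_def inner_axis)
  also have "(\<Prod>b\<in>Basis. ((\<chi> k. pi) - (\<chi> k. - pi) :: real ^ 'd) \<bullet> b) = (\<Prod>b\<in>(Basis :: (real ^ 'd) set). 2 * pi)"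
    by (intro prod.cong refl) (auto simp: Basis_vec_def inner_axis)
  finally show ?thesis by simp
qed

lemma integrable_cube:
  fixes g :: "real ^ 'd \<Rightarrow> complex"
  assumes [measurable]: "g \<in> borel_measurable borel" and b: "\<And>x. x \<in> cube \<Longrightarrow> cmod (g x) \<le> B"
  shows "integrable lborel (\<lambda>x. indicator cube x *\<^sub>R g x)"
proof (rule integrableI_bounded_set_indicator[where B=B])
  show "emeasure lborel (cube :: (real ^ 'd) set) < \<infinity>" by (simp add: emeasure_cube)
qed (use b in auto)

lemma integrable_cube_real:
  fixes g :: "real ^ 'd \<Rightarrow> real"
  assumes [measurable]: "g \<in> borel_measurable borel" and b: "\<And>x. x \<in> cube \<Longrightarrow> \<bar>g x\<bar> \<le> B"
  shows "integrable lborel (\<lambda>x. indicator cube x * g x)"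
proof -
  have "integrable lborel (\<lambda>x. indicator cube x *\<^sub>R g x)"
  proof (rule integrableI_bounded_set_indicator[where B=B])
    show "emeasure lborel (cube :: (real ^ 'd) set) < \<infinity>" by (simp add: emeasure_cube)
  qed (use b in auto)
  then show ?thesis by simp
qed

lemma fchar_add: "fchar (j + k) x = fchar j x * fchar k x"
  by (simp add: fchar_def exp_add[symmetric] distrib_left distrib_right sum.distrib)

lemma fchar_0 [simp]: "fchar 0 x = 1"
  by (simp add: fchar_def)

lemma norm_fchar [simp]: "cmod (fchar j x) = 1"
  by (simp add: fchar_def norm_exp_i_times)

lemma cnj_fchar: "cnj (fchar j x) = fchar (- j) x"
  by (simp add: fchar_def exp_cnj sum_negf)

lemma fchar_shift: "fchar j (x + y) = fchar j x * fchar j y"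
  by (simp add: fchar_def exp_add[symmetric] distrib_left sum.distrib)

lemma fchar_measurable [measurable]: "fchar j \<in> borel_measurable borel"
proof -
  have "continuous_on UNIV (fchar j)" unfolding fchar_def by (intro continuous_intros)
  then show ?thesis by (rule borel_measurable_continuous_onI)
qed

lemma integral_cis_int:
  "(LINT t:{-pi..pi}|lborel. exp (\<i> * complex_of_real (real_of_int m * t))) = (if m = 0 then 2 * pi else 0)"
proof (cases "m = 0")
  case True
  then show ?thesis by (simp add: set_lebesgue_integral_def scaleR_conv_of_real)
next
  case False
  define f where "f z = exp (\<i> * of_int m * z) / (\<i> * of_int m)" for z :: complex
  define F where "F t = f (complex_of_real t)" for t
  have e: "exp (\<i> * complex_of_real (real_of_int m * t)) = exp (\<i> * of_int m * complex_of_real t)" for t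
    by (simp add: mult.assoc)
  have "(f has_field_derivative exp (\<i> * of_int m * z)) (at z)" for z
    unfolding f_def using False by (auto intro!: derivative_eq_intros)
  then have D: "(F has_vector_derivative exp (\<i> * complex_of_real (real_of_int m * t))) (at t within {-pi..pi})" for t
    unfolding F_def e by (intro has_vector_derivative_real_field)
  have "(LINT t:{-pi..pi}|lborel. exp (\<i> * complex_of_real (real_of_int m * t))) = F pi - F (- pi)"
    unfolding set_lebesgue_integral_def
    by (rule integral_FTC_atLeastAtMost) (use D in \<open>auto intro!: continuous_intros\<close>)
  also have "F pi = F (- pi)"
  proof -
    have "exp (\<i> * complex_of_real (real_of_int m * pi)) = exp (\<i> * complex_of_real (real_of_int m * (- pi)))"
      by (subst exp_eq) (auto intro!: exI[of _ m] simp: algebra_simps)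
    then show ?thesis unfolding F_def f_def e by simp
  qed
  finally show ?thesis using False by simp
qed

lemma bij_axis: "bij_betw (\<lambda>k. axis k 1) (UNIV :: 'd set) (Basis :: (real ^ 'd) set)"
  unfolding bij_betw_def by (auto simp: inj_on_def axis_eq_axis Basis_vec_def)

lemma integral_fchar:
  fixes j :: "int ^ 'd"
  shows "(LINT x|lborel. indicator cube x *\<^sub>R fchar j x) = (if j = 0 then (2 * pi) ^ CARD('d) else 0)"
proof -
  interpret product_sigma_finite "\<lambda>_::real ^ 'd. lborel :: real measure" ..
  let ?B = "Basis :: (real ^ 'd) set"
  define J where "J b = j $ (the_inv_into UNIV (\<lambda>k. axis k (1::real)) b)" for b
  have inv: "the_inv_into UNIV (\<lambda>k. axis k (1::real)) (axis k 1) = k" for k :: 'd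
    by (rule the_inv_into_f_f) (auto simp: inj_on_def axis_eq_axis)
  have comp: "(\<Sum>b\<in>?B. x b *\<^sub>R b) $ k = x (axis k 1)" for x k
    by (subst sum.reindex_bij_betw[OF bij_axis, symmetric])
       (simp add: axis_def if_distrib sum.delta cong: if_cong)
  have meas: "(\<lambda>x. indicator cube x *\<^sub>R fchar j x) \<in> borel_measurable (borel :: (real ^ 'd) measure)" by measurable
  have "(LINT x|lborel. indicator cube x *\<^sub>R fchar j x)
     = (LINT x|PiM ?B (\<lambda>_. lborel). indicator cube (\<Sum>b\<in>?B. x b *\<^sub>R b) *\<^sub>R fchar j (\<Sum>b\<in>?B. x b *\<^sub>R b))"
    by (subst lborel_eq) (rule integral_distr[OF _ meas], measurable)
  also have "\<dots> = (LINT x|PiM ?B (\<lambda>_. lborel). (\<Prod>b\<in>?B. indicator {-pi..pi} (x b) *\<^sub>R exp (\<i> * complex_of_real (real_of_int (J b) * x b))))"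
  proof (intro Bochner_Integration.integral_cong refl)
    fix x :: "real ^ 'd \<Rightarrow> real"
    have 1: "(indicator cube (\<Sum>b\<in>?B. x b *\<^sub>R b) :: real) = (\<Prod>b\<in>?B. indicator {-pi..pi} (x b))"
    proof (cases "\<forall>k. x (axis k 1) \<in> {-pi..pi}")
      case True
      then have "(\<Sum>b\<in>?B. x b *\<^sub>R b) \<in> cube" unfolding cube_iff comp by auto
      moreover have "\<forall>b\<in>?B. x b \<in> {-pi..pi}" using True by (auto simp: Basis_vec_def)
      ultimately show ?thesis by simp
    next
      case False
      then have "(\<Sum>b\<in>?B. x b *\<^sub>R b) \<notin> cube" unfolding cube_iff comp by auto
      moreover have "\<exists>b\<in>?B. indicator {-pi..pi} (x b) = (0::real)" using False by (auto simp: Basis_vec_def indicator_def)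
      then have "(\<Prod>b\<in>?B. indicator {-pi..pi} (x b) :: real) = 0" by (intro prod_zero) auto
      ultimately show ?thesis by simp
    qed
    have 2: "fchar j (\<Sum>b\<in>?B. x b *\<^sub>R b) = (\<Prod>b\<in>?B. exp (\<i> * complex_of_real (real_of_int (J b) * x b)))"
    proof -
      have "(\<Sum>k\<in>UNIV. real_of_int (j $ k) * x (axis k 1)) = (\<Sum>b\<in>?B. real_of_int (J b) * x b)"
        by (subst sum.reindex_bij_betw[OF bij_axis, symmetric]) (simp add: J_def inv)
      then show ?thesis
        unfolding fchar_def comp by (simp add: exp_sum[symmetric] sum_distrib_left)
    qed
    show "indicator cube (\<Sum>b\<in>?B. x b *\<^sub>R b) *\<^sub>R fchar j (\<Sum>b\<in>?B. x b *\<^sub>R b)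
      = (\<Prod>b\<in>?B. indicator {-pi..pi} (x b) *\<^sub>R exp (\<i> * complex_of_real (real_of_int (J b) * x b)))"
      unfolding 1 2 by (simp add: scaleR_conv_of_real prod.distrib)
  qed
  also have "\<dots> = (\<Prod>b\<in>?B. LINT t:{-pi..pi}|lborel. exp (\<i> * complex_of_real (real_of_int (J b) * t)))"
    unfolding set_lebesgue_integral_def
  proof (rule product_integral_prod)
    fix b
    show "integrable lborel (\<lambda>x. indicator {-pi..pi} x *\<^sub>R exp (\<i> * complex_of_real (real_of_int (J b) * x)))"
      by (rule integrableI_bounded_set_indicator[where B=1]) (auto simp: norm_exp_i_times)
  qed simp
  also have "\<dots> = (\<Prod>k\<in>UNIV. if j $ k = 0 then 2 * pi else 0)"
    unfolding integral_cis_int by (subst prod.reindex_bij_betw[OF bij_axis, symmetric]) (simp add: J_def inv)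
  also have "\<dots> = (if j = 0 then (2 * pi) ^ CARD('d) else 0)"
    by (auto simp: vec_eq_iff intro: prod_zero)
  finally show ?thesis .
qed

lemma trig_measurable [measurable]: "(\<lambda>x. \<Sum>j\<in>F. a j * fchar j x) \<in> borel_measurable borel"
  by measurable

lemma trig_bound: "cmod (\<Sum>j\<in>F. a j * fchar j x) \<le> (\<Sum>j\<in>F. cmod (a j))"
  by (rule order_trans[OF norm_sum]) (simp add: norm_mult)

lemma trig_parseval:
  fixes F :: "(int ^ 'd) set"
  assumes F: "finite F"
  shows "(LINT x|lborel. indicator cube x * (cmod (\<Sum>j\<in>F. a j * fchar j x))\<^sup>2) = (2 * pi) ^ CARD('d) * (\<Sum>j\<in>F. (cmod (a j))\<^sup>2)"
proof -
  have "complex_of_real (LINT x|lborel. indicator cube x * (cmod (\<Sum>j\<in>F. a j * fchar j x))\<^sup>2)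
      = (LINT x|lborel. complex_of_real (indicator cube x * (cmod (\<Sum>j\<in>F. a j * fchar j x))\<^sup>2))"
    by (rule integral_complex_of_real[symmetric])
  also have "\<dots> = (LINT x|lborel. (\<Sum>j\<in>F. \<Sum>k\<in>F. (a j * cnj (a k)) * (indicator cube x *\<^sub>R fchar (j - k) x)))"
  proof (intro Bochner_Integration.integral_cong refl)
    fix x
    have "complex_of_real ((cmod (\<Sum>j\<in>F. a j * fchar j x))\<^sup>2) = (\<Sum>j\<in>F. a j * fchar j x) * cnj (\<Sum>j\<in>F. a j * fchar j x)"
      by (rule complex_norm_square)
    also have "\<dots> = (\<Sum>j\<in>F. \<Sum>k\<in>F. (a j * cnj (a k)) * fchar (j - k) x)"
      unfolding cnj_sum sum_product diff_conv_add_uminus fchar_add by (simp add: cnj_fchar mult_ac)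
    finally show "complex_of_real (indicator cube x * (cmod (\<Sum>j\<in>F. a j * fchar j x))\<^sup>2)
       = (\<Sum>j\<in>F. \<Sum>k\<in>F. (a j * cnj (a k)) * (indicator cube x *\<^sub>R fchar (j - k) x))"
      by (cases "x \<in> cube") auto
  qed
  also have "\<dots> = (\<Sum>j\<in>F. \<Sum>k\<in>F. (a j * cnj (a k)) * (LINT x|lborel. indicator cube x *\<^sub>R fchar (j - k) x))"
  proof -
    have i: "integrable lborel (\<lambda>x. indicator cube x *\<^sub>R fchar j x)" for j :: "int ^ 'd"
      by (rule integrable_cube[where B=1]) auto
    show ?thesis
      by (subst Bochner_Integration.integral_sum, intro Bochner_Integration.integrable_sum integrable_mult_right i,
          subst Bochner_Integration.integral_sum, intro integrable_mult_right i, simp only: integral_mult_right_zero)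
  qed
  also have "\<dots> = (\<Sum>j\<in>F. \<Sum>k\<in>F. if k = j then (2 * pi) ^ CARD('d) * complex_of_real ((cmod (a j))\<^sup>2) else 0)"
    unfolding integral_fchar complex_norm_square by (intro sum.cong refl) auto
  also have "\<dots> = complex_of_real ((2 * pi) ^ CARD('d) * (\<Sum>j\<in>F. (cmod (a j))\<^sup>2))"
    using F by (simp add: sum.delta sum_distrib_left)
  finally show ?thesis using of_real_eq_iff by blast
qed

section \<open>Density of trigonometric polynomials\<close>

definition trig_polys :: "(real ^ 'd \<Rightarrow> complex) set" where
  "trig_polys = {f. \<exists>F a. finite F \<and> f = (\<lambda>x. \<Sum>j\<in>F. a j * fchar j x)}"

lemma trig_polysI: "finite F \<Longrightarrow> (\<lambda>x. \<Sum>j\<in>F. a j * fchar j x) \<in> trig_polys"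
  unfolding trig_polys_def by blast

lemma trig_polys_fchar: "(\<lambda>x. c * fchar j x) \<in> trig_polys"
  using trig_polysI[of "{j}" "\<lambda>_. c"] by simp

lemma trig_polys_const: "(\<lambda>x. c) \<in> trig_polys"
  using trig_polys_fchar[of c 0] by simp

lemma trig_polys_add:
  assumes "f \<in> trig_polys" "g \<in> trig_polys"
  shows "(\<lambda>x. f x + g x) \<in> trig_polys"
proof -
  obtain F a G b where FG: "finite F" "f = (\<lambda>x. \<Sum>j\<in>F. a j * fchar j x)" "finite G" "g = (\<lambda>x. \<Sum>j\<in>G. b j * fchar j x)"
    using assms unfolding trig_polys_def by blast
  have "f x + g x = (\<Sum>j\<in>F \<union> G. ((if j \<in> F then a j else 0) + (if j \<in> G then b j else 0)) * fchar j x)" for x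
  proof -
    have "f x = (\<Sum>j\<in>F \<union> G. (if j \<in> F then a j else 0) * fchar j x)"
      unfolding FG using FG by (intro sum.mono_neutral_cong_left) auto
    moreover have "g x = (\<Sum>j\<in>F \<union> G. (if j \<in> G then b j else 0) * fchar j x)"
      unfolding FG using FG by (intro sum.mono_neutral_cong_left) auto
    ultimately show ?thesis by (simp add: sum.distrib distrib_right)
  qed
  then show ?thesis using trig_polysI[of "F \<union> G" "\<lambda>j. (if j \<in> F then a j else 0) + (if j \<in> G then b j else 0)"] FG(1,3)
    by simp
qed

lemma trig_polys_sum: "finite A \<Longrightarrow> (\<And>i. i \<in> A \<Longrightarrow> f i \<in> trig_polys) \<Longrightarrow> (\<lambda>x. \<Sum>i\<in>A. f i x) \<in> trig_polys"
  by (induction A rule: finite_induct) (auto intro: trig_polys_const trig_polys_add)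

lemma trig_polys_mult:
  assumes "f \<in> trig_polys" "g \<in> trig_polys"
  shows "(\<lambda>x. f x * g x) \<in> trig_polys"
proof -
  obtain F a G b where FG: "finite F" "f = (\<lambda>x. \<Sum>j\<in>F. a j * fchar j x)" "finite G" "g = (\<lambda>x. \<Sum>j\<in>G. b j * fchar j x)"
    using assms unfolding trig_polys_def by blast
  have "f x * g x = (\<Sum>j\<in>F. \<Sum>k\<in>G. (a j * b k) * fchar (j + k) x)" for x
    unfolding FG sum_product fchar_add by (simp add: mult_ac)
  moreover have "(\<lambda>x. \<Sum>j\<in>F. \<Sum>k\<in>G. (a j * b k) * fchar (j + k) x) \<in> trig_polys"
    by (intro trig_polys_sum FG trig_polys_fchar)
  ultimately show ?thesis by simp
qed

text \<open>The map to the torus. Real polynomials on its target pull back to trigonometric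
  polynomials, so the Stone-Weierstrass theorem on its compact image gives density.\<close>

definition torus_map :: "real ^ 'd \<Rightarrow> complex ^ 'd" where
  "torus_map x = (\<chi> k. exp (\<i> * complex_of_real (x $ k)))"

lemma continuous_torus_map: "continuous_on S torus_map"
  unfolding torus_map_def by (intro continuous_intros)

lemma fchar_axis: "fchar (axis k m) x = exp (\<i> * complex_of_real (real_of_int m * x $ k))"
  unfolding fchar_def by (simp add: axis_def if_distrib if_distribR sum.delta cong: if_cong)

lemma trig_polys_real_polynomial:
  fixes p :: "complex ^ 'd \<Rightarrow> real"
  assumes "real_polynomial_function p"
  shows "(\<lambda>x. complex_of_real (p (torus_map x))) \<in> trig_polys"
  using assms
proof (induction p)
  case (linear f)
  interpret bounded_linear f by fact
  \<comment> \<open>Cosine and sine of one coordinate are combinations of the characters with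
    frequency 1 and -1 along its axis; a linear function of the torus point is a combination of
    these.\<close>
  have ax: "axis k c = Re c *\<^sub>R axis k 1 + Im c *\<^sub>R axis k \<i>" for k :: 'd and c
    by (auto simp: axis_def vec_eq_iff complex_eq_iff)
  have dec: "w = (\<Sum>k\<in>UNIV. axis k (w $ k))" for w :: "complex ^ 'd"
    by (auto simp: vec_eq_iff axis_def if_distrib sum.delta cong: if_cong)
  have fw: "f w = (\<Sum>k\<in>UNIV. Re (w $ k) * f (axis k 1) + Im (w $ k) * f (axis k \<i>))" for w
  proof -
    have "f w = (\<Sum>k\<in>UNIV. f (axis k (w $ k)))" by (subst dec) (rule sum)
    also have "\<dots> = (\<Sum>k\<in>UNIV. Re (w $ k) * f (axis k 1) + Im (w $ k) * f (axis k \<i>))"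
      by (intro sum.cong refl, subst ax) (simp add: add scaleR)
    finally show ?thesis .
  qed
  have ch: "fchar (axis k m) x = cis (real_of_int m * x $ k)" "torus_map x $ k = cis (x $ k)" for x :: "real ^ 'd" and k m
    by (simp_all only: fchar_axis torus_map_def cis_conv_exp vec_lambda_beta)
  have re: "complex_of_real (Re (torus_map x $ k)) = 1/2 * fchar (axis k 1) x + 1/2 * fchar (axis k (-1)) x" for x :: "real ^ 'd" and k
    by (simp add: ch complex_eq_iff)
  have im: "complex_of_real (Im (torus_map x $ k)) = (- \<i>/2) * fchar (axis k 1) x + (\<i>/2) * fchar (axis k (-1)) x" for x :: "real ^ 'd" and k
    by (simp add: ch complex_eq_iff)
  have "complex_of_real (f (torus_map x)) = (\<Sum>k\<in>UNIV. (1/2 * fchar (axis k 1) x + 1/2 * fchar (axis k (-1)) x) * complex_of_real (f (axis k 1)) +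
      ((- \<i>/2) * fchar (axis k 1) x + (\<i>/2) * fchar (axis k (-1)) x) * complex_of_real (f (axis k \<i>)))" for x :: "real ^ 'd"
    unfolding fw[of "torus_map x"] by (simp only: of_real_sum of_real_add of_real_mult re im)
  moreover have "(\<lambda>x :: real ^ 'd. \<Sum>k\<in>UNIV. (1/2 * fchar (axis k 1) x + 1/2 * fchar (axis k (-1)) x) * complex_of_real (f (axis k 1)) +
      ((- \<i>/2) * fchar (axis k 1) x + (\<i>/2) * fchar (axis k (-1)) x) * complex_of_real (f (axis k \<i>))) \<in> trig_polys"
    by (intro trig_polys_sum trig_polys_add trig_polys_mult trig_polys_fchar trig_polys_const finite_class.finite_UNIV)
  ultimately show ?case by presburger
next
  case (const c)
  then show ?case by (rule trig_polys_const)
next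
  case (add f g)
  show ?case using trig_polys_add[OF add.IH] by (simp only: of_real_add)
next
  case (mult f g)
  show ?case using trig_polys_mult[OF mult.IH] by (simp only: of_real_mult)
qed

text \<open>A function vanishing outside the open cube takes equal values at points that the torus
  identifies, and so descends to a continuous function on the torus.\<close>

lemma trig_polys_dense:
  fixes \<psi> :: "real ^ 'd \<Rightarrow> complex"
  assumes cont: "continuous_on UNIV \<psi>" and zero: "\<And>x. x \<notin> open_cube \<Longrightarrow> \<psi> x = 0" and e: "e > 0"
  shows "\<exists>p\<in>trig_polys. \<forall>x\<in>cube. cmod (\<psi> x - p x) < e"
proof -
  define T where "T = (torus_map ` cube :: (complex ^ 'd) set)"
  define \<psi>' where "\<psi>' w = \<psi> (SOME x. x \<in> cube \<and> torus_map x = w)" for w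
  \<comment> \<open>Two distinct points of the closed cube with the same image differ in some
    coordinate by a nonzero multiple of 2 pi, so both lie on the boundary, where \<psi>
    vanishes.\<close>
  have wd: "\<psi> x = \<psi> y" if xy: "x \<in> cube" "y \<in> cube" and eq: "torus_map x = torus_map y" for x y
  proof (cases "x = y")
    case False
    then obtain k where k: "x $ k \<noteq> y $ k" by (auto simp: vec_eq_iff)
    have "exp (\<i> * complex_of_real (x $ k)) = exp (\<i> * complex_of_real (y $ k))"
      using eq by (auto simp: torus_map_def vec_eq_iff)
    then obtain n :: int where "\<i> * complex_of_real (x $ k) = \<i> * complex_of_real (y $ k) + (of_int (2 * n) * pi) * \<i>"
      unfolding exp_eq by blast
    then have "Im (\<i> * complex_of_real (x $ k)) = Im (\<i> * complex_of_real (y $ k) + (of_int (2 * n) * pi) * \<i>)" by simp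
    then have n: "x $ k = y $ k + 2 * real_of_int n * pi" by simp
    have b: "- pi \<le> x $ k" "x $ k \<le> pi" "- pi \<le> y $ k" "y $ k \<le> pi" using xy by (auto simp: cube_iff)
    have "n \<noteq> 0" using n k by auto
    then consider "n \<ge> 1" | "n \<le> -1" by linarith
    then have "x \<notin> open_cube \<and> y \<notin> open_cube"
    proof cases
      case 1
      then have "1 * pi \<le> real_of_int n * pi" by (intro mult_right_mono) auto
      then have "\<not> x $ k < pi" "\<not> - pi < y $ k" using n b by linarith+
      then show ?thesis unfolding open_cube_iff by blast
    next
      case 2
      then have "real_of_int n * pi \<le> (-1) * pi" by (intro mult_right_mono) auto
      then have "\<not> - pi < x $ k" "\<not> y $ k < pi" using n b by linarith+
      then show ?thesis unfolding open_cube_iff by blast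
    qed
    then show ?thesis using zero by simp
  qed simp
  have comp: "\<psi>' (torus_map x) = \<psi> x" if "x \<in> cube" for x
  proof -
    let ?y = "SOME y. y \<in> cube \<and> torus_map y = torus_map x"
    have "?y \<in> cube \<and> torus_map ?y = torus_map x"
      by (rule someI[where x=x]) (use that in auto)
    then show ?thesis unfolding \<psi>'_def using wd that by blast
  qed
  \<comment> \<open>A continuous map from a compact space onto a Hausdorff space is a quotient map,
    so continuity can be tested after composition with the torus map.\<close>
  have "continuous_on T \<psi>'"
    unfolding continuous_on_open_invariant
  proof (intro allI impI)
    fix B :: "complex set" assume B: "open B"
    have "openin (top_of_set cube) (cube \<inter> \<psi> -` B)"
      using continuous_on_subset[OF cont] B by (intro continuous_openin_preimage_gen) auto
    moreover have "cube \<inter> \<psi> -` B = cube \<inter> torus_map -` (T \<inter> \<psi>' -` B)"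
    proof -
      have "torus_map x \<in> T" "\<psi>' (torus_map x) = \<psi> x" if "x \<in> cube" for x
        using that comp by (auto simp: T_def)
      then show ?thesis by auto
    qed
    ultimately have "openin (top_of_set T) (T \<inter> \<psi>' -` B)"
      using Abstract_Topology_2.continuous_imp_quotient_map[OF continuous_torus_map T_def[symmetric] compact_cube, of "T \<inter> \<psi>' -` B"]
      by auto
    then show "\<exists>A. open A \<and> A \<inter> T = \<psi>' -` B \<inter> T"
      unfolding openin_open by blast
  qed
  moreover have "compact T" unfolding T_def by (intro compact_continuous_image continuous_torus_map compact_cube)
  ultimately obtain g where g: "polynomial_function g" "\<And>w. w \<in> T \<Longrightarrow> norm (\<psi>' w - g w) < e"
    using Stone_Weierstrass_polynomial_function[of T \<psi>' e] e by blast
  have "real_polynomial_function (Re \<circ> g)" "real_polynomial_function (Im \<circ> g)"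
    using g(1) bounded_linear_Re bounded_linear_Im unfolding polynomial_function_def by blast+
  then have "(\<lambda>x. complex_of_real ((Re \<circ> g) (torus_map x)) + \<i> * complex_of_real ((Im \<circ> g) (torus_map x))) \<in> trig_polys"
    by (intro trig_polys_add trig_polys_mult trig_polys_const trig_polys_real_polynomial)
  then have "(\<lambda>x. g (torus_map x)) \<in> trig_polys"
    by (simp add: complex_eq[symmetric])
  moreover have "cmod (\<psi> x - g (torus_map x)) < e" if "x \<in> cube" for x
  proof -
    have "torus_map x \<in> T" using that by (simp add: T_def)
    then show ?thesis using g(2)[of "torus_map x"] comp[OF that] by simp
  qed
  ultimately show ?thesis by (intro bexI[of _ "\<lambda>x. g (torus_map x)"] ballI)
qed

text \<open>The converse of Bessel's inequality, for a function known only to be integrable;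
  square-integrability is part of the conclusion. By duality it suffices to bound the integrals of f
  against test functions by their L2 norms, first for trigonometric polynomials, then for ever
  larger classes.\<close>

lemma fourier_duality:
  fixes f :: "real ^ 'd \<Rightarrow> complex"
  assumes f: "integrable lborel f" and zero: "\<And>x. x \<notin> open_cube \<Longrightarrow> f x = 0"
    and B: "\<And>F. finite F \<Longrightarrow> (\<Sum>j\<in>F. (cmod (LINT x|lborel. f x * fchar j x))\<^sup>2) \<le> B"
  shows "(\<integral>\<^sup>+x. ennreal ((cmod (f x))\<^sup>2) \<partial>lborel) \<le> ennreal (B / (2 * pi) ^ CARD('d))"
proof -
  define c where "c j = (LINT x|lborel. f x * fchar j x)" for j :: "int ^ 'd"
  define B' where "B' = B / (2 * pi) ^ CARD('d)"
  have B0: "B \<ge> 0" using B[of "{}"] by simp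
  have B'0: "B' \<ge> 0" using B0 by (simp add: B'_def)
  have [measurable]: "f \<in> borel_measurable borel" using borel_measurable_integrable[OF f] by simp
  have zero': "f x = 0" if "x \<notin> cube" for x using zero open_cube_subset that by blast
  have nm: "cmod (a * b) \<le> M * cmod a" if "cmod b \<le> M" for a b M
    using mult_right_mono[OF that, of "cmod a"] by (simp add: norm_mult mult.commute)
  have int_mult: "integrable lborel (\<lambda>x. f x * g x)"
    if g [measurable]: "g \<in> borel_measurable borel" and b: "\<And>x. x \<in> cube \<Longrightarrow> cmod (g x) \<le> M" for g M
  proof (rule Bochner_Integration.integrable_bound[where f="\<lambda>x. M * cmod (f x)"])
    show "integrable lborel (\<lambda>x. M * cmod (f x))" using f by simp
    show "AE x in lborel. cmod (f x * g x) \<le> norm (M * cmod (f x))"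
    proof (rule AE_I2)
      fix x
      show "cmod (f x * g x) \<le> norm (M * cmod (f x))"
      proof (cases "x \<in> cube")
        case True
        have "cmod (f x * g x) = cmod (g x) * cmod (f x)" by (simp add: norm_mult)
        also have "\<dots> \<le> M * cmod (f x)" by (intro mult_right_mono b True) auto
        also have "\<dots> \<le> norm (M * cmod (f x))" by simp
        finally show ?thesis .
      qed (simp add: zero')
    qed
  qed measurable
  \<comment> \<open>Trigonometric polynomials: Cauchy-Schwarz for the coefficients and Parseval for
    p.\<close>
  have a: "(cmod (LINT x|lborel. f x * p x))\<^sup>2 \<le> B' * (LINT x|lborel. indicator cube x * (cmod (p x))\<^sup>2)"
    if p: "p \<in> trig_polys" for p
  proof -
    obtain F a where F: "finite F" and pe: "p = (\<lambda>x. \<Sum>j\<in>F. a j * fchar j x)"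
      using p unfolding trig_polys_def by blast
    have "(LINT x|lborel. f x * p x) = (LINT x|lborel. (\<Sum>j\<in>F. a j * (f x * fchar j x)))"
      unfolding pe by (simp add: sum_distrib_left mult_ac)
    also have "\<dots> = (\<Sum>j\<in>F. a j * c j)"
    proof -
      have i: "integrable lborel (\<lambda>x. f x * fchar j x)" for j by (rule int_mult[where M=1]) auto
      show ?thesis unfolding c_def 
        by (subst Bochner_Integration.integral_sum, intro integrable_mult_right i, simp only: integral_mult_right_zero)
    qed
    finally have e: "(LINT x|lborel. f x * p x) = (\<Sum>j\<in>F. a j * c j)" .
    have "(cmod (\<Sum>j\<in>F. a j * c j))\<^sup>2 \<le> (\<Sum>j\<in>F. cmod (a j) * cmod (c j))\<^sup>2"
      by (intro power_mono order_trans[OF norm_sum]) (auto simp: norm_mult)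
    also have "\<dots> \<le> (\<Sum>j\<in>F. (cmod (a j))\<^sup>2) * (\<Sum>j\<in>F. (cmod (c j))\<^sup>2)"
      by (rule Cauchy_Schwarz_ineq_sum)
    also have "\<dots> \<le> (\<Sum>j\<in>F. (cmod (a j))\<^sup>2) * B"
      unfolding c_def by (intro mult_left_mono B F sum_nonneg) auto
    also have "\<dots> = B' * ((2 * pi) ^ CARD('d) * (\<Sum>j\<in>F. (cmod (a j))\<^sup>2))"
      by (simp add: B'_def)
    also have "\<dots> = B' * (LINT x|lborel. indicator cube x * (cmod (p x))\<^sup>2)"
      unfolding pe trig_parseval[OF F] ..
    finally show ?thesis unfolding e .
  qed
  \<comment> \<open>Continuous functions vanishing outside the open cube, by uniform
    approximation.\<close>
  have b: "(cmod (LINT x|lborel. f x * \<psi> x))\<^sup>2 \<le> B' * (LINT x|lborel. indicator cube x * (cmod (\<psi> x))\<^sup>2)"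
    if cont: "continuous_on UNIV \<psi>" and z: "\<And>x. x \<notin> open_cube \<Longrightarrow> \<psi> x = 0" for \<psi>
  proof -
    have [measurable]: "\<psi> \<in> borel_measurable borel" using cont by (rule borel_measurable_continuous_onI)
    have "bounded (\<psi> ` cube)"
      by (intro compact_imp_bounded compact_continuous_image compact_cube continuous_on_subset[OF cont]) auto
    then obtain M where M: "\<And>x. x \<in> cube \<Longrightarrow> cmod (\<psi> x) \<le> M" unfolding bounded_iff by blast
    have "\<exists>p\<in>trig_polys. \<forall>x\<in>cube. cmod (\<psi> x - p x) < 1 / real (Suc n)" for n
      by (rule trig_polys_dense[OF cont z]) auto
    then obtain p where p: "\<And>n. p n \<in> trig_polys" "\<And>n x. x \<in> cube \<Longrightarrow> cmod (\<psi> x - p n x) < 1 / real (Suc n)"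
      by metis
    have [measurable]: "p n \<in> borel_measurable borel" for n
      using p(1)[of n] unfolding trig_polys_def by auto
    have pM: "cmod (p n x) \<le> M + 1" if "x \<in> cube" for n x
    proof -
      have "1 / real (Suc n) \<le> 1" by simp
      then have "cmod (\<psi> x - p n x) < 1" using p(2)[OF that, of n] by linarith
      moreover have "cmod (p n x) \<le> cmod (\<psi> x) + cmod (\<psi> x - p n x)"
        using norm_triangle_ineq4[of "\<psi> x" "\<psi> x - p n x"] by simp
      ultimately show ?thesis using M[OF that] by linarith
    qed
    have lim: "(\<lambda>n. p n x) \<longlonglongrightarrow> \<psi> x" if "x \<in> cube" for x
    proof (rule metric_LIMSEQ_I)
      fix r :: real assume "r > 0"
      then obtain N where N: "1 / real (Suc N) < r" using nat_approx_posE by blast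
      show "\<exists>N. \<forall>n\<ge>N. dist (p n x) (\<psi> x) < r"
      proof (intro exI allI impI)
        fix n assume n: "n \<ge> N"
        then have "1 / real (Suc n) \<le> 1 / real (Suc N)" by (simp add: frac_le)
        then show "dist (p n x) (\<psi> x) < r" using p(2)[OF that, of n] N by (simp add: dist_norm norm_minus_commute)
      qed
    qed
    have L1: "(\<lambda>n. LINT x|lborel. f x * p n x) \<longlonglongrightarrow> (LINT x|lborel. f x * \<psi> x)"
    proof (rule integral_dominated_convergence[where w="\<lambda>x. (M + 1) * cmod (f x)"])
      show "integrable lborel (\<lambda>x. (M + 1) * cmod (f x))" using f by simp
      show "AE x in lborel. (\<lambda>n. f x * p n x) \<longlonglongrightarrow> f x * \<psi> x"
      proof (rule AE_I2)
        fix x show "(\<lambda>n. f x * p n x) \<longlonglongrightarrow> f x * \<psi> x"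
          using zero'[of x] by (cases "x \<in> cube") (auto intro!: tendsto_mult_left lim)
      qed
      fix n
      show "AE x in lborel. cmod (f x * p n x) \<le> (M + 1) * cmod (f x)"
      proof (rule AE_I2)
        fix x show "cmod (f x * p n x) \<le> (M + 1) * cmod (f x)"
          using pM[of x n] zero'[of x] by (cases "x \<in> cube") (auto intro: nm)
      qed
    qed measurable
    have L2: "(\<lambda>n. LINT x|lborel. indicator cube x * (cmod (p n x))\<^sup>2) \<longlonglongrightarrow> (LINT x|lborel. indicator cube x * (cmod (\<psi> x))\<^sup>2)"
    proof (rule integral_dominated_convergence[where w="\<lambda>x. indicator cube x * (M + 1)\<^sup>2"])
      show "integrable lborel (\<lambda>x::real ^ 'd. indicator cube x * (M + 1)\<^sup>2)"
        by (rule integrable_cube_real[where B="(M + 1)\<^sup>2"]) auto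
      show "AE x in lborel. (\<lambda>n. indicator cube x * (cmod (p n x))\<^sup>2) \<longlonglongrightarrow> indicator cube x * (cmod (\<psi> x))\<^sup>2"
      proof (rule AE_I2)
        fix x show "(\<lambda>n. indicator cube x * (cmod (p n x))\<^sup>2) \<longlonglongrightarrow> indicator cube x * (cmod (\<psi> x))\<^sup>2"
          by (cases "x \<in> cube") (auto intro!: tendsto_intros lim)
      qed
      fix n show "AE x in lborel. norm (indicator cube x * (cmod (p n x))\<^sup>2) \<le> indicator cube x * (M + 1)\<^sup>2"
        using pM by (intro AE_I2) (auto simp: indicator_def intro!: power_mono)
    qed measurable
    show ?thesis
      by (rule LIMSEQ_le[OF tendsto_power[OF tendsto_norm[OF L1]] tendsto_mult_left[OF L2]]) (use a p(1) in blast)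
  qed
  \<comment> \<open>Bounded measurable functions, by almost everywhere approximation with continuous
    ones.\<close>
  have c: "(cmod (LINT x|lborel. f x * \<phi> x))\<^sup>2 \<le> B' * (LINT x|lborel. indicator cube x * (cmod (\<phi> x))\<^sup>2)"
    if [measurable]: "\<phi> \<in> borel_measurable borel" and z: "\<And>x. x \<notin> open_cube \<Longrightarrow> \<phi> x = 0"
      and M: "\<And>x. cmod (\<phi> x) \<le> M" "M > 0" for \<phi> M
  proof -
    have m12: "(\<lambda>x. Re (\<phi> x)) measurable_on UNIV" "(\<lambda>x. Im (\<phi> x)) measurable_on UNIV"
      by (auto intro!: lebesgue_measurable_imp_measurable_on_real measurable_completion)
    obtain N1 g1 where 1: "negligible N1" "\<forall>n. continuous_on UNIV (g1 n)"
        "\<forall>x. x \<notin> N1 \<longrightarrow> (\<lambda>n. g1 n x) \<longlonglongrightarrow> (if x \<in> UNIV then Re (\<phi> x) else 0)"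
      using m12(1) unfolding measurable_on_def by blast
    obtain N2 g2 where 2: "negligible N2" "\<forall>n. continuous_on UNIV (g2 n)"
        "\<forall>x. x \<notin> N2 \<longrightarrow> (\<lambda>n. g2 n x) \<longlonglongrightarrow> (if x \<in> UNIV then Im (\<phi> x) else 0)"
      using m12(2) unfolding measurable_on_def by blast
    note N = 1(1) 2(1)
    have g: "continuous_on UNIV (g1 n)" "continuous_on UNIV (g2 n)" for n
      using 1(2) 2(2) by blast+
    have g3: "(\<lambda>n. g1 n x) \<longlonglongrightarrow> Re (\<phi> x)" if "x \<notin> N1" for x
      using 1(3)[rule_format, OF that] by (simp only: UNIV_I if_True)
    have g4: "(\<lambda>n. g2 n x) \<longlonglongrightarrow> Im (\<phi> x)" if "x \<notin> N2" for x
      using 2(3)[rule_format, OF that] by (simp only: UNIV_I if_True)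
    define G where "G n x = Complex (g1 n x) (g2 n x)" for n x
    define cut where "cut n x = min 1 (real n * infdist x (- open_cube))" for n and x :: "real ^ 'd"
    \<comment> \<open>The continuous approximants of \<phi> are cut off towards the boundary of the
      cube and clipped radially to modulus at most M. The first makes the previous class applicable,
      the second supplies a dominating function.\<close>
    define \<psi> where "\<psi> n x = complex_of_real (cut n x * (M / max M (cmod (G n x)))) * G n x" for n x
    have cG: "continuous_on UNIV (G n)" for n unfolding G_def by (intro continuous_intros g)
    have c\<psi>: "continuous_on UNIV (\<psi> n)" for n
      unfolding \<psi>_def cut_def using M(2) by (intro continuous_intros cG) auto
    have cutb: "0 \<le> cut n x" "cut n x \<le> 1" for n x by (auto simp: cut_def infdist_nonneg)
    have z\<psi>: "\<psi> n x = 0" if "x \<notin> open_cube" for n x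
      using that by (simp add: \<psi>_def cut_def)
    have bd: "cmod (\<psi> n x) \<le> M" for n x
    proof -
      have "cmod (\<psi> n x) = cut n x * (M * (cmod (G n x) / max M (cmod (G n x))))"
        using cutb[of n x] M(2) by (simp add: \<psi>_def norm_mult norm_divide)
      also have "\<dots> \<le> 1 * (M * 1)"
        using cutb[of n x] M(2) by (intro mult_mono) (auto simp: divide_le_eq_1 max_def)
      finally show ?thesis by simp
    qed
    have lim: "(\<lambda>n. \<psi> n x) \<longlonglongrightarrow> \<phi> x" if x: "x \<notin> N1" "x \<notin> N2" for x
    proof (cases "x \<in> open_cube")
      case True
      have cl: "closed (- open_cube :: (real ^ 'd) set)" by (simp add: open_cube_def open_box closed_Compl)
      have ne: "(- open_cube :: (real ^ 'd) set) \<noteq> {}"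
      proof -
        have "(\<chi> k. pi) \<in> (- open_cube :: (real ^ 'd) set)" by (simp add: open_cube_iff)
        then show ?thesis by blast
      qed
      have pos: "infdist x (- open_cube) > 0"
        using in_closed_iff_infdist_zero[OF cl ne, of x] infdist_nonneg[of x "- open_cube"] True by (simp add: less_le)
      have "eventually (\<lambda>n. cut n x = 1) sequentially"
      proof -
        obtain n0 where n0: "1 / infdist x (- open_cube) < real n0" using reals_Archimedean2 by blast
        show ?thesis unfolding eventually_sequentially
        proof (intro exI allI impI)
          fix n assume "n0 \<le> n"
          then have "1 / infdist x (- open_cube) < real n" using n0 by linarith
          then have "1 < real n * infdist x (- open_cube)" using pos by (simp add: field_simps)
          then show "cut n x = 1" by (simp add: cut_def)
        qed
      qed
      then have "(\<lambda>n. cut n x) \<longlonglongrightarrow> 1" by (rule tendsto_eventually)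
      moreover have GL: "(\<lambda>n. G n x) \<longlonglongrightarrow> \<phi> x"
        unfolding G_def using g3[OF x(1)] g4[OF x(2)] by (simp add: tendsto_complex_iff)
      ultimately have "(\<lambda>n. \<psi> n x) \<longlonglongrightarrow> complex_of_real (1 * (M / max M (cmod (\<phi> x)))) * \<phi> x"
        unfolding \<psi>_def using M(2) by (intro tendsto_intros) auto
      moreover have "max M (cmod (\<phi> x)) = M" using M(1)[of x] by simp
      ultimately show ?thesis using M(2) by simp
    next
      case False
      then show ?thesis using z z\<psi> by simp
    qed
    have AEN: "AE x in lborel. x \<notin> N1 \<union> N2"
    proof -
      have "negligible (N1 \<union> N2)" using N by simp
      then have "N1 \<union> N2 \<in> null_sets lebesgue" using negligible_iff_null_sets by blast
      then have "AE x in lebesgue. x \<notin> N1 \<union> N2" by (rule AE_not_in)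
      then show ?thesis by (rule AE_completion_iff[THEN iffD1])
    qed
    have [measurable]: "\<psi> n \<in> borel_measurable borel" for n using c\<psi> by (rule borel_measurable_continuous_onI)
    have L1: "(\<lambda>n. LINT x|lborel. f x * \<psi> n x) \<longlonglongrightarrow> (LINT x|lborel. f x * \<phi> x)"
    proof (rule integral_dominated_convergence[where w="\<lambda>x. M * cmod (f x)"])
      show "integrable lborel (\<lambda>x. M * cmod (f x))" using f by simp
      show "AE x in lborel. (\<lambda>n. f x * \<psi> n x) \<longlonglongrightarrow> f x * \<phi> x"
        using AEN by eventually_elim (auto intro!: tendsto_intros lim)
      fix n
      show "AE x in lborel. cmod (f x * \<psi> n x) \<le> M * cmod (f x)"
        using bd by (intro AE_I2 nm)
    qed measurable
    have L2: "(\<lambda>n. LINT x|lborel. indicator cube x * (cmod (\<psi> n x))\<^sup>2) \<longlonglongrightarrow> (LINT x|lborel. indicator cube x * (cmod (\<phi> x))\<^sup>2)"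
    proof (rule integral_dominated_convergence[where w="\<lambda>x. indicator cube x * M\<^sup>2"])
      show "integrable lborel (\<lambda>x::real ^ 'd. indicator cube x * M\<^sup>2)"
        by (rule integrable_cube_real[where B="M\<^sup>2"]) auto
      show "AE x in lborel. (\<lambda>n. indicator cube x * (cmod (\<psi> n x))\<^sup>2) \<longlonglongrightarrow> indicator cube x * (cmod (\<phi> x))\<^sup>2"
        using AEN by eventually_elim (auto intro!: tendsto_intros lim)
      fix n show "AE x in lborel. norm (indicator cube x * (cmod (\<psi> n x))\<^sup>2) \<le> indicator cube x * M\<^sup>2"
        using bd by (intro AE_I2) (auto simp: indicator_def intro!: power_mono)
    qed measurable
    show ?thesis
      by (rule LIMSEQ_le[OF tendsto_power[OF tendsto_norm[OF L1]] tendsto_mult_left[OF L2]]) (use b[OF c\<psi> z\<psi>] in blast)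
  qed
  define T where "T n x = (if cmod (f x) \<le> real (Suc n) then (cmod (f x))\<^sup>2 else 0)" for n x
  have [measurable]: "T n \<in> borel_measurable borel" for n unfolding T_def by measurable
  have Tint: "integrable lborel (T n)" for n
  proof (rule Bochner_Integration.integrable_bound[where f="\<lambda>x. real (Suc n) * cmod (f x)"])
    show "integrable lborel (\<lambda>x. real (Suc n) * cmod (f x))" using f by simp
    show "AE x in lborel. norm (T n x) \<le> norm (real (Suc n) * cmod (f x))"
      by (intro AE_I2) (auto simp: T_def power2_eq_square intro: mult_right_mono)
  qed measurable
  have d: "(LINT x|lborel. T n x) \<le> B'" for n
  proof -
    \<comment> \<open>Tested against its own truncated conjugate, f gives an integral I with I^2 at
      most B' * I, hence I at most B'. Fatou's lemma then removes the truncation.\<close>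
    define \<phi> where "\<phi> x = (if cmod (f x) \<le> real (Suc n) then cnj (f x) else 0)" for x
    have [measurable]: "cnj \<in> borel_measurable borel"
      by (intro borel_measurable_continuous_onI continuous_intros)
    have [measurable]: "\<phi> \<in> borel_measurable borel" unfolding \<phi>_def by measurable
    have "(cmod (LINT x|lborel. f x * \<phi> x))\<^sup>2 \<le> B' * (LINT x|lborel. indicator cube x * (cmod (\<phi> x))\<^sup>2)"
      by (rule c[where M="real (Suc n)"]) (auto simp: \<phi>_def zero)
    moreover have "f x * \<phi> x = complex_of_real (T n x)" for x
      using complex_norm_square[of "f x"] by (simp add: \<phi>_def T_def)
    moreover have "indicator cube x * (cmod (\<phi> x))\<^sup>2 = T n x" for x
      using zero'[of x] by (cases "x \<in> cube") (auto simp: \<phi>_def T_def)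
    ultimately have "(LINT x|lborel. T n x)\<^sup>2 \<le> B' * (LINT x|lborel. T n x)" by simp
    moreover have "(LINT x|lborel. T n x) \<ge> 0" by (intro integral_nonneg_AE AE_I2) (simp add: T_def)
    ultimately show ?thesis using B'0
      by (cases "(LINT x|lborel. T n x) = 0") (auto simp: power2_eq_square)
  qed
  have "(\<integral>\<^sup>+x. ennreal ((cmod (f x))\<^sup>2) \<partial>lborel) = (\<integral>\<^sup>+x. liminf (\<lambda>n. ennreal (T n x)) \<partial>lborel)"
  proof (intro nn_integral_cong)
    fix x
    have "eventually (\<lambda>n. T n x = (cmod (f x))\<^sup>2) sequentially"
    proof -
      obtain n0 where n0: "cmod (f x) < real n0" using reals_Archimedean2 by blast
      show ?thesis unfolding eventually_sequentially
        using n0 by (intro exI[of _ n0]) (auto simp: T_def)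
    qed
    then have "eventually (\<lambda>n. ennreal (T n x) = ennreal ((cmod (f x))\<^sup>2)) sequentially"
      by eventually_elim simp
    then have "(\<lambda>n. ennreal (T n x)) \<longlonglongrightarrow> ennreal ((cmod (f x))\<^sup>2)" by (rule tendsto_eventually)
    then show "ennreal ((cmod (f x))\<^sup>2) = liminf (\<lambda>n. ennreal (T n x))"
      by (rule lim_imp_Liminf[OF sequentially_bot, symmetric])
  qed
  also have "\<dots> \<le> liminf (\<lambda>n. \<integral>\<^sup>+x. ennreal (T n x) \<partial>lborel)"
    by (rule nn_integral_liminf) measurable
  also have "\<dots> \<le> liminf (\<lambda>n. ennreal B')"
  proof (rule Liminf_mono, rule always_eventually, rule allI)
    fix n
    have "(\<integral>\<^sup>+x. ennreal (T n x) \<partial>lborel) = ennreal (LINT x|lborel. T n x)"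
      by (rule nn_integral_eq_integral[OF Tint]) (simp add: T_def)
    also have "\<dots> \<le> ennreal B'" by (intro ennreal_leI d)
    finally show "(\<integral>\<^sup>+x. ennreal (T n x) \<partial>lborel) \<le> ennreal B'" .
  qed
  also have "\<dots> = ennreal B'" by (simp add: Liminf_const)
  finally show ?thesis unfolding B'_def .
qed

text \<open>The sum of the squared coefficients is the integral of f against the trigonometric
  polynomial with the conjugate coefficients, whose own L2 norm is that same sum by
  Parseval.\<close>

lemma fourier_bessel:
  fixes f :: "real ^ 'd \<Rightarrow> complex"
  assumes f: "integrable lborel f" and f2: "integrable lborel (\<lambda>x. (cmod (f x))\<^sup>2)"
    and zero: "\<And>x. x \<notin> cube \<Longrightarrow> f x = 0" and F: "finite F"
  shows "(\<Sum>j\<in>F. (cmod (LINT x|lborel. f x * fchar j x))\<^sup>2) \<le> (2 * pi) ^ CARD('d) * (LINT x|lborel. (cmod (f x))\<^sup>2)"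
proof -
  define c where "c j = (LINT x|lborel. f x * fchar j x)" for j :: "int ^ 'd"
  define p where "p x = (\<Sum>j\<in>F. cnj (c j) * fchar j x)" for x
  define t :: real where "t = (2 * pi) ^ CARD('d)"
  define S where "S = (\<Sum>j\<in>F. (cmod (c j))\<^sup>2)"
  have t: "t > 0" by (simp add: t_def)
  have [measurable]: "f \<in> borel_measurable borel" using borel_measurable_integrable[OF f] by simp
  have [measurable]: "p \<in> borel_measurable borel" unfolding p_def by measurable
  have i: "integrable lborel (\<lambda>x. f x * fchar j x)" for j
    by (rule Bochner_Integration.integrable_bound[OF f]) (auto simp: norm_mult)
  have "complex_of_real S = (\<Sum>j\<in>F. cnj (c j) * c j)"
    unfolding S_def of_real_sum complex_norm_square by (simp add: mult.commute)
  also have "\<dots> = (LINT x|lborel. (\<Sum>j\<in>F. cnj (c j) * (f x * fchar j x)))"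
    unfolding c_def
    by (subst Bochner_Integration.integral_sum, intro integrable_mult_right i, simp only: integral_mult_right_zero)
  also have "\<dots> = (LINT x|lborel. f x * p x)"
    unfolding p_def by (simp add: sum_distrib_left mult_ac)
  finally have e: "complex_of_real S = (LINT x|lborel. f x * p x)" .
  have ip: "integrable lborel (\<lambda>x. f x * p x)"
    unfolding p_def sum_distrib_left
  proof (intro Bochner_Integration.integrable_sum)
    fix j
    show "integrable lborel (\<lambda>x. f x * (cnj (c j) * fchar j x))"
      using integrable_mult_right[OF i[of j], of "cnj (c j)"] by (simp only: mult_ac)
  qed
  have ip2: "integrable lborel (\<lambda>x. indicator cube x * (cmod (p x))\<^sup>2)"
    by (rule integrable_cube_real[where B="(\<Sum>j\<in>F. cmod (cnj (c j)))\<^sup>2"])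
       (auto simp del: complex_mod_cnj simp: p_def intro!: power_mono trig_bound)
  have par: "(LINT x|lborel. indicator cube x * (cmod (p x))\<^sup>2) = t * S"
    unfolding p_def trig_parseval[OF F] t_def S_def by simp
  have "S \<le> cmod (LINT x|lborel. f x * p x)" unfolding e[symmetric] by simp
  also have "\<dots> \<le> (LINT x|lborel. cmod (f x * p x))" by (rule integral_norm_bound)
  \<comment> \<open>The weight t = (2 pi)^d in the inequality 2ab <= t a^2 + b^2 / t is the Parseval
    constant, so exactly half of S reappears on the right and is absorbed.\<close>
  also have "\<dots> \<le> (LINT x|lborel. 1 / 2 * (t * (cmod (f x))\<^sup>2 + 1 / t * (indicator cube x * (cmod (p x))\<^sup>2)))"
  proof (rule integral_mono)
    fix x
    show "cmod (f x * p x) \<le> 1 / 2 * (t * (cmod (f x))\<^sup>2 + 1 / t * (indicator cube x * (cmod (p x))\<^sup>2))"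
    proof (cases "x \<in> cube")
      case True
      have "0 \<le> (sqrt t * cmod (f x) - cmod (p x) / sqrt t)\<^sup>2" by simp
      also have "\<dots> = t * (cmod (f x))\<^sup>2 + (cmod (p x))\<^sup>2 / t - 2 * (cmod (f x) * cmod (p x))"
        using t by (simp add: power2_diff power_mult_distrib power_divide)
      finally show ?thesis using True by (simp add: norm_mult)
    qed (use t zero in simp)
  qed (use ip ip2 f2 in simp_all)
  also have "\<dots> = 1 / 2 * (t * (LINT x|lborel. (cmod (f x))\<^sup>2) + 1 / t * (t * S))"
    using f2 ip2 by (simp add: par)
  finally have "S \<le> t * (LINT x|lborel. (cmod (f x))\<^sup>2)" using t by simp
  then show ?thesis by (simp add: S_def t_def c_def)
qed

section \<open>Frequency boxes and lattice sums\<close>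

lemma finite_freq_box: "finite (freq_box m :: (int ^ 'd) set)"
  and card_freq_box: "card (freq_box m :: (int ^ 'd) set) = (2 * m + 1) ^ CARD('d)"
  and sum_freq_box_prod: "(\<Sum>j\<in>(freq_box m :: (int ^ 'd) set). \<Prod>k\<in>UNIV. g (j $ k)) = (\<Sum>i\<in>{-int m..int m}. g i :: real) ^ CARD('d)"
proof -
  have b: "bij_betw (\<lambda>f. \<chi> k. f k) (PiE UNIV (\<lambda>_. {-int m..int m})) (freq_box m :: (int ^ 'd) set)"
    by (rule bij_betw_byWitness[where f'="\<lambda>j k. j $ k"]) (auto simp: freq_box_def PiE_def)
  show f: "finite (freq_box m :: (int ^ 'd) set)"
    using bij_betw_finite[OF b] by (simp add: finite_PiE)
  show "card (freq_box m :: (int ^ 'd) set) = (2 * m + 1) ^ CARD('d)"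
    using bij_betw_same_card[OF b] by (simp add: card_PiE nat_add_distrib nat_mult_distrib)
  have "(\<Sum>j\<in>(freq_box m :: (int ^ 'd) set). \<Prod>k\<in>UNIV. g (j $ k)) = (\<Sum>f\<in>PiE UNIV (\<lambda>_::'d. {-int m..int m}). \<Prod>k\<in>UNIV. g (f k))"
    by (subst sum.reindex_bij_betw[OF b, symmetric]) simp
  also have "\<dots> = (\<Prod>k\<in>(UNIV :: 'd set). \<Sum>i\<in>{-int m..int m}. g i)"
    by (rule prod_sum_PiE[symmetric]) auto
  finally show "(\<Sum>j\<in>(freq_box m :: (int ^ 'd) set). \<Prod>k\<in>UNIV. g (j $ k)) = (\<Sum>i\<in>{-int m..int m}. g i :: real) ^ CARD('d)"
    by simp
qed

lemma abs_le_lnorm: "\<bar>real_of_int (j $ k)\<bar> \<le> lnorm j"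
  unfolding lnorm_def using component_le_norm_cart[of "(\<chi> k. real_of_int (j $ k))" k] by simp

lemma lnorm_nonneg [simp]: "lnorm j \<ge> 0"
  by (simp add: lnorm_def)

lemma finite_subset_freq_box:
  assumes "finite F"
  obtains m where "F \<subseteq> freq_box m"
proof -
  define m where "m = Max (insert 0 ((\<lambda>j. nat \<lceil>lnorm j\<rceil>) ` F))"
  have "j \<in> freq_box m" if "j \<in> F" for j
  proof -
    have "nat \<lceil>lnorm j\<rceil> \<le> m" unfolding m_def using assms that by (intro Max_ge) auto
    then have "lnorm j \<le> real m" by linarith
    then have "\<bar>real_of_int (j $ k)\<bar> \<le> real m" for k using abs_le_lnorm[of j k] by linarith
    then show ?thesis unfolding freq_box_def by (auto simp: abs_le_iff) (smt (verit) of_int_le_iff of_int_of_nat_eq of_int_minus)+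
  qed
  then show ?thesis using that by blast
qed

text \<open>The norm dominates every coordinate, so the decay p may be shared equally: each of the d
  coordinates receives the exponent p / d > 1 and the lattice sum is bounded by a d-th power of a
  one-dimensional one.\<close>

lemma lnorm_sum_bound:
  assumes p: "p > real CARD('d)"
  shows "\<exists>C\<ge>0. \<forall>F :: (int ^ 'd) set. finite F \<longrightarrow> (\<Sum>j\<in>F. (1 + lnorm j) powr (- p)) \<le> C"
proof -
  define q where "q = p / real CARD('d)"
  have q: "q > 1" using p by (simp add: q_def)
  define g where "g i = (1 + \<bar>real_of_int i\<bar>) powr (- q)" for i
  define Z where "Z = (\<Sum>n. real (Suc n) powr (- q))"
  have sm: "summable (\<lambda>n. real (Suc n) powr (- q))"
    using q by (subst summable_Suc_iff) (simp add: summable_real_powr_iff)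
  have g1: "(\<Sum>i\<in>{-int m..int m}. g i) \<le> 2 * Z" for m
  proof -
    have "(\<Sum>i\<in>{-int m..int m}. g i) \<le> (\<Sum>i\<in>int ` {..m}. g i) + (\<Sum>i\<in>(\<lambda>n. - int n) ` {..m}. g i)"
    proof -
      have "{-int m..int m} \<subseteq> int ` {..m} \<union> (\<lambda>n. - int n) ` {..m}"
      proof
        fix i assume "i \<in> {-int m..int m}"
        then show "i \<in> int ` {..m} \<union> (\<lambda>n. - int n) ` {..m}"
          by (cases "i \<ge> 0") (auto intro!: image_eqI[of _ _ "nat \<bar>i\<bar>"])
      qed
      then have "(\<Sum>i\<in>{-int m..int m}. g i) \<le> (\<Sum>i\<in>int ` {..m} \<union> (\<lambda>n. - int n) ` {..m}. g i)"
        by (intro sum_mono2) (auto simp: g_def)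
      also have "\<dots> \<le> (\<Sum>i\<in>int ` {..m}. g i) + (\<Sum>i\<in>(\<lambda>n. - int n) ` {..m}. g i)"
        by (subst sum.union_inter[symmetric]) (auto intro!: sum_nonneg simp: g_def)
      finally show ?thesis .
    qed
    also have "(\<Sum>i\<in>int ` {..m}. g i) = (\<Sum>n\<le>m. real (Suc n) powr (- q))"
      by (subst sum.reindex) (auto simp: g_def add.commute inj_on_def)
    also have "(\<Sum>i\<in>(\<lambda>n. - int n) ` {..m}. g i) = (\<Sum>n\<le>m. real (Suc n) powr (- q))"
      by (subst sum.reindex) (auto simp: g_def add.commute inj_on_def)
    also have "(\<Sum>n\<le>m. real (Suc n) powr (- q)) \<le> Z"
      unfolding Z_def by (intro sum_le_suminf sm) auto
    finally show ?thesis by simp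
  qed
  have Z: "Z \<ge> 0" unfolding Z_def by (intro suminf_nonneg sm) auto
  have pt: "(1 + lnorm j) powr (- p) \<le> (\<Prod>k\<in>UNIV. g (j $ k))" for j :: "int ^ 'd"
  proof -
    have "(1 + lnorm j) powr (- p) = ((1 + lnorm j) powr (- q)) ^ CARD('d)"
    proof -
      have "((1 + lnorm j) powr (- q)) ^ CARD('d) = ((1 + lnorm j) powr (- q)) powr real CARD('d)"
      proof (subst powr_realpow)
        have "1 + lnorm j > 0" using lnorm_nonneg[of j] by linarith
        then show "0 < (1 + lnorm j) powr (- q)" by simp
      qed simp
      also have "\<dots> = (1 + lnorm j) powr (- q * real CARD('d))" by (rule powr_powr)
      finally show ?thesis by (simp add: q_def)
    qed
    also have "\<dots> = (\<Prod>k\<in>(UNIV :: 'd set). (1 + lnorm j) powr (- q))" by simp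
    also have "\<dots> \<le> (\<Prod>k\<in>UNIV. g (j $ k))"
      unfolding g_def using q abs_le_lnorm[of j] by (intro prod_mono) (auto intro!: powr_mono2')
    finally show ?thesis .
  qed
  have "(\<Sum>j\<in>F. (1 + lnorm j) powr (- p)) \<le> (2 * Z) ^ CARD('d)" if F: "finite F" for F :: "(int ^ 'd) set"
  proof -
    obtain m where m: "F \<subseteq> freq_box m" using finite_subset_freq_box[OF F] .
    have "(\<Sum>j\<in>F. (1 + lnorm j) powr (- p)) \<le> (\<Sum>j\<in>(freq_box m :: (int ^ 'd) set). (1 + lnorm j) powr (- p))"
      by (intro sum_mono2 finite_freq_box m) auto
    also have "\<dots> \<le> (\<Sum>j\<in>(freq_box m :: (int ^ 'd) set). \<Prod>k\<in>UNIV. g (j $ k))" by (intro sum_mono pt)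
    also have "\<dots> = (\<Sum>i\<in>{-int m..int m}. g i) ^ CARD('d)" by (rule sum_freq_box_prod)
    also have "\<dots> \<le> (2 * Z) ^ CARD('d)" by (intro power_mono g1 sum_nonneg) (auto simp: g_def)
    finally show ?thesis .
  qed
  then show ?thesis using Z by (intro exI[of _ "(2 * Z) ^ CARD('d)"]) auto
qed

text \<open>The l-th power of a linear form expands into words s of length l over the coordinates.
  The letter counts of a word form a multi-index of degree l, which is zero only for the empty
  word.\<close>

lemma dot_power_reproduce:
  fixes z :: "real ^ 'd" and m :: "'d \<Rightarrow> real"
  assumes rep: "\<And>\<kappa>. \<kappa> \<in> multi_indices L \<Longrightarrow> (\<Sum>j\<in>J. wt j * xi z (w j) \<kappa>) = (if \<kappa> = 0 then 1 else 0)"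
    and l: "l \<le> L"
  shows "(\<Sum>j\<in>J. wt j * (\<Sum>k\<in>UNIV. m k * (w j $ k - z $ k)) ^ l) = (if l = 0 then 1 else 0)"
proof -
  define P where "P = (PiE {..<l} (\<lambda>_. UNIV) :: (nat \<Rightarrow> 'd) set)"
  define \<kappa> where "\<kappa> s = (\<chi> k. card {i \<in> {..<l}. s i = k})" for s :: "nat \<Rightarrow> 'd"
  have deg: "(\<Sum>k\<in>UNIV. \<kappa> s $ k) = l" for s
  proof -
    have "(\<Sum>k\<in>UNIV. \<kappa> s $ k) = (\<Sum>k\<in>UNIV. \<Sum>i\<in>{i \<in> {..<l}. s i = k}. 1)" by (simp add: \<kappa>_def)
    also have "\<dots> = (\<Sum>i\<in>{..<l}. 1)" by (rule sum.group) auto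
    finally show ?thesis by simp
  qed
  have mi: "\<kappa> s \<in> multi_indices L" for s using deg[of s] l by (simp add: multi_indices_def)
  have pw: "(\<Sum>k\<in>UNIV. m k * (w j $ k - z $ k)) ^ l = (\<Sum>s\<in>P. (\<Prod>i<l. m (s i)) * xi z (w j) (\<kappa> s))" for j
  proof -
    have "(\<Sum>k\<in>UNIV. m k * (w j $ k - z $ k)) ^ l = (\<Prod>i<l. \<Sum>k\<in>UNIV. m k * (w j $ k - z $ k))" by simp
    also have "\<dots> = (\<Sum>s\<in>P. \<Prod>i<l. m (s i) * (w j $ s i - z $ s i))"
      unfolding P_def by (rule prod_sum_PiE) auto
    also have "\<dots> = (\<Sum>s\<in>P. (\<Prod>i<l. m (s i)) * xi z (w j) (\<kappa> s))"
    proof (intro sum.cong refl)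
      fix s
      have "(\<Prod>i<l. w j $ s i - z $ s i) = (\<Prod>k\<in>UNIV. \<Prod>i\<in>{i \<in> {..<l}. s i = k}. w j $ s i - z $ s i)"
        by (rule prod.group[symmetric]) auto
      also have "\<dots> = (\<Prod>k\<in>UNIV. \<Prod>i\<in>{i \<in> {..<l}. s i = k}. w j $ k - z $ k)"
        by (intro prod.cong refl) auto
      also have "\<dots> = xi z (w j) (\<kappa> s)" by (simp add: xi_def \<kappa>_def)
      finally show "(\<Prod>i<l. m (s i) * (w j $ s i - z $ s i)) = (\<Prod>i<l. m (s i)) * xi z (w j) (\<kappa> s)"
        by (simp add: prod.distrib)
    qed
    finally show ?thesis .
  qed
  have "(\<Sum>j\<in>J. wt j * (\<Sum>k\<in>UNIV. m k * (w j $ k - z $ k)) ^ l) = (\<Sum>s\<in>P. (\<Prod>i<l. m (s i)) * (\<Sum>j\<in>J. wt j * xi z (w j) (\<kappa> s)))"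
    unfolding pw sum_distrib_left by (subst sum.swap) (simp add: mult_ac)
  also have "\<dots> = (\<Sum>s\<in>P. (\<Prod>i<l. m (s i)) * (if l = 0 then 1 else 0))"
  proof (intro sum.cong refl arg_cong2[where f="(*)"])
    fix s
    have "\<kappa> s = 0 \<longleftrightarrow> l = 0" using deg[of s] by (auto simp: vec_eq_iff \<kappa>_def)
    then show "(\<Sum>j\<in>J. wt j * xi z (w j) (\<kappa> s)) = (if l = 0 then 1 else 0)" by (simp add: rep[OF mi])
  qed
  also have "\<dots> = (if l = 0 then 1 else 0)" by (simp add: P_def)
  finally show ?thesis .
qed

text \<open>A character at w is the character at z times the exponential of an imaginary linear form
  in w - z. Its Taylor polynomial of degree L - 1 is reproduced exactly by the weights, and the
  remainder is at most the L-th power of the form.\<close>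

lemma fchar_reproduce:
  fixes z :: "real ^ 'd"
  assumes rep: "\<And>\<kappa>. \<kappa> \<in> multi_indices L \<Longrightarrow> (\<Sum>j\<in>J. wt j * xi z (w j) \<kappa>) = (if \<kappa> = 0 then 1 else 0)"
    and L: "L \<ge> 1" and R: "\<And>j. j \<in> J \<Longrightarrow> norm (w j - z) \<le> R"
  shows "cmod ((\<Sum>j\<in>J. complex_of_real (wt j) * fchar m (w j)) - fchar m z) \<le> (lnorm m * R) ^ L * (\<Sum>j\<in>J. \<bar>wt j\<bar>)"
proof -
  define \<theta> where "\<theta> j = (\<Sum>k\<in>UNIV. real_of_int (m $ k) * (w j $ k - z $ k))" for j
  obtain L' where L': "L = Suc L'" using L by (cases L) auto
  define p where "p t = (\<Sum>k\<le>L'. (\<i> * complex_of_real t) ^ k / fact k)" for t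
  have fw: "fchar m (w j) = fchar m z * exp (\<i> * complex_of_real (\<theta> j))" for j
    unfolding fchar_def exp_add[symmetric] \<theta>_def
    by (simp add: distrib_left[symmetric] sum.distrib[symmetric] right_diff_distrib flip: of_real_add)
  have th: "\<bar>\<theta> j\<bar> \<le> lnorm m * R" if "j \<in> J" for j
  proof -
    have "\<theta> j = (\<chi> k. real_of_int (m $ k)) \<bullet> (w j - z)" by (simp add: \<theta>_def inner_vec_def)
    then have "\<bar>\<theta> j\<bar> \<le> lnorm m * norm (w j - z)" unfolding lnorm_def by (simp add: Cauchy_Schwarz_ineq2)
    also have "\<dots> \<le> lnorm m * R" by (intro mult_left_mono R that) simp
    finally show ?thesis .
  qed
  have "(\<Sum>j\<in>J. complex_of_real (wt j) * p (\<theta> j)) = (\<Sum>k\<le>L'. (\<i> ^ k / fact k) * complex_of_real (\<Sum>j\<in>J. wt j * \<theta> j ^ k))"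
    unfolding p_def sum_distrib_left of_real_sum by (subst sum.swap) (simp add: power_mult_distrib mult_ac)
  also have "\<dots> = (\<Sum>k\<le>L'. (\<i> ^ k / fact k) * complex_of_real (if k = 0 then 1 else 0))"
  proof (intro sum.cong refl arg_cong2[where f="(*)"] arg_cong[where f=complex_of_real])
    fix k assume "k \<in> {..L'}"
    then have k: "k \<le> L" using L' by simp
    show "(\<Sum>j\<in>J. wt j * \<theta> j ^ k) = (if k = 0 then 1 else 0)"
      unfolding \<theta>_def by (rule dot_power_reproduce[OF rep k])
  qed
  also have "\<dots> = (\<Sum>k\<le>L'. if k = 0 then 1 else 0)" by (intro sum.cong) auto
  also have "\<dots> = 1" by simp
  finally have p1: "(\<Sum>j\<in>J. complex_of_real (wt j) * p (\<theta> j)) = 1" .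
  have "(\<Sum>j\<in>J. complex_of_real (wt j) * fchar m (w j)) - fchar m z
     = fchar m z * ((\<Sum>j\<in>J. complex_of_real (wt j) * exp (\<i> * complex_of_real (\<theta> j))) - (\<Sum>j\<in>J. complex_of_real (wt j) * p (\<theta> j)))"
    unfolding p1 fw by (simp add: sum_distrib_left algebra_simps)
  also have "\<dots> = fchar m z * (\<Sum>j\<in>J. complex_of_real (wt j) * (exp (\<i> * complex_of_real (\<theta> j)) - p (\<theta> j)))"
    by (simp add: sum_subtractf right_diff_distrib)
  finally have "cmod ((\<Sum>j\<in>J. complex_of_real (wt j) * fchar m (w j)) - fchar m z)
     = cmod (\<Sum>j\<in>J. complex_of_real (wt j) * (exp (\<i> * complex_of_real (\<theta> j)) - p (\<theta> j)))"
    by (simp add: norm_mult)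
  also have "\<dots> \<le> (\<Sum>j\<in>J. \<bar>wt j\<bar> * (lnorm m * R) ^ L)"
  proof (rule order_trans[OF norm_sum], rule sum_mono)
    fix j assume j: "j \<in> J"
    have "cmod (exp (\<i> * complex_of_real (\<theta> j)) - p (\<theta> j)) \<le> \<bar>\<theta> j\<bar> ^ L / fact L"
      unfolding p_def L' using iexp_approx1[of "\<theta> j" L'] by simp
    also have "\<dots> \<le> \<bar>\<theta> j\<bar> ^ L" by (simp add: divide_le_eq mult_left_le_one_le fact_ge_1 mult_le_cancel_left1)
    also have "\<dots> \<le> (lnorm m * R) ^ L" using th[OF j] by (intro power_mono) auto
    finally show "cmod (complex_of_real (wt j) * (exp (\<i> * complex_of_real (\<theta> j)) - p (\<theta> j))) \<le> \<bar>wt j\<bar> * (lnorm m * R) ^ L"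
      by (simp add: norm_mult mult_left_mono)
  qed
  also have "\<dots> = (lnorm m * R) ^ L * (\<Sum>j\<in>J. \<bar>wt j\<bar>)"
    unfolding sum_distrib_right[symmetric] by (rule mult.commute)
  finally show ?thesis .
qed

lemma AE_cube_open_cube: "AE x in lborel. x \<in> cube \<longrightarrow> x \<in> (open_cube :: (real ^ 'd) set)"
proof -
  have "negligible (cube - open_cube :: (real ^ 'd) set)"
    unfolding cube_def open_cube_def by (rule negligible_frontier_interval)
  then have "cube - open_cube \<in> null_sets (lebesgue :: (real ^ 'd) measure)" using negligible_iff_null_sets by blast
  then have "AE x in lebesgue. x \<notin> (cube - open_cube :: (real ^ 'd) set)" by (rule AE_not_in)
  then have "AE x in lborel. x \<notin> (cube - open_cube :: (real ^ 'd) set)" by (rule AE_completion_iff[THEN iffD1])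
  then show ?thesis by eventually_elim auto
qed

text \<open>The difference of a trigonometric sum and h has on the cube the coefficients of the sum
  minus those of h, by orthogonality; \<open>fourier_duality\<close> converts a bound on them into
  an L2 bound.\<close>

lemma fourier_sum_error:
  fixes h :: "real ^ 'd \<Rightarrow> real"
  assumes h: "integrable lborel h" and zero: "\<And>x. x \<notin> open_cube \<Longrightarrow> h x = 0" and F: "finite F"
    and B: "\<And>G. finite G \<Longrightarrow> (\<Sum>j\<in>G. (cmod ((if j \<in> F then a j else 0) - ft h j))\<^sup>2) \<le> B"
  shows "(\<integral>\<^sup>+x\<in>cube. ennreal ((cmod ((\<Sum>j\<in>F. a j * fchar (- j) x) / complex_of_real ((2 * pi) ^ CARD('d)) - complex_of_real (h x)))\<^sup>2) \<partial>lborel)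
     \<le> ennreal (B / (2 * pi) ^ CARD('d))"
proof -
  define V :: complex where "V = complex_of_real ((2 * pi) ^ CARD('d))"
  have V: "V \<noteq> 0" by (simp add: V_def)
  define p where "p x = (\<Sum>j\<in>F. a j * fchar (- j) x) / V" for x
  \<comment> \<open>Restricted to the open cube, as duality requires; the boundary has measure
    zero.\<close>
  define f where "f x = indicator open_cube x *\<^sub>R (p x - complex_of_real (h x))" for x
  have [measurable]: "h \<in> borel_measurable borel" using borel_measurable_integrable[OF h] by simp
  have [measurable]: "p \<in> borel_measurable borel" unfolding p_def by measurable
  have [measurable]: "f \<in> borel_measurable borel" unfolding f_def by measurable
  have pb: "cmod (p x) \<le> (\<Sum>j\<in>F. cmod (a j)) / cmod V" for x
  proof -
    have "cmod (\<Sum>j\<in>F. a j * fchar (- j) x) \<le> (\<Sum>j\<in>F. cmod (a j))"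
      by (rule order_trans[OF norm_sum]) (simp add: norm_mult)
    then show ?thesis unfolding p_def norm_divide by (intro divide_right_mono) auto
  qed
  have ae: "AE x in lborel. f x = indicator cube x *\<^sub>R p x - complex_of_real (h x)"
    using AE_cube_open_cube
  proof eventually_elim
    case (elim x)
    then show ?case using zero[of x] open_cube_subset by (cases "x \<in> open_cube") (auto simp: f_def)
  qed
  have ip: "integrable lborel (\<lambda>x. indicator cube x *\<^sub>R p x)" by (rule integrable_cube[OF _ pb]) auto
  have ih: "integrable lborel (\<lambda>x. complex_of_real (h x))" using h by simp
  have if': "integrable lborel f"
    using ae ip ih by (subst integrable_cong_AE[where g="\<lambda>x. indicator cube x *\<^sub>R p x - complex_of_real (h x)"]) auto
  have coef: "(LINT x|lborel. f x * fchar k x) = (if k \<in> F then a k else 0) - ft h k" for k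
  proof -
    have i1: "integrable lborel (\<lambda>x. indicator cube x *\<^sub>R (p x * fchar k x))"
      by (rule integrable_cube[where B="(\<Sum>j\<in>F. cmod (a j)) / cmod V"]) (auto simp: norm_mult pb)
    have i2: "integrable lborel (\<lambda>x. complex_of_real (h x) * fchar k x)"
      by (rule Bochner_Integration.integrable_bound[OF ih]) (auto simp: norm_mult)
    have "(LINT x|lborel. f x * fchar k x) = (LINT x|lborel. indicator cube x *\<^sub>R (p x * fchar k x) - complex_of_real (h x) * fchar k x)"
    proof (rule integral_cong_AE)
      show "AE x in lborel. f x * fchar k x = indicator cube x *\<^sub>R (p x * fchar k x) - complex_of_real (h x) * fchar k x"
        using ae by eventually_elim (simp add: left_diff_distrib)
    qed (auto simp: f_def)
    also have "\<dots> = (LINT x|lborel. indicator cube x *\<^sub>R (p x * fchar k x)) - ft h k"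
      unfolding ft_def by (rule Bochner_Integration.integral_diff[OF i1 i2])
    also have "(LINT x|lborel. indicator cube x *\<^sub>R (p x * fchar k x)) = (LINT x|lborel. (\<Sum>j\<in>F. a j / V * (indicator cube x *\<^sub>R fchar (- j + k) x)))"
    proof (intro Bochner_Integration.integral_cong refl)
      fix x
      show "indicator cube x *\<^sub>R (p x * fchar k x) = (\<Sum>j\<in>F. a j / V * (indicator cube x *\<^sub>R fchar (- j + k) x))"
      proof -
        have "p x * fchar k x = (\<Sum>j\<in>F. a j / V * fchar (- j + k) x)"
          unfolding p_def fchar_add sum_divide_distrib sum_distrib_right by (intro sum.cong refl) simp
        then show ?thesis by (cases "x \<in> cube") simp_all
      qed
    qed
    also have "\<dots> = (\<Sum>j\<in>F. a j / V * (LINT x|lborel. indicator cube x *\<^sub>R fchar (- j + k) x))"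
    proof -
      have i: "integrable lborel (\<lambda>x. indicator cube x *\<^sub>R fchar j x)" for j :: "int ^ 'd"
        by (rule integrable_cube[where B=1]) auto
      show ?thesis
        by (subst Bochner_Integration.integral_sum, intro integrable_mult_right i, simp only: integral_mult_right_zero)
    qed
    also have "\<dots> = (\<Sum>j\<in>F. if j = k then a k else 0)"
      unfolding integral_fchar using V by (intro sum.cong refl) (auto simp: V_def)
    also have "\<dots> = (if k \<in> F then a k else 0)" using F by (simp add: sum.delta)
    finally show ?thesis .
  qed
  have "(\<integral>\<^sup>+x. ennreal ((cmod (f x))\<^sup>2) \<partial>lborel) \<le> ennreal (B / (2 * pi) ^ CARD('d))"
  proof (rule fourier_duality[OF if'])
    show "f x = 0" if "x \<notin> open_cube" for x using that by (simp add: f_def)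
    show "(\<Sum>j\<in>G. (cmod (LINT x|lborel. f x * fchar j x))\<^sup>2) \<le> B" if "finite G" for G
      unfolding coef by (rule B[OF that])
  qed
  moreover have "(\<integral>\<^sup>+x\<in>cube. ennreal ((cmod (p x - complex_of_real (h x)))\<^sup>2) \<partial>lborel) \<le> (\<integral>\<^sup>+x. ennreal ((cmod (f x))\<^sup>2) \<partial>lborel)"
  proof (rule nn_integral_mono_AE)
    show "AE x in lborel. ennreal ((cmod (p x - complex_of_real (h x)))\<^sup>2) * indicator cube x \<le> ennreal ((cmod (f x))\<^sup>2)"
      using AE_cube_open_cube by eventually_elim (auto simp: f_def indicator_def)
  qed
  ultimately show ?thesis unfolding p_def V_def by (rule order_trans[rotated])
qed

section \<open>The regression function\<close>

lemma distr_reflect_lborel: "distr lborel borel (\<lambda>x. y - x) = (lborel :: 'a::euclidean_space measure)"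
proof -
  have "lborel = density (distr lborel borel (\<lambda>x. y + (-1) *\<^sub>R x)) (\<lambda>_. ennreal (\<bar>-1\<bar> ^ DIM('a)))"
    by (rule lborel_affine) simp
  then show ?thesis by (simp add: density_1)
qed

lemma integral_reflect_lborel:
  fixes F :: "'a::euclidean_space \<Rightarrow> 'b::{banach, second_countable_topology}"
  assumes [measurable]: "F \<in> borel_measurable borel"
  shows "(LINT z|lborel. F (y - z)) = (LINT z|lborel. F z)"
    and "integrable lborel (\<lambda>z. F (y - z)) \<longleftrightarrow> integrable lborel F"
proof -
  have m: "(\<lambda>z. y - z) \<in> measurable lborel (borel :: 'a measure)" by simp
  show "(LINT z|lborel. F (y - z)) = (LINT z|lborel. F z)"
    using integral_distr[OF m, of F] unfolding distr_reflect_lborel by simp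
  show "integrable lborel (\<lambda>z. F (y - z)) \<longleftrightarrow> integrable lborel F"
    using integrable_distr_eq[OF m, of F] unfolding distr_reflect_lborel by simp
qed

lemma integral_shift_lborel:
  fixes F :: "'a::euclidean_space \<Rightarrow> 'b::{banach, second_countable_topology}"
  assumes [measurable]: "F \<in> borel_measurable borel"
  shows "(LINT x|lborel. F (z + x)) = (LINT x|lborel. F x)"
proof -
  have m: "(+) z \<in> measurable lborel (borel :: 'a measure)" by simp
  show ?thesis using integral_distr[OF m, of F] unfolding lborel_distr_plus by simp
qed

lemma nn_integral_shift_lborel:
  assumes [measurable]: "F \<in> borel_measurable borel"
  shows "(\<integral>\<^sup>+x. F (z + x) \<partial>lborel) = (\<integral>\<^sup>+x. F x \<partial>(lborel :: 'a::euclidean_space measure))"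
proof -
  have m: "(+) z \<in> measurable lborel (borel :: 'a measure)" by simp
  show ?thesis using nn_integral_distr[OF m, of F] unfolding lborel_distr_plus by simp
qed

lemma AE_shift_lborel:
  assumes "AE x in (lborel :: 'a::euclidean_space measure). P x" and [measurable]: "Measurable.pred borel P"
  shows "AE x in lborel. P (z + x)"
proof -
  have m: "(+) z \<in> measurable lborel (borel :: 'a measure)" by simp
  have "AE x in distr lborel borel ((+) z). P x" unfolding lborel_distr_plus by (rule assms(1))
  then show ?thesis by (subst (asm) AE_distr_iff[OF m]) auto
qed

section \<open>Consequences of the Sobolev condition\<close>

lemma sobolev_finite_sum:
  assumes "sobolev \<alpha> C h" "finite F"
  shows "(\<Sum>j\<in>F. (cmod (ft h j))\<^sup>2 * (1 + lnorm j powr (2 * \<alpha>))) \<le> C"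
proof -
  have "(\<Sum>j\<in>F. (cmod (ft h j))\<^sup>2 * (1 + lnorm j powr (2 * \<alpha>))) \<le> (\<Sum>\<^sub>\<infinity>j. (cmod (ft h j))\<^sup>2 * (1 + lnorm j powr (2 * \<alpha>)))"
    using assms unfolding sobolev_def by (intro finite_sum_le_infsum) auto
  then show ?thesis using assms unfolding sobolev_def by linarith
qed

lemma one_plus_powr_le:
  fixes x :: real
  assumes "x \<ge> 0" "a \<ge> 0"
  shows "(1 + x) powr (2 * a) \<le> 4 powr a * (1 + x powr (2 * a))"
proof -
  have "(1 + x) powr (2 * a) \<le> (2 * max 1 x) powr (2 * a)" using assms by (intro powr_mono2) auto
  also have "\<dots> = 2 powr (2 * a) * max 1 x powr (2 * a)" by (rule powr_mult)
  also have "(2::real) powr (2 * a) = (2 powr 2) powr a" by (simp only: powr_powr)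
  also have "(2::real) powr 2 = 4" by simp
  also have "max 1 x powr (2 * a) \<le> 1 + x powr (2 * a)" by (simp add: max_def)
  finally show ?thesis by (simp add: mult_left_mono)
qed

lemma sobolev_tail:
  fixes h :: "real ^ 'd \<Rightarrow> real"
  assumes s: "sobolev \<alpha> C h" and F: "finite F" "F \<inter> freq_box m = {}" and a: "\<alpha> > 0"
  shows "(\<Sum>j\<in>F. (cmod (ft h j))\<^sup>2) \<le> C * real (Suc m) powr (- 2 * \<alpha>)"
proof -
  have "real (Suc m) powr (2 * \<alpha>) * (\<Sum>j\<in>F. (cmod (ft h j))\<^sup>2) \<le> (\<Sum>j\<in>F. (cmod (ft h j))\<^sup>2 * (1 + lnorm j powr (2 * \<alpha>)))"
    unfolding sum_distrib_left
  proof (rule sum_mono)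
    fix j assume "j \<in> F"
    then have "j \<notin> freq_box m" using F by blast
    then obtain k where "\<not> (j $ k \<in> {- int m..int m})" unfolding freq_box_def by blast
    then have "int (Suc m) \<le> \<bar>j $ k\<bar>" by auto
    then have "real (Suc m) \<le> \<bar>real_of_int (j $ k)\<bar>" by linarith
    then have "real (Suc m) \<le> lnorm j" using abs_le_lnorm[of j k] by linarith
    then have "real (Suc m) powr (2 * \<alpha>) \<le> lnorm j powr (2 * \<alpha>)" using a by (intro powr_mono2) auto
    then have "real (Suc m) powr (2 * \<alpha>) \<le> 1 + lnorm j powr (2 * \<alpha>)" by simp
    then show "real (Suc m) powr (2 * \<alpha>) * (cmod (ft h j))\<^sup>2 \<le> (cmod (ft h j))\<^sup>2 * (1 + lnorm j powr (2 * \<alpha>))"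
      by (subst mult.commute) (intro mult_left_mono, auto)
  qed
  also have "\<dots> \<le> C" by (rule sobolev_finite_sum[OF s F(1)])
  finally show ?thesis by (simp add: powr_minus field_simps)
qed

text \<open>What the condition on \<alpha> provides for the analysis of one h: 2 * \<alpha> > d
  makes its Fourier coefficients absolutely summable, and L at most \<alpha> lets the Sobolev weight
  absorb L-th powers of frequencies.\<close>

locale berkson_fourier =
  fixes f\<delta> :: "real ^ 'd \<Rightarrow> real" and H :: "(real ^ 'd) set" and \<alpha> C\<alpha> \<gamma> c\<delta> C\<delta> :: real and L :: nat
  assumes H: "compact H" "H \<subseteq> open_cube" "supp f\<delta> \<subseteq> H"
    and dens: "integrable lborel f\<delta>" "\<And>x. 0 \<le> f\<delta> x" "(LINT x|lborel. f\<delta> x) = 1"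
    and sm: "0 < c\<delta>" "0 < C\<delta>" "\<gamma> > real CARD('d) / 2" "ordinary_smooth c\<delta> C\<delta> \<gamma> f\<delta>"
    and \<alpha>: "2 * \<alpha> > real CARD('d)" "real L \<le> \<alpha>" "L \<ge> 1" "C\<alpha> > 0"
begin

definition hclass :: "(real ^ 'd \<Rightarrow> real) \<Rightarrow> bool" where
  "hclass h \<longleftrightarrow> integrable lborel h \<and> supp h \<subseteq> H \<and> sobolev \<alpha> C\<alpha> h"

text \<open>The conditional mean of U given Z = z, that is, the mean of h (z + \<delta>).\<close>

definition reg :: "(real ^ 'd \<Rightarrow> real) \<Rightarrow> real ^ 'd \<Rightarrow> real" where
  "reg h = conv h (\<lambda>x. f\<delta> (- x))"

text \<open>The partial Fourier sum of h; the frequency -j appears because the coefficients are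
  taken without conjugation.\<close>

definition psum :: "(real ^ 'd \<Rightarrow> real) \<Rightarrow> nat \<Rightarrow> real ^ 'd \<Rightarrow> complex" where
  "psum h m x = (\<Sum>j\<in>freq_box m. ft h j * fchar (- j) x) / complex_of_real ((2 * pi) ^ CARD('d))"

lemma f\<delta>_measurable [measurable]: "f\<delta> \<in> borel_measurable borel"
  using borel_measurable_integrable[OF dens(1)] by simp

lemma hclass_measurable: "hclass h \<Longrightarrow> h \<in> borel_measurable borel"
  using borel_measurable_integrable[of lborel h] by (simp add: hclass_def)

lemma hclass_zero: "hclass h \<Longrightarrow> x \<notin> H \<Longrightarrow> h x = 0"
  using closure_subset[of "{x. h x \<noteq> 0}"] unfolding hclass_def supp_def by blast

lemma f\<delta>_zero: "x \<notin> H \<Longrightarrow> f\<delta> x = 0"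
  using H(3) closure_subset[of "{x. f\<delta> x \<noteq> 0}"] unfolding supp_def by blast

lemma two_pi_power_ge_1: "(2 * pi) ^ n \<ge> (1::real)"
  using pi_gt3 by (intro one_le_power) auto

lemma divide_two_pi_le: "0 \<le> B \<Longrightarrow> B / (2 * pi) ^ n \<le> (B::real)"
  using frac_le[of B B 1 "(2 * pi) ^ n"] two_pi_power_ge_1[of n] by simp

lemma weighted_sum_bound:
  assumes h: "hclass h" and F: "finite F"
  shows "(\<Sum>j\<in>F. (cmod (ft h j) * (1 + lnorm j) ^ L)\<^sup>2) \<le> 4 powr \<alpha> * C\<alpha>"
proof -
  have "(\<Sum>j\<in>F. (cmod (ft h j) * (1 + lnorm j) ^ L)\<^sup>2) \<le> (\<Sum>j\<in>F. 4 powr \<alpha> * ((cmod (ft h j))\<^sup>2 * (1 + lnorm j powr (2 * \<alpha>))))"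
  proof (rule sum_mono)
    fix j :: "int ^ 'd"
    have pos: "1 + lnorm j > 0" using lnorm_nonneg[of j] by linarith
    have "((1 + lnorm j) ^ L)\<^sup>2 = (1 + lnorm j) powr (2 * real L)"
      using powr_realpow[OF pos, of "L * 2"] by (simp add: power_mult[symmetric] mult.commute)
    also have "\<dots> \<le> (1 + lnorm j) powr (2 * \<alpha>)" using \<alpha>(2) by (intro powr_mono) auto
    also have "\<dots> \<le> 4 powr \<alpha> * (1 + lnorm j powr (2 * \<alpha>))" using \<alpha> by (intro one_plus_powr_le) auto
    finally have "(cmod (ft h j))\<^sup>2 * ((1 + lnorm j) ^ L)\<^sup>2 \<le> (cmod (ft h j))\<^sup>2 * (4 powr \<alpha> * (1 + lnorm j powr (2 * \<alpha>)))"
      by (intro mult_left_mono) auto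
    then show "(cmod (ft h j) * (1 + lnorm j) ^ L)\<^sup>2 \<le> 4 powr \<alpha> * ((cmod (ft h j))\<^sup>2 * (1 + lnorm j powr (2 * \<alpha>)))"
      by (simp add: power_mult_distrib mult_ac)
  qed
  also have "\<dots> = 4 powr \<alpha> * (\<Sum>j\<in>F. (cmod (ft h j))\<^sup>2 * (1 + lnorm j powr (2 * \<alpha>)))"
    by (simp add: sum_distrib_left)
  also have "\<dots> \<le> 4 powr \<alpha> * C\<alpha>"
    using h F unfolding hclass_def by (intro mult_left_mono sobolev_finite_sum) auto
  finally show ?thesis .
qed

text \<open>Young's inequality with the weight (1 + |j|)^(2 \<alpha>): its product with the squared
  coefficients is controlled by the Sobolev condition, and its reciprocal is summable because 2 *
  \<alpha> > d.\<close>

lemma abs_sum_bound: "\<exists>B\<ge>0. \<forall>h. hclass h \<longrightarrow> (\<forall>F. finite F \<longrightarrow> (\<Sum>j\<in>F. cmod (ft h j)) \<le> B)"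
proof -
  obtain Z where Z: "Z \<ge> 0" "\<And>F :: (int ^ 'd) set. finite F \<Longrightarrow> (\<Sum>j\<in>F. (1 + lnorm j) powr (- (2 * \<alpha>))) \<le> Z"
    using lnorm_sum_bound[OF \<alpha>(1)] by blast
  have "(\<Sum>j\<in>F. cmod (ft h j)) \<le> 4 powr \<alpha> * C\<alpha> + Z" if h: "hclass h" and F: "finite F" for h F
  proof -
    have "(\<Sum>j\<in>F. cmod (ft h j)) \<le> (\<Sum>j\<in>F. 4 powr \<alpha> * ((cmod (ft h j))\<^sup>2 * (1 + lnorm j powr (2 * \<alpha>))) + (1 + lnorm j) powr (- (2 * \<alpha>)))"
    proof (rule sum_mono)
      fix j :: "int ^ 'd"
      define x where "x = (1 + lnorm j) powr \<alpha>"
      have x: "x > 0" using lnorm_nonneg[of j] unfolding x_def by (subst powr_gt_zero) linarith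
      have x2: "x\<^sup>2 = (1 + lnorm j) powr (2 * \<alpha>)" "(1 / x)\<^sup>2 = (1 + lnorm j) powr (- (2 * \<alpha>))"
        by (simp_all add: x_def power2_eq_square powr_add[symmetric] powr_minus field_simps)
      have "0 \<le> (cmod (ft h j) * x - 1 / x)\<^sup>2" by simp
      also have "\<dots> = (cmod (ft h j))\<^sup>2 * x\<^sup>2 + (1 / x)\<^sup>2 - 2 * cmod (ft h j)"
        using x by (simp add: power2_diff power_mult_distrib)
      finally have "2 * cmod (ft h j) \<le> (cmod (ft h j))\<^sup>2 * x\<^sup>2 + (1 / x)\<^sup>2" by simp
      moreover have "(cmod (ft h j))\<^sup>2 * x\<^sup>2 \<le> 4 powr \<alpha> * ((cmod (ft h j))\<^sup>2 * (1 + lnorm j powr (2 * \<alpha>)))"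
      proof -
        have "x\<^sup>2 \<le> 4 powr \<alpha> * (1 + lnorm j powr (2 * \<alpha>))" unfolding x2 using \<alpha> by (intro one_plus_powr_le) auto
        then have "(cmod (ft h j))\<^sup>2 * x\<^sup>2 \<le> (cmod (ft h j))\<^sup>2 * (4 powr \<alpha> * (1 + lnorm j powr (2 * \<alpha>)))"
          by (intro mult_left_mono) auto
        then show ?thesis by (simp only: mult_ac)
      qed
      ultimately show "cmod (ft h j) \<le> 4 powr \<alpha> * ((cmod (ft h j))\<^sup>2 * (1 + lnorm j powr (2 * \<alpha>))) + (1 + lnorm j) powr (- (2 * \<alpha>))"
        using norm_ge_zero[of "ft h j"] unfolding x2(2)[symmetric] by linarith
    qed
    also have "\<dots> = 4 powr \<alpha> * (\<Sum>j\<in>F. (cmod (ft h j))\<^sup>2 * (1 + lnorm j powr (2 * \<alpha>))) + (\<Sum>j\<in>F. (1 + lnorm j) powr (- (2 * \<alpha>)))"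
      by (simp add: sum.distrib sum_distrib_left)
    also have "\<dots> \<le> 4 powr \<alpha> * C\<alpha> + Z"
      using h F Z unfolding hclass_def by (intro add_mono mult_left_mono sobolev_finite_sum) auto
    finally show ?thesis .
  qed
  then show ?thesis using Z(1) \<alpha>(4) by (intro exI[of _ "4 powr \<alpha> * C\<alpha> + Z"]) auto
qed

lemma psum_measurable [measurable]: "psum h m \<in> borel_measurable borel"
  unfolding psum_def by measurable

lemma psum_error:
  assumes h: "hclass h"
  shows "(\<integral>\<^sup>+x\<in>cube. ennreal ((cmod (psum h m x - complex_of_real (h x)))\<^sup>2) \<partial>lborel) \<le> ennreal (C\<alpha> * real (Suc m) powr (- 2 * \<alpha>))"
proof -
  define B where "B = C\<alpha> * real (Suc m) powr (- 2 * \<alpha>)"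
  have a0: "\<alpha> > 0" using \<alpha>(1) by (smt (verit) of_nat_0_le_iff)
  have "(\<integral>\<^sup>+x\<in>cube. ennreal ((cmod (psum h m x - complex_of_real (h x)))\<^sup>2) \<partial>lborel) \<le> ennreal (B / (2 * pi) ^ CARD('d))"
    unfolding psum_def
  proof (rule fourier_sum_error)
    show "integrable lborel h" using h by (simp add: hclass_def)
    show "h x = 0" if "x \<notin> open_cube" for x using hclass_zero[OF h, of x] that H(2) by blast
    show "finite (freq_box m :: (int ^ 'd) set)" by (rule finite_freq_box)
    fix G :: "(int ^ 'd) set" assume G: "finite G"
    have "(\<Sum>j\<in>G. (cmod ((if j \<in> freq_box m then ft h j else 0) - ft h j))\<^sup>2) = (\<Sum>j\<in>G - freq_box m. (cmod (ft h j))\<^sup>2)"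
      using G by (intro sum.mono_neutral_cong_right) auto
    also have "\<dots> \<le> B"
      unfolding B_def using h G a0 by (intro sobolev_tail) (auto simp: hclass_def)
    finally show "(\<Sum>j\<in>G. (cmod ((if j \<in> freq_box m then ft h j else 0) - ft h j))\<^sup>2) \<le> B" .
  qed
  also have "\<dots> \<le> ennreal B"
    using \<alpha>(4) by (intro ennreal_leI divide_two_pi_le) (simp add: B_def)
  finally show ?thesis unfolding B_def .
qed

lemma tail_tendsto_0: "(\<lambda>m. C * real (Suc m) powr (- 2 * \<alpha>)) \<longlonglongrightarrow> 0"
proof -
  have a0: "\<alpha> > 0" using \<alpha>(1) by (smt (verit) of_nat_0_le_iff)
  have "(\<lambda>m. real (Suc m) powr (- 2 * \<alpha>)) \<longlonglongrightarrow> 0"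
    by (rule tendsto_neg_powr[OF _ filterlim_compose[OF filterlim_real_sequentially filterlim_Suc]]) (use a0 in simp)
  then show ?thesis by (rule tendsto_mult_right_zero)
qed

text \<open>The partial sums are bounded by B uniformly in h and converge to h in L2, so the part of
  |h| exceeding B has L2 norm zero. The bound on h holds almost everywhere only, since h is
  determined up to null sets by its coefficients.\<close>

lemma hclass_bounded:
  "\<exists>B\<ge>0. \<forall>h. hclass h \<longrightarrow> (\<forall>m x. cmod (psum h m x) \<le> B) \<and> (AE x in lborel. \<bar>h x\<bar> \<le> B)"
proof -
  obtain B where B: "B \<ge> 0" "\<And>h F. hclass h \<Longrightarrow> finite F \<Longrightarrow> (\<Sum>j\<in>F. cmod (ft h j)) \<le> B"
    using abs_sum_bound by blast
  have ps: "cmod (psum h m x) \<le> B" if h: "hclass h" for h m x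
  proof -
    have "cmod (\<Sum>j\<in>freq_box m. ft h j * fchar (- j) x) \<le> (\<Sum>j\<in>freq_box m. cmod (ft h j))"
      by (rule order_trans[OF norm_sum]) (simp add: norm_mult)
    also have "\<dots> \<le> B" by (rule B(2)[OF h finite_freq_box])
    finally have "cmod (\<Sum>j\<in>freq_box m. ft h j * fchar (- j) x) \<le> B" .
    then have "cmod (psum h m x) \<le> B / (2 * pi) ^ CARD('d)"
      unfolding psum_def norm_divide norm_of_real by (simp add: divide_right_mono)
    also have "\<dots> \<le> B" by (rule divide_two_pi_le[OF B(1)])
    finally show ?thesis .
  qed
  have "AE x in lborel. \<bar>h x\<bar> \<le> B" if h: "hclass h" for h
  proof -
    note [measurable] = hclass_measurable[OF h]
    define D where "D = (\<integral>\<^sup>+x. ennreal ((max 0 (\<bar>h x\<bar> - B))\<^sup>2) \<partial>lborel)"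
    have Dm: "D \<le> ennreal (C\<alpha> * real (Suc m) powr (- 2 * \<alpha>))" for m
    proof -
      have "D \<le> (\<integral>\<^sup>+x\<in>cube. ennreal ((cmod (psum h m x - complex_of_real (h x)))\<^sup>2) \<partial>lborel)"
        unfolding D_def
      proof (rule nn_integral_mono)
        fix x
        show "ennreal ((max 0 (\<bar>h x\<bar> - B))\<^sup>2) \<le> ennreal ((cmod (psum h m x - complex_of_real (h x)))\<^sup>2) * indicator cube x"
        proof (cases "x \<in> cube")
          case True
          have "\<bar>h x\<bar> - cmod (psum h m x) \<le> cmod (psum h m x - complex_of_real (h x))"
            using norm_triangle_ineq2[of "complex_of_real (h x)" "psum h m x"] by (simp add: norm_minus_commute)
          then have "max 0 (\<bar>h x\<bar> - B) \<le> cmod (psum h m x - complex_of_real (h x))"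
            using ps[OF h, of m x] by simp
          then show ?thesis using True by (simp add: ennreal_leI power_mono)
        next
          case False
          then have "h x = 0" using hclass_zero[OF h, of x] H(2) open_cube_subset by blast
          then show ?thesis using B(1) by (simp add: max_def)
        qed
      qed
      also have "\<dots> \<le> ennreal (C\<alpha> * real (Suc m) powr (- 2 * \<alpha>))" by (rule psum_error[OF h])
      finally show ?thesis .
    qed
    have "(\<lambda>m. ennreal (C\<alpha> * real (Suc m) powr (- 2 * \<alpha>))) \<longlonglongrightarrow> ennreal 0"
      using tail_tendsto_0 by (intro tendsto_ennrealI)
    then have "D \<le> ennreal 0" by (rule LIMSEQ_le_const) (use Dm in auto)
    then have "D = 0" by simp
    then have "AE x in lborel. ennreal ((max 0 (\<bar>h x\<bar> - B))\<^sup>2) = 0"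
      unfolding D_def by (subst (asm) nn_integral_0_iff_AE) auto
    then show ?thesis by eventually_elim (auto simp: max_def split: if_splits)
  qed
  then show ?thesis using ps B(1) by blast
qed

text \<open>Since \<gamma> > d/2, the upper smoothness bound makes the squared coefficients
  summable.\<close>

lemma f\<delta>_square: "\<exists>B\<ge>0. (\<integral>\<^sup>+x. ennreal ((f\<delta> x)\<^sup>2) \<partial>lborel) \<le> ennreal B"
proof -
  have "2 * \<gamma> > real CARD('d)" using sm(3) by simp
  then obtain Z where Z: "Z \<ge> 0" "\<And>F :: (int ^ 'd) set. finite F \<Longrightarrow> (\<Sum>j\<in>F. (1 + lnorm j) powr (- (2 * \<gamma>))) \<le> Z"
    using lnorm_sum_bound by blast
  have "(\<integral>\<^sup>+x. ennreal ((cmod (complex_of_real (f\<delta> x)))\<^sup>2) \<partial>lborel) \<le> ennreal (C\<delta>\<^sup>2 * Z / (2 * pi) ^ CARD('d))"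
  proof (rule fourier_duality)
    show "integrable lborel (\<lambda>x. complex_of_real (f\<delta> x))" using dens by simp
    show "complex_of_real (f\<delta> x) = 0" if "x \<notin> open_cube" for x using f\<delta>_zero[of x] that H(2) by auto
    fix F :: "(int ^ 'd) set" assume F: "finite F"
    have "(\<Sum>j\<in>F. (cmod (LINT x|lborel. complex_of_real (f\<delta> x) * fchar j x))\<^sup>2) \<le> (\<Sum>j\<in>F. C\<delta>\<^sup>2 * (1 + lnorm j) powr (- (2 * \<gamma>)))"
    proof (rule sum_mono)
      fix j :: "int ^ 'd"
      have "cmod (ft f\<delta> j) \<le> C\<delta> * (1 + lnorm j) powr (- \<gamma>)" using sm(4) by (simp add: ordinary_smooth_def)
      then have "(cmod (ft f\<delta> j))\<^sup>2 \<le> (C\<delta> * (1 + lnorm j) powr (- \<gamma>))\<^sup>2" by (intro power_mono) auto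
      also have "\<dots> = C\<delta>\<^sup>2 * (1 + lnorm j) powr (- (2 * \<gamma>))"
        by (simp add: power2_eq_square powr_add[symmetric])
      finally show "(cmod (LINT x|lborel. complex_of_real (f\<delta> x) * fchar j x))\<^sup>2 \<le> C\<delta>\<^sup>2 * (1 + lnorm j) powr (- (2 * \<gamma>))"
        unfolding ft_def .
    qed
    also have "\<dots> \<le> C\<delta>\<^sup>2 * Z" unfolding sum_distrib_left[symmetric] by (intro mult_left_mono Z F) auto
    finally show "(\<Sum>j\<in>F. (cmod (LINT x|lborel. complex_of_real (f\<delta> x) * fchar j x))\<^sup>2) \<le> C\<delta>\<^sup>2 * Z" .
  qed
  then show ?thesis using Z(1) by (intro exI[of _ "C\<delta>\<^sup>2 * Z / (2 * pi) ^ CARD('d)"]) auto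
qed

lemma reg_eq:
  assumes h: "hclass h"
  shows "reg h z = (LINT x|lborel. h (z + x) * f\<delta> x)"
proof -
  note [measurable] = hclass_measurable[OF h]
  have "reg h z = (LINT y|lborel. h y * f\<delta> (y - z))" by (simp add: reg_def conv_def)
  also have "\<dots> = (LINT x|lborel. h (z + x) * f\<delta> x)"
    using integral_shift_lborel[of "\<lambda>y. h y * f\<delta> (y - z)" z] by simp
  finally show ?thesis .
qed

lemma reg_integrable:
  assumes h: "hclass h" and b: "AE x in lborel. \<bar>h x\<bar> \<le> B"
  shows "integrable lborel (\<lambda>x. h (z + x) * f\<delta> x)" "\<bar>reg h z\<bar> \<le> B" "AE x in lborel. \<bar>h (z + x)\<bar> \<le> B"
proof -
  note [measurable] = hclass_measurable[OF h]
  show ae: "AE x in lborel. \<bar>h (z + x)\<bar> \<le> B" by (rule AE_shift_lborel[OF b]) measurable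
  show i: "integrable lborel (\<lambda>x. h (z + x) * f\<delta> x)"
  proof (rule Bochner_Integration.integrable_bound[where f="\<lambda>x. B * f\<delta> x"])
    show "integrable lborel (\<lambda>x. B * f\<delta> x)" using dens by simp
    show "AE x in lborel. norm (h (z + x) * f\<delta> x) \<le> norm (B * f\<delta> x)"
      using ae by eventually_elim (auto simp: abs_mult dens(2) intro!: mult_right_mono)
  qed measurable
  have "\<bar>reg h z\<bar> \<le> (LINT x|lborel. \<bar>h (z + x) * f\<delta> x\<bar>)"
    unfolding reg_eq[OF h] by (rule integral_abs_bound)
  also have "\<dots> \<le> (LINT x|lborel. B * f\<delta> x)"
  proof (rule integral_mono_AE)
    show "AE x in lborel. \<bar>h (z + x) * f\<delta> x\<bar> \<le> B * f\<delta> x"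
      using ae by eventually_elim (auto simp: abs_mult dens(2) intro!: mult_right_mono)
  qed (use i dens in auto)
  also have "\<dots> = B" using dens by simp
  finally show "\<bar>reg h z\<bar> \<le> B" .
qed

text \<open>As \<open>z\<close> may lie outside the cube, \<open>reg h\<close> is not given by one Fourier series. Near \<open>z\<close> only those
  error values \<open>x\<close> matter for which \<open>z + x\<close> is close to \<open>H\<close>; restricting the error density to them gives
  coefficients that are products of two square-summable sequences.\<close>

lemma local_expansion:
  "\<exists>r0>0. \<exists>C\<ge>0. \<forall>h z. hclass h \<longrightarrow> (\<exists>c. (\<forall>m. (\<Sum>k\<in>freq_box m. cmod (c k) * (1 + lnorm k) ^ L) \<le> C) \<and>
     (\<forall>y. norm (y - z) \<le> r0 \<longrightarrow> (\<lambda>m. \<Sum>k\<in>freq_box m. c k * fchar (- k) y) \<longlonglongrightarrow> complex_of_real (reg h y)))"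
proof -
  obtain e where e: "e > 0" "(\<Union>x\<in>H. ball x e) \<subseteq> open_cube"
    using compact_subset_open_imp_ball_epsilon_subset[OF H(1) _ H(2)] by (auto simp: open_cube_def open_box)
  \<comment> \<open>H is moved twice by at most r0, once in passing to the neighbourhood HK and once
    from z to y; 2 * r0 < e keeps everything inside the open cube.\<close>
  define r0 where "r0 = e / 4"
  have r0: "r0 > 0" using e by (simp add: r0_def)
  define HK where "HK = {u + v | u v. u \<in> H \<and> v \<in> cball 0 r0}"
  have "compact HK" unfolding HK_def by (rule compact_sums[OF H(1) compact_cball])
  then have [measurable]: "HK \<in> sets borel" by (simp add: borel_closed compact_imp_closed)
  obtain B2 where B2: "B2 \<ge> 0" "(\<integral>\<^sup>+x. ennreal ((f\<delta> x)\<^sup>2) \<partial>lborel) \<le> ennreal B2" using f\<delta>_square by blast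
  obtain Bh where Bh: "Bh \<ge> 0" "\<And>h m x. hclass h \<Longrightarrow> cmod (psum h m x) \<le> Bh" "\<And>h. hclass h \<Longrightarrow> AE x in lborel. \<bar>h x\<bar> \<le> Bh"
    using hclass_bounded by blast
  define V where "V = (2 * pi) ^ CARD('d)"
  have V: "V \<ge> 1" unfolding V_def by (rule two_pi_power_ge_1)
  define C where "C = 4 powr \<alpha> * C\<alpha> + V * B2"
  have i2: "integrable lborel (\<lambda>x. (f\<delta> x)\<^sup>2)"
    using B2(2) by (intro integrableI_nonneg) (auto intro: le_less_trans)
  have I2: "(LINT x|lborel. (f\<delta> x)\<^sup>2) \<le> B2"
    using B2 by (subst (asm) nn_integral_eq_integral[OF i2]) auto
  have main: "\<exists>c. (\<forall>m. (\<Sum>k\<in>freq_box m. cmod (c k) * (1 + lnorm k) ^ L) \<le> C) \<and>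
     (\<forall>y. norm (y - z) \<le> r0 \<longrightarrow> (\<lambda>m. \<Sum>k\<in>freq_box m. c k * fchar (- k) y) \<longlonglongrightarrow> complex_of_real (reg h y))"
    if h: "hclass h" for h z
  proof -
    note [measurable] = hclass_measurable[OF h]
    \<comment> \<open>The error density restricted to those x with z + x near H. The restriction
      depends on z alone, so one set of coefficients serves all y near z.\<close>
    define f where "f x = indicator HK (z + x) * f\<delta> x" for x
    have [measurable]: "f \<in> borel_measurable borel" unfolding f_def by measurable
    have f0: "0 \<le> f x" "f x \<le> f\<delta> x" for x using dens(2)[of x] by (auto simp: f_def indicator_def)
    have if1: "integrable lborel f"
      by (rule Bochner_Integration.integrable_bound[OF dens(1)]) (use f0 dens(2) in auto)
    have fsq: "(f x)\<^sup>2 \<le> (f\<delta> x)\<^sup>2" for x using f0 by (intro power_mono)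
    have if2: "integrable lborel (\<lambda>x. (f x)\<^sup>2)"
      by (rule Bochner_Integration.integrable_bound[OF i2]) (use fsq in auto)
    have If2: "(LINT x|lborel. (f x)\<^sup>2) \<le> B2"
      using integral_mono[OF if2 i2 fsq] I2 by linarith
    define b where "b k = (LINT x|lborel. complex_of_real (f x) * fchar (- k) x)" for k
    define c where "c k = ft h k / complex_of_real V * b k" for k
    have bess: "(\<Sum>k\<in>freq_box m. (cmod (b k))\<^sup>2) \<le> V * B2" for m
    proof -
      have "(\<Sum>k\<in>freq_box m. (cmod (b k))\<^sup>2) = (\<Sum>j\<in>uminus ` freq_box m. (cmod (LINT x|lborel. complex_of_real (f x) * fchar j x))\<^sup>2)"
        by (subst sum.reindex) (auto simp: b_def)
      also have "\<dots> \<le> V * (LINT x|lborel. (cmod (complex_of_real (f x)))\<^sup>2)"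
        unfolding V_def
      proof (rule fourier_bessel)
        show "integrable lborel (\<lambda>x. complex_of_real (f x))" using if1 by simp
        show "integrable lborel (\<lambda>x. (cmod (complex_of_real (f x)))\<^sup>2)" using if2 by simp
        show "complex_of_real (f x) = 0" if "x \<notin> cube" for x
          using f\<delta>_zero[of x] that H(2) open_cube_subset by (auto simp: f_def)
        show "finite (uminus ` freq_box m :: (int ^ 'd) set)" using finite_freq_box by blast
      qed
      also have "\<dots> \<le> V * B2" using If2 V by (intro mult_left_mono) auto
      finally show ?thesis .
    qed
    have cb: "(\<Sum>k\<in>freq_box m. cmod (c k) * (1 + lnorm k) ^ L) \<le> C" for m
    proof -
      have "(\<Sum>k\<in>freq_box m. cmod (c k) * (1 + lnorm k) ^ L) \<le> (\<Sum>k\<in>freq_box m. (cmod (ft h k) * (1 + lnorm k) ^ L)\<^sup>2 + (cmod (b k))\<^sup>2)"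
      proof (rule sum_mono)
        fix k :: "int ^ 'd"
        define a where "a = cmod (ft h k) * (1 + lnorm k) ^ L"
        have a: "a \<ge> 0" by (simp add: a_def)
        have "cmod (c k) * (1 + lnorm k) ^ L = a * cmod (b k) / V"
          using V by (simp add: c_def a_def norm_mult norm_divide)
        also have "\<dots> \<le> a * cmod (b k)" using a unfolding V_def by (intro divide_two_pi_le) auto
        \<comment> \<open>The coefficients of h with the weight of order L are square-summable by
          the Sobolev condition, those of f by Bessel's inequality; hence the products are
          summable.\<close>
        also have "\<dots> \<le> a\<^sup>2 + (cmod (b k))\<^sup>2"
        proof -
          have "2 * (a * cmod (b k)) \<le> a\<^sup>2 + (cmod (b k))\<^sup>2" using sum_squares_bound[of a "cmod (b k)"] by (simp add: mult.assoc)
          moreover have "0 \<le> a * cmod (b k)" using a by simp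
          ultimately show ?thesis by linarith
        qed
        finally show "cmod (c k) * (1 + lnorm k) ^ L \<le> (cmod (ft h k) * (1 + lnorm k) ^ L)\<^sup>2 + (cmod (b k))\<^sup>2"
          unfolding a_def .
      qed
      also have "\<dots> \<le> C"
        unfolding sum.distrib C_def by (intro add_mono weighted_sum_bound h finite_freq_box bess)
      finally show ?thesis .
    qed
    have lim: "(\<lambda>m. \<Sum>k\<in>freq_box m. c k * fchar (- k) y) \<longlonglongrightarrow> complex_of_real (reg h y)"
      if y: "norm (y - z) \<le> r0" for y
    proof -
      \<comment> \<open>Where the restricted density is nonzero, the argument of h lies in the cube,
        so the Fourier series of h represents it there.\<close>
      have shift_in: "y + x \<in> open_cube" if "z + x \<in> HK" for x
      proof -
        obtain u v where uv: "z + x = u + v" "u \<in> H" "norm v \<le> r0" using \<open>z + x \<in> HK\<close> by (auto simp: HK_def)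
        have "u - (y + x) = - (v + (y - z))" using uv(1) by (simp add: algebra_simps)
        then have "dist u (y + x) = norm (v + (y - z))" by (simp only: dist_norm norm_minus_cancel)
        also have "\<dots> \<le> r0 + r0" using uv(3) y by (rule norm_triangle_mono)
        also have "\<dots> < e" using e by (simp add: r0_def)
        finally have "y + x \<in> ball u e" by simp
        then show ?thesis using e(2) uv(2) by blast
      qed
      \<comment> \<open>Where the density has been cut away, h vanishes, so the restriction does not
        change the regression function near z.\<close>
      have shift_out: "h (y + x) = 0" if "z + x \<notin> HK" for x
      proof (rule ccontr)
        assume "h (y + x) \<noteq> 0"
        then have "y + x \<in> H" using hclass_zero[OF h] by blast
        moreover have "z + x = (y + x) + (z - y)" by simp
        moreover have "z - y \<in> cball 0 r0" using y by (simp add: norm_minus_commute)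
        ultimately have "z + x \<in> HK" unfolding HK_def by blast
        then show False using that by simp
      qed
      define D where "D m = (LINT x|lborel. complex_of_real (f x) * (psum h m (y + x) - complex_of_real (h (y + x))))" for m
      have ip: "integrable lborel (\<lambda>x. complex_of_real (f x) * psum h m (y + x))" for m
      proof (rule Bochner_Integration.integrable_bound[where f="\<lambda>x. Bh * f x"])
        show "integrable lborel (\<lambda>x. Bh * f x)" using if1 by simp
        show "AE x in lborel. cmod (complex_of_real (f x) * psum h m (y + x)) \<le> norm (Bh * f x)"
        proof (rule AE_I2)
          fix x
          have "cmod (psum h m (y + x)) * f x \<le> Bh * f x" by (rule mult_right_mono[OF Bh(2)[OF h] f0(1)])
          then show "cmod (complex_of_real (f x) * psum h m (y + x)) \<le> norm (Bh * f x)"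
            using f0(1)[of x] Bh(1) by (simp add: norm_mult mult.commute)
        qed
      qed measurable
      have ih: "integrable lborel (\<lambda>x. complex_of_real (f x) * complex_of_real (h (y + x)))"
      proof (rule Bochner_Integration.integrable_bound[where f="\<lambda>x. h (y + x) * f\<delta> x"])
        show "integrable lborel (\<lambda>x. h (y + x) * f\<delta> x)" by (rule reg_integrable(1)[OF h Bh(3)[OF h]])
        show "AE x in lborel. cmod (complex_of_real (f x) * complex_of_real (h (y + x))) \<le> norm (h (y + x) * f\<delta> x)"
          using f0 dens(2) by (intro AE_I2) (auto simp: norm_mult abs_mult mult.commute intro!: mult_right_mono)
      qed measurable
      have "(\<Sum>k\<in>freq_box m. c k * fchar (- k) y) - complex_of_real (reg h y) = D m" for m
      proof -
        have "(LINT x|lborel. complex_of_real (f x) * psum h m (y + x)) = (LINT x|lborel. (\<Sum>k\<in>freq_box m. (ft h k / complex_of_real V * fchar (- k) y) * (complex_of_real (f x) * fchar (- k) x)))"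
          unfolding psum_def V_def fchar_shift sum_divide_distrib sum_distrib_left
          by (intro Bochner_Integration.integral_cong sum.cong refl) simp
        also have "\<dots> = (\<Sum>k\<in>freq_box m. (ft h k / complex_of_real V * fchar (- k) y) * b k)"
        proof -
          have i: "integrable lborel (\<lambda>x. complex_of_real (f x) * fchar k x)" for k
            by (rule Bochner_Integration.integrable_bound[OF if1]) (auto simp: norm_mult)
          show ?thesis unfolding b_def
            by (subst Bochner_Integration.integral_sum, intro integrable_mult_right i, simp only: integral_mult_right_zero)
        qed
        also have "\<dots> = (\<Sum>k\<in>freq_box m. c k * fchar (- k) y)" by (simp add: c_def mult_ac)
        finally have 1: "(LINT x|lborel. complex_of_real (f x) * psum h m (y + x)) = (\<Sum>k\<in>freq_box m. c k * fchar (- k) y)" .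
        have "(LINT x|lborel. complex_of_real (f x) * complex_of_real (h (y + x))) = (LINT x|lborel. complex_of_real (h (y + x) * f\<delta> x))"
        proof (intro Bochner_Integration.integral_cong refl)
          fix x show "complex_of_real (f x) * complex_of_real (h (y + x)) = complex_of_real (h (y + x) * f\<delta> x)"
            using shift_out[of x] by (cases "z + x \<in> HK") (auto simp: f_def)
        qed
        also have "\<dots> = complex_of_real (reg h y)" unfolding reg_eq[OF h] by (rule integral_complex_of_real)
        finally have 2: "(LINT x|lborel. complex_of_real (f x) * complex_of_real (h (y + x))) = complex_of_real (reg h y)" .
        show ?thesis unfolding D_def right_diff_distrib 1[symmetric] 2[symmetric]
          by (rule Bochner_Integration.integral_diff[OF ip ih, symmetric])
      qed
      note Deq = this
      have iD: "integrable lborel (\<lambda>x. complex_of_real (f x) * (psum h m (y + x) - complex_of_real (h (y + x))))" for m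
        unfolding right_diff_distrib by (rule Bochner_Integration.integrable_diff[OF ip ih])
      \<comment> \<open>Cauchy-Schwarz: the L2 norm of f against the L2 error of the partial sum
        over the cube. This yields convergence at every y, although the series of h is only
        controlled in L2.\<close>
      have Dsq: "(cmod (D m))\<^sup>2 \<le> B2 * (C\<alpha> * real (Suc m) powr (- 2 * \<alpha>))" for m
      proof -
        define g where "g x = ennreal (cmod (psum h m (y + x) - complex_of_real (h (y + x)))) * indicator cube (y + x)" for x
        have [measurable]: "g \<in> borel_measurable borel" unfolding g_def by measurable
        have "ennreal (cmod (D m)) \<le> (\<integral>\<^sup>+x. ennreal (cmod (complex_of_real (f x) * (psum h m (y + x) - complex_of_real (h (y + x))))) \<partial>lborel)"
          unfolding D_def by (rule integral_norm_bound_ennreal[OF iD])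
        also have "\<dots> \<le> (\<integral>\<^sup>+x. ennreal (f x) * g x \<partial>lborel)"
        proof (rule nn_integral_mono)
          fix x
          show "ennreal (cmod (complex_of_real (f x) * (psum h m (y + x) - complex_of_real (h (y + x))))) \<le> ennreal (f x) * g x"
          proof (cases "z + x \<in> HK")
            case True
            then have "y + x \<in> cube" using shift_in open_cube_subset by blast
            then show ?thesis using f0(1)[of x] by (simp add: g_def norm_mult ennreal_mult)
          qed (simp add: f_def)
        qed
        finally have "ennreal (cmod (D m)) \<le> (\<integral>\<^sup>+x. ennreal (f x) * g x \<partial>lborel)" .
        then have "(ennreal (cmod (D m)))\<^sup>2 \<le> (\<integral>\<^sup>+x. ennreal (f x) * g x \<partial>lborel)\<^sup>2" by (intro power_mono) auto
        also have "\<dots> \<le> (\<integral>\<^sup>+x. (ennreal (f x))\<^sup>2 \<partial>lborel) * (\<integral>\<^sup>+x. (g x)\<^sup>2 \<partial>lborel)"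
          by (rule Cauchy_Schwarz_nn_integral) auto
        also have "(\<integral>\<^sup>+x. (ennreal (f x))\<^sup>2 \<partial>lborel) \<le> ennreal B2"
        proof -
          have "(\<integral>\<^sup>+x. (ennreal (f x))\<^sup>2 \<partial>lborel) = (\<integral>\<^sup>+x. ennreal ((f x)\<^sup>2) \<partial>lborel)" using f0(1) by (simp add: ennreal_power)
          also have "\<dots> = ennreal (LINT x|lborel. (f x)\<^sup>2)" by (rule nn_integral_eq_integral[OF if2]) simp
          also have "\<dots> \<le> ennreal B2" by (rule ennreal_leI[OF If2])
          finally show ?thesis .
        qed
        also have "(\<integral>\<^sup>+x. (g x)\<^sup>2 \<partial>lborel) \<le> ennreal (C\<alpha> * real (Suc m) powr (- 2 * \<alpha>))"
        proof -
          have "(\<integral>\<^sup>+x. (g x)\<^sup>2 \<partial>lborel) = (\<integral>\<^sup>+x. ennreal ((cmod (psum h m (y + x) - complex_of_real (h (y + x))))\<^sup>2) * indicator cube (y + x) \<partial>lborel)"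
            by (intro nn_integral_cong) (auto simp: g_def ennreal_power indicator_def)
          also have "\<dots> = (\<integral>\<^sup>+x\<in>cube. ennreal ((cmod (psum h m x - complex_of_real (h x)))\<^sup>2) \<partial>lborel)"
            by (rule nn_integral_shift_lborel[of "\<lambda>x. ennreal ((cmod (psum h m x - complex_of_real (h x)))\<^sup>2) * indicator cube x"]) measurable
          also have "\<dots> \<le> ennreal (C\<alpha> * real (Suc m) powr (- 2 * \<alpha>))" by (rule psum_error[OF h])
          finally show ?thesis .
        qed
        finally have "(ennreal (cmod (D m)))\<^sup>2 \<le> ennreal B2 * ennreal (C\<alpha> * real (Suc m) powr (- 2 * \<alpha>))"
          by (simp add: mult_mono)
        also have "\<dots> = ennreal (B2 * (C\<alpha> * real (Suc m) powr (- 2 * \<alpha>)))"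
          using B2(1) \<alpha>(4) by (intro ennreal_mult[symmetric]) auto
        finally have "ennreal ((cmod (D m))\<^sup>2) \<le> ennreal (B2 * (C\<alpha> * real (Suc m) powr (- 2 * \<alpha>)))" by (simp add: ennreal_power)
        then show ?thesis using B2(1) \<alpha>(4) by (subst (asm) ennreal_le_iff) auto
      qed
      have "(\<lambda>m. (cmod (D m))\<^sup>2) \<longlonglongrightarrow> 0"
      proof (rule tendsto_sandwich[OF _ _ tendsto_const])
        show "(\<lambda>m. B2 * C\<alpha> * real (Suc m) powr (- 2 * \<alpha>)) \<longlonglongrightarrow> 0" by (rule tail_tendsto_0)
        show "eventually (\<lambda>m. (cmod (D m))\<^sup>2 \<le> B2 * C\<alpha> * real (Suc m) powr (- 2 * \<alpha>)) sequentially"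
          using Dsq by (intro always_eventually allI) (simp only: mult.assoc)
      qed simp
      then have "(\<lambda>m. sqrt ((cmod (D m))\<^sup>2)) \<longlonglongrightarrow> sqrt 0" by (rule tendsto_real_sqrt)
      then have "(\<lambda>m. cmod (D m)) \<longlonglongrightarrow> 0" by simp
      then have "D \<longlonglongrightarrow> 0" by (rule tendsto_norm_zero_cancel)
      then have "(\<lambda>m. (\<Sum>k\<in>freq_box m. c k * fchar (- k) y) - complex_of_real (reg h y)) \<longlonglongrightarrow> 0" unfolding Deq .
      then show ?thesis by (rule LIM_zero_cancel)
    qed
    show ?thesis using cb lim by (intro exI[of _ c]) blast
  qed
  have C: "C \<ge> 0" using B2 V \<alpha>(4) by (simp add: C_def)
  show ?thesis by (intro exI[of _ r0] conjI r0 exI[of _ C] C allI impI main)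
qed

text \<open>In the local expansion the product of g and the character is a series of characters,
  each reproduced up to a remainder of order R^L. Only radii below r0 are covered by the expansion;
  for larger ones the boundedness of g suffices.\<close>

lemma local_bias:
  "\<exists>C\<ge>0. \<forall>h z J wt w R j. hclass h \<longrightarrow> finite J \<longrightarrow>
     (\<forall>\<kappa>\<in>multi_indices L. (\<Sum>i\<in>J. wt i * xi z (w i) \<kappa>) = (if \<kappa> = 0 then 1 else 0)) \<longrightarrow>
     (\<forall>i\<in>J. norm (w i - z) \<le> R) \<longrightarrow>
     cmod ((\<Sum>i\<in>J. complex_of_real (wt i) * (complex_of_real (reg h (w i)) * fchar j (w i))) - complex_of_real (reg h z) * fchar j z)
       \<le> C * (1 + lnorm j) ^ L * (R ^ L * (\<Sum>i\<in>(J :: nat set). \<bar>wt i\<bar>))"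
proof -
  obtain r0 C where r0: "r0 > 0" and C: "C \<ge> 0" and ex: "\<And>h z. hclass h \<Longrightarrow> \<exists>c. (\<forall>m. (\<Sum>k\<in>freq_box m. cmod (c k) * (1 + lnorm k) ^ L) \<le> C) \<and>
     (\<forall>y. norm (y - z) \<le> r0 \<longrightarrow> (\<lambda>m. \<Sum>k\<in>freq_box m. c k * fchar (- k) y) \<longlonglongrightarrow> complex_of_real (reg h y))"
    using local_expansion by blast
  obtain Bh where Bh: "Bh \<ge> 0" "\<And>h. hclass h \<Longrightarrow> AE x in lborel. \<bar>h x\<bar> \<le> Bh"
    using hclass_bounded by blast
  \<comment> \<open>The second summand covers R > r0: the trivial bound 2 * Bh is at most this
    constant times R^L.\<close>
  define C' where "C' = C + 2 * Bh / r0 ^ L"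
  have C': "C' \<ge> 0" "C \<le> C'" "2 * Bh / r0 ^ L \<le> C'" using C Bh r0 by (auto simp: C'_def)
  have main: "cmod ((\<Sum>i\<in>J. complex_of_real (wt i) * (complex_of_real (reg h (w i)) * fchar j (w i))) - complex_of_real (reg h z) * fchar j z)
       \<le> C' * (1 + lnorm j) ^ L * (R ^ L * (\<Sum>i\<in>J. \<bar>wt i\<bar>))"
    if h: "hclass h" and J: "finite J" and rep: "\<And>\<kappa>. \<kappa> \<in> multi_indices L \<Longrightarrow> (\<Sum>i\<in>J. wt i * xi z (w i) \<kappa>) = (if \<kappa> = 0 then 1 else 0)"
      and R: "\<And>i. i \<in> J \<Longrightarrow> norm (w i - z) \<le> R" for h z and J :: "nat set" and wt w R j
  proof -
    let ?W = "\<Sum>i\<in>J. \<bar>wt i\<bar>"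
    have "(0 :: nat ^ 'd) \<in> multi_indices L" by (simp add: multi_indices_def)
    from rep[OF this] have s1: "(\<Sum>i\<in>J. wt i) = 1" by (simp add: xi_def)
    then have J0: "J \<noteq> {}" by auto
    then have Rn: "R \<ge> 0" using R norm_ge_zero by (meson all_not_in_conv order_trans)
    have W1: "?W \<ge> 1" using sum_abs[of wt J] s1 by simp
    have lj: "(1 + lnorm j) ^ L \<ge> 1" using lnorm_nonneg[of j] by (intro one_le_power) linarith
    show ?thesis
    proof (cases "R \<le> r0")
      case True
      obtain c where c: "\<And>m. (\<Sum>k\<in>freq_box m. cmod (c k) * (1 + lnorm k) ^ L) \<le> C"
        "\<And>y. norm (y - z) \<le> r0 \<Longrightarrow> (\<lambda>m. \<Sum>k\<in>freq_box m. c k * fchar (- k) y) \<longlonglongrightarrow> complex_of_real (reg h y)"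
        using ex[OF h, of z] by blast
      define S where "S m y = (\<Sum>k\<in>freq_box m. c k * fchar (- k) y)" for m y
      have lim: "(\<lambda>m. (\<Sum>i\<in>J. complex_of_real (wt i) * (S m (w i) * fchar j (w i))) - S m z * fchar j z) \<longlonglongrightarrow>
        (\<Sum>i\<in>J. complex_of_real (wt i) * (complex_of_real (reg h (w i)) * fchar j (w i))) - complex_of_real (reg h z) * fchar j z"
        unfolding S_def using R True r0
        by (intro tendsto_diff tendsto_sum tendsto_mult_left tendsto_mult_right c(2)) (auto intro: order_trans)
      have bd: "cmod ((\<Sum>i\<in>J. complex_of_real (wt i) * (S m (w i) * fchar j (w i))) - S m z * fchar j z) \<le> C * (1 + lnorm j) ^ L * (R ^ L * ?W)" for m
      proof -
        have "(\<Sum>i\<in>J. complex_of_real (wt i) * (S m (w i) * fchar j (w i))) - S m z * fchar j z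
          = (\<Sum>k\<in>freq_box m. c k * ((\<Sum>i\<in>J. complex_of_real (wt i) * fchar (- k + j) (w i)) - fchar (- k + j) z))"
        proof -
          have "(\<Sum>i\<in>J. complex_of_real (wt i) * (S m (w i) * fchar j (w i))) = (\<Sum>k\<in>freq_box m. c k * (\<Sum>i\<in>J. complex_of_real (wt i) * fchar (- k + j) (w i)))"
            unfolding S_def fchar_add sum_distrib_left sum_distrib_right by (subst sum.swap) (simp add: mult_ac)
          moreover have "S m z * fchar j z = (\<Sum>k\<in>freq_box m. c k * fchar (- k + j) z)"
            unfolding S_def fchar_add sum_distrib_right by (simp add: mult_ac)
          ultimately show ?thesis by (simp only: right_diff_distrib sum_subtractf)
        qed
        also have "cmod \<dots> \<le> (\<Sum>k\<in>freq_box m. (cmod (c k) * (1 + lnorm k) ^ L) * ((1 + lnorm j) ^ L * (R ^ L * ?W)))"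
        proof (rule order_trans[OF norm_sum], rule sum_mono)
          fix k :: "int ^ 'd"
          \<comment> \<open>The product bound (1 + |k|) (1 + |j|) separates the frequency k, which
            is summed against the coefficients of g, from the frequency j, which stays in the
            estimate.\<close>
          have "lnorm (- k + j) \<le> lnorm k + lnorm j"
          proof -
            have "(\<chi> i. real_of_int ((- k + j) $ i)) = - (\<chi> i. real_of_int (k $ i)) + ((\<chi> i. real_of_int (j $ i)) :: real ^ 'd)"
              by (simp add: vec_eq_iff)
            then show ?thesis unfolding lnorm_def by (metis norm_minus_cancel norm_triangle_ineq)
          qed
          also have "\<dots> \<le> (1 + lnorm k) * (1 + lnorm j)"
          proof -
            have "0 \<le> lnorm k * lnorm j" by simp
            moreover have "(1 + lnorm k) * (1 + lnorm j) = 1 + lnorm k + lnorm j + lnorm k * lnorm j" by (simp add: algebra_simps)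
            ultimately show ?thesis by linarith
          qed
          finally have "(lnorm (- k + j) * R) ^ L \<le> ((1 + lnorm k) * (1 + lnorm j) * R) ^ L"
            using Rn by (intro power_mono mult_right_mono) auto
          then have "cmod ((\<Sum>i\<in>J. complex_of_real (wt i) * fchar (- k + j) (w i)) - fchar (- k + j) z) \<le> ((1 + lnorm k) * (1 + lnorm j) * R) ^ L * ?W"
            using fchar_reproduce[OF rep \<alpha>(3) R, of "- k + j"] W1 by (meson mult_right_mono order_trans zero_le_one)
          then have "cmod (c k) * cmod ((\<Sum>i\<in>J. complex_of_real (wt i) * fchar (- k + j) (w i)) - fchar (- k + j) z) \<le> cmod (c k) * (((1 + lnorm k) * (1 + lnorm j) * R) ^ L * ?W)"
            by (intro mult_left_mono) auto
          then show "cmod (c k * ((\<Sum>i\<in>J. complex_of_real (wt i) * fchar (- k + j) (w i)) - fchar (- k + j) z))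
             \<le> (cmod (c k) * (1 + lnorm k) ^ L) * ((1 + lnorm j) ^ L * (R ^ L * ?W))"
            by (simp only: norm_mult power_mult_distrib mult_ac)
        qed
        also have "\<dots> = (\<Sum>k\<in>freq_box m. cmod (c k) * (1 + lnorm k) ^ L) * ((1 + lnorm j) ^ L * (R ^ L * ?W))"
          by (rule sum_distrib_right[symmetric])
        also have "\<dots> \<le> C * ((1 + lnorm j) ^ L * (R ^ L * ?W))"
          using Rn W1 lj by (intro mult_right_mono c(1)) auto
        finally show ?thesis by (simp only: mult.assoc)
      qed
      have "cmod ((\<Sum>i\<in>J. complex_of_real (wt i) * (complex_of_real (reg h (w i)) * fchar j (w i))) - complex_of_real (reg h z) * fchar j z)
        \<le> C * (1 + lnorm j) ^ L * (R ^ L * ?W)"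
        by (rule LIMSEQ_le_const2[OF tendsto_norm[OF lim]]) (use bd in blast)
      also have "\<dots> \<le> C' * (1 + lnorm j) ^ L * (R ^ L * ?W)"
        using C' Rn W1 lj by (intro mult_right_mono) auto
      finally show ?thesis .
    next
      case False
      have gb: "\<bar>reg h y\<bar> \<le> Bh" for y by (rule reg_integrable(2)[OF h Bh(2)[OF h]])
      have "cmod (\<Sum>i\<in>J. complex_of_real (wt i) * (complex_of_real (reg h (w i)) * fchar j (w i))) \<le> (\<Sum>i\<in>J. \<bar>wt i\<bar> * Bh)"
        by (rule order_trans[OF norm_sum], rule sum_mono) (simp add: norm_mult gb mult_left_mono)
      also have "\<dots> = ?W * Bh" by (rule sum_distrib_right[symmetric])
      finally have 1: "cmod (\<Sum>i\<in>J. complex_of_real (wt i) * (complex_of_real (reg h (w i)) * fchar j (w i))) \<le> ?W * Bh" .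
      have "cmod (complex_of_real (reg h z) * fchar j z) \<le> 1 * Bh" using gb[of z] by (simp add: norm_mult)
      also have "\<dots> \<le> ?W * Bh" using W1 Bh(1) by (intro mult_right_mono) auto
      finally have 2: "cmod (complex_of_real (reg h z) * fchar j z) \<le> ?W * Bh" .
      have "cmod ((\<Sum>i\<in>J. complex_of_real (wt i) * (complex_of_real (reg h (w i)) * fchar j (w i))) - complex_of_real (reg h z) * fchar j z) \<le> ?W * Bh + ?W * Bh"
        by (rule order_trans[OF norm_triangle_ineq4 add_mono[OF 1 2]])
      also have "\<dots> = 2 * Bh * (1 * (1 * ?W))" by simp
      also have "2 * Bh = 2 * Bh / r0 ^ L * r0 ^ L" using r0 by simp
      also have "2 * Bh / r0 ^ L * r0 ^ L * (1 * (1 * ?W)) \<le> C' * R ^ L * ((1 + lnorm j) ^ L * (1 * ?W))"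
        using C' lj W1 False r0 Rn by (intro mult_mono power_mono mult_right_mono mult_nonneg_nonneg) auto
      also have "\<dots> = C' * (1 + lnorm j) ^ L * (R ^ L * ?W)" by simp
      finally show ?thesis .
    qed
  qed
  show ?thesis using main C'(1) by (intro exI[of _ C'] conjI allI impI) auto
qed

text \<open>Fubini, with j.z written as j.y - j.(y - z). The reflected density in \<open>reg\<close>
  is what produces the frequency -j, the one by which the estimator divides.\<close>

lemma integral_reg_fchar:
  assumes h: "hclass h"
  shows "(LINT z|lborel. complex_of_real (reg h z) * fchar j z) = ft h j * ft f\<delta> (- j)"
proof -
  note [measurable] = hclass_measurable[OF h]
  have ih: "integrable lborel h" using h by (simp add: hclass_def)
  define G where "G y z = complex_of_real (h y * f\<delta> (y - z)) * fchar j z" for y z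
  have inner: "G y z = complex_of_real (h y) * fchar j y * (complex_of_real (f\<delta> (y - z)) * fchar (- j) (y - z))" for y z
  proof -
    have "fchar j y * fchar (- j) (y - z) = fchar j (z + (y - z)) * fchar (- j) (y - z)" by simp
    also have "\<dots> = fchar j z * fchar (j + - j) (y - z)" unfolding fchar_shift fchar_add by simp
    finally show ?thesis by (simp add: G_def)
  qed
  have Gm: "(\<lambda>(y, z). G y z) \<in> borel_measurable (lborel \<Otimes>\<^sub>M lborel)" unfolding G_def by measurable
  have fr: "integrable lborel (\<lambda>x. complex_of_real (f\<delta> x) * fchar (- j) x)"
    by (rule Bochner_Integration.integrable_bound[OF dens(1)]) (auto simp: norm_mult)
  have ii: "integrable lborel (\<lambda>z. G y z)" for y
    unfolding inner by (intro integrable_mult_right) (subst integral_reflect_lborel(2), auto simp: fr)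
  have nI: "(LINT z|lborel. norm (G y z)) = \<bar>h y\<bar>" for y
  proof -
    have "(LINT z|lborel. norm (G y z)) = (LINT z|lborel. \<bar>h y\<bar> * f\<delta> (y - z))"
      by (simp add: G_def norm_mult abs_mult dens(2))
    also have "\<dots> = \<bar>h y\<bar> * (LINT z|lborel. f\<delta> (y - z))" by (rule integral_mult_right_zero)
    also have "(LINT z|lborel. f\<delta> (y - z)) = 1" by (subst integral_reflect_lborel(1)) (auto simp: dens(3))
    finally show ?thesis by simp
  qed
  have pair: "integrable (lborel \<Otimes>\<^sub>M lborel) (\<lambda>(y, z). G y z)"
    by (rule lborel_pair.Fubini_integrable[OF Gm]) (use ii nI ih in \<open>auto simp: case_prod_beta\<close>)
  have "(LINT z|lborel. complex_of_real (reg h z) * fchar j z) = (LINT z|lborel. LINT y|lborel. G y z)"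
  proof (intro Bochner_Integration.integral_cong refl)
    fix z
    have "complex_of_real (reg h z) = (LINT y|lborel. complex_of_real (h y * f\<delta> (y - z)))"
      unfolding reg_def conv_def by (subst integral_complex_of_real) simp
    then show "complex_of_real (reg h z) * fchar j z = (LINT y|lborel. G y z)"
      unfolding G_def by (simp only: integral_mult_left_zero)
  qed
  also have "\<dots> = (LINT y|lborel. LINT z|lborel. G y z)" by (rule lborel_pair.Fubini_integral[OF pair])
  also have "\<dots> = (LINT y|lborel. complex_of_real (h y) * fchar j y * ft f\<delta> (- j))"
  proof (intro Bochner_Integration.integral_cong refl)
    fix y
    have "(LINT z|lborel. G y z) = complex_of_real (h y) * fchar j y * (LINT z|lborel. complex_of_real (f\<delta> (y - z)) * fchar (- j) (y - z))"
      unfolding inner by (rule integral_mult_right_zero)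
    also have "(LINT z|lborel. complex_of_real (f\<delta> (y - z)) * fchar (- j) (y - z)) = ft f\<delta> (- j)"
      unfolding ft_def using integral_reflect_lborel(1)[of "\<lambda>x. complex_of_real (f\<delta> x) * fchar (- j) x" y] by simp
    finally show "(LINT z|lborel. G y z) = complex_of_real (h y) * fchar j y * ft f\<delta> (- j)" .
  qed
  also have "\<dots> = ft h j * ft f\<delta> (- j)" unfolding ft_def[of h] by (rule integral_mult_left_zero)
  finally show ?thesis .
qed

end

section \<open>The observation noise\<close>

text \<open>Only pairs are extracted from the mutual independence: the conditional mean uses (Z,
  \<delta>) for the signal and (Z, \<epsilon>) for the error.\<close>

lemma (in prob_space) joint_distr_of_indep_sets:
  fixes X :: "'a \<Rightarrow> 'b::{second_countable_topology}" and Y :: "'a \<Rightarrow> 'c::{second_countable_topology}"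
  assumes ind: "indep_sets F I" and ik: "i \<in> I" "k \<in> I" "i \<noteq> k"
    and F: "F i = sets (vimage_algebra (space M) X borel)" "F k = sets (vimage_algebra (space M) Y borel)"
    and X: "X \<in> borel_measurable M" and Y: "Y \<in> borel_measurable M"
  shows "distr M borel X \<Otimes>\<^sub>M distr M borel Y = distr M (borel \<Otimes>\<^sub>M borel) (\<lambda>\<omega>. (X \<omega>, Y \<omega>))"
proof -
  have pr: "prob (a \<inter> b) = prob a * prob b" if "a \<in> F i" "b \<in> F k" for a b
  proof -
    have "prob (\<Inter>j\<in>{i, k}. if j = i then a else b) = (\<Prod>j\<in>{i, k}. prob (if j = i then a else b))"
      using that ik by (intro indep_setsD[OF ind]) auto
    then show ?thesis using ik by (simp add: Int_commute)
  qed
  note [measurable] = X Y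
  interpret X: prob_space "distr M borel X" by (rule prob_space_distr) simp
  interpret Y: prob_space "distr M borel Y" by (rule prob_space_distr) simp
  show ?thesis
  proof (rule pair_measure_eqI)
    show "sigma_finite_measure (distr M borel X)" "sigma_finite_measure (distr M borel Y)" by unfold_locales
    show "sets (distr M borel X \<Otimes>\<^sub>M distr M borel Y) = sets (distr M (borel \<Otimes>\<^sub>M borel) (\<lambda>\<omega>. (X \<omega>, Y \<omega>)))"
      by simp
    fix A B assume "A \<in> sets (distr M borel X)" "B \<in> sets (distr M borel Y)"
    then have AB [measurable]: "A \<in> sets borel" "B \<in> sets borel" by auto
    have "X -` A \<inter> space M \<in> F i" "Y -` B \<inter> space M \<in> F k"
      unfolding F using AB by (auto intro!: in_vimage_algebra)
    then have e: "prob ((X -` A \<inter> space M) \<inter> (Y -` B \<inter> space M)) = prob (X -` A \<inter> space M) * prob (Y -` B \<inter> space M)"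
      by (rule pr)
    have s: "(X -` A \<inter> space M) \<inter> (Y -` B \<inter> space M) = (\<lambda>\<omega>. (X \<omega>, Y \<omega>)) -` (A \<times> B) \<inter> space M" by auto
    show "emeasure (distr M borel X) A * emeasure (distr M borel Y) B = emeasure (distr M (borel \<Otimes>\<^sub>M borel) (\<lambda>\<omega>. (X \<omega>, Y \<omega>))) (A \<times> B)"
      using e unfolding s by (simp add: emeasure_distr emeasure_eq_measure ennreal_mult[symmetric])
  qed
qed

definition obs_law :: "'a measure \<Rightarrow> ('a \<Rightarrow> real ^ 'd) \<Rightarrow> ('a \<Rightarrow> real ^ 'd) \<Rightarrow> ('a \<Rightarrow> real)
    \<Rightarrow> (real ^ 'd \<Rightarrow> real) \<Rightarrow> (real \<times> (real ^ 'd)) measure" where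
  "obs_law M Z \<delta> \<epsilon> h = distr M borel (\<lambda>\<omega>. (h (Z \<omega> + \<delta> \<omega>) + \<epsilon> \<omega>, Z \<omega>))"

context berkson_fourier
begin

lemma reg_measurable:
  assumes "hclass h"
  shows "reg h \<in> borel_measurable borel"
proof -
  note [measurable] = hclass_measurable[OF assms]
  have "(\<lambda>z. LINT y|lborel. h y * f\<delta> (- (z - y))) \<in> borel_measurable borel" by measurable
  then show ?thesis unfolding reg_def conv_def by simp
qed

context
  fixes M :: "'a measure" and Z \<delta> :: "'a \<Rightarrow> real ^ 'd" and \<epsilon> :: "'a \<Rightarrow> real" and fZ :: "real ^ 'd \<Rightarrow> real"
  assumes model: "berkson_errors M Z \<delta> \<epsilon> fZ f\<delta>"
begin

interpretation prob_space M using model by (simp add: berkson_errors_def)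

lemma model_measurable [measurable]:
  "Z \<in> borel_measurable M" "\<delta> \<in> borel_measurable M" "\<epsilon> \<in> borel_measurable M"
  using model by (auto simp: berkson_errors_def distributed_def)

lemma distr_Z: "distr M borel Z = density lborel (\<lambda>x. ennreal (fZ x))"
proof -
  have "distr M borel Z = distr M lborel Z" by (rule distr_cong) auto
  then show ?thesis using model by (simp add: berkson_errors_def distributed_def)
qed

lemma distr_\<delta>: "distr M borel \<delta> = density lborel (\<lambda>x. ennreal (f\<delta> x))"
proof -
  have "distr M borel \<delta> = distr M lborel \<delta>" by (rule distr_cong) auto
  then show ?thesis using model by (simp add: berkson_errors_def distributed_def)
qed

lemma joint_Z\<delta>: "distr M borel Z \<Otimes>\<^sub>M distr M borel \<delta> = distr M (borel \<Otimes>\<^sub>M borel) (\<lambda>\<omega>. (Z \<omega>, \<delta> \<omega>))"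
  and joint_Z\<epsilon>: "distr M borel Z \<Otimes>\<^sub>M distr M borel \<epsilon> = distr M (borel \<Otimes>\<^sub>M borel) (\<lambda>\<omega>. (Z \<omega>, \<epsilon> \<omega>))"
proof -
  have ind: "indep_sets (\<lambda>i. [sets (vimage_algebra (space M) Z borel),
             sets (vimage_algebra (space M) \<delta> borel),
             sets (vimage_algebra (space M) \<epsilon> borel)] ! i) {..<3}"
    using model by (simp add: berkson_errors_def)
  show "distr M borel Z \<Otimes>\<^sub>M distr M borel \<delta> = distr M (borel \<Otimes>\<^sub>M borel) (\<lambda>\<omega>. (Z \<omega>, \<delta> \<omega>))"
    by (rule joint_distr_of_indep_sets[OF ind, of 0 1]) auto
  show "distr M borel Z \<Otimes>\<^sub>M distr M borel \<epsilon> = distr M (borel \<Otimes>\<^sub>M borel) (\<lambda>\<omega>. (Z \<omega>, \<epsilon> \<omega>))"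
    by (rule joint_distr_of_indep_sets[OF ind, of 0 2]) auto
qed

lemma nn_integral_joint:
  fixes X :: "'a \<Rightarrow> 'c::{second_countable_topology}" and F :: "(real ^ 'd) \<times> 'c \<Rightarrow> ennreal"
  assumes j: "distr M borel Z \<Otimes>\<^sub>M distr M borel X = distr M (borel \<Otimes>\<^sub>M borel) (\<lambda>\<omega>. (Z \<omega>, X \<omega>))"
    and [measurable]: "X \<in> borel_measurable M" "F \<in> borel_measurable (borel \<Otimes>\<^sub>M borel)"
  shows "(\<integral>\<^sup>+\<omega>. F (Z \<omega>, X \<omega>) \<partial>M) = (\<integral>\<^sup>+z. \<integral>\<^sup>+x. F (z, x) \<partial>distr M borel X \<partial>distr M borel Z)"
proof -
  interpret X: prob_space "distr M borel X" by (rule prob_space_distr) simp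
  have "(\<integral>\<^sup>+\<omega>. F (Z \<omega>, X \<omega>) \<partial>M) = integral\<^sup>N (distr M (borel \<Otimes>\<^sub>M borel) (\<lambda>\<omega>. (Z \<omega>, X \<omega>))) F"
    by (subst nn_integral_distr) auto
  also have "\<dots> = (\<integral>\<^sup>+z. \<integral>\<^sup>+x. F (z, x) \<partial>distr M borel X \<partial>distr M borel Z)"
    unfolding j[symmetric] by (rule X.nn_integral_fst[symmetric]) simp
  finally show ?thesis .
qed

lemma integral_joint:
  fixes X :: "'a \<Rightarrow> 'c::{second_countable_topology}" and F :: "(real ^ 'd) \<times> 'c \<Rightarrow> real"
  assumes j: "distr M borel Z \<Otimes>\<^sub>M distr M borel X = distr M (borel \<Otimes>\<^sub>M borel) (\<lambda>\<omega>. (Z \<omega>, X \<omega>))"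
    and [measurable]: "X \<in> borel_measurable M" "F \<in> borel_measurable (borel \<Otimes>\<^sub>M borel)"
    and i: "integrable M (\<lambda>\<omega>. F (Z \<omega>, X \<omega>))"
  shows "(LINT \<omega>|M. F (Z \<omega>, X \<omega>)) = (LINT z|distr M borel Z. LINT x|distr M borel X. F (z, x))"
proof -
  interpret X: prob_space "distr M borel X" by (rule prob_space_distr) simp
  interpret Z: prob_space "distr M borel Z" by (rule prob_space_distr) simp
  interpret P: pair_sigma_finite "distr M borel Z" "distr M borel X" by unfold_locales
  have "integrable (distr M (borel \<Otimes>\<^sub>M borel) (\<lambda>\<omega>. (Z \<omega>, X \<omega>))) F"
    using i by (subst integrable_distr_eq) auto
  then have i': "integrable (distr M borel Z \<Otimes>\<^sub>M distr M borel X) F" unfolding j .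
  have "(LINT \<omega>|M. F (Z \<omega>, X \<omega>)) = integral\<^sup>L (distr M (borel \<Otimes>\<^sub>M borel) (\<lambda>\<omega>. (Z \<omega>, X \<omega>))) F"
    by (subst integral_distr) auto
  also have "\<dots> = (LINT z|distr M borel Z. LINT x|distr M borel X. F (z, x))"
    unfolding j[symmetric] by (rule P.integral_fst'[OF i', symmetric])
  finally show ?thesis .
qed

lemma obs_measurable:
  assumes "hclass h"
  shows "(\<lambda>\<omega>. (h (Z \<omega> + \<delta> \<omega>) + \<epsilon> \<omega>, Z \<omega>)) \<in> borel_measurable M"
proof -
  note [measurable] = hclass_measurable[OF assms]
  show ?thesis by measurable
qed

lemma obs_law_snd:
  assumes h: "hclass h"
  shows "distr (obs_law M Z \<delta> \<epsilon> h) borel snd = density lborel (\<lambda>x. ennreal (fZ x))"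
  unfolding obs_law_def
  by (subst distr_distr[OF borel_measurable_continuous_onI[OF continuous_on_snd[OF continuous_on_id]] obs_measurable[OF h]])
     (simp add: comp_def distr_Z)

text \<open>The bound on h holds almost everywhere; it survives the random shift because \<delta>
  has a density and null sets are translation invariant.\<close>

lemma cond_second_moment_h:
  assumes h: "hclass h" and b: "AE x in lborel. \<bar>h x\<bar> \<le> B" "B \<ge> 0" and f: "f \<in> borel_measurable borel"
  shows "(\<integral>\<^sup>+\<omega>. ennreal ((h (Z \<omega> + \<delta> \<omega>))\<^sup>2) * f (Z \<omega>) \<partial>M) \<le> ennreal (B\<^sup>2) * (\<integral>\<^sup>+\<omega>. f (Z \<omega>) \<partial>M)"
proof -
  note [measurable] = hclass_measurable[OF h] f
  interpret D: prob_space "distr M borel \<delta>" by (rule prob_space_distr) simp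
  have "(\<integral>\<^sup>+\<omega>. ennreal ((h (Z \<omega> + \<delta> \<omega>))\<^sup>2) * f (Z \<omega>) \<partial>M)
    = (\<integral>\<^sup>+z. \<integral>\<^sup>+x. ennreal ((h (z + x))\<^sup>2) * f z \<partial>distr M borel \<delta> \<partial>distr M borel Z)"
    using nn_integral_joint[OF joint_Z\<delta>, of "\<lambda>(z, x). ennreal ((h (z + x))\<^sup>2) * f z"] by simp
  also have "\<dots> \<le> (\<integral>\<^sup>+z. ennreal (B\<^sup>2) * f z \<partial>distr M borel Z)"
  proof (rule nn_integral_mono)
    fix z
    have "AE x in lborel. \<bar>h (z + x)\<bar> \<le> B" by (rule reg_integrable(3)[OF h b(1)])
    then have "AE x in distr M borel \<delta>. \<bar>h (z + x)\<bar> \<le> B"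
      unfolding distr_\<delta> by (subst AE_density) auto
    then have "(\<integral>\<^sup>+x. ennreal ((h (z + x))\<^sup>2) * f z \<partial>distr M borel \<delta>) \<le> (\<integral>\<^sup>+x. ennreal (B\<^sup>2) * f z \<partial>distr M borel \<delta>)"
    proof (intro nn_integral_mono_AE, eventually_elim)
      case (elim x)
      then have "\<bar>h (z + x)\<bar>\<^sup>2 \<le> B\<^sup>2" by (intro power_mono) auto
      then show ?case by (intro mult_right_mono ennreal_leI) auto
    qed
    also have "\<dots> = ennreal (B\<^sup>2) * f z" using D.emeasure_space_1 by simp
    finally show "(\<integral>\<^sup>+x. ennreal ((h (z + x))\<^sup>2) * f z \<partial>distr M borel \<delta>) \<le> ennreal (B\<^sup>2) * f z" .
  qed
  also have "\<dots> = ennreal (B\<^sup>2) * (\<integral>\<^sup>+\<omega>. f (Z \<omega>) \<partial>M)"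
    by (subst nn_integral_distr, simp, simp, subst nn_integral_cmult) auto
  finally show ?thesis .
qed

lemma cond_second_moment_eps:
  assumes f: "f \<in> borel_measurable borel"
  shows "(\<integral>\<^sup>+\<omega>. ennreal ((\<epsilon> \<omega>)\<^sup>2) * f (Z \<omega>) \<partial>M) = ennreal (LINT \<omega>|M. (\<epsilon> \<omega>)\<^sup>2) * (\<integral>\<^sup>+\<omega>. f (Z \<omega>) \<partial>M)"
proof -
  note [measurable] = f
  have i: "integrable M (\<lambda>\<omega>. (\<epsilon> \<omega>)\<^sup>2)" using model by (simp add: berkson_errors_def)
  have "(\<integral>\<^sup>+\<omega>. ennreal ((\<epsilon> \<omega>)\<^sup>2) * f (Z \<omega>) \<partial>M) = (\<integral>\<^sup>+z. \<integral>\<^sup>+e. ennreal (e\<^sup>2) * f z \<partial>distr M borel \<epsilon> \<partial>distr M borel Z)"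
    using nn_integral_joint[OF joint_Z\<epsilon>, of "\<lambda>(z, e). ennreal (e\<^sup>2) * f z"] by simp
  also have "\<dots> = (\<integral>\<^sup>+z. ennreal (LINT \<omega>|M. (\<epsilon> \<omega>)\<^sup>2) * f z \<partial>distr M borel Z)"
  proof (rule nn_integral_cong)
    fix z
    have "(\<integral>\<^sup>+e. ennreal (e\<^sup>2) * f z \<partial>distr M borel \<epsilon>) = (\<integral>\<^sup>+e. ennreal (e\<^sup>2) \<partial>distr M borel \<epsilon>) * f z"
      by (rule nn_integral_multc) simp
    also have "(\<integral>\<^sup>+e. ennreal (e\<^sup>2) \<partial>distr M borel \<epsilon>) = (\<integral>\<^sup>+\<omega>. ennreal ((\<epsilon> \<omega>)\<^sup>2) \<partial>M)"
      by (subst nn_integral_distr) auto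
    also have "\<dots> = ennreal (LINT \<omega>|M. (\<epsilon> \<omega>)\<^sup>2)" by (rule nn_integral_eq_integral[OF i]) simp
    finally show "(\<integral>\<^sup>+e. ennreal (e\<^sup>2) * f z \<partial>distr M borel \<epsilon>) = ennreal (LINT \<omega>|M. (\<epsilon> \<omega>)\<^sup>2) * f z" .
  qed
  also have "\<dots> = ennreal (LINT \<omega>|M. (\<epsilon> \<omega>)\<^sup>2) * (\<integral>\<^sup>+\<omega>. f (Z \<omega>) \<partial>M)"
    by (subst nn_integral_distr, simp, simp, subst nn_integral_cmult) auto
  finally show ?thesis .
qed

text \<open>A bound on the conditional variance of U given Z, expressed through arbitrary
  nonnegative weights f of Z. The constant s precedes h, so it is uniform over the class.\<close>

lemma obs_variance:
  "\<exists>s\<ge>0. \<forall>h f. hclass h \<longrightarrow> f \<in> borel_measurable borel \<longrightarrow>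
    (\<integral>\<^sup>+p. ennreal ((fst p - reg h (snd p))\<^sup>2) * f (snd p) \<partial>obs_law M Z \<delta> \<epsilon> h) \<le> ennreal s * (\<integral>\<^sup>+p. f (snd p) \<partial>obs_law M Z \<delta> \<epsilon> h)"
proof -
  obtain B where B: "B \<ge> 0" "\<And>h. hclass h \<Longrightarrow> AE x in lborel. \<bar>h x\<bar> \<le> B"
    using hclass_bounded by blast
  define e2 where "e2 = (LINT \<omega>|M. (\<epsilon> \<omega>)\<^sup>2)"
  have e2: "e2 \<ge> 0" unfolding e2_def by (intro integral_nonneg_AE AE_I2) simp
  define s where "s = 3 * (B\<^sup>2 + B\<^sup>2 + e2)"
  have "(\<integral>\<^sup>+p. ennreal ((fst p - reg h (snd p))\<^sup>2) * f (snd p) \<partial>obs_law M Z \<delta> \<epsilon> h) \<le> ennreal s * (\<integral>\<^sup>+p. f (snd p) \<partial>obs_law M Z \<delta> \<epsilon> h)"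
    if h: "hclass h" and f: "f \<in> borel_measurable borel" for h f
  proof -
    note [measurable] = hclass_measurable[OF h] f reg_measurable[OF h]
    have sndm: "(\<lambda>p. snd p) \<in> measurable (borel :: (real \<times> (real ^ 'd)) measure) borel"
      "(\<lambda>p. fst p) \<in> measurable (borel :: (real \<times> (real ^ 'd)) measure) borel"
      by (auto intro!: borel_measurable_continuous_onI continuous_intros)
    note [measurable] = sndm
    have "(\<integral>\<^sup>+p. ennreal ((fst p - reg h (snd p))\<^sup>2) * f (snd p) \<partial>obs_law M Z \<delta> \<epsilon> h)
      = (\<integral>\<^sup>+\<omega>. ennreal ((h (Z \<omega> + \<delta> \<omega>) + \<epsilon> \<omega> - reg h (Z \<omega>))\<^sup>2) * f (Z \<omega>) \<partial>M)"
      unfolding obs_law_def by (subst nn_integral_distr[OF obs_measurable[OF h]]) auto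
    also have "\<dots> \<le> (\<integral>\<^sup>+\<omega>. 3 * (ennreal ((h (Z \<omega> + \<delta> \<omega>))\<^sup>2) * f (Z \<omega>) + ennreal (B\<^sup>2) * f (Z \<omega>) + ennreal ((\<epsilon> \<omega>)\<^sup>2) * f (Z \<omega>)) \<partial>M)"
    proof (rule nn_integral_mono)
      fix \<omega>
      define a b c where "a = h (Z \<omega> + \<delta> \<omega>)" "b = reg h (Z \<omega>)" "c = \<epsilon> \<omega>"
      have "\<bar>b\<bar>\<^sup>2 \<le> B\<^sup>2" unfolding a_b_c_def using reg_integrable(2)[OF h B(2)[OF h]] by (intro power_mono) auto
      moreover have "(a + c - b)\<^sup>2 \<le> 3 * (a\<^sup>2 + b\<^sup>2 + c\<^sup>2)"
      proof -
        have "3 * (a\<^sup>2 + b\<^sup>2 + c\<^sup>2) - (a + c - b)\<^sup>2 = (a - c)\<^sup>2 + (a + b)\<^sup>2 + (b + c)\<^sup>2"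
          by (simp add: power2_eq_square algebra_simps)
        moreover have "(a - c)\<^sup>2 + (a + b)\<^sup>2 + (b + c)\<^sup>2 \<ge> 0" by simp
        ultimately show ?thesis by linarith
      qed
      ultimately have "(a + c - b)\<^sup>2 \<le> 3 * (a\<^sup>2 + B\<^sup>2 + c\<^sup>2)" by simp
      then have "ennreal ((a + c - b)\<^sup>2) \<le> ennreal (3 * (a\<^sup>2 + B\<^sup>2 + c\<^sup>2))" by (rule ennreal_leI)
      also have "\<dots> = 3 * (ennreal (a\<^sup>2) + ennreal (B\<^sup>2) + ennreal (c\<^sup>2))" by (simp add: ennreal_mult)
      finally have "ennreal ((a + c - b)\<^sup>2) * f (Z \<omega>) \<le> 3 * (ennreal (a\<^sup>2) + ennreal (B\<^sup>2) + ennreal (c\<^sup>2)) * f (Z \<omega>)"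
        by (intro mult_right_mono) auto
      then show "ennreal ((h (Z \<omega> + \<delta> \<omega>) + \<epsilon> \<omega> - reg h (Z \<omega>))\<^sup>2) * f (Z \<omega>) \<le>
         3 * (ennreal ((h (Z \<omega> + \<delta> \<omega>))\<^sup>2) * f (Z \<omega>) + ennreal (B\<^sup>2) * f (Z \<omega>) + ennreal ((\<epsilon> \<omega>)\<^sup>2) * f (Z \<omega>))"
        unfolding a_b_c_def by (simp only: distrib_right distrib_left mult.assoc)
    qed
    also have "\<dots> = 3 * ((\<integral>\<^sup>+\<omega>. ennreal ((h (Z \<omega> + \<delta> \<omega>))\<^sup>2) * f (Z \<omega>) \<partial>M) + ennreal (B\<^sup>2) * (\<integral>\<^sup>+\<omega>. f (Z \<omega>) \<partial>M) + (\<integral>\<^sup>+\<omega>. ennreal ((\<epsilon> \<omega>)\<^sup>2) * f (Z \<omega>) \<partial>M))"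
      by (simp add: nn_integral_cmult nn_integral_add)
    also have "\<dots> \<le> 3 * (ennreal (B\<^sup>2) * (\<integral>\<^sup>+\<omega>. f (Z \<omega>) \<partial>M) + ennreal (B\<^sup>2) * (\<integral>\<^sup>+\<omega>. f (Z \<omega>) \<partial>M) + ennreal e2 * (\<integral>\<^sup>+\<omega>. f (Z \<omega>) \<partial>M))"
      unfolding cond_second_moment_eps[OF f] e2_def
      by (intro mult_left_mono add_mono cond_second_moment_h[OF h B(2)[OF h] B(1) f]) auto
    also have "\<dots> = ennreal s * (\<integral>\<^sup>+\<omega>. f (Z \<omega>) \<partial>M)"
    proof -
      have "ennreal s = 3 * (ennreal (B\<^sup>2) + ennreal (B\<^sup>2) + ennreal e2)"
      proof -
        have "ennreal s = ennreal 3 * ennreal (B\<^sup>2 + B\<^sup>2 + e2)"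
          unfolding s_def by (rule ennreal_mult) (use e2 in auto)
        also have "ennreal (B\<^sup>2 + B\<^sup>2 + e2) = ennreal (B\<^sup>2 + B\<^sup>2) + ennreal e2"
          by (rule ennreal_plus) (use e2 in auto)
        also have "ennreal (B\<^sup>2 + B\<^sup>2) = ennreal (B\<^sup>2) + ennreal (B\<^sup>2)"
          by (rule ennreal_plus) auto
        finally show ?thesis by simp
      qed
      then show ?thesis by (simp only: distrib_right mult.assoc)
    qed
    also have "(\<integral>\<^sup>+\<omega>. f (Z \<omega>) \<partial>M) = (\<integral>\<^sup>+p. f (snd p) \<partial>obs_law M Z \<delta> \<epsilon> h)"
      unfolding obs_law_def by (subst nn_integral_distr[OF obs_measurable[OF h]]) auto
    finally show ?thesis .
  qed
  moreover have "s \<ge> 0" using e2 by (simp add: s_def)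
  ultimately show ?thesis by blast
qed

lemma obs_mean_bounded:
  assumes h: "hclass h" and f: "f \<in> borel_measurable borel" and fb: "\<And>z. \<bar>f z\<bar> \<le> c"
  shows "(LINT \<omega>|M. (h (Z \<omega> + \<delta> \<omega>) + \<epsilon> \<omega> - reg h (Z \<omega>)) * f (Z \<omega>)) = 0"
proof -
  obtain B where B: "B \<ge> 0" "AE x in lborel. \<bar>h x\<bar> \<le> B"
    using hclass_bounded h by blast
  note [measurable] = hclass_measurable[OF h] f reg_measurable[OF h]
  have c0: "c \<ge> 0" using fb[of 0] by linarith
  have e0: "integrable M (\<lambda>\<omega>. (\<epsilon> \<omega>)\<^sup>2)" "(LINT \<omega>|M. \<epsilon> \<omega>) = 0" using model by (auto simp: berkson_errors_def)
  have i\<epsilon>: "integrable M \<epsilon>" by (rule square_integrable_imp_integrable[OF _ e0(1)]) simp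
  have h2: "integrable M (\<lambda>\<omega>. (h (Z \<omega> + \<delta> \<omega>))\<^sup>2)"
  proof (rule integrableI_nonneg)
    have "(\<integral>\<^sup>+\<omega>. ennreal ((h (Z \<omega> + \<delta> \<omega>))\<^sup>2) \<partial>M) \<le> ennreal (B\<^sup>2) * (\<integral>\<^sup>+\<omega>. 1 \<partial>M)"
      using cond_second_moment_h[OF h B(2,1), of "\<lambda>_. 1"] by simp
    then show "(\<integral>\<^sup>+\<omega>. ennreal ((h (Z \<omega> + \<delta> \<omega>))\<^sup>2) \<partial>M) < \<infinity>"
      using emeasure_space_1 by (auto intro: le_less_trans)
  qed auto
  have ih: "integrable M (\<lambda>\<omega>. h (Z \<omega> + \<delta> \<omega>))" by (rule square_integrable_imp_integrable[OF _ h2]) simp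
  have bm: "integrable M (\<lambda>\<omega>. X \<omega> * f (Z \<omega>))" if "integrable M X" for X
  proof (rule Bochner_Integration.integrable_bound[where f="\<lambda>\<omega>. c * X \<omega>"])
    show "integrable M (\<lambda>\<omega>. c * X \<omega>)" using that by simp
    have [measurable]: "X \<in> borel_measurable M" using that by (rule borel_measurable_integrable)
    show "(\<lambda>\<omega>. X \<omega> * f (Z \<omega>)) \<in> borel_measurable M" by measurable
    show "AE \<omega> in M. norm (X \<omega> * f (Z \<omega>)) \<le> norm (c * X \<omega>)"
    proof (rule AE_I2)
      fix \<omega>
      have "\<bar>f (Z \<omega>)\<bar> * \<bar>X \<omega>\<bar> \<le> c * \<bar>X \<omega>\<bar>" by (intro mult_right_mono fb) simp
      then show "norm (X \<omega> * f (Z \<omega>)) \<le> norm (c * X \<omega>)" using c0 by (simp add: abs_mult mult.commute)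
    qed
  qed
  have ig: "integrable M (\<lambda>\<omega>. reg h (Z \<omega>))"
    by (rule integrable_const_bound[where B=B]) (auto simp: reg_integrable(2)[OF h B(2)])
  have 1: "(LINT \<omega>|M. h (Z \<omega> + \<delta> \<omega>) * f (Z \<omega>)) = (LINT \<omega>|M. reg h (Z \<omega>) * f (Z \<omega>))"
  proof -
    have "(LINT \<omega>|M. h (Z \<omega> + \<delta> \<omega>) * f (Z \<omega>)) = (LINT z|distr M borel Z. LINT x|distr M borel \<delta>. h (z + x) * f z)"
      using integral_joint[OF joint_Z\<delta>, of "\<lambda>(z, x). h (z + x) * f z"] bm[OF ih] by simp
    also have "\<dots> = (LINT z|distr M borel Z. reg h z * f z)"
    proof (intro Bochner_Integration.integral_cong refl)
      fix z
      have "(LINT x|distr M borel \<delta>. h (z + x)) = (LINT x|lborel. f\<delta> x *\<^sub>R h (z + x))"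
        unfolding distr_\<delta> by (rule integral_density) (auto simp: dens(2))
      also have "\<dots> = reg h z" unfolding reg_eq[OF h] by (simp add: mult.commute)
      finally show "(LINT x|distr M borel \<delta>. h (z + x) * f z) = reg h z * f z" by simp
    qed
    also have "\<dots> = (LINT \<omega>|M. reg h (Z \<omega>) * f (Z \<omega>))" by (subst integral_distr) auto
    finally show ?thesis .
  qed
  have 2: "(LINT \<omega>|M. \<epsilon> \<omega> * f (Z \<omega>)) = 0"
  proof -
    have "(LINT \<omega>|M. \<epsilon> \<omega> * f (Z \<omega>)) = (LINT z|distr M borel Z. LINT e|distr M borel \<epsilon>. e * f z)"
      using integral_joint[OF joint_Z\<epsilon>, of "\<lambda>(z, e). e * f z"] bm[OF i\<epsilon>] by simp
    moreover have "(LINT e|distr M borel \<epsilon>. e) = 0" using e0(2) by (subst integral_distr) auto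
    ultimately show ?thesis by simp
  qed
  have "(LINT \<omega>|M. (h (Z \<omega> + \<delta> \<omega>) + \<epsilon> \<omega> - reg h (Z \<omega>)) * f (Z \<omega>))
    = (LINT \<omega>|M. h (Z \<omega> + \<delta> \<omega>) * f (Z \<omega>) + \<epsilon> \<omega> * f (Z \<omega>) - reg h (Z \<omega>) * f (Z \<omega>))"
    by (simp add: algebra_simps)
  also have "\<dots> = 0" using bm[OF ih] bm[OF i\<epsilon>] bm[OF ig] by (simp add: 1 2)
  finally show ?thesis .
qed

text \<open>The residual has conditional mean zero. The weights that occur are unbounded, so the
  bounded case is extended by truncating f.\<close>

lemma obs_mean:
  assumes h: "hclass h" and f: "f \<in> borel_measurable borel"
  shows "(LINT p|obs_law M Z \<delta> \<epsilon> h. (fst p - reg h (snd p)) * f (snd p)) = 0"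
proof -
  note [measurable] = hclass_measurable[OF h] f reg_measurable[OF h]
  have sndm: "(\<lambda>p. snd p) \<in> measurable (borel :: (real \<times> (real ^ 'd)) measure) borel"
      "(\<lambda>p. fst p) \<in> measurable (borel :: (real \<times> (real ^ 'd)) measure) borel"
    by (auto intro!: borel_measurable_continuous_onI continuous_intros)
  note [measurable] = sndm
  define Y where "Y \<omega> = h (Z \<omega> + \<delta> \<omega>) + \<epsilon> \<omega> - reg h (Z \<omega>)" for \<omega>
  have [measurable]: "Y \<in> borel_measurable M" unfolding Y_def by measurable
  have eq: "(LINT p|obs_law M Z \<delta> \<epsilon> h. (fst p - reg h (snd p)) * f (snd p)) = (LINT \<omega>|M. Y \<omega> * f (Z \<omega>))"
    unfolding obs_law_def Y_def by (subst integral_distr[OF obs_measurable[OF h]]) auto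
  show ?thesis
  proof (cases "integrable M (\<lambda>\<omega>. Y \<omega> * f (Z \<omega>))")
    \<comment> \<open>A non-integrable function has Bochner integral 0 by convention.\<close>
    case False
    then show ?thesis unfolding eq by (rule not_integrable_integral_eq)
  next
    case True
    define g where "g n z = (if \<bar>f z\<bar> \<le> real n then f z else 0)" for n z
    have [measurable]: "g n \<in> borel_measurable borel" for n unfolding g_def by measurable
    have "(\<lambda>n. LINT \<omega>|M. Y \<omega> * g n (Z \<omega>)) \<longlonglongrightarrow> (LINT \<omega>|M. Y \<omega> * f (Z \<omega>))"
    proof (rule integral_dominated_convergence[where w="\<lambda>\<omega>. \<bar>Y \<omega> * f (Z \<omega>)\<bar>"])
      show "AE \<omega> in M. (\<lambda>n. Y \<omega> * g n (Z \<omega>)) \<longlonglongrightarrow> Y \<omega> * f (Z \<omega>)"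
      proof (rule AE_I2, rule tendsto_mult_left, rule tendsto_eventually)
        fix \<omega>
        obtain n0 where "\<bar>f (Z \<omega>)\<bar> < real n0" using reals_Archimedean2 by blast
        then show "eventually (\<lambda>n. g n (Z \<omega>) = f (Z \<omega>)) sequentially"
          unfolding eventually_sequentially by (intro exI[of _ n0]) (auto simp: g_def)
      qed
      show "AE \<omega> in M. norm (Y \<omega> * g n (Z \<omega>)) \<le> \<bar>Y \<omega> * f (Z \<omega>)\<bar>" for n
        by (rule AE_I2) (auto simp: g_def)
    qed (use True in auto)
    moreover have "(LINT \<omega>|M. Y \<omega> * g n (Z \<omega>)) = 0" for n
      unfolding Y_def by (rule obs_mean_bounded[OF h, where c="real n"]) (auto simp: g_def)
    ultimately have "(\<lambda>n. 0 :: real) \<longlonglongrightarrow> (LINT \<omega>|M. Y \<omega> * f (Z \<omega>))" by simp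
    then have "(LINT \<omega>|M. Y \<omega> * f (Z \<omega>)) = 0" by (metis LIMSEQ_unique tendsto_const)
    then show ?thesis unfolding eq .
  qed
qed

declare model_measurable [measurable del]

end

end

text \<open>Given the design, the residuals are centred and uncorrelated, so only the diagonal of
  the squared sum survives. Conditioning is replaced by integrating one observation at a time: the
  weights involve the second components only.\<close>

lemma weighted_noise_variance:
  fixes \<mu> :: "(real \<times> (real ^ 'd)) measure" and a :: "nat \<Rightarrow> (nat \<Rightarrow> real ^ 'd) \<Rightarrow> real"
  assumes pr: "prob_space \<mu>" and s\<mu> [measurable_cong]: "sets \<mu> = sets borel" and g [measurable]: "g \<in> borel_measurable borel"
    and I: "finite I" and s: "s \<ge> 0"
    and V1: "\<And>f. f \<in> borel_measurable borel \<Longrightarrow> (\<integral>\<^sup>+p. ennreal ((fst p - g (snd p))\<^sup>2) * f (snd p) \<partial>\<mu>) \<le> ennreal s * (\<integral>\<^sup>+p. f (snd p) \<partial>\<mu>)"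
    and V2: "\<And>f :: real ^ 'd \<Rightarrow> real. f \<in> borel_measurable borel \<Longrightarrow> (LINT p|\<mu>. (fst p - g (snd p)) * f (snd p)) = 0"
    and a: "\<And>i. i \<in> I \<Longrightarrow> a i \<in> borel_measurable (PiM I (\<lambda>_. borel))"
    and acong: "\<And>i w w'. (\<And>j. j \<in> I \<Longrightarrow> w j = w' j) \<Longrightarrow> a i w = a i w'"
    and fin: "\<And>i. i \<in> I \<Longrightarrow> (\<integral>\<^sup>+p. ennreal ((a i (\<lambda>j. snd (p j)))\<^sup>2) \<partial>PiM I (\<lambda>_. \<mu>)) < \<infinity>"
  shows "(\<integral>\<^sup>+p. ennreal ((\<Sum>i\<in>I. (fst (p i) - g (snd (p i))) * a i (\<lambda>j. snd (p j)))\<^sup>2) \<partial>PiM I (\<lambda>_. \<mu>))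
    \<le> ennreal s * (\<integral>\<^sup>+p. (\<Sum>i\<in>I. ennreal ((a i (\<lambda>j. snd (p j)))\<^sup>2)) \<partial>PiM I (\<lambda>_. \<mu>))"
proof -
  interpret prob_space \<mu> by (rule pr)
  interpret P: product_sigma_finite "\<lambda>_::nat. \<mu>" by unfold_locales
  have sndm: "snd \<in> measurable (borel :: (real \<times> (real ^ 'd)) measure) borel"
      "fst \<in> measurable (borel :: (real \<times> (real ^ 'd)) measure) borel"
    by (auto intro!: borel_measurable_continuous_onI continuous_intros)
  note [measurable] = sndm
  define A where "A i p = a i (\<lambda>j. snd (p j))" for i and p :: "nat \<Rightarrow> real \<times> (real ^ 'd)"
  define X where "X i p = (fst (p i) - g (snd (p i))) * A i p" for i p
  have comp: "(\<lambda>p. p i) \<in> measurable (PiM I (\<lambda>_. \<mu>)) borel" if "i \<in> I" for i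
    using measurable_component_singleton[OF that, of "\<lambda>_. \<mu>"] measurable_cong_sets[OF refl s\<mu>] by blast
  have Am [measurable]: "A i \<in> borel_measurable (PiM I (\<lambda>_. \<mu>))" if i: "i \<in> I" for i
  proof -
    have "(\<lambda>p. \<lambda>j\<in>I. snd (p j)) \<in> measurable (PiM I (\<lambda>_. \<mu>)) (PiM I (\<lambda>_. borel))"
      by (intro measurable_restrict measurable_compose[OF comp sndm(1)])
    from measurable_compose[OF this a[OF i]]
    have "(\<lambda>p. a i (\<lambda>j\<in>I. snd (p j))) \<in> borel_measurable (PiM I (\<lambda>_. \<mu>))" .
    moreover have "a i (\<lambda>j\<in>I. snd (p j)) = A i p" for p unfolding A_def by (rule acong) simp
    ultimately show ?thesis by simp
  qed
  have etam: "(\<lambda>p. fst (p i) - g (snd (p i))) \<in> borel_measurable (PiM I (\<lambda>_. \<mu>))" if "i \<in> I" for i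
  proof -
    note [measurable] = comp[OF that]
    show ?thesis by measurable
  qed
  have Xm [measurable]: "X i \<in> borel_measurable (PiM I (\<lambda>_. \<mu>))" if "i \<in> I" for i
    unfolding X_def using that by (intro borel_measurable_times etam Am)
  have upd: "(\<lambda>j. snd ((p(i := y)) j)) = (\<lambda>j. snd (p j))(i := snd y)" for p i and y :: "real \<times> (real ^ 'd)" by auto
  have secm: "(\<lambda>v. a k ((\<lambda>j. snd (p j))(i := v))) \<in> borel_measurable borel" if i: "i \<in> I" and k: "k \<in> I" for p :: "nat \<Rightarrow> real \<times> (real ^ 'd)" and i k
  proof -
    have "(\<lambda>v. \<lambda>j\<in>I. ((\<lambda>j. snd (p j))(i := v)) j) \<in> measurable borel (PiM I (\<lambda>_. borel))"
      by (rule measurable_restrict) (auto simp: fun_upd_def)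
    from measurable_compose[OF this a[OF k]]
    have "(\<lambda>v. a k (\<lambda>j\<in>I. ((\<lambda>j. snd (p j))(i := v)) j)) \<in> borel_measurable borel" .
    moreover have "a k (\<lambda>j\<in>I. ((\<lambda>j. snd (p j))(i := v)) j) = a k ((\<lambda>j. snd (p j))(i := v))" for v by (rule acong) simp
    ultimately show ?thesis by simp
  qed
  have X2: "(\<integral>\<^sup>+p. ennreal ((X i p)\<^sup>2) \<partial>PiM I (\<lambda>_. \<mu>)) \<le> ennreal s * (\<integral>\<^sup>+p. ennreal ((A i p)\<^sup>2) \<partial>PiM I (\<lambda>_. \<mu>))" if i: "i \<in> I" for i
  proof -
    define I' where "I' = I - {i}"
    have I': "finite I'" "i \<notin> I'" "I = insert i I'" using I i by (auto simp: I'_def)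
    have "(\<integral>\<^sup>+p. ennreal ((X i p)\<^sup>2) \<partial>PiM I (\<lambda>_. \<mu>)) = (\<integral>\<^sup>+p. \<integral>\<^sup>+y. ennreal ((X i (p(i := y)))\<^sup>2) \<partial>\<mu> \<partial>PiM I' (\<lambda>_. \<mu>))"
      unfolding I'(3) by (rule P.product_nn_integral_insert[OF I'(1,2)]) (use Xm[OF i] in \<open>simp add: I'(3)[symmetric]\<close>)
    also have "\<dots> \<le> (\<integral>\<^sup>+p. ennreal s * (\<integral>\<^sup>+y. ennreal ((A i (p(i := y)))\<^sup>2) \<partial>\<mu>) \<partial>PiM I' (\<lambda>_. \<mu>))"
    proof (rule nn_integral_mono)
      fix p :: "nat \<Rightarrow> real \<times> (real ^ 'd)"
      define f where "f v = ennreal ((a i ((\<lambda>j. snd (p j))(i := v)))\<^sup>2)" for v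
      have fm: "f \<in> borel_measurable borel" unfolding f_def using secm[OF i i] by measurable
      have "(\<integral>\<^sup>+y. ennreal ((X i (p(i := y)))\<^sup>2) \<partial>\<mu>) = (\<integral>\<^sup>+y. ennreal ((fst y - g (snd y))\<^sup>2) * f (snd y) \<partial>\<mu>)"
        by (intro nn_integral_cong) (simp add: X_def A_def upd f_def power_mult_distrib ennreal_mult del: fun_upd_apply, simp add: ennreal_mult)
      also have "\<dots> \<le> ennreal s * (\<integral>\<^sup>+y. f (snd y) \<partial>\<mu>)" by (rule V1[OF fm])
      also have "(\<integral>\<^sup>+y. f (snd y) \<partial>\<mu>) = (\<integral>\<^sup>+y. ennreal ((A i (p(i := y)))\<^sup>2) \<partial>\<mu>)"
        by (simp add: f_def A_def upd del: fun_upd_apply)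
      finally show "(\<integral>\<^sup>+y. ennreal ((X i (p(i := y)))\<^sup>2) \<partial>\<mu>) \<le> ennreal s * (\<integral>\<^sup>+y. ennreal ((A i (p(i := y)))\<^sup>2) \<partial>\<mu>)" .
    qed
    also have "\<dots> = ennreal s * (\<integral>\<^sup>+p. \<integral>\<^sup>+y. ennreal ((A i (p(i := y)))\<^sup>2) \<partial>\<mu> \<partial>PiM I' (\<lambda>_. \<mu>))"
    proof (rule nn_integral_cmult)
      have "(\<lambda>(p, y). ennreal ((A i (p(i := y)))\<^sup>2)) \<in> borel_measurable (PiM I' (\<lambda>_. \<mu>) \<Otimes>\<^sub>M \<mu>)"
        using measurable_compose[OF measurable_add_dim[of i I' "\<lambda>_. \<mu>"], of "\<lambda>p. ennreal ((A i p)\<^sup>2)" borel] Am[OF i]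
        by (simp add: I'(3)[symmetric] case_prod_beta)
      then show "(\<lambda>p. \<integral>\<^sup>+y. ennreal ((A i (p(i := y)))\<^sup>2) \<partial>\<mu>) \<in> borel_measurable (PiM I' (\<lambda>_. \<mu>))"
        by (rule borel_measurable_nn_integral)
    qed
    also have "(\<integral>\<^sup>+p. \<integral>\<^sup>+y. ennreal ((A i (p(i := y)))\<^sup>2) \<partial>\<mu> \<partial>PiM I' (\<lambda>_. \<mu>)) = (\<integral>\<^sup>+p. ennreal ((A i p)\<^sup>2) \<partial>PiM I (\<lambda>_. \<mu>))"
      unfolding I'(3) by (rule P.product_nn_integral_insert[OF I'(1,2), symmetric]) (use Am[OF i] in \<open>simp add: I'(3)[symmetric]\<close>)
    finally show ?thesis .
  qed
  have iX2: "integrable (PiM I (\<lambda>_. \<mu>)) (\<lambda>p. (X i p)\<^sup>2)" if i: "i \<in> I" for i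
  proof (rule integrableI_nonneg)
    show "(\<lambda>p. (X i p)\<^sup>2) \<in> borel_measurable (PiM I (\<lambda>_. \<mu>))" using Xm[OF i] by measurable
    have "(\<integral>\<^sup>+p. ennreal ((X i p)\<^sup>2) \<partial>PiM I (\<lambda>_. \<mu>)) \<le> ennreal s * (\<integral>\<^sup>+p. ennreal ((A i p)\<^sup>2) \<partial>PiM I (\<lambda>_. \<mu>))" by (rule X2[OF i])
    also have "\<dots> < \<infinity>" using fin[OF i] unfolding A_def by (simp add: ennreal_mult_less_top)
    finally show "(\<integral>\<^sup>+p. ennreal ((X i p)\<^sup>2) \<partial>PiM I (\<lambda>_. \<mu>)) < \<infinity>" .
  qed simp
  have iXX: "integrable (PiM I (\<lambda>_. \<mu>)) (\<lambda>p. X i p * X k p)" if "i \<in> I" "k \<in> I" for i k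
  proof (rule Bochner_Integration.integrable_bound[where f="\<lambda>p. (X i p)\<^sup>2 + (X k p)\<^sup>2"])
    show "integrable (PiM I (\<lambda>_. \<mu>)) (\<lambda>p. (X i p)\<^sup>2 + (X k p)\<^sup>2)" using that by (intro Bochner_Integration.integrable_add iX2)
    show "(\<lambda>p. X i p * X k p) \<in> borel_measurable (PiM I (\<lambda>_. \<mu>))" using that by (intro borel_measurable_times Xm)
    show "AE p in PiM I (\<lambda>_. \<mu>). norm (X i p * X k p) \<le> norm ((X i p)\<^sup>2 + (X k p)\<^sup>2)"
    proof (rule AE_I2)
      fix p
      have "2 * \<bar>X i p * X k p\<bar> \<le> (X i p)\<^sup>2 + (X k p)\<^sup>2"
        using sum_squares_bound[of "\<bar>X i p\<bar>" "\<bar>X k p\<bar>"] by (simp add: abs_mult)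
      then show "norm (X i p * X k p) \<le> norm ((X i p)\<^sup>2 + (X k p)\<^sup>2)" by simp
    qed
  qed
  \<comment> \<open>Integrating observation i first, the residual of k is a constant and both
    weights become one function of the design point at i, so the centring hypothesis applies. Fubini
    is licensed by the square-integrability of the summands.\<close>
  have cross: "(LINT p|PiM I (\<lambda>_. \<mu>). X i p * X k p) = 0" if i: "i \<in> I" and k: "k \<in> I" and ne: "i \<noteq> k" for i k
  proof -
    define I' where "I' = I - {i}"
    have I': "finite I'" "i \<notin> I'" "I = insert i I'" using I i by (auto simp: I'_def)
    have "(LINT p|PiM I (\<lambda>_. \<mu>). X i p * X k p) = (LINT p|PiM I' (\<lambda>_. \<mu>). LINT y|\<mu>. X i (p(i := y)) * X k (p(i := y)))"
      unfolding I'(3) by (rule P.product_integral_insert[OF I'(1,2)]) (use iXX[OF i k] in \<open>simp add: I'(3)[symmetric]\<close>)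
    also have "\<dots> = (LINT p|PiM I' (\<lambda>_. \<mu>). 0)"
    proof (intro Bochner_Integration.integral_cong refl)
      fix p :: "nat \<Rightarrow> real \<times> (real ^ 'd)"
      define f where "f v = a i ((\<lambda>j. snd (p j))(i := v)) * ((fst (p k) - g (snd (p k))) * a k ((\<lambda>j. snd (p j))(i := v)))" for v
      have fm: "f \<in> borel_measurable borel"
        unfolding f_def by (intro borel_measurable_times borel_measurable_const secm i k)
      have "(LINT y|\<mu>. X i (p(i := y)) * X k (p(i := y))) = (LINT y|\<mu>. (fst y - g (snd y)) * f (snd y))"
        unfolding X_def A_def upd f_def using ne by (intro Bochner_Integration.integral_cong refl) (simp add: mult_ac)
      also have "\<dots> = 0" by (rule V2[OF fm])
      finally show "(LINT y|\<mu>. X i (p(i := y)) * X k (p(i := y))) = 0" .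
    qed
    finally show ?thesis by simp
  qed
  have sq: "(\<Sum>i\<in>I. X i p)\<^sup>2 = (\<Sum>i\<in>I. \<Sum>k\<in>I. X i p * X k p)" for p by (simp add: power2_eq_square sum_product)
  have iS: "integrable (PiM I (\<lambda>_. \<mu>)) (\<lambda>p. (\<Sum>i\<in>I. X i p)\<^sup>2)"
    unfolding sq by (intro Bochner_Integration.integrable_sum iXX)
  have "(LINT p|PiM I (\<lambda>_. \<mu>). (\<Sum>i\<in>I. X i p)\<^sup>2) = (\<Sum>i\<in>I. \<Sum>k\<in>I. LINT p|PiM I (\<lambda>_. \<mu>). X i p * X k p)"
    unfolding sq by (simp add: Bochner_Integration.integral_sum Bochner_Integration.integrable_sum iXX)
  also have "\<dots> = (\<Sum>i\<in>I. \<Sum>k\<in>I. if k = i then LINT p|PiM I (\<lambda>_. \<mu>). (X i p)\<^sup>2 else 0)"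
    using cross by (intro sum.cong refl) (auto simp: power2_eq_square)
  also have "\<dots> = (\<Sum>i\<in>I. LINT p|PiM I (\<lambda>_. \<mu>). (X i p)\<^sup>2)" using I by (simp add: sum.delta)
  finally have L: "(LINT p|PiM I (\<lambda>_. \<mu>). (\<Sum>i\<in>I. X i p)\<^sup>2) = (\<Sum>i\<in>I. LINT p|PiM I (\<lambda>_. \<mu>). (X i p)\<^sup>2)" .
  have "(\<integral>\<^sup>+p. ennreal ((\<Sum>i\<in>I. X i p)\<^sup>2) \<partial>PiM I (\<lambda>_. \<mu>)) = ennreal (\<Sum>i\<in>I. LINT p|PiM I (\<lambda>_. \<mu>). (X i p)\<^sup>2)"
    unfolding L[symmetric] by (rule nn_integral_eq_integral[OF iS]) simp
  also have "\<dots> = (\<Sum>i\<in>I. ennreal (LINT p|PiM I (\<lambda>_. \<mu>). (X i p)\<^sup>2))"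
    by (intro sum_ennreal[symmetric] integral_nonneg_AE AE_I2) simp
  also have "\<dots> = (\<Sum>i\<in>I. \<integral>\<^sup>+p. ennreal ((X i p)\<^sup>2) \<partial>PiM I (\<lambda>_. \<mu>))"
    by (intro sum.cong refl nn_integral_eq_integral[symmetric] iX2) auto
  also have "\<dots> \<le> (\<Sum>i\<in>I. ennreal s * (\<integral>\<^sup>+p. ennreal ((A i p)\<^sup>2) \<partial>PiM I (\<lambda>_. \<mu>)))" by (intro sum_mono X2)
  also have "\<dots> = ennreal s * (\<integral>\<^sup>+p. (\<Sum>i\<in>I. ennreal ((A i p)\<^sup>2)) \<partial>PiM I (\<lambda>_. \<mu>))"
  proof -
    have "(\<integral>\<^sup>+p. (\<Sum>i\<in>I. ennreal ((A i p)\<^sup>2)) \<partial>PiM I (\<lambda>_. \<mu>)) = (\<Sum>i\<in>I. \<integral>\<^sup>+p. ennreal ((A i p)\<^sup>2) \<partial>PiM I (\<lambda>_. \<mu>))"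
    proof (rule nn_integral_sum)
      fix i assume "i \<in> I"
      note [measurable] = Am[OF this]
      show "(\<lambda>p. ennreal ((A i p)\<^sup>2)) \<in> borel_measurable (PiM I (\<lambda>_. \<mu>))" by measurable
    qed
    then show ?thesis by (simp add: sum_distrib_left)
  qed
  finally show ?thesis unfolding X_def A_def .
qed

section \<open>The averaged weights\<close>

lemma cell_unique:
  assumes J: "J \<in> k_subsets n K" "J' \<in> k_subsets n K" and z: "z \<in> cell T n w J" "z \<in> cell T n w J'"
  shows "J = J'"
proof (rule ccontr)
  assume ne: "J \<noteq> J'"
  have f: "finite J" "finite J'" "card J = card J'" "J \<subseteq> {1..n}" "J' \<subseteq> {1..n}"
    using J by (auto simp: k_subsets_def intro: finite_subset)
  have "\<not> J \<subseteq> J'" using card_subset_eq[OF f(2)] f(3) ne by blast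
  then obtain j where j: "j \<in> J" "j \<notin> J'" by blast
  have "\<not> J' \<subseteq> J" using card_subset_eq[OF f(1)] f(3) ne by (metis)
  then obtain k where k: "k \<in> J'" "k \<notin> J" by blast
  have "norm (z - w j) < norm (z - w k)" using z(1) j k f by (auto simp: cell_def)
  moreover have "norm (z - w k) < norm (z - w j)" using z(2) j k f by (auto simp: cell_def)
  ultimately show False by simp
qed

lemma neighbours_eq:
  assumes "J \<in> k_subsets n K" "z \<in> cell T n w J"
  shows "neighbours T n K w z = J"
  unfolding neighbours_def
proof (rule the_equality)
  show "J \<in> k_subsets n K \<and> z \<in> cell T n w J" using assms by simp
  fix J' assume "J' \<in> k_subsets n K \<and> z \<in> cell T n w J'"
  then show "J' = J" using cell_unique[OF _ assms(1) _ assms(2)] by simp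
qed

text \<open>The value of the choice operator on an unsatisfiable predicate. All singular matrices
  give the predicate \<open>\<lambda>B. False\<close>, so \<open>matrix_inv_on\<close> has this one
  value for each of them.\<close>

definition singular_inv :: "'i \<Rightarrow> 'i \<Rightarrow> real" where
  "singular_inv = (SOME B. False)"

lemma matrix_inv_on_singular:
  assumes I: "finite I" and d: "det_on I A = 0"
  shows "matrix_inv_on I A = singular_inv"
proof -
  obtain v where v: "\<exists>i\<in>I. v i \<noteq> 0" "\<forall>i\<in>I. (\<Sum>k\<in>I. A i k * v k) = 0"
    using det_on_zero_kernel[OF I d] by blast
  have "\<not> (\<forall>i\<in>I. \<forall>j\<in>I. (\<Sum>k\<in>I. A i k * B k j) = (if i = j then 1 else 0) \<and>
     (\<Sum>k\<in>I. B i k * A k j) = (if i = j then 1 else 0))" for B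
  proof
    assume B: "\<forall>i\<in>I. \<forall>j\<in>I. (\<Sum>k\<in>I. A i k * B k j) = (if i = j then 1 else 0) \<and>
     (\<Sum>k\<in>I. B i k * A k j) = (if i = j then 1 else 0)"
    have "v i = 0" if i: "i \<in> I" for i
    proof -
      have "v i = (\<Sum>j\<in>I. (if i = j then 1 else 0) * v j)"
        using I i by (simp add: sum.delta if_distrib if_distribR cong: if_cong)
      also have "\<dots> = (\<Sum>j\<in>I. (\<Sum>k\<in>I. B i k * A k j) * v j)"
        using B i by (intro sum.cong refl) simp
      also have "\<dots> = (\<Sum>k\<in>I. B i k * (\<Sum>j\<in>I. A k j * v j))"
        unfolding sum_distrib_left sum_distrib_right by (subst sum.swap) (simp add: mult_ac)
      also have "\<dots> = 0" using v(2) by simp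
      finally show ?thesis .
    qed
    then show False using v(1) by blast
  qed
  note n = this
  show ?thesis unfolding matrix_inv_on_def singular_inv_def by (simp only: n)
qed

text \<open>On singular configurations the choice operator returns one fixed matrix, so the weight is a
  measurable function of the evaluation point there as well.\<close>

lemma lp_weight_eq:
  assumes "J \<in> k_subsets n K" "z \<in> cell T n w J"
  shows "lp_weight T n K L w z v = (if det_on (multi_indices L) (gram J z w) = 0
    then \<Sum>\<kappa>\<in>multi_indices L. singular_inv 0 \<kappa> * xi z v \<kappa> else wgt L J z w v)"
proof -
  have lm: "local_matrix T n K w z = gram J z w"
    by (intro ext) (simp add: local_matrix_def gram_def neighbours_eq[OF assms(1,2)])
  show ?thesis
  proof (cases "det_on (multi_indices L) (gram J z w) = 0")
    case True
    then show ?thesis unfolding lp_weight_def lm by (simp add: matrix_inv_on_singular[OF finite_multi_indices True])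
  next
    case False
    then show ?thesis unfolding lp_weight_def lm wgt_def
      by (simp add: matrix_inv_on_eq[OF finite_multi_indices False zero_multi_indices])
  qed
qed

lemma sum_cells:
  assumes J: "J \<in> k_subsets n K" and z: "z \<in> cell T n w J"
  shows "(\<Sum>J'\<in>k_subsets n K. if z \<in> cell T n w J' then f J' else 0) = (f J :: 'b::comm_monoid_add)"
proof -
  have "(\<Sum>J'\<in>k_subsets n K. if z \<in> cell T n w J' then f J' else 0) = (\<Sum>J'\<in>k_subsets n K. if J' = J then f J else 0)"
  proof (intro sum.cong refl)
    fix J' assume J': "J' \<in> k_subsets n K"
    show "(if z \<in> cell T n w J' then f J' else 0) = (if J' = J then f J else 0)"
    proof (cases "z \<in> cell T n w J'")
      case True
      then have "J' = J" by (rule cell_unique[OF J' J _ z])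
      then show ?thesis using z by simp
    next
      case False
      then have "J' \<noteq> J" using z by blast
      then show ?thesis using False by simp
    qed
  qed
  then show ?thesis using J finite_k_subsets by (simp add: sum.delta)
qed

lemma nbr_moment_cell:
  fixes T :: "(real ^ 'd) set"
  assumes J: "J \<in> k_subsets n K" and z: "z \<in> cell T n w J"
  shows "nbr_moment T n K L q z w = wnorm L J z w * ennreal ((1 + real n powr (1 / real CARD('d)) * rad J z w) ^ q)"
proof -
  have "nbr_moment T n K L q z w = (\<Sum>J'\<in>k_subsets n K. if z \<in> cell T n w J' then
      wnorm L J' z w * ennreal ((1 + real n powr (1 / real CARD('d)) * rad J' z w) ^ q) else 0)"
    unfolding nbr_moment_def by (intro sum.cong refl) (simp add: indicator_def)
  then show ?thesis by (simp only: sum_cells[OF J z])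
qed

lemma cell_sets:
  fixes T :: "(real ^ 'd) set"
  assumes "T \<in> sets borel" "J \<subseteq> {1..n}"
  shows "cell T n w J \<in> sets borel"
  using measurable_cell[OF assms, of "\<lambda>z. z" borel "\<lambda>_. w"] by simp

lemma cell_subset: "cell T n w J \<subseteq> T"
  by (auto simp: cell_def)

text \<open>Shells of width 1/h: the shell m has volume of order ((m + 1) / h)^d, and a decay of
  order d + 2 leaves the summable (m + 1)^(-2).\<close>

lemma decay_integral:
  assumes q: "q \<ge> CARD('d) + 2"
  shows "\<exists>C\<ge>0. \<forall>h>0. \<forall>w :: real ^ 'd. (\<integral>\<^sup>+z. ennreal (1 / (1 + h * norm (z - w)) ^ q) \<partial>lborel) \<le> ennreal (C / h ^ CARD('d))"
proof -
  let ?d = "CARD('d)"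
  define V :: real where "V = unit_ball_vol (real ?d)"
  define Q where "Q = (\<Sum>m. 1 / real (Suc m) ^ 2)"
  have V: "V \<ge> 0" by (simp add: V_def)
  have sm: "summable (\<lambda>m. 1 / real (Suc m) ^ 2)"
    using inverse_power_summable[of 2, where ?'a=real] by (subst summable_Suc_iff) (simp add: divide_inverse)
  have Q: "Q \<ge> 0" unfolding Q_def by (intro suminf_nonneg sm) auto
  have "(\<integral>\<^sup>+z. ennreal (1 / (1 + h * norm (z - w)) ^ q) \<partial>lborel) \<le> ennreal (V * Q / h ^ ?d)"
    if h: "h > 0" for h and w :: "real ^ 'd"
  proof -
    have [measurable]: "cball w r \<in> sets borel" for r by simp
    have "(\<integral>\<^sup>+z. ennreal (1 / (1 + h * norm (z - w)) ^ q) \<partial>lborel)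
      \<le> (\<integral>\<^sup>+z. (\<Sum>m. ennreal (1 / real (Suc m) ^ (?d + 2)) * indicator (cball w (real (Suc m) / h)) z) \<partial>lborel)"
    proof (rule nn_integral_mono)
      fix z
      define t where "t = h * norm (z - w)"
      have t0: "t \<ge> 0" using h by (simp add: t_def)
      define m where "m = nat \<lfloor>t\<rfloor>"
      have "real m = real_of_int \<lfloor>t\<rfloor>" using t0 by (simp add: m_def)
      then have m: "real m \<le> t" "t \<le> real (Suc m)" by linarith+
      have "1 / (1 + t) ^ q \<le> 1 / real (Suc m) ^ (?d + 2)"
      proof -
        have "real (Suc m) ^ (?d + 2) \<le> (1 + t) ^ (?d + 2)" using m by (intro power_mono) auto
        also have "\<dots> \<le> (1 + t) ^ q" using t0 q by (intro power_increasing) auto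
        finally show ?thesis by (intro divide_left_mono) (use t0 in \<open>auto intro!: mult_pos_pos\<close>)
      qed
      moreover have "z \<in> cball w (real (Suc m) / h)"
      proof -
        have "norm (z - w) \<le> real (Suc m) / h" using m(2) h by (simp add: t_def field_simps)
        then show ?thesis by (simp add: dist_norm norm_minus_commute del: of_nat_Suc)
      qed
      ultimately have "ennreal (1 / (1 + t) ^ q) \<le> (\<Sum>m\<in>{m}. ennreal (1 / real (Suc m) ^ (?d + 2)) * indicator (cball w (real (Suc m) / h)) z)"
        by (simp add: ennreal_leI del: of_nat_Suc mem_cball)
      also have "\<dots> \<le> (\<Sum>m. ennreal (1 / real (Suc m) ^ (?d + 2)) * indicator (cball w (real (Suc m) / h)) z)"
        by (rule sum_le_suminf) auto
      finally show "ennreal (1 / (1 + h * norm (z - w)) ^ q) \<le> (\<Sum>m. ennreal (1 / real (Suc m) ^ (?d + 2)) * indicator (cball w (real (Suc m) / h)) z)"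
        unfolding t_def .
    qed
    also have "\<dots> = (\<Sum>m. ennreal (1 / real (Suc m) ^ (?d + 2)) * emeasure lborel (cball w (real (Suc m) / h)))"
      by (subst nn_integral_suminf, measurable) (simp only: nn_integral_cmult_indicator lborelD \<open>\<And>r. cball w r \<in> sets borel\<close> sets_lborel)
    also have "\<dots> = (\<Sum>m. ennreal (V / h ^ ?d * (1 / real (Suc m) ^ 2)))"
    proof (rule arg_cong[where f=suminf], rule ext)
      fix m
      have "ennreal (1 / real (Suc m) ^ (?d + 2)) * emeasure lborel (cball w (real (Suc m) / h))
        = ennreal (1 / real (Suc m) ^ (?d + 2) * (V * (real (Suc m) / h) ^ ?d))"
      proof -
        have "emeasure lborel (cball w (real (Suc m) / h)) = ennreal (V * (real (Suc m) / h) ^ ?d)"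
          using h by (simp add: emeasure_cball V_def del: of_nat_Suc)
        then show ?thesis using h V by (simp only:) (rule ennreal_mult[symmetric], auto)
      qed
      also have "1 / real (Suc m) ^ (?d + 2) * (V * (real (Suc m) / h) ^ ?d) = V / h ^ ?d * (1 / real (Suc m) ^ 2)"
        by (simp add: power_divide power_add power2_eq_square del: of_nat_Suc)
      finally show "ennreal (1 / real (Suc m) ^ (?d + 2)) * emeasure lborel (cball w (real (Suc m) / h)) = ennreal (V / h ^ ?d * (1 / real (Suc m) ^ 2))" .
    qed
    also have "\<dots> = ennreal (V / h ^ ?d * Q)"
    proof -
      have "(\<Sum>m. ennreal (V / h ^ ?d * (1 / real (Suc m) ^ 2))) = ennreal (\<Sum>m. V / h ^ ?d * (1 / real (Suc m) ^ 2))"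
        using V h by (intro suminf_ennreal2 summable_mult sm) simp
      then show ?thesis unfolding Q_def suminf_mult[OF sm] .
    qed
    finally show ?thesis by (simp add: mult.commute)
  qed
  then show ?thesis using V Q by (intro exI[of _ "V * Q"]) auto
qed

lemma k_smallest_exists:
  fixes D :: "nat \<Rightarrow> real"
  assumes "inj_on D {1..n}" "K \<le> n"
  shows "\<exists>J\<in>k_subsets n K. \<forall>j\<in>J. \<forall>k\<in>{1..n} - J. D j < D k"
  using assms(2)
proof (induction K)
  case 0
  then show ?case by (intro bexI[of _ "{}"]) (auto simp: k_subsets_def)
next
  case (Suc K)
  then obtain J where J: "J \<in> k_subsets n K" "\<forall>j\<in>J. \<forall>k\<in>{1..n} - J. D j < D k" by auto
  have fJ: "finite J" "J \<subseteq> {1..n}" "card J = K" using J by (auto simp: k_subsets_def intro: finite_subset)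
  have ne: "{1..n} - J \<noteq> {}"
  proof
    assume "{1..n} - J = {}"
    then have "card {1..n} \<le> card J" using fJ by (intro card_mono) auto
    then show False using Suc.prems fJ by simp
  qed
  define A where "A = {1..n} - J"
  have A: "finite A" "A \<noteq> {}" using ne by (auto simp: A_def)
  have "Min (D ` A) \<in> D ` A" using A by (intro Min_in) auto
  then obtain i where i0: "Min (D ` A) = D i" "i \<in> A" by (rule imageE)
  have i: "i \<in> {1..n} - J" "\<And>k. k \<in> {1..n} - J \<Longrightarrow> D i \<le> D k"
  proof -
    show "i \<in> {1..n} - J" using i0(2) by (simp add: A_def)
    fix k assume "k \<in> {1..n} - J"
    then have "Min (D ` A) \<le> D k" using A(1) by (intro Min_le) (auto simp: A_def)
    then show "D i \<le> D k" unfolding i0(1) .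
  qed
  have lt: "D i < D k" if "k \<in> {1..n} - insert i J" for k
  proof -
    have "D i \<noteq> D k" using assms(1) that i(1) by (auto dest: inj_onD)
    then show ?thesis using i(2)[of k] that by auto
  qed
  show ?case
  proof (rule bexI[of _ "insert i J"])
    show "insert i J \<in> k_subsets n (Suc K)" using fJ i by (auto simp: k_subsets_def)
    show "\<forall>j\<in>insert i J. \<forall>k\<in>{1..n} - insert i J. D j < D k" using J(2) lt by auto
  qed
qed

text \<open>Equal distance to two distinct design points confines z to their bisecting hyperplane, a
  null set; off these finitely many hyperplanes the K smallest distances determine a cell.\<close>

lemma AE_in_cell:
  fixes w :: "nat \<Rightarrow> real ^ 'd"
  assumes inj: "inj_on w {1..n}" and K: "K \<le> n"
  shows "AE z in lborel. z \<in> T \<longrightarrow> (\<exists>J\<in>k_subsets n K. z \<in> cell T n w J)"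
proof -
  have tie: "AE z in lborel. norm (z - w i) \<noteq> norm (z - w k)" if ne: "w i \<noteq> w k" for i k
  proof -
    have "negligible {z. (2 *\<^sub>R (w k - w i)) \<bullet> z = (norm (w k))\<^sup>2 - (norm (w i))\<^sup>2}"
      using ne by (intro negligible_hyperplane) auto
    then have "{z. (2 *\<^sub>R (w k - w i)) \<bullet> z = (norm (w k))\<^sup>2 - (norm (w i))\<^sup>2} \<in> null_sets lebesgue"
      using negligible_iff_null_sets by blast
    then have "AE z in lebesgue. z \<notin> {z. (2 *\<^sub>R (w k - w i)) \<bullet> z = (norm (w k))\<^sup>2 - (norm (w i))\<^sup>2}"
      by (rule AE_not_in)
    then have "AE z in lborel. z \<notin> {z. (2 *\<^sub>R (w k - w i)) \<bullet> z = (norm (w k))\<^sup>2 - (norm (w i))\<^sup>2}"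
      by (rule AE_completion_iff[THEN iffD1])
    then show ?thesis
    proof eventually_elim
      case (elim z)
      show ?case
      proof
        assume "norm (z - w i) = norm (z - w k)"
        then have "(norm (z - w i))\<^sup>2 = (norm (z - w k))\<^sup>2" by simp
        then have "(2 *\<^sub>R (w k - w i)) \<bullet> z = (norm (w k))\<^sup>2 - (norm (w i))\<^sup>2"
          by (simp add: power2_norm_eq_inner algebra_simps inner_commute)
        then show False using elim by simp
      qed
    qed
  qed
  have "AE z in lborel. \<forall>i\<in>{1..n}. \<forall>k\<in>{1..n}. i \<noteq> k \<longrightarrow> norm (z - w i) \<noteq> norm (z - w k)"
  proof (intro AE_finite_allI)
    fix i k assume ik: "i \<in> {1..n}" "k \<in> {1..n}"
    show "AE z in lborel. i \<noteq> k \<longrightarrow> norm (z - w i) \<noteq> norm (z - w k)"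
    proof (cases "i = k")
      case False
      then have "w i \<noteq> w k" using inj ik by (auto dest: inj_onD)
      from tie[OF this] show ?thesis by eventually_elim simp
    qed simp
  qed auto
  then show ?thesis
  proof eventually_elim
    case (elim z)
    then have "inj_on (\<lambda>i. norm (z - w i)) {1..n}" unfolding inj_on_def by blast
    then obtain J where "J \<in> k_subsets n K" "\<forall>j\<in>J. \<forall>k\<in>{1..n} - J. norm (z - w j) < norm (z - w k)"
      using k_smallest_exists[OF _ K] by blast
    then show ?case by (auto simp: cell_def)
  qed
qed

section \<open>Weights integrated over the evaluation point\<close>

definition nbr_mass :: "(real ^ 'd) set \<Rightarrow> nat \<Rightarrow> nat \<Rightarrow> nat \<Rightarrow> nat \<Rightarrow> (nat \<Rightarrow> real ^ 'd) \<Rightarrow> ennreal" where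
  "nbr_mass T n K L q w = (\<integral>\<^sup>+z. nbr_moment T n K L q z w \<partial>lborel)"

definition cell_wgt :: "(real ^ 'd) set \<Rightarrow> nat \<Rightarrow> nat \<Rightarrow> nat set \<Rightarrow> (nat \<Rightarrow> real ^ 'd) \<Rightarrow> nat \<Rightarrow> real ^ 'd \<Rightarrow> real" where
  "cell_wgt T n L J w i z = indicator (cell T n w J) z * wgt L J z w (w i)"

definition avg_wgt :: "(real ^ 'd) set \<Rightarrow> nat \<Rightarrow> nat \<Rightarrow> nat \<Rightarrow> nat \<Rightarrow> (nat \<Rightarrow> real ^ 'd) \<Rightarrow> real" where
  "avg_wgt T n K L i w = (\<Sum>J\<in>{J\<in>k_subsets n K. i \<in> J}. LINT z|lborel. cell_wgt T n L J w i z)"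

context
  fixes T :: "(real ^ 'd) set" and n K L q :: nat and w :: "nat \<Rightarrow> real ^ 'd"
  assumes T [measurable]: "T \<in> sets borel" and Tf: "emeasure lborel T < \<infinity>" and K: "K > 0" "n \<ge> K"
    and fin: "nbr_mass T n K L q w < \<infinity>"
begin

lemma nbr_moment_measurable [measurable]: "(\<lambda>z. nbr_moment T n K L q z w) \<in> borel_measurable borel"
  by (rule measurable_nbr_moment[OF T K(1)]) auto

lemma wnorm_le_moment:
  assumes J: "J \<in> k_subsets n K" and z: "z \<in> cell T n w J"
  shows "wnorm L J z w \<le> nbr_moment T n K L q z w"
proof -
  have "rad J z w \<ge> 0" using k_subsetsD[OF J K(1)] by (intro rad_nonneg)
  then have "(1::real) \<le> (1 + real n powr (1 / real CARD('d)) * rad J z w) ^ q" by (intro one_le_power) simp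
  then have "wnorm L J z w * ennreal 1 \<le> wnorm L J z w * ennreal ((1 + real n powr (1 / real CARD('d)) * rad J z w) ^ q)"
    by (intro mult_left_mono ennreal_leI) auto
  then show ?thesis unfolding nbr_moment_cell[OF J z] by simp
qed

text \<open>A finite integral of the neighbour moment forces it to be finite almost everywhere,
  which excludes the value infinity that \<open>wnorm\<close> has on singular
  configurations.\<close>

lemma AE_regular: "AE z in lborel. \<forall>J\<in>k_subsets n K. z \<in> cell T n w J \<longrightarrow> det_on (multi_indices L) (gram J z w) \<noteq> 0"
proof -
  have "AE z in lborel. nbr_moment T n K L q z w \<noteq> \<infinity>"
    by (rule nn_integral_PInf_AE) (use fin in \<open>auto simp: nbr_mass_def\<close>)
  then show ?thesis
  proof eventually_elim
    case (elim z)
    show ?case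
    proof (intro ballI impI notI)
      fix J assume J: "J \<in> k_subsets n K" "z \<in> cell T n w J" "det_on (multi_indices L) (gram J z w) = 0"
      then have "wnorm L J z w = \<infinity>" by (simp add: wnorm_def)
      then show False using wnorm_le_moment[OF J(1,2)] elim by (simp add: top_unique)
    qed
  qed
qed

lemma cell_wgt_measurable [measurable]:
  assumes J: "J \<in> k_subsets n K"
  shows "cell_wgt T n L J w i \<in> borel_measurable borel"
proof -
  have [measurable]: "cell T n w J \<in> sets borel" using k_subsetsD[OF J K(1)] by (intro cell_sets T)
  have [measurable]: "(\<lambda>z. wgt L J z w (w i)) \<in> borel_measurable borel"
    using measurable_wgt[of "\<lambda>z. z" borel J "\<lambda>_. w" "\<lambda>_. w i" L] by simp
  show ?thesis unfolding cell_wgt_def by measurable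
qed

lemma cell_wgt_square:
  assumes J: "J \<in> k_subsets n K" and z: "z \<in> cell T n w J"
  shows "ennreal (\<Sum>i\<in>J. (cell_wgt T n L J w i z)\<^sup>2) \<le> wnorm L J z w"
  using z by (simp add: cell_wgt_def wnorm_def)

text \<open>On the set T of finite measure |x| is at most 1 + x^2, and the squares are dominated by
  the neighbour moment.\<close>

lemma cell_wgt_integrable:
  assumes J: "J \<in> k_subsets n K" and i: "i \<in> J"
  shows "integrable lborel (cell_wgt T n L J w i)"
proof (rule integrableI_bounded)
  show "cell_wgt T n L J w i \<in> borel_measurable lborel" using cell_wgt_measurable[OF J] by simp
  have "(\<integral>\<^sup>+z. ennreal (norm (cell_wgt T n L J w i z)) \<partial>lborel) \<le> (\<integral>\<^sup>+z. indicator T z + nbr_moment T n K L q z w \<partial>lborel)"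
  proof (rule nn_integral_mono)
    fix z
    show "ennreal (norm (cell_wgt T n L J w i z)) \<le> indicator T z + nbr_moment T n K L q z w"
    proof (cases "z \<in> cell T n w J")
      case True
      define x where "x = cell_wgt T n L J w i z"
      have "2 * \<bar>x\<bar> \<le> 1 + x\<^sup>2" using sum_squares_bound[of 1 "\<bar>x\<bar>"] by simp
      then have "\<bar>x\<bar> \<le> 1 + x\<^sup>2" by (smt (verit) abs_ge_zero)
      then have "ennreal \<bar>x\<bar> \<le> ennreal (1 + x\<^sup>2)" by (rule ennreal_leI)
      also have "\<dots> = ennreal 1 + ennreal (x\<^sup>2)" by (rule ennreal_plus) auto
      also have "ennreal (x\<^sup>2) \<le> ennreal (\<Sum>i\<in>J. (cell_wgt T n L J w i z)\<^sup>2)"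
        unfolding x_def using i k_subsetsD[OF J K(1)] by (intro ennreal_leI member_le_sum) auto
      also have "\<dots> \<le> nbr_moment T n K L q z w"
        using cell_wgt_square[OF J True] wnorm_le_moment[OF J True] by (rule order_trans)
      also have "ennreal 1 = indicator T z" using True cell_subset[of T n w J] by auto
      finally show ?thesis by (simp add: x_def add_left_mono)
    qed (simp add: cell_wgt_def)
  qed
  also have "\<dots> = emeasure lborel T + nbr_mass T n K L q w"
    by (subst nn_integral_add) (auto simp: nbr_mass_def)
  also have "\<dots> < \<infinity>" using Tf fin by simp
  finally show "(\<integral>\<^sup>+z. ennreal (norm (cell_wgt T n L J w i z)) \<partial>lborel) < \<infinity>" .
qed

lemma avg_wgt_swap:
  "(\<Sum>i\<in>{1..n}. c i * complex_of_real (avg_wgt T n K L i w)) = (\<Sum>J\<in>k_subsets n K. \<Sum>i\<in>J. c i * complex_of_real (LINT z|lborel. cell_wgt T n L J w i z))"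
proof -
  have "(\<Sum>i\<in>{1..n}. c i * complex_of_real (avg_wgt T n K L i w))
     = (\<Sum>i\<in>{1..n}. \<Sum>J\<in>{J\<in>k_subsets n K. i \<in> J}. c i * complex_of_real (LINT z|lborel. cell_wgt T n L J w i z))"
    by (simp add: avg_wgt_def sum_distrib_left)
  also have "\<dots> = (\<Sum>J\<in>k_subsets n K. \<Sum>i\<in>{i\<in>{1..n}. i \<in> J}. c i * complex_of_real (LINT z|lborel. cell_wgt T n L J w i z))"
    by (rule sum.swap_restrict) (auto simp: finite_k_subsets)
  also have "\<dots> = (\<Sum>J\<in>k_subsets n K. \<Sum>i\<in>J. c i * complex_of_real (LINT z|lborel. cell_wgt T n L J w i z))"
    using k_subsetsD(3)[OF _ K(1)] by (intro sum.cong refl) blast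
  finally show ?thesis .
qed

lemma Psi_hat_eq:
  "Psi_hat T n K L u w j = (\<Sum>i\<in>{1..n}. (complex_of_real (u i) * fchar j (w i)) * complex_of_real (avg_wgt T n K L i w))"
proof -
  have "(LINT z:cell T n w J|lborel. (\<Sum>i\<in>J. (complex_of_real (u i) * fchar j (w i)) * complex_of_real (lp_weight T n K L w z (w i))))
     = (\<Sum>i\<in>J. (complex_of_real (u i) * fchar j (w i)) * complex_of_real (LINT z|lborel. cell_wgt T n L J w i z))"
    if J: "J \<in> k_subsets n K" for J
  proof -
    have [measurable]: "cell T n w J \<in> sets borel" using k_subsetsD[OF J K(1)] by (intro cell_sets T)
    have i: "integrable lborel (\<lambda>z. (complex_of_real (u i) * fchar j (w i)) * complex_of_real (cell_wgt T n L J w i z))" if "i \<in> J" for i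
      by (rule integrable_mult_right, rule integrable_of_real, rule cell_wgt_integrable[OF J that])
    have ae: "AE z in lborel. indicator (cell T n w J) z *\<^sub>R (\<Sum>i\<in>J. (complex_of_real (u i) * fchar j (w i)) * complex_of_real (lp_weight T n K L w z (w i)))
      = (\<Sum>i\<in>J. (complex_of_real (u i) * fchar j (w i)) * complex_of_real (cell_wgt T n L J w i z))"
      using AE_regular
    proof eventually_elim
      case (elim z)
      show ?case
      proof (cases "z \<in> cell T n w J")
        case True
        then have "det_on (multi_indices L) (gram J z w) \<noteq> 0" using elim J by blast
        then show ?thesis using True by (simp add: cell_wgt_def lp_weight_eq[OF J True])
      qed (simp add: cell_wgt_def)
    qed
    \<comment> \<open>A measurable representative of the weight on the cell, including its singular
      points; changing the integrand on a null set requires both versions to be measurable.\<close>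
    define lw where "lw i z = (if det_on (multi_indices L) (gram J z w) = 0
      then \<Sum>\<kappa>\<in>multi_indices L. singular_inv 0 \<kappa> * xi z (w i) \<kappa> else wgt L J z w (w i))" for i z
    have [measurable]: "(\<lambda>z. det_on (multi_indices L) (gram J z w)) \<in> borel_measurable borel"
      by (intro measurable_det_on finite_multi_indices measurable_gram) auto
    have [measurable]: "(\<lambda>z. wgt L J z w (w i)) \<in> borel_measurable borel" for i
      using measurable_wgt[of "\<lambda>z. z" borel J "\<lambda>_. w" "\<lambda>_. w i" L] by simp
    have [measurable]: "(\<lambda>z. xi z (w i) \<kappa>) \<in> borel_measurable borel" for i \<kappa>
      using measurable_xi[of "\<lambda>z. z" borel "\<lambda>_. w i"] by simp
    have [measurable]: "lw i \<in> borel_measurable borel" for i unfolding lw_def by measurable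
    have lwe: "indicator (cell T n w J) z *\<^sub>R (\<Sum>i\<in>J. (complex_of_real (u i) * fchar j (w i)) * complex_of_real (lp_weight T n K L w z (w i)))
       = indicator (cell T n w J) z *\<^sub>R (\<Sum>i\<in>J. (complex_of_real (u i) * fchar j (w i)) * complex_of_real (lw i z))" for z
      by (cases "z \<in> cell T n w J") (simp_all add: lw_def lp_weight_eq[OF J])
    have sm: "(\<lambda>z. \<Sum>i\<in>J. (complex_of_real (u i) * fchar j (w i)) * complex_of_real (cell_wgt T n L J w i z)) \<in> borel_measurable lborel"
      using cell_wgt_measurable[OF J] by measurable
    have sm2: "(\<lambda>z. indicator (cell T n w J) z *\<^sub>R (\<Sum>i\<in>J. (complex_of_real (u i) * fchar j (w i)) * complex_of_real (lw i z))) \<in> borel_measurable lborel"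
      by measurable
    have "(LINT z:cell T n w J|lborel. (\<Sum>i\<in>J. (complex_of_real (u i) * fchar j (w i)) * complex_of_real (lp_weight T n K L w z (w i))))
      = (LINT z|lborel. (\<Sum>i\<in>J. (complex_of_real (u i) * fchar j (w i)) * complex_of_real (cell_wgt T n L J w i z)))"
      unfolding set_lebesgue_integral_def lwe
      by (rule integral_cong_AE[OF sm2 sm]) (use ae[unfolded lwe] in simp)
    also have "\<dots> = (\<Sum>i\<in>J. (complex_of_real (u i) * fchar j (w i)) * complex_of_real (LINT z|lborel. cell_wgt T n L J w i z))"
      by (subst Bochner_Integration.integral_sum, rule i, assumption) (simp add: integral_complex_of_real)
    finally show ?thesis .
  qed
  then show ?thesis unfolding Psi_hat_def avg_wgt_swap by (intro sum.cong refl)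
qed

end

section \<open>Dependence on the sample through the indices 1 to n\<close>

lemma sum_cell_wgt:
  "(\<Sum>J\<in>{J\<in>k_subsets n K. i \<in> J}. cell_wgt T n L J w i z) =
    (\<Sum>J\<in>k_subsets n K. if z \<in> cell T n w J then (if i \<in> J then wgt L J z w (w i) else 0) else 0)"
  unfolding sum.inter_filter[OF finite_k_subsets]
  by (intro sum.cong refl) (simp add: cell_wgt_def)

lemma cell_cong:
  assumes "\<And>j. j \<in> {1..n} \<Longrightarrow> w j = w' j" and J: "J \<subseteq> {1..n}"
  shows "cell T n w J = cell T n w' J"
  unfolding cell_def
proof (rule Collect_cong)
  fix z
  have "(\<forall>j\<in>J. \<forall>k\<in>{1..n} - J. norm (z - w j) < norm (z - w k)) \<longleftrightarrow> (\<forall>j\<in>J. \<forall>k\<in>{1..n} - J. norm (z - w' j) < norm (z - w' k))"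
  proof (intro ball_cong refl)
    fix j k assume "j \<in> J" "k \<in> {1..n} - J"
    then have "w j = w' j" "w k = w' k" using J by (auto intro!: assms(1))
    then show "(norm (z - w j) < norm (z - w k)) = (norm (z - w' j) < norm (z - w' k))" by simp
  qed
  then show "(z \<in> T \<and> (\<forall>j\<in>J. \<forall>k\<in>{1..n} - J. norm (z - w j) < norm (z - w k))) = (z \<in> T \<and> (\<forall>j\<in>J. \<forall>k\<in>{1..n} - J. norm (z - w' j) < norm (z - w' k)))"
    by simp
qed

lemma avg_wgt_cong:
  assumes "\<And>j. j \<in> {1..n} \<Longrightarrow> w j = w' j" "K > 0"
  shows "avg_wgt T n K L i w = avg_wgt T n K L i w'"
proof -
  have "cell_wgt T n L J w i z = cell_wgt T n L J w' i z" if J: "J \<in> k_subsets n K" "i \<in> J" for J z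
  proof -
    have s: "J \<subseteq> {1..n}" using k_subsetsD[OF J(1) assms(2)] by blast
    then have e: "j \<in> J \<Longrightarrow> w j = w' j" for j using assms(1) by blast
    have "cell T n w J = cell T n w' J" by (rule cell_cong[OF assms(1) s])
    moreover have "gram J z w = gram J z w'" unfolding gram_def by (intro ext sum.cong refl) (simp only: e)
    ultimately show ?thesis by (simp only: cell_wgt_def wgt_def e[OF J(2)])
  qed
  then show ?thesis unfolding avg_wgt_def
    by (intro sum.cong refl arg_cong[where f="integral\<^sup>L lborel"] ext) blast
qed

lemma nbr_mass_cong:
  fixes w w' :: "nat \<Rightarrow> real ^ 'd"
  assumes "\<And>j. j \<in> {1..n} \<Longrightarrow> w j = w' j" "K > 0"
  shows "nbr_mass T n K L q w = nbr_mass T n K L q w'"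
proof -
  have "nbr_moment T n K L q z w = nbr_moment T n K L q z w'" for z
    unfolding nbr_moment_def
  proof (intro sum.cong refl)
    fix J assume J: "J \<in> k_subsets n K"
    have s: "J \<subseteq> {1..n}" using k_subsetsD[OF J(1) assms(2)] by blast
    then have e: "j \<in> J \<Longrightarrow> w j = w' j" for j using assms(1) by blast
    have c: "cell T n w J = cell T n w' J" by (rule cell_cong[OF assms(1) s])
    have g: "gram J z w = gram J z w'" unfolding gram_def by (intro ext sum.cong refl) (simp only: e)
    have s: "(\<Sum>j\<in>J. (wgt L J z w (w j))\<^sup>2) = (\<Sum>j\<in>J. (wgt L J z w' (w' j))\<^sup>2)"
      by (intro sum.cong refl) (simp only: wgt_def g e)
    have r: "rad J z w = rad J z w'" by (rule rad_cong) (rule e)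
    show "indicator (cell T n w J) z * (wnorm L J z w * ennreal ((1 + real n powr (1 / real CARD('d)) * rad J z w) ^ q)) =
       indicator (cell T n w' J) z * (wnorm L J z w' * ennreal ((1 + real n powr (1 / real CARD('d)) * rad J z w') ^ q))"
      unfolding c r wnorm_def g s ..
  qed
  then show ?thesis unfolding nbr_mass_def by simp
qed

lemma measurable_avg_wgt:
  fixes T :: "(real ^ 'd) set"
  assumes T: "T \<in> sets borel" and K: "K > 0" and y: "\<And>j. j \<in> {1..n} \<Longrightarrow> (\<lambda>x. y x j) \<in> borel_measurable M"
  shows "(\<lambda>x. avg_wgt T n K L i (y x)) \<in> borel_measurable M"
  unfolding avg_wgt_def
proof (intro borel_measurable_sum lborel.borel_measurable_lebesgue_integral)
  fix J assume "J \<in> {J\<in>k_subsets n K. i \<in> J}"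
  then have J: "J \<in> k_subsets n K" "i \<in> J" by auto
  note Jd = k_subsetsD[OF J(1) K]
  have y': "(\<lambda>p. y (fst p) j) \<in> borel_measurable (M \<Otimes>\<^sub>M lborel)" if "j \<in> {1..n}" for j
    by (rule measurable_compose[OF measurable_fst y[OF that]])
  have s: "snd \<in> borel_measurable (M \<Otimes>\<^sub>M (lborel :: (real ^ 'd) measure))" by measurable
  have [measurable]: "{p \<in> space (M \<Otimes>\<^sub>M lborel). snd p \<in> cell T n (y (fst p)) J} \<in> sets (M \<Otimes>\<^sub>M lborel)"
    by (rule measurable_cell[OF T Jd(3) s y'])
  have [measurable]: "(\<lambda>p. wgt L J (snd p) (y (fst p)) (y (fst p) i)) \<in> borel_measurable (M \<Otimes>\<^sub>M lborel)"
    by (rule measurable_wgt[OF s y' y']) (use Jd J in auto)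
  have "(\<lambda>p. if snd p \<in> cell T n (y (fst p)) J then wgt L J (snd p) (y (fst p)) (y (fst p) i) else 0) \<in> borel_measurable (M \<Otimes>\<^sub>M lborel)"
    by measurable
  then show "(\<lambda>(x, z). cell_wgt T n L J (y x) i z) \<in> borel_measurable (M \<Otimes>\<^sub>M lborel)"
    by (simp add: cell_wgt_def split_def indicator_def if_distrib if_distribR cong: if_cong)
qed

lemma measurable_nbr_mass:
  fixes T :: "(real ^ 'd) set"
  assumes T: "T \<in> sets borel" and K: "K > 0" and y: "\<And>j. j \<in> {1..n} \<Longrightarrow> (\<lambda>x. y x j) \<in> borel_measurable M"
  shows "(\<lambda>x. nbr_mass T n K L q (y x)) \<in> borel_measurable M"
  unfolding nbr_mass_def
proof (rule lborel.borel_measurable_nn_integral)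
  have y': "(\<lambda>p. y (fst p) j) \<in> borel_measurable (M \<Otimes>\<^sub>M lborel)" if "j \<in> {1..n}" for j
    by (rule measurable_compose[OF measurable_fst y[OF that]])
  have s: "snd \<in> borel_measurable (M \<Otimes>\<^sub>M (lborel :: (real ^ 'd) measure))" by measurable
  show "(\<lambda>(x, z). nbr_moment T n K L q z (y x)) \<in> borel_measurable (M \<Otimes>\<^sub>M lborel)"
    using measurable_nbr_moment[OF T K s y'] by (simp add: split_def)
qed

context
  fixes T :: "(real ^ 'd) set" and n K L q :: nat and w :: "nat \<Rightarrow> real ^ 'd"
  assumes T [measurable]: "T \<in> sets borel" and Tf: "emeasure lborel T < \<infinity>" and K: "K > 0" "n \<ge> K"
    and fin: "nbr_mass T n K L q w < \<infinity>"
begin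

lemmas cell_wgt_borel = cell_wgt_measurable[OF T Tf K fin]
lemmas cell_wgt_lborel_integrable = cell_wgt_integrable[OF T Tf K fin]

lemma nbr_moment_borel [measurable]: "(\<lambda>z. nbr_moment T n K L q z w) \<in> borel_measurable borel"
  by (rule nbr_moment_measurable[OF T Tf K fin])

text \<open>Cauchy-Schwarz with the weight \<open>(1 + n powr (1 / d) * norm (z - w i)) ^ q\<close>, whose reciprocal has
  integral of order \<open>1 / n\<close>.\<close>

lemma avg_wgt_square_sum:
  assumes C: "C \<ge> 0" "\<And>v :: real ^ 'd. (\<integral>\<^sup>+z. ennreal (1 / (1 + real n powr (1 / real CARD('d)) * norm (z - v)) ^ q) \<partial>lborel) \<le> ennreal C"
  shows "ennreal (\<Sum>i\<in>{1..n}. (avg_wgt T n K L i w)\<^sup>2) \<le> ennreal C * nbr_mass T n K L q w"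
proof -
  define h where "h = real n powr (1 / real CARD('d))"
  have h: "h \<ge> 0" by (simp add: h_def)
  define a where "a i z = (\<Sum>J\<in>{J\<in>k_subsets n K. i \<in> J}. cell_wgt T n L J w i z)" for i z
  have [measurable]: "a i \<in> borel_measurable borel" for i
    unfolding a_def by (intro borel_measurable_sum) (use cell_wgt_borel in auto)
  have A: "avg_wgt T n K L i w = (LINT z|lborel. a i z)" and ia: "integrable lborel (a i)" for i
  proof -
    show "integrable lborel (a i)" unfolding a_def by (intro Bochner_Integration.integrable_sum cell_wgt_lborel_integrable) auto
    show "avg_wgt T n K L i w = (LINT z|lborel. a i z)" unfolding a_def avg_wgt_def
      by (rule Bochner_Integration.integral_sum[symmetric]) (intro cell_wgt_lborel_integrable; simp)
  qed
  define om where "om i z = (1 + h * norm (z - w i)) ^ q" for i z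
  have om: "om i z > 0" for i z using h by (auto simp: om_def intro!: zero_less_power add_pos_nonneg)
  have [measurable]: "om i \<in> borel_measurable borel" for i unfolding om_def by measurable
  have 1: "ennreal ((avg_wgt T n K L i w)\<^sup>2) \<le> (\<integral>\<^sup>+z. ennreal ((a i z)\<^sup>2 * om i z) \<partial>lborel) * ennreal C" for i
  proof -
    have "ennreal \<bar>avg_wgt T n K L i w\<bar> \<le> (\<integral>\<^sup>+z. ennreal \<bar>a i z\<bar> \<partial>lborel)"
      using integral_norm_bound_ennreal[OF ia[of i]] by (simp add: A)
    also have "\<dots> = (\<integral>\<^sup>+z. ennreal (\<bar>a i z\<bar> * sqrt (om i z)) * ennreal (1 / sqrt (om i z)) \<partial>lborel)"
    proof (rule nn_integral_cong)
      fix z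
      have "\<bar>a i z\<bar> = \<bar>a i z\<bar> * sqrt (om i z) * (1 / sqrt (om i z))" using om[of i z] by simp
      then show "ennreal \<bar>a i z\<bar> = ennreal (\<bar>a i z\<bar> * sqrt (om i z)) * ennreal (1 / sqrt (om i z))"
        using om[of i z] by (subst ennreal_mult[symmetric]) auto
    qed
    finally have "(ennreal \<bar>avg_wgt T n K L i w\<bar>)\<^sup>2 \<le> (\<integral>\<^sup>+z. ennreal (\<bar>a i z\<bar> * sqrt (om i z)) * ennreal (1 / sqrt (om i z)) \<partial>lborel)\<^sup>2"
      by (intro power_mono) auto
    also have "\<dots> \<le> (\<integral>\<^sup>+z. (ennreal (\<bar>a i z\<bar> * sqrt (om i z)))\<^sup>2 \<partial>lborel) * (\<integral>\<^sup>+z. (ennreal (1 / sqrt (om i z)))\<^sup>2 \<partial>lborel)"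
      by (rule Cauchy_Schwarz_nn_integral) measurable
    also have "(\<integral>\<^sup>+z. (ennreal (\<bar>a i z\<bar> * sqrt (om i z)))\<^sup>2 \<partial>lborel) = (\<integral>\<^sup>+z. ennreal ((a i z)\<^sup>2 * om i z) \<partial>lborel)"
    proof (rule nn_integral_cong)
      fix z
      show "(ennreal (\<bar>a i z\<bar> * sqrt (om i z)))\<^sup>2 = ennreal ((a i z)\<^sup>2 * om i z)"
        using om[of i z] by (subst ennreal_power) (auto simp: power_mult_distrib)
    qed
    also have "(\<integral>\<^sup>+z. (ennreal (1 / sqrt (om i z)))\<^sup>2 \<partial>lborel) = (\<integral>\<^sup>+z. ennreal (1 / om i z) \<partial>lborel)"
    proof (rule nn_integral_cong)
      fix z
      show "(ennreal (1 / sqrt (om i z)))\<^sup>2 = ennreal (1 / om i z)"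
        using om[of i z] by (subst ennreal_power) (auto simp: power_divide)
    qed
    also have "(\<integral>\<^sup>+z. ennreal ((a i z)\<^sup>2 * om i z) \<partial>lborel) * (\<integral>\<^sup>+z. ennreal (1 / om i z) \<partial>lborel)
       \<le> (\<integral>\<^sup>+z. ennreal ((a i z)\<^sup>2 * om i z) \<partial>lborel) * ennreal C"
      using C(2)[of "w i"] by (intro mult_left_mono) (auto simp: om_def h_def)
    finally show ?thesis by (simp add: ennreal_power)
  qed
  have 2: "(\<Sum>i\<in>{1..n}. ennreal ((a i z)\<^sup>2 * om i z)) \<le> nbr_moment T n K L q z w" for z
  proof (cases "\<exists>J\<in>k_subsets n K. z \<in> cell T n w J")
    case False
    then have "a i z = 0" for i unfolding a_def sum_cell_wgt by (intro sum.neutral) auto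
    then show ?thesis by simp
  next
    case True
    then obtain J where J: "J \<in> k_subsets n K" "z \<in> cell T n w J" by blast
    note Jd = k_subsetsD[OF J(1) K(1)]
    have az: "a i z = (if i \<in> J then wgt L J z w (w i) else 0)" for i
      unfolding a_def sum_cell_wgt by (rule sum_cells[OF J])
    have r: "rad J z w \<ge> 0" using Jd by (intro rad_nonneg)
    define c where "c = (1 + h * rad J z w) ^ q"
    have c: "c \<ge> 0" using h r by (simp add: c_def)
    have "(\<Sum>i\<in>{1..n}. ennreal ((a i z)\<^sup>2 * om i z)) = ennreal (\<Sum>i\<in>{1..n}. (a i z)\<^sup>2 * om i z)"
      using om by (intro sum_ennreal) (simp add: less_imp_le)
    also have "(\<Sum>i\<in>{1..n}. (a i z)\<^sup>2 * om i z) \<le> (\<Sum>i\<in>{1..n}. if i \<in> J then (wgt L J z w (w i))\<^sup>2 * c else 0)"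
    proof (rule sum_mono)
      fix i assume "i \<in> {1..n}"
      show "(a i z)\<^sup>2 * om i z \<le> (if i \<in> J then (wgt L J z w (w i))\<^sup>2 * c else 0)"
      proof (cases "i \<in> J")
        case True
        \<comment> \<open>A neighbour of z is at distance at most the radius, so the Cauchy-Schwarz
          weight is dominated by the radius factor in \<open>nbr_moment\<close>.\<close>
        have "om i z \<le> c" unfolding om_def c_def using h rad_ge[OF Jd(1) True, of z w] by (intro power_mono add_left_mono mult_left_mono) auto
        then show ?thesis using True by (simp add: az mult_left_mono)
      qed (simp add: az)
    qed
    also have "\<dots> = (\<Sum>i\<in>J. (wgt L J z w (w i))\<^sup>2) * c"
    proof -
      have "(\<Sum>i\<in>{1..n}. if i \<in> J then (wgt L J z w (w i))\<^sup>2 * c else 0) = (\<Sum>i\<in>{1..n} \<inter> J. (wgt L J z w (w i))\<^sup>2 * c)"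
        by (rule sum.inter_restrict[symmetric]) simp
      also have "{1..n} \<inter> J = J" using Jd by blast
      finally show ?thesis by (simp add: sum_distrib_right)
    qed
    finally have "(\<Sum>i\<in>{1..n}. ennreal ((a i z)\<^sup>2 * om i z)) \<le> ennreal (\<Sum>i\<in>J. (wgt L J z w (w i))\<^sup>2) * ennreal c"
      using c by (simp add: ennreal_leI ennreal_mult' sum_nonneg)
    also have "\<dots> \<le> wnorm L J z w * ennreal c" by (intro mult_right_mono) (auto simp: wnorm_def)
    also have "\<dots> = nbr_moment T n K L q z w" unfolding nbr_moment_cell[OF J] c_def h_def ..
    finally show ?thesis .
  qed
  have "ennreal (\<Sum>i\<in>{1..n}. (avg_wgt T n K L i w)\<^sup>2) = (\<Sum>i\<in>{1..n}. ennreal ((avg_wgt T n K L i w)\<^sup>2))"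
    by (rule sum_ennreal[symmetric]) simp
  also have "\<dots> \<le> (\<Sum>i\<in>{1..n}. (\<integral>\<^sup>+z. ennreal ((a i z)\<^sup>2 * om i z) \<partial>lborel) * ennreal C)"
    by (intro sum_mono 1)
  also have "\<dots> = (\<integral>\<^sup>+z. (\<Sum>i\<in>{1..n}. ennreal ((a i z)\<^sup>2 * om i z)) \<partial>lborel) * ennreal C"
    by (subst nn_integral_sum) (auto simp: sum_distrib_right)
  also have "\<dots> \<le> nbr_mass T n K L q w * ennreal C"
    unfolding nbr_mass_def by (intro mult_right_mono nn_integral_mono 2) auto
  finally show ?thesis by (simp add: mult.commute)
qed

text \<open>The integral of r is compared with its local polynomial approximation pointwise in z;
  Cauchy-Schwarz over T and over the K weights brings in the squared weights, which
  \<open>nbr_mass\<close> controls.\<close>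

lemma avg_wgt_bias:
  fixes r :: "real ^ 'd \<Rightarrow> complex"
  assumes inj: "inj_on w {1..n}" and r: "integrable lborel r" "\<And>z. z \<notin> T \<Longrightarrow> r z = 0" and B: "B \<ge> 0"
    and loc: "\<And>z J. J \<in> k_subsets n K \<Longrightarrow> det_on (multi_indices L) (gram J z w) \<noteq> 0 \<Longrightarrow>
      cmod ((\<Sum>i\<in>J. complex_of_real (wgt L J z w (w i)) * r (w i)) - r z) \<le> B * (rad J z w ^ L * (\<Sum>i\<in>J. \<bar>wgt L J z w (w i)\<bar>))"
    and q: "q \<ge> 2 * L"
  shows "ennreal ((cmod ((\<Sum>i\<in>{1..n}. r (w i) * complex_of_real (avg_wgt T n K L i w)) - (LINT z|lborel. r z)))\<^sup>2)
    \<le> ennreal (B\<^sup>2 * real K / (real n powr (1 / real CARD('d))) ^ (2 * L)) * emeasure lborel T * nbr_mass T n K L q w"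
proof -
  define h where "h = real n powr (1 / real CARD('d))"
  have h: "h > 0" using K by (simp add: h_def)
  define G where "G z = (\<Sum>J\<in>k_subsets n K. \<Sum>i\<in>J. r (w i) * complex_of_real (cell_wgt T n L J w i z)) - r z" for z
  have [measurable]: "r \<in> borel_measurable lborel" using r(1) by (rule borel_measurable_integrable)
  have iG1: "integrable lborel (\<lambda>z. (\<Sum>J\<in>k_subsets n K. \<Sum>i\<in>J. r (w i) * complex_of_real (cell_wgt T n L J w i z)))"
    by (intro Bochner_Integration.integrable_sum integrable_mult_right integrable_of_real cell_wgt_lborel_integrable)
  have iG: "integrable lborel G" unfolding G_def by (intro Bochner_Integration.integrable_diff iG1 r)
  have [measurable]: "G \<in> borel_measurable lborel" using iG by (rule borel_measurable_integrable)
  have eq: "(\<Sum>i\<in>{1..n}. r (w i) * complex_of_real (avg_wgt T n K L i w)) - (LINT z|lborel. r z) = (LINT z|lborel. G z)"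
  proof -
    have "(LINT z|lborel. (\<Sum>J\<in>k_subsets n K. \<Sum>i\<in>J. r (w i) * complex_of_real (cell_wgt T n L J w i z)))
      = (\<Sum>J\<in>k_subsets n K. \<Sum>i\<in>J. r (w i) * complex_of_real (LINT z|lborel. cell_wgt T n L J w i z))"
    proof (subst Bochner_Integration.integral_sum)
      fix J assume J: "J \<in> k_subsets n K"
      show "integrable lborel (\<lambda>z. \<Sum>i\<in>J. r (w i) * complex_of_real (cell_wgt T n L J w i z))"
        by (intro Bochner_Integration.integrable_sum integrable_mult_right integrable_of_real cell_wgt_lborel_integrable J)
    next
      show "(\<Sum>J\<in>k_subsets n K. LINT z|lborel. (\<Sum>i\<in>J. r (w i) * complex_of_real (cell_wgt T n L J w i z)))
        = (\<Sum>J\<in>k_subsets n K. \<Sum>i\<in>J. r (w i) * complex_of_real (LINT z|lborel. cell_wgt T n L J w i z))"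
      proof (intro sum.cong refl)
        fix J assume J: "J \<in> k_subsets n K"
        have ii: "integrable lborel (\<lambda>z. r (w i) * complex_of_real (cell_wgt T n L J w i z))" if "i \<in> J" for i
          by (intro integrable_mult_right integrable_of_real cell_wgt_lborel_integrable J that)
        show "(LINT z|lborel. (\<Sum>i\<in>J. r (w i) * complex_of_real (cell_wgt T n L J w i z))) = (\<Sum>i\<in>J. r (w i) * complex_of_real (LINT z|lborel. cell_wgt T n L J w i z))"
          by (subst Bochner_Integration.integral_sum, rule ii, assumption) (simp add: integral_complex_of_real)
      qed
    qed
    then show ?thesis unfolding avg_wgt_swap[OF T Tf K fin] G_def
      by (simp add: Bochner_Integration.integral_diff[OF iG1 r(1)])
  qed
  have pt: "AE z in lborel. ennreal ((cmod (G z))\<^sup>2) \<le> ennreal (B\<^sup>2 * real K / h ^ (2 * L)) * nbr_moment T n K L q z w \<and> (z \<notin> T \<longrightarrow> G z = 0)"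
    using AE_regular[OF T Tf K fin] AE_in_cell[OF inj K(2), of T]
  proof eventually_elim
    case (elim z)
    show ?case
    proof (cases "z \<in> T")
      case False
      have "z \<notin> cell T n w J" for J using False by (auto simp: cell_def)
      then have "G z = 0" unfolding G_def by (simp add: cell_wgt_def r(2)[OF False])
      then show ?thesis by simp
    next
      case True
      then obtain J where J: "J \<in> k_subsets n K" "z \<in> cell T n w J" using elim by blast
      note Jd = k_subsetsD[OF J(1) K(1)]
      have d: "det_on (multi_indices L) (gram J z w) \<noteq> 0" using elim(1) J by blast
      have r0: "rad J z w \<ge> 0" using Jd by (intro rad_nonneg)
      have "(\<Sum>J\<in>k_subsets n K. \<Sum>i\<in>J. r (w i) * complex_of_real (cell_wgt T n L J w i z))
        = (\<Sum>J\<in>k_subsets n K. if z \<in> cell T n w J then (\<Sum>i\<in>J. complex_of_real (wgt L J z w (w i)) * r (w i)) else 0)"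
        by (intro sum.cong refl) (simp add: cell_wgt_def mult.commute)
      also have "\<dots> = (\<Sum>i\<in>J. complex_of_real (wgt L J z w (w i)) * r (w i))" by (rule sum_cells[OF J])
      finally have "cmod (G z) \<le> B * (rad J z w ^ L * (\<Sum>i\<in>J. \<bar>wgt L J z w (w i)\<bar>))"
        unfolding G_def using loc[OF J(1) d] by simp
      then have "(cmod (G z))\<^sup>2 \<le> (B * (rad J z w ^ L * (\<Sum>i\<in>J. \<bar>wgt L J z w (w i)\<bar>)))\<^sup>2"
        by (intro power_mono) auto
      also have "\<dots> = B\<^sup>2 * rad J z w ^ (2 * L) * (\<Sum>i\<in>J. \<bar>wgt L J z w (w i)\<bar>)\<^sup>2"
        by (simp add: power_mult_distrib power_mult[symmetric] mult.commute)
      also have "\<dots> \<le> B\<^sup>2 * rad J z w ^ (2 * L) * (real K * (\<Sum>i\<in>J. (wgt L J z w (w i))\<^sup>2))"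
      proof -
        have "(\<Sum>i\<in>J. \<bar>wgt L J z w (w i)\<bar>)\<^sup>2 \<le> (\<Sum>i\<in>J. 1\<^sup>2) * (\<Sum>i\<in>J. \<bar>wgt L J z w (w i)\<bar>\<^sup>2)"
          using Cauchy_Schwarz_ineq_sum[of "\<lambda>_. 1" "\<lambda>i. \<bar>wgt L J z w (w i)\<bar>" J] by simp
        then show ?thesis using r0 Jd(4) by (intro mult_left_mono) auto
      qed
      \<comment> \<open>Powers of the radius are traded for powers of 1/h; the exponent q at least 2
        * L makes the radius factor of \<open>nbr_moment\<close> large enough.\<close>
      also have "\<dots> \<le> B\<^sup>2 * ((1 + h * rad J z w) ^ q / h ^ (2 * L)) * (real K * (\<Sum>i\<in>J. (wgt L J z w (w i))\<^sup>2))"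
      proof -
        have "h ^ (2 * L) * rad J z w ^ (2 * L) = (h * rad J z w) ^ (2 * L)" by (simp add: power_mult_distrib)
        also have "\<dots> \<le> (1 + h * rad J z w) ^ (2 * L)" using h r0 by (intro power_mono) auto
        also have "\<dots> \<le> (1 + h * rad J z w) ^ q" using h r0 q by (intro power_increasing) auto
        finally have "rad J z w ^ (2 * L) \<le> (1 + h * rad J z w) ^ q / h ^ (2 * L)" using h by (simp add: field_simps)
        then show ?thesis by (intro mult_right_mono mult_left_mono mult_nonneg_nonneg sum_nonneg) auto
      qed
      also have "\<dots> = (B\<^sup>2 * real K / h ^ (2 * L)) * ((\<Sum>i\<in>J. (wgt L J z w (w i))\<^sup>2) * (1 + h * rad J z w) ^ q)"
        by simp
      finally have "ennreal ((cmod (G z))\<^sup>2) \<le> ennreal ((B\<^sup>2 * real K / h ^ (2 * L)) * ((\<Sum>i\<in>J. (wgt L J z w (w i))\<^sup>2) * (1 + h * rad J z w) ^ q))"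
        by (rule ennreal_leI)
      also have "\<dots> = ennreal (B\<^sup>2 * real K / h ^ (2 * L)) * (ennreal (\<Sum>i\<in>J. (wgt L J z w (w i))\<^sup>2) * ennreal ((1 + h * rad J z w) ^ q))"
        using h r0 by (subst ennreal_mult, simp, simp add: sum_nonneg, subst ennreal_mult) (auto simp: sum_nonneg)
      also have "\<dots> = ennreal (B\<^sup>2 * real K / h ^ (2 * L)) * nbr_moment T n K L q z w"
        unfolding nbr_moment_cell[OF J] h_def[symmetric] wnorm_def using d by simp
      finally show ?thesis using True by simp
    qed
  qed
  have "ennreal (cmod (LINT z|lborel. G z)) \<le> (\<integral>\<^sup>+z. ennreal (cmod (G z)) \<partial>lborel)"
    by (rule integral_norm_bound_ennreal[OF iG])
  also have "\<dots> = (\<integral>\<^sup>+z. indicator T z * ennreal (cmod (G z)) \<partial>lborel)"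
  proof (rule nn_integral_cong_AE)
    show "AE z in lborel. ennreal (cmod (G z)) = indicator T z * ennreal (cmod (G z))"
      using pt by eventually_elim (auto simp: indicator_def)
  qed
  finally have "(ennreal (cmod (LINT z|lborel. G z)))\<^sup>2 \<le> (\<integral>\<^sup>+z. indicator T z * ennreal (cmod (G z)) \<partial>lborel)\<^sup>2"
    by (intro power_mono) auto
  also have "\<dots> \<le> (\<integral>\<^sup>+z. (indicator T z)\<^sup>2 \<partial>lborel) * (\<integral>\<^sup>+z. (ennreal (cmod (G z)))\<^sup>2 \<partial>lborel)"
    by (rule Cauchy_Schwarz_nn_integral) measurable
  also have "(\<integral>\<^sup>+z. (indicator T z)\<^sup>2 \<partial>lborel) = emeasure lborel T"
  proof -
    have "(\<integral>\<^sup>+z. (indicator T z)\<^sup>2 \<partial>lborel) = (\<integral>\<^sup>+z. indicator T z \<partial>lborel)"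
      by (rule nn_integral_cong) (simp add: indicator_def)
    then show ?thesis by simp
  qed
  finally have cs: "(ennreal (cmod (LINT z|lborel. G z)))\<^sup>2 \<le> emeasure lborel T * (\<integral>\<^sup>+z. (ennreal (cmod (G z)))\<^sup>2 \<partial>lborel)" .
  have "(\<integral>\<^sup>+z. (ennreal (cmod (G z)))\<^sup>2 \<partial>lborel) \<le> (\<integral>\<^sup>+z. ennreal (B\<^sup>2 * real K / h ^ (2 * L)) * nbr_moment T n K L q z w \<partial>lborel)"
  proof (rule nn_integral_mono_AE)
    show "AE z in lborel. (ennreal (cmod (G z)))\<^sup>2 \<le> ennreal (B\<^sup>2 * real K / h ^ (2 * L)) * nbr_moment T n K L q z w"
      using pt by eventually_elim (simp add: ennreal_power)
  qed
  also have "\<dots> = ennreal (B\<^sup>2 * real K / h ^ (2 * L)) * nbr_mass T n K L q w"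
    unfolding nbr_mass_def by (rule nn_integral_cmult) measurable
  finally have "emeasure lborel T * (\<integral>\<^sup>+z. (ennreal (cmod (G z)))\<^sup>2 \<partial>lborel) \<le> emeasure lborel T * (ennreal (B\<^sup>2 * real K / h ^ (2 * L)) * nbr_mass T n K L q w)"
    by (rule mult_left_mono) simp
  then have "(ennreal (cmod (LINT z|lborel. G z)))\<^sup>2 \<le> emeasure lborel T * (ennreal (B\<^sup>2 * real K / h ^ (2 * L)) * nbr_mass T n K L q w)"
    by (rule order_trans[OF cs])
  then show ?thesis unfolding eq h_def[symmetric] by (simp add: ennreal_power mult_ac)
qed

end

section \<open>Bounds on a frequency box and distinctness of the design points\<close>

lemma lnorm_freq_box:
  assumes "j \<in> (freq_box m :: (int ^ 'd) set)"
  shows "1 + lnorm j \<le> real (CARD('d) + 1) * real (Suc m)"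
proof -
  have "lnorm j \<le> (\<Sum>k\<in>UNIV. \<bar>real_of_int (j $ k)\<bar>)"
    unfolding lnorm_def using norm_le_l1_cart[of "(\<chi> k. real_of_int (j $ k))"] by simp
  also have "\<dots> \<le> (\<Sum>k\<in>(UNIV :: 'd set). real m)"
  proof (rule sum_mono)
    fix k
    have "j $ k \<in> {- int m..int m}" using assms by (auto simp: freq_box_def)
    then have "\<bar>j $ k\<bar> \<le> int m" by auto
    then show "\<bar>real_of_int (j $ k)\<bar> \<le> real m" by linarith
  qed
  finally have "lnorm j \<le> real CARD('d) * real m" by simp
  then show ?thesis by (simp add: algebra_simps)
qed

lemma card_freq_box_le: "real (card (freq_box m :: (int ^ 'd) set)) \<le> 2 ^ CARD('d) * real (Suc m) ^ CARD('d)"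
proof -
  have "real (2 * m + 1) ^ CARD('d) \<le> (2 * real (Suc m)) ^ CARD('d)" by (intro power_mono) auto
  then show ?thesis by (simp add: card_freq_box power_mult_distrib del: of_nat_Suc)
qed

text \<open>A tie of two independent observations means that one hits the value of the other, a
  point of mass zero. Distinct design points are what makes almost every z belong to a cell.\<close>

lemma AE_PiM_inj_on:
  fixes \<nu> :: "'b::{second_countable_topology, t2_space} measure" and I :: "'i set"
  assumes pr: "prob_space \<nu>" and s\<nu> [measurable_cong]: "sets \<nu> = sets borel" and pt: "\<And>x. emeasure \<nu> {x} = 0" and I: "finite I"
  shows "AE p in PiM I (\<lambda>_. \<nu>). inj_on p I"
proof -
  interpret prob_space \<nu> by (rule pr)
  interpret P: product_sigma_finite "\<lambda>_::'i. \<nu>" by unfold_locales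
  have ne: "AE p in PiM I (\<lambda>_. \<nu>). p i \<noteq> p k" if ik: "i \<in> I" "k \<in> I" "i \<noteq> k" for i k
  proof -
    define A where "A = {p \<in> space (PiM I (\<lambda>_. \<nu>)). p i = p k}"
    have [measurable]: "(\<lambda>p. p i) \<in> measurable (PiM I (\<lambda>_. \<nu>)) borel" "(\<lambda>p. p k) \<in> measurable (PiM I (\<lambda>_. \<nu>)) borel"
      using measurable_component_singleton[OF ik(1), of "\<lambda>_. \<nu>"] measurable_component_singleton[OF ik(2), of "\<lambda>_. \<nu>"]
      by (simp_all add: measurable_cong_sets[OF refl s\<nu>])
    have A [measurable]: "A \<in> sets (PiM I (\<lambda>_. \<nu>))" unfolding A_def by measurable
    have Ie: "I = insert i (I - {i})" using ik by blast
    have "emeasure (PiM I (\<lambda>_. \<nu>)) A = (\<integral>\<^sup>+p. indicator A p \<partial>PiM (insert i (I - {i})) (\<lambda>_. \<nu>))"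
      using Ie A by simp
    also have "\<dots> = (\<integral>\<^sup>+p. \<integral>\<^sup>+y. indicator A (p(i := y)) \<partial>\<nu> \<partial>PiM (I - {i}) (\<lambda>_. \<nu>))"
      by (rule P.product_nn_integral_insert) (use I A Ie in auto)
    also have "\<dots> \<le> (\<integral>\<^sup>+p. \<integral>\<^sup>+y. indicator {p k} y \<partial>\<nu> \<partial>PiM (I - {i}) (\<lambda>_. \<nu>))"
      using ik by (intro nn_integral_mono) (auto simp: A_def indicator_def)
    also have "\<dots> = (\<integral>\<^sup>+p. emeasure \<nu> {p k} \<partial>PiM (I - {i}) (\<lambda>_. \<nu>))"
      by (intro nn_integral_cong nn_integral_indicator) (simp add: s\<nu>)
    also have "\<dots> = 0" by (simp add: pt)
    finally have "emeasure (PiM I (\<lambda>_. \<nu>)) A = 0" by simp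
    then have "A \<in> null_sets (PiM I (\<lambda>_. \<nu>))" using A by auto
    then show ?thesis by (rule AE_I') (auto simp: A_def)
  qed
  have "AE p in PiM I (\<lambda>_. \<nu>). \<forall>i\<in>I. \<forall>k\<in>I. i \<noteq> k \<longrightarrow> p i \<noteq> p k"
  proof (intro AE_finite_allI I)
    fix i k assume "i \<in> I" "k \<in> I"
    then show "AE p in PiM I (\<lambda>_. \<nu>). i \<noteq> k \<longrightarrow> p i \<noteq> p k" using ne[of i k] by (cases "i = k") auto
  qed
  then show ?thesis by eventually_elim (auto simp: inj_on_def)
qed

context berkson_fourier
begin

text \<open>The squared noise part of \<open>Psi_hat\<close> for a real test function \<psi>. The
  real and the imaginary part of a character are inserted separately, since the variance bound is
  for real weights.\<close>

definition noise :: "(real ^ 'd) set \<Rightarrow> nat \<Rightarrow> nat \<Rightarrow> (real ^ 'd \<Rightarrow> real) \<Rightarrow> (nat \<Rightarrow> real) \<Rightarrow> (nat \<Rightarrow> real ^ 'd) \<Rightarrow> (real ^ 'd \<Rightarrow> real) \<Rightarrow> ennreal" where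
  "noise T n K h u w \<psi> = ennreal ((\<Sum>i\<in>{1..n}. (u i - reg h (w i)) * (\<psi> (w i) * avg_wgt T n K L i w))\<^sup>2)"

text \<open>U_i = (U_i - g(Z_i)) + g(Z_i) splits the error into noise and bias. The target is the
  integral of g times the character over all of space, which T captures because g vanishes outside
  it.\<close>

lemma Psi_hat_error:
  assumes T: "T \<in> sets borel" "emeasure lborel T < \<infinity>" and K: "K > 0" "n \<ge> K"
    and fin: "nbr_mass T n K L q w < \<infinity>" and inj: "inj_on w {1..n}" and q: "q \<ge> 2 * L"
    and h: "hclass h" "\<And>z. z \<notin> T \<Longrightarrow> reg h z = 0"
    and Cb: "Cb \<ge> 0" "\<And>z J wt w R j. finite J \<Longrightarrow>
       (\<forall>\<kappa>\<in>multi_indices L. (\<Sum>i\<in>J. wt i * xi z (w i) \<kappa>) = (if \<kappa> = 0 then 1 else 0)) \<Longrightarrow>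
       (\<forall>i\<in>J. norm (w i - z) \<le> R) \<Longrightarrow>
       cmod ((\<Sum>i\<in>J. complex_of_real (wt i) * (complex_of_real (reg h (w i)) * fchar j (w i))) - complex_of_real (reg h z) * fchar j z)
         \<le> Cb * (1 + lnorm j) ^ L * (R ^ L * (\<Sum>i\<in>(J :: nat set). \<bar>wt i\<bar>))"
  shows "ennreal ((cmod (Psi_hat T n K L u w j - ft h j * ft f\<delta> (- j)))\<^sup>2)
    \<le> 2 * noise T n K h u w (\<lambda>z. Re (fchar j z)) + 2 * noise T n K h u w (\<lambda>z. Im (fchar j z))
      + 2 * (ennreal ((Cb * (1 + lnorm j) ^ L)\<^sup>2 * real K / (real n powr (1 / real CARD('d))) ^ (2 * L)) * emeasure lborel T * nbr_mass T n K L q w)"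
proof -
  define A where "A i = avg_wgt T n K L i w" for i
  define r where "r z = complex_of_real (reg h z) * fchar j z" for z
  define X where "X = (\<Sum>i\<in>{1..n}. complex_of_real (u i - reg h (w i)) * fchar j (w i) * complex_of_real (A i))"
  define Y where "Y = (\<Sum>i\<in>{1..n}. r (w i) * complex_of_real (A i)) - (LINT z|lborel. r z)"
  obtain B where B: "B \<ge> 0" "AE x in lborel. \<bar>h x\<bar> \<le> B" using hclass_bounded h(1) by blast
  have [measurable]: "reg h \<in> borel_measurable borel" by (rule reg_measurable[OF h(1)])
  have ir: "integrable lborel r"
  proof (rule Bochner_Integration.integrable_bound[where f="\<lambda>z. B * indicator T z"])
    show "integrable lborel (\<lambda>z. B * indicator T z)" using T by (intro integrable_mult_right integrable_real_indicator) auto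
    show "r \<in> borel_measurable lborel" unfolding r_def by measurable
    have "norm (r z) \<le> norm (B * indicator T z)" for z
      using reg_integrable(2)[OF h(1) B(2), of z] h(2)[of z] B(1) by (cases "z \<in> T") (auto simp: r_def norm_mult)
    then show "AE z in lborel. norm (r z) \<le> norm (B * indicator T z :: real)" by (intro AE_I2)
  qed
  have Yb: "ennreal ((cmod Y)\<^sup>2) \<le> ennreal ((Cb * (1 + lnorm j) ^ L)\<^sup>2 * real K / (real n powr (1 / real CARD('d))) ^ (2 * L)) * emeasure lborel T * nbr_mass T n K L q w"
    unfolding Y_def A_def
  proof (rule avg_wgt_bias[OF T K fin inj ir _ _ _ q])
    show "r z = 0" if "z \<notin> T" for z using h(2)[OF that] by (simp add: r_def)
    show "0 \<le> Cb * (1 + lnorm j) ^ L" using Cb(1) by (intro mult_nonneg_nonneg zero_le_power add_nonneg_nonneg) auto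
    fix z J assume J: "J \<in> k_subsets n K" and d: "det_on (multi_indices L) (gram J z w) \<noteq> 0"
    note Jd = k_subsetsD[OF J K(1)]
    show "cmod ((\<Sum>i\<in>J. complex_of_real (wgt L J z w (w i)) * r (w i)) - r z) \<le> Cb * (1 + lnorm j) ^ L * (rad J z w ^ L * (\<Sum>i\<in>J. \<bar>wgt L J z w (w i)\<bar>))"
      unfolding r_def
    proof (rule Cb(2)[OF Jd(1)])
      show "\<forall>\<kappa>\<in>multi_indices L. (\<Sum>i\<in>J. wgt L J z w (w i) * xi z (w i) \<kappa>) = (if \<kappa> = 0 then 1 else 0)"
        by (intro ballI wgt_reproduce[OF d])
      show "\<forall>i\<in>J. norm (w i - z) \<le> rad J z w"
        using rad_ge[OF Jd(1), of _ z w] by (simp add: norm_minus_commute)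
    qed
  qed
  have "Psi_hat T n K L u w j - ft h j * ft f\<delta> (- j) = X + Y"
    unfolding Psi_hat_eq[OF T K fin] integral_reg_fchar[OF h(1), symmetric] X_def Y_def A_def r_def
    by (simp add: sum.distrib[symmetric] algebra_simps)
  then have "(cmod (Psi_hat T n K L u w j - ft h j * ft f\<delta> (- j)))\<^sup>2 \<le> 2 * (Re X)\<^sup>2 + 2 * (Im X)\<^sup>2 + 2 * (cmod Y)\<^sup>2"
  proof -
    have "(cmod (X + Y))\<^sup>2 \<le> (cmod X + cmod Y)\<^sup>2" by (intro power_mono norm_triangle_ineq) simp
    also have "\<dots> \<le> 2 * (cmod X)\<^sup>2 + 2 * (cmod Y)\<^sup>2" using sum_squares_bound[of "cmod X" "cmod Y"] by (simp add: power2_sum)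
    finally show ?thesis using \<open>_ = X + Y\<close> by (simp add: cmod_power2)
  qed
  then have "ennreal ((cmod (Psi_hat T n K L u w j - ft h j * ft f\<delta> (- j)))\<^sup>2) \<le> ennreal (2 * (Re X)\<^sup>2 + 2 * (Im X)\<^sup>2 + 2 * (cmod Y)\<^sup>2)"
    by (rule ennreal_leI)
  also have "\<dots> = 2 * ennreal ((Re X)\<^sup>2) + 2 * ennreal ((Im X)\<^sup>2) + 2 * ennreal ((cmod Y)\<^sup>2)"
    by (simp add: ennreal_plus ennreal_mult)
  also have "ennreal ((Re X)\<^sup>2) = noise T n K h u w (\<lambda>z. Re (fchar j z))"
    unfolding noise_def X_def A_def by (simp add: mult_ac)
  also have "ennreal ((Im X)\<^sup>2) = noise T n K h u w (\<lambda>z. Im (fchar j z))"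
    unfolding noise_def X_def A_def by (simp add: mult_ac)
  finally show ?thesis using Yb by (blast intro: order_trans add_left_mono mult_left_mono zero_le)
qed

text \<open>Inside the box the coefficient error of the estimator is that of \<open>Psi_hat\<close>
  divided by a coefficient of the error density; outside the box it is the coefficient of h
  itself.\<close>

lemma h_hat_error:
  assumes h: "hclass h" and P: "\<And>j. j \<in> freq_box m \<Longrightarrow> ennreal ((cmod (Psi_hat T n K L u w j - ft h j * ft f\<delta> (- j)))\<^sup>2) \<le> P j"
  shows "(\<integral>\<^sup>+x\<in>cube. ennreal ((cmod (h_hat f\<delta> T n K L m u w x - complex_of_real (h x)))\<^sup>2) \<partial>lborel)
    \<le> ennreal ((real (CARD('d) + 1) * real (Suc m)) powr (2 * \<gamma>) / c\<delta>\<^sup>2) * (\<Sum>j\<in>freq_box m. P j) + ennreal (C\<alpha> * real (Suc m) powr (- 2 * \<alpha>))"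
proof -
  \<comment> \<open>A common bound for the reciprocal of |f_delta^ft(-j)|^2 on the box, from the
    lower smoothness bound.\<close>
  define W where "W = (real (CARD('d) + 1) * real (Suc m)) powr (2 * \<gamma>) / c\<delta>\<^sup>2"
  have W: "W \<ge> 0" by (simp add: W_def)
  define F where "F = (freq_box m :: (int ^ 'd) set)"
  have F: "finite F" unfolding F_def by (rule finite_freq_box)
  define b where "b j = (cmod (Psi_hat T n K L u w j - ft h j * ft f\<delta> (- j)))\<^sup>2" for j
  define a where "a j = Psi_hat T n K L u w j / ft f\<delta> (- j)" for j
  define t where "t = C\<alpha> * real (Suc m) powr (- 2 * \<alpha>)"
  have t: "t \<ge> 0" using \<alpha> by (simp add: t_def)
  have \<alpha>0: "\<alpha> > 0" using \<alpha>(1) by (smt (verit) of_nat_0_le_iff)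
  have g0: "\<gamma> > 0" using sm(3) by (smt (verit) of_nat_0_le_iff divide_nonneg_nonneg)
  have main: "(cmod (a j - ft h j))\<^sup>2 \<le> W * b j" if j: "j \<in> F" for j
  proof -
    define f where "f = ft f\<delta> (- j)"
    have ln: "lnorm (- j) = lnorm j"
    proof -
      have "((\<chi> k. real_of_int ((- j) $ k)) :: real ^ 'd) = - (\<chi> k. real_of_int (j $ k))" by (simp add: vec_eq_iff)
      then show ?thesis unfolding lnorm_def by (simp only: norm_minus_cancel)
    qed
    have f: "c\<delta> * (1 + lnorm j) powr (- \<gamma>) \<le> cmod f" using sm(4) unfolding ordinary_smooth_def f_def by (metis ln)
    have p: "1 + lnorm j > 0" using lnorm_nonneg[of j] by linarith
    have f0: "cmod f > 0" using f p sm(1) by (smt (verit) mult_pos_pos powr_gt_zero)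
    have "1 \<le> W * (cmod f)\<^sup>2"
    proof -
      have "(c\<delta> * (1 + lnorm j) powr (- \<gamma>))\<^sup>2 \<le> (cmod f)\<^sup>2" using f sm(1) by (intro power_mono) auto
      then have "W * (c\<delta> * (1 + lnorm j) powr (- \<gamma>))\<^sup>2 \<le> W * (cmod f)\<^sup>2" using W by (rule mult_left_mono)
      moreover have "1 \<le> W * (c\<delta> * (1 + lnorm j) powr (- \<gamma>))\<^sup>2"
      proof -
        have "(1 + lnorm j) powr (2 * \<gamma>) \<le> (real (CARD('d) + 1) * real (Suc m)) powr (2 * \<gamma>)"
          using lnorm_freq_box[of j m] j g0 p by (intro powr_mono2) (auto simp: F_def)
        then have "(1 + lnorm j) powr (2 * \<gamma>) / c\<delta>\<^sup>2 * (c\<delta> * (1 + lnorm j) powr (- \<gamma>))\<^sup>2 \<le> W * (c\<delta> * (1 + lnorm j) powr (- \<gamma>))\<^sup>2"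
          unfolding W_def by (intro mult_right_mono divide_right_mono) auto
        moreover have "(1 + lnorm j) powr (2 * \<gamma>) / c\<delta>\<^sup>2 * (c\<delta> * (1 + lnorm j) powr (- \<gamma>))\<^sup>2 = 1"
        proof -
          have "((1 + lnorm j) powr (- \<gamma>))\<^sup>2 = (1 + lnorm j) powr (- (2 * \<gamma>))"
            unfolding power2_eq_square powr_add[symmetric] by (rule arg_cong[where f="\<lambda>t. (1 + lnorm j) powr t"]) simp
          then show ?thesis using sm(1) p by (simp add: power_mult_distrib powr_minus field_simps)
        qed
        ultimately show ?thesis by (simp only:)
      qed
      ultimately show ?thesis by linarith
    qed
    then have i: "1 / (cmod f)\<^sup>2 \<le> W" using f0 by (simp add: field_simps)
    have "a j - ft h j = (Psi_hat T n K L u w j - ft h j * f) / f" using f0 by (simp add: a_def f_def[symmetric] field_simps)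
    then have "(cmod (a j - ft h j))\<^sup>2 = 1 / (cmod f)\<^sup>2 * b j" by (simp add: b_def f_def norm_divide power_divide)
    also have "\<dots> \<le> W * b j" using i by (rule mult_right_mono) (simp add: b_def)
    finally show ?thesis .
  qed
  have G: "(\<Sum>j\<in>G. (cmod ((if j \<in> F then a j else 0) - ft h j))\<^sup>2) \<le> W * (\<Sum>j\<in>F. b j) + t" if G: "finite G" for G
  proof -
    have "(\<Sum>j\<in>G. (cmod ((if j \<in> F then a j else 0) - ft h j))\<^sup>2)
      = (\<Sum>j\<in>G \<inter> F. (cmod ((if j \<in> F then a j else 0) - ft h j))\<^sup>2) + (\<Sum>j\<in>G - F. (cmod ((if j \<in> F then a j else 0) - ft h j))\<^sup>2)"
      by (rule sum.Int_Diff[OF G])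
    moreover have "(\<Sum>j\<in>G \<inter> F. (cmod ((if j \<in> F then a j else 0) - ft h j))\<^sup>2) \<le> (\<Sum>j\<in>G \<inter> F. W * b j)"
      using main by (intro sum_mono) simp
    moreover have "(\<Sum>j\<in>G \<inter> F. W * b j) \<le> (\<Sum>j\<in>F. W * b j)" using F W by (intro sum_mono2) (auto simp: b_def)
    moreover have "(\<Sum>j\<in>G - F. (cmod ((if j \<in> F then a j else 0) - ft h j))\<^sup>2) = (\<Sum>j\<in>G - F. (cmod (ft h j))\<^sup>2)"
      by (intro sum.cong refl) auto
    moreover have "(\<Sum>j\<in>G - F. (cmod (ft h j))\<^sup>2) \<le> t" unfolding t_def
      by (rule sobolev_tail[OF _ _ _ \<alpha>0]) (use h G in \<open>auto simp: hclass_def F_def\<close>)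
    ultimately show ?thesis by (simp add: sum_distrib_left)
  qed
  have ih: "integrable lborel h" using h by (simp add: hclass_def)
  have z: "h x = 0" if "x \<notin> open_cube" for x using hclass_zero[OF h] H(2) that by blast
  have hh: "h_hat f\<delta> T n K L m u w x = (\<Sum>j\<in>F. a j * fchar (- j) x) / complex_of_real ((2 * pi) ^ CARD('d))" for x
    unfolding h_hat_def F_def a_def by (simp add: times_divide_eq_left)
  have b0: "0 \<le> (\<Sum>j\<in>F. b j)" by (intro sum_nonneg) (simp add: b_def)
  have "(\<integral>\<^sup>+x\<in>cube. ennreal ((cmod (h_hat f\<delta> T n K L m u w x - complex_of_real (h x)))\<^sup>2) \<partial>lborel)
     \<le> ennreal ((W * (\<Sum>j\<in>F. b j) + t) / (2 * pi) ^ CARD('d))"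
    unfolding hh by (rule fourier_sum_error[OF ih z F G])
  also have "\<dots> \<le> ennreal (W * (\<Sum>j\<in>F. b j) + t)"
    using W b0 t by (intro ennreal_leI divide_two_pi_le) simp
  also have "\<dots> = ennreal W * (\<Sum>j\<in>F. ennreal (b j)) + ennreal t"
    using W b0 t by (simp add: ennreal_plus ennreal_mult sum_ennreal b_def)
  also have "\<dots> \<le> ennreal W * (\<Sum>j\<in>F. P j) + ennreal t"
    using P by (intro add_right_mono mult_left_mono sum_mono) (auto simp: b_def F_def)
  finally show ?thesis unfolding W_def F_def t_def .
qed

end

section \<open>The risk bound\<close>

lemma nn_integral_nbr_mass:
  fixes T :: "(real ^ 'd) set"
  assumes pr: "prob_space \<nu>" and s\<nu> [measurable_cong]: "sets \<nu> = sets borel" and T [measurable]: "T \<in> sets borel" and K: "K > 0"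
    and C: "\<And>z. z \<in> T \<Longrightarrow> (\<integral>\<^sup>+w. nbr_moment T n K L q z w \<partial>PiM {1..n} (\<lambda>_. \<nu>)) \<le> ennreal C"
  shows "(\<integral>\<^sup>+w. nbr_mass T n K L q w \<partial>PiM {1..n} (\<lambda>_. \<nu>)) \<le> ennreal C * emeasure lborel T"
proof -
  interpret prob_space \<nu> by (rule pr)
  interpret P: product_prob_space "\<lambda>_::nat. \<nu>" "{1..n}" by unfold_locales
  interpret pair_sigma_finite "PiM {1..n} (\<lambda>_::nat. \<nu>)" "lborel :: (real ^ 'd) measure"
    by unfold_locales
  have comp: "(\<lambda>x. fst x j) \<in> borel_measurable (PiM {1..n} (\<lambda>_. \<nu>) \<Otimes>\<^sub>M (lborel :: (real ^ 'd) measure))" if "j \<in> {1..n}" for j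
  proof -
    have "(\<lambda>p. p j) \<in> measurable (PiM {1..n} (\<lambda>_. \<nu>)) borel"
      using measurable_component_singleton[OF that, of "\<lambda>_. \<nu>"] by (simp add: measurable_cong_sets[OF refl s\<nu>])
    then show ?thesis by (rule measurable_compose[OF measurable_fst])
  qed
  have m: "(\<lambda>(w, z). nbr_moment T n K L q z w) \<in> borel_measurable (PiM {1..n} (\<lambda>_. \<nu>) \<Otimes>\<^sub>M lborel)"
  proof -
    have "snd \<in> borel_measurable (PiM {1..n} (\<lambda>_. \<nu>) \<Otimes>\<^sub>M (lborel :: (real ^ 'd) measure))" by measurable
    from measurable_nbr_moment[OF T K this comp] show ?thesis by (simp add: split_def)
  qed
  have "(\<integral>\<^sup>+w. nbr_mass T n K L q w \<partial>PiM {1..n} (\<lambda>_. \<nu>)) = (\<integral>\<^sup>+z. \<integral>\<^sup>+w. nbr_moment T n K L q z w \<partial>PiM {1..n} (\<lambda>_. \<nu>) \<partial>lborel)"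
    unfolding nbr_mass_def by (rule Fubini'[OF m, symmetric])
  also have "\<dots> \<le> (\<integral>\<^sup>+z. ennreal C * indicator T z \<partial>lborel)"
  proof (rule nn_integral_mono)
    fix z
    show "(\<integral>\<^sup>+w. nbr_moment T n K L q z w \<partial>PiM {1..n} (\<lambda>_. \<nu>)) \<le> ennreal C * indicator T z"
    proof (cases "z \<in> T")
      case False
      then have "nbr_moment T n K L q z w = 0" for w
        unfolding nbr_moment_def by (intro sum.neutral) (auto simp: cell_def)
      then show ?thesis by simp
    qed (use C in simp)
  qed
  also have "\<dots> = ennreal C * emeasure lborel T" by (rule nn_integral_cmult_indicator) simp
  finally show ?thesis .
qed

lemma rate_terms_le:
  fixes W F A y a1 a2 u v Ca tt :: real
  assumes "W * F \<le> A * y" "0 \<le> A" "0 \<le> y" "0 \<le> a1" "0 \<le> a2" "0 \<le> u" "0 \<le> v" "0 \<le> Ca" "0 \<le> tt"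
  shows "W * F * (a1 * u + a2 * v) + Ca * tt \<le> (A * (a1 + a2) + Ca) * (y * (u + v) + tt)"
proof -
  have "W * F * (a1 * u + a2 * v) \<le> A * y * (a1 * u + a2 * v)" using assms by (intro mult_right_mono add_nonneg_nonneg mult_nonneg_nonneg)
  also have "\<dots> \<le> A * y * ((a1 + a2) * (u + v))" using assms by (intro mult_left_mono) (auto simp: algebra_simps)
  finally have "W * F * (a1 * u + a2 * v) \<le> A * (a1 + a2) * (y * (u + v))" by (simp add: mult_ac)
  moreover have "0 \<le> A * (a1 + a2) * tt" "0 \<le> Ca * (y * (u + v))" using assms by auto
  ultimately show ?thesis by (simp add: distrib_left distrib_right)
qed

context berkson_fourier
begin

context
  fixes M :: "'a measure" and Z \<delta> :: "'a \<Rightarrow> real ^ 'd" and \<epsilon> :: "'a \<Rightarrow> real" and fZ :: "real ^ 'd \<Rightarrow> real"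
    and T S :: "(real ^ 'd) set" and K :: nat and rb ra \<rho> :: real
  assumes model: "berkson_errors M Z \<delta> \<epsilon> fZ f\<delta>"
    and K6: "K \<ge> 6 * L * card (multi_indices L :: (nat ^ 'd) set)" and N2: "card (multi_indices L :: (nat ^ 'd) set) \<ge> 2"
    and rb: "rb \<ge> 0" "\<And>x. fZ x \<le> rb * indicator S x"
    and ra: "ra > 0" "\<And>x. x \<in> S \<Longrightarrow> ra \<le> fZ x"
    and S: "S \<in> sets borel" "bounded S"
    and T: "T \<in> sets borel" "T \<subseteq> S" and \<rho>: "\<rho> > 0" "\<And>z. z \<in> T \<Longrightarrow> ball z \<rho> \<subseteq> S"
begin

text \<open>The risk for an arbitrary smoothing parameter m. The constant is chosen before n, h, m
  and the sample, which is possible because the bounds on h, g, the local bias and the conditional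
  variance are uniform over \<open>hclass\<close>.\<close>

lemma risk_bound:
  "\<exists>C\<ge>0. \<forall>n\<ge>K. \<forall>h m. hclass h \<longrightarrow> (\<forall>z. z \<notin> T \<longrightarrow> reg h z = 0) \<longrightarrow>
    (\<forall>(N :: 'b measure) Us Zs. iid_copies N n Us Zs M (\<lambda>\<omega>. h (Z \<omega> + \<delta> \<omega>) + \<epsilon> \<omega>) Z \<longrightarrow>
      (\<integral>\<^sup>+\<omega>. (\<integral>\<^sup>+x\<in>cube. ennreal ((cmod (h_hat f\<delta> T n K L m (\<lambda>i. Us i \<omega>) (\<lambda>i. Zs i \<omega>) x - complex_of_real (h x)))\<^sup>2) \<partial>lborel) \<partial>N)
       \<le> ennreal (C * (real (Suc m) powr (2 * \<gamma> + real CARD('d)) *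
            (1 / real n + real (Suc m) ^ (2 * L) / (real n powr (1 / real CARD('d))) ^ (2 * L)) + real (Suc m) powr (- 2 * \<alpha>))))"
proof -
  let ?d = "CARD('d)"
  interpret M: prob_space M using model by (simp add: berkson_errors_def)
  define \<nu> where "\<nu> = density lborel (\<lambda>x. ennreal (fZ x))"
  have s\<nu>: "sets \<nu> = sets borel" by (simp add: \<nu>_def)
  have \<nu>: "\<nu> = distr M borel Z" unfolding \<nu>_def distr_Z[OF model] ..
  have pr\<nu>: "prob_space \<nu>" unfolding \<nu> by (rule M.prob_space_distr) (rule model_measurable[OF model])
  have fZ0: "0 \<le> fZ x" for x using model by (simp add: berkson_errors_def)
  have efZ: "(\<lambda>x. ennreal (fZ x)) \<in> borel_measurable borel" using model by (simp add: berkson_errors_def distributed_def)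
  have fZm: "fZ \<in> borel_measurable borel"
  proof -
    have "(\<lambda>x. enn2real (ennreal (fZ x))) \<in> borel_measurable borel" using efZ by measurable
    then show ?thesis by (simp add: fZ0)
  qed
  have null: "emeasure \<nu> {x} = 0" for x
  proof -
    have "emeasure \<nu> {x} = (\<integral>\<^sup>+y. ennreal (fZ y) * indicator {x} y \<partial>lborel)"
      unfolding \<nu>_def by (rule emeasure_density) (use efZ in auto)
    also have "\<dots> = 0" by (rule nn_integral_null_set) auto
    finally show ?thesis .
  qed
  have K0: "K > 0" using K6 N2 \<alpha>(3) by (intro gr0I) auto
  \<comment> \<open>2 * L for the bias and d + 2 for the integrability of the reciprocal
    Cauchy-Schwarz weight.\<close>
  define q where "q = 2 * L + ?d + 2"
  obtain Cm where Cm: "Cm \<ge> 0" "\<And>n z. n \<ge> K \<Longrightarrow> z \<in> T \<Longrightarrow> (\<integral>\<^sup>+w. nbr_moment T n K L q z w \<partial>PiM {1..n} (\<lambda>_. \<nu>)) \<le> ennreal Cm"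
    using nbr_moment_bound[OF \<alpha>(3) N2 K6 fZm pr\<nu>[unfolded \<nu>_def] rb ra S T \<rho>, of q] unfolding \<nu>_def by blast
  obtain s where s: "s \<ge> 0" "\<And>h f. hclass h \<Longrightarrow> f \<in> borel_measurable borel \<Longrightarrow>
    (\<integral>\<^sup>+p. ennreal ((fst p - reg h (snd p))\<^sup>2) * f (snd p) \<partial>obs_law M Z \<delta> \<epsilon> h) \<le> ennreal s * (\<integral>\<^sup>+p. f (snd p) \<partial>obs_law M Z \<delta> \<epsilon> h)"
    using obs_variance[OF model] by blast
  obtain Cb where Cb: "Cb \<ge> 0" "\<And>h z J wt w R j. hclass h \<Longrightarrow> finite J \<Longrightarrow>
     (\<forall>\<kappa>\<in>multi_indices L. (\<Sum>i\<in>J. wt i * xi z (w i) \<kappa>) = (if \<kappa> = 0 then 1 else 0)) \<Longrightarrow>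
     (\<forall>i\<in>J. norm (w i - z) \<le> R) \<Longrightarrow>
     cmod ((\<Sum>i\<in>J. complex_of_real (wt i) * (complex_of_real (reg h (w i)) * fchar j (w i))) - complex_of_real (reg h z) * fchar j z)
       \<le> Cb * (1 + lnorm j) ^ L * (R ^ L * (\<Sum>i\<in>(J :: nat set). \<bar>wt i\<bar>))"
  proof -
    from local_bias show thesis
      by (elim exE conjE) (rule that, assumption, elim allE impE, assumption+)
  qed
  have dq: "q \<ge> ?d + 2" by (simp add: q_def)
  obtain C3 where C3: "C3 \<ge> 0" "\<And>h (w :: real ^ 'd). h > 0 \<Longrightarrow> (\<integral>\<^sup>+z. ennreal (1 / (1 + h * norm (z - w)) ^ q) \<partial>lborel) \<le> ennreal (C3 / h ^ ?d)"
  proof -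
    from decay_integral[OF dq] show thesis
      by (elim exE conjE) (rule that, assumption, elim allE impE, assumption+)
  qed
  have Tb: "emeasure lborel T < \<infinity>"
  proof -
    have "bounded T" using S(2) T(2) by (rule bounded_subset)
    then show ?thesis using emeasure_bounded_finite[of T] by simp
  qed
  define vT where "vT = measure lborel T"
  have vT: "emeasure lborel T = ennreal vT" "vT \<ge> 0"
    unfolding vT_def using Tb by (auto intro!: emeasure_eq_ennreal_measure)
  define E where "E = Cm * vT"
  have E: "E \<ge> 0" using Cm vT by (simp add: E_def)
  define D where "D = real (?d + 1)"
  have D: "D \<ge> 1" by (simp add: D_def)
  define A where "A = D powr (2 * \<gamma>) / c\<delta>\<^sup>2 * 2 ^ ?d"
  define a1 where "a1 = 4 * (s * (C3 * E))"
  define a2 where "a2 = 2 * ((Cb\<^sup>2 * D ^ (2 * L) * real K) * vT * E)"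
  have nonneg: "A \<ge> 0" "a1 \<ge> 0" "a2 \<ge> 0" "C\<alpha> \<ge> 0"
    using s C3 E Cb vT D \<alpha> by (auto simp: A_def a1_def a2_def)
  have main: "(\<integral>\<^sup>+\<omega>. (\<integral>\<^sup>+x\<in>cube. ennreal ((cmod (h_hat f\<delta> T n K L m (\<lambda>i. Us i \<omega>) (\<lambda>i. Zs i \<omega>) x - complex_of_real (h x)))\<^sup>2) \<partial>lborel) \<partial>N)
       \<le> ennreal ((A * (a1 + a2) + C\<alpha>) * (real (Suc m) powr (2 * \<gamma> + real ?d) *
            (1 / real n + real (Suc m) ^ (2 * L) / (real n powr (1 / real ?d)) ^ (2 * L)) + real (Suc m) powr (- 2 * \<alpha>)))"
    if n: "n \<ge> K" and h: "hclass h" "\<And>z. z \<notin> T \<Longrightarrow> reg h z = 0" and iid: "iid_copies N n Us Zs M (\<lambda>\<omega>. h (Z \<omega> + \<delta> \<omega>) + \<epsilon> \<omega>) Z"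
    for n m h and N :: "'b measure" and Us Zs
  proof -
    define I where "I = {1..n}"
    have I: "finite I" "I \<noteq> {}" using n K0 by (auto simp: I_def)
    define g where "g = reg h"
    have g [measurable]: "g \<in> borel_measurable borel" unfolding g_def by (rule reg_measurable[OF h(1)])
    define \<mu> where "\<mu> = obs_law M Z \<delta> \<epsilon> h"
    have s\<mu> [measurable_cong]: "sets \<mu> = sets borel" by (simp add: \<mu>_def obs_law_def)
    have pr\<mu>: "prob_space \<mu>" unfolding \<mu>_def obs_law_def by (rule M.prob_space_distr) (rule obs_measurable[OF model h(1)])
    define P where "P = PiM I (\<lambda>_. \<mu>)"
    define w where "w p = (\<lambda>j. snd (p j))" for p :: "nat \<Rightarrow> real \<times> (real ^ 'd)"
    define u where "u p = (\<lambda>j. fst (p j))" for p :: "nat \<Rightarrow> real \<times> (real ^ 'd)"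
    have fs: "snd \<in> measurable (borel :: (real \<times> (real ^ 'd)) measure) borel"
      "fst \<in> measurable (borel :: (real \<times> (real ^ 'd)) measure) borel"
      by (auto intro!: borel_measurable_continuous_onI continuous_intros)
    have comp: "(\<lambda>p. p i) \<in> measurable P borel" if "i \<in> I" for i
      using measurable_component_singleton[OF that, of "\<lambda>_. \<mu>"] by (simp add: P_def measurable_cong_sets[OF refl s\<mu>])
    have wm: "(\<lambda>p. w p i) \<in> borel_measurable P" and um: "(\<lambda>p. u p i) \<in> borel_measurable P" if "i \<in> I" for i
      unfolding w_def u_def using measurable_compose[OF comp[OF that] fs(1)] measurable_compose[OF comp[OF that] fs(2)] by simp_all
    have sndd: "distr \<mu> \<nu> snd = \<nu>"
    proof -
      have "distr \<mu> \<nu> snd = distr \<mu> borel snd" by (rule distr_cong) (simp_all add: s\<nu>)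
      then show ?thesis unfolding \<mu>_def obs_law_snd[OF model h(1)] \<nu>_def .
    qed
    have snd\<nu>: "snd \<in> measurable \<mu> \<nu>" using fs(1) by (simp add: measurable_cong_sets[OF s\<mu> s\<nu>])
    \<comment> \<open>Forgetting the responses turns the law of the sample into the law of the
      design, in which the neighbour moments were computed.\<close>
    have dP: "distr P (PiM I (\<lambda>_. \<nu>)) (compose I snd) = PiM I (\<lambda>_. \<nu>)"
      unfolding P_def using distr_PiM_finite_prob_space'[OF I(1), of "\<lambda>_. \<mu>" "\<lambda>_. \<nu>" snd] pr\<mu> pr\<nu> snd\<nu> by (simp add: sndd)
    have cm: "compose I snd \<in> measurable P (PiM I (\<lambda>_. \<nu>))"
      unfolding P_def compose_def
    proof (rule measurable_restrict)
      fix i assume "i \<in> I"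
      then have "(\<lambda>p. p i) \<in> measurable (PiM I (\<lambda>_. \<mu>)) \<mu>" by (rule measurable_component_singleton)
      then show "(\<lambda>p. snd (p i)) \<in> measurable (PiM I (\<lambda>_. \<mu>)) \<nu>" by (rule measurable_compose[OF _ snd\<nu>])
    qed
    have cw: "compose I snd p j = w p j" if "j \<in> I" for p j using that by (simp add: compose_def w_def)
    define mass where "mass p = nbr_mass T n K L q (w p)" for p
    have massm: "mass \<in> borel_measurable P" unfolding mass_def
      by (rule measurable_nbr_mass[OF T(1) K0]) (rule wm, simp add: I_def)
    have EM: "(\<integral>\<^sup>+p. mass p \<partial>P) \<le> ennreal E"
    proof -
      have \<nu>m: "(\<lambda>v. nbr_mass T n K L q v) \<in> borel_measurable (PiM I (\<lambda>_. \<nu>))"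
      proof (rule measurable_nbr_mass[OF T(1) K0])
        fix j assume "j \<in> {1..n}"
        then show "(\<lambda>v. v j) \<in> borel_measurable (PiM I (\<lambda>_. \<nu>))"
          using measurable_component_singleton[of j I "\<lambda>_. \<nu>"] by (simp add: I_def measurable_cong_sets[OF refl s\<nu>])
      qed
      have me: "mass = (\<lambda>p. nbr_mass T n K L q (compose I snd p))"
        unfolding mass_def by (rule ext, rule nbr_mass_cong[OF _ K0]) (rule cw[symmetric], simp add: I_def)
      have "(\<integral>\<^sup>+p. mass p \<partial>P) = (\<integral>\<^sup>+v. nbr_mass T n K L q v \<partial>distr P (PiM I (\<lambda>_. \<nu>)) (compose I snd))"
        unfolding me by (rule nn_integral_distr[OF cm, symmetric]) (use \<nu>m in simp)
      also have "\<dots> \<le> ennreal Cm * emeasure lborel T" unfolding dP unfolding I_def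
        by (rule nn_integral_nbr_mass[OF pr\<nu> s\<nu> T(1) K0 Cm(2)[OF n]])
      also have "\<dots> = ennreal E" using Cm vT by (simp add: E_def ennreal_mult)
      finally show ?thesis .
    qed
    have fin: "AE p in P. mass p < \<infinity>"
    proof -
      have "(\<integral>\<^sup>+p. mass p \<partial>P) \<noteq> \<infinity>" using EM by (auto simp: top_unique)
      from nn_integral_PInf_AE[OF massm this] show ?thesis by eventually_elim (simp add: less_top)
    qed
    have inj: "AE p in P. inj_on (w p) I"
    proof -
      have "AE v in distr P (PiM I (\<lambda>_. \<nu>)) (compose I snd). inj_on v I"
        unfolding dP by (rule AE_PiM_inj_on[OF pr\<nu> s\<nu> null I(1)])
      from AE_distrD[OF cm this] show ?thesis
        by eventually_elim (simp add: inj_on_def cw)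
    qed
    have n0: "real n > 0" using n K0 by simp
    define hn where "hn = real n powr (1 / real ?d)"
    have hn: "hn > 0" "hn ^ ?d = real n"
      using n0 by (simp_all add: hn_def powr_realpow[symmetric] powr_powr)
    have square: "AE p in P. ennreal (\<Sum>i\<in>I. (avg_wgt T n K L i (w p))\<^sup>2) \<le> ennreal (C3 / real n) * mass p"
      using fin
    proof eventually_elim
      case (elim p)
      show ?case unfolding I_def mass_def
      proof (rule avg_wgt_square_sum[OF T(1) Tb K0 n])
        show "nbr_mass T n K L q (w p) < \<infinity>" using elim by (simp add: mass_def)
        show "0 \<le> C3 / real n" using C3(1) by simp
        fix v :: "real ^ 'd"
        show "(\<integral>\<^sup>+z. ennreal (1 / (1 + real n powr (1 / real ?d) * norm (z - v)) ^ q) \<partial>lborel) \<le> ennreal (C3 / real n)"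
          using C3(2)[OF hn(1), of v] unfolding hn(2) by (simp add: hn_def)
      qed
    qed
    have noise: "(\<integral>\<^sup>+p. noise T n K h (u p) (w p) \<psi> \<partial>P) \<le> ennreal (s * (C3 / real n * E))"
      if \<psi>m: "\<psi> \<in> borel_measurable borel" and \<psi>b: "\<And>z. \<bar>\<psi> z\<bar> \<le> 1" for \<psi>
    proof -
      \<comment> \<open>Set to 0 off I, so that dependence on the coordinates in I alone holds for
        every index i.\<close>
      define a where "a i v = (if i \<in> I then \<psi> (v i) * avg_wgt T n K L i v else 0)" for i and v :: "nat \<Rightarrow> real ^ 'd"
      have le: "AE p in P. (\<Sum>i\<in>I. ennreal ((a i (\<lambda>j. snd (p j)))\<^sup>2)) \<le> ennreal (C3 / real n) * mass p"
        using square
      proof eventually_elim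
        case (elim p)
        have "(\<Sum>i\<in>I. ennreal ((a i (\<lambda>j. snd (p j)))\<^sup>2)) = ennreal (\<Sum>i\<in>I. (a i (w p))\<^sup>2)"
          unfolding w_def by (rule sum_ennreal) simp
        also have "\<dots> \<le> ennreal (\<Sum>i\<in>I. (avg_wgt T n K L i (w p))\<^sup>2)"
        proof (intro ennreal_leI sum_mono)
          fix i assume i: "i \<in> I"
          have "(\<psi> (w p i))\<^sup>2 \<le> 1\<^sup>2" using \<psi>b[of "w p i"] by (subst power2_le_iff_abs_le) auto
          then show "(a i (w p))\<^sup>2 \<le> (avg_wgt T n K L i (w p))\<^sup>2"
            using i mult_right_mono[of "(\<psi> (w p i))\<^sup>2" 1 "(avg_wgt T n K L i (w p))\<^sup>2"] by (simp add: a_def power_mult_distrib)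
        qed
        finally show ?case using elim by (rule order_trans)
      qed
      have int: "(\<integral>\<^sup>+p. (\<Sum>i\<in>I. ennreal ((a i (\<lambda>j. snd (p j)))\<^sup>2)) \<partial>P) \<le> ennreal (C3 / real n * E)"
      proof -
        have "(\<integral>\<^sup>+p. (\<Sum>i\<in>I. ennreal ((a i (\<lambda>j. snd (p j)))\<^sup>2)) \<partial>P) \<le> (\<integral>\<^sup>+p. ennreal (C3 / real n) * mass p \<partial>P)"
          using le by (rule nn_integral_mono_AE)
        also have "\<dots> = ennreal (C3 / real n) * (\<integral>\<^sup>+p. mass p \<partial>P)" by (rule nn_integral_cmult[OF massm])
        also have "\<dots> \<le> ennreal (C3 / real n) * ennreal E" by (intro mult_left_mono EM) simp
        finally show ?thesis using C3(1) E by (simp add: ennreal_mult[symmetric])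
      qed
      have "(\<integral>\<^sup>+p. ennreal ((\<Sum>i\<in>I. (fst (p i) - g (snd (p i))) * a i (\<lambda>j. snd (p j)))\<^sup>2) \<partial>PiM I (\<lambda>_. \<mu>))
        \<le> ennreal s * (\<integral>\<^sup>+p. (\<Sum>i\<in>I. ennreal ((a i (\<lambda>j. snd (p j)))\<^sup>2)) \<partial>PiM I (\<lambda>_. \<mu>))"
      proof (rule weighted_noise_variance[OF pr\<mu> s\<mu> g I(1) s(1)])
        show "(\<integral>\<^sup>+p. ennreal ((fst p - g (snd p))\<^sup>2) * f (snd p) \<partial>\<mu>) \<le> ennreal s * (\<integral>\<^sup>+p. f (snd p) \<partial>\<mu>)"
          if "f \<in> borel_measurable borel" for f unfolding g_def \<mu>_def by (rule s(2)[OF h(1) that])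
        show "(LINT p|\<mu>. (fst p - g (snd p)) * f (snd p)) = 0" if "f \<in> borel_measurable borel" for f :: "real ^ 'd \<Rightarrow> real"
          unfolding g_def \<mu>_def by (rule obs_mean[OF model h(1) that])
        show "a i \<in> borel_measurable (PiM I (\<lambda>_. borel))" if i: "i \<in> I" for i
        proof -
          have c: "(\<lambda>v. v j) \<in> borel_measurable (PiM I (\<lambda>_. borel :: (real ^ 'd) measure))" if "j \<in> I" for j
            using that by (rule measurable_component_singleton)
          have "(\<lambda>v. \<psi> (v i)) \<in> borel_measurable (PiM I (\<lambda>_. borel))" by (rule measurable_compose[OF c[OF i] \<psi>m])
          moreover have "(\<lambda>v. avg_wgt T n K L i v) \<in> borel_measurable (PiM I (\<lambda>_. borel))"
            by (rule measurable_avg_wgt[OF T(1) K0]) (rule c, simp add: I_def)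
          ultimately have "(\<lambda>v. \<psi> (v i) * avg_wgt T n K L i v) \<in> borel_measurable (PiM I (\<lambda>_. borel))"
            by (rule borel_measurable_times)
          then show ?thesis using i by (simp add: a_def[abs_def])
        qed
        show "a i v = a i v'" if e: "\<And>j. j \<in> I \<Longrightarrow> v j = v' j" for i v v'
        proof (cases "i \<in> I")
          case True
          have "avg_wgt T n K L i v = avg_wgt T n K L i v'"
            by (rule avg_wgt_cong[OF _ K0]) (rule e, simp add: I_def)
          then show ?thesis using True e[OF True] by (simp add: a_def)
        qed (simp add: a_def)
        show "(\<integral>\<^sup>+p. ennreal ((a i (\<lambda>j. snd (p j)))\<^sup>2) \<partial>PiM I (\<lambda>_. \<mu>)) < \<infinity>" if i: "i \<in> I" for i
        proof -
          have "(\<integral>\<^sup>+p. ennreal ((a i (\<lambda>j. snd (p j)))\<^sup>2) \<partial>P) \<le> (\<integral>\<^sup>+p. (\<Sum>i\<in>I. ennreal ((a i (\<lambda>j. snd (p j)))\<^sup>2)) \<partial>P)"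
            using i I(1) by (intro nn_integral_mono member_le_sum) auto
          also have "\<dots> < \<infinity>" using int by (rule le_less_trans) simp
          finally show ?thesis unfolding P_def .
        qed
      qed
      also have "\<dots> \<le> ennreal s * ennreal (C3 / real n * E)"
        using int unfolding P_def by (intro mult_left_mono) auto
      also have "\<dots> = ennreal (s * (C3 / real n * E))" using s(1) C3(1) E by (simp add: ennreal_mult[symmetric])
      also have "(\<lambda>p. ennreal ((\<Sum>i\<in>I. (fst (p i) - g (snd (p i))) * a i (\<lambda>j. snd (p j)))\<^sup>2)) = (\<lambda>p. noise T n K h (u p) (w p) \<psi>)"
        unfolding noise_def u_def w_def g_def I_def[symmetric]
        by (intro ext arg_cong[where f="\<lambda>t. ennreal (t\<^sup>2)"] sum.cong refl) (simp add: a_def)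
      finally show ?thesis unfolding P_def .
    qed
    have noisem: "(\<lambda>p. noise T n K h (u p) (w p) \<psi>) \<in> borel_measurable P" if \<psi>m: "\<psi> \<in> borel_measurable borel" for \<psi>
      unfolding noise_def I_def[symmetric] g_def[symmetric]
    proof (intro measurable_compose[OF _ measurable_ennreal] borel_measurable_power borel_measurable_sum borel_measurable_times borel_measurable_diff)
      fix i assume i: "i \<in> I"
      show "(\<lambda>p. u p i) \<in> borel_measurable P" by (rule um[OF i])
      show "(\<lambda>p. g (w p i)) \<in> borel_measurable P" by (rule measurable_compose[OF wm[OF i] g])
      show "(\<lambda>p. \<psi> (w p i)) \<in> borel_measurable P" by (rule measurable_compose[OF wm[OF i] \<psi>m])
      show "(\<lambda>p. avg_wgt T n K L i (w p)) \<in> borel_measurable P"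
        by (rule measurable_avg_wgt[OF T(1) K0]) (rule wm, simp add: I_def)
    qed
    define x where "x = real (Suc m)"
    have x: "x \<ge> 1" by (simp add: x_def)
    define F where "F = (freq_box m :: (int ^ 'd) set)"
    define W where "W = (D * x) powr (2 * \<gamma>) / c\<delta>\<^sup>2"
    have W: "W \<ge> 0" by (simp add: W_def)
    define b where "b = (Cb * (D * x) ^ L)\<^sup>2 * real K / hn ^ (2 * L)"
    have b: "b \<ge> 0" using hn(1) by (simp add: b_def)
    define t where "t = C\<alpha> * x powr (- 2 * \<alpha>)"
    have t: "t \<ge> 0" using nonneg by (simp add: t_def)
    \<comment> \<open>A measurable majorant of the loss as a function of the sample. The expected
      loss is compared with its integral, which can be transported to the product space.\<close>
    define G where "G p = ennreal W * (\<Sum>j\<in>F. 2 * noise T n K h (u p) (w p) (\<lambda>z. Re (fchar j z)) + 2 * noise T n K h (u p) (w p) (\<lambda>z. Im (fchar j z))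
      + 2 * (ennreal b * emeasure lborel T * mass p)) + ennreal t" for p
    have Rem: "(\<lambda>z. Re (fchar j z)) \<in> borel_measurable borel" "(\<lambda>z. Im (fchar j z)) \<in> borel_measurable borel" for j :: "int ^ 'd"
      by measurable
    have Reb: "\<bar>Re (fchar j z)\<bar> \<le> 1" "\<bar>Im (fchar j z)\<bar> \<le> 1" for j :: "int ^ 'd" and z
      using abs_Re_le_cmod[of "fchar j z"] abs_Im_le_cmod[of "fchar j z"] by simp_all
    note [measurable] = noisem[OF Rem(1)] noisem[OF Rem(2)] massm
    have Gm: "G \<in> borel_measurable P" unfolding G_def by measurable
    have GI: "(\<integral>\<^sup>+p. G p \<partial>P) \<le> ennreal (W * real (card F) * (4 * (s * (C3 / real n * E)) + 2 * (b * vT * E)) + t)"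
    proof -
      interpret P: prob_space P unfolding P_def by (rule prob_space_PiM) (rule pr\<mu>)
      define N1 where "N1 j = (\<integral>\<^sup>+p. noise T n K h (u p) (w p) (\<lambda>z. Re (fchar j z)) \<partial>P)" for j
      define N2 where "N2 j = (\<integral>\<^sup>+p. noise T n K h (u p) (w p) (\<lambda>z. Im (fchar j z)) \<partial>P)" for j
      define e where "e = s * (C3 / real n * E)"
      have e: "e \<ge> 0" using s C3 E by (simp add: e_def)
      have "(\<integral>\<^sup>+p. G p \<partial>P) = ennreal W * (\<Sum>j\<in>F. 2 * N1 j + 2 * N2 j + 2 * (ennreal b * emeasure lborel T * (\<integral>\<^sup>+p. mass p \<partial>P))) + ennreal t"
        unfolding G_def N1_def N2_def
        by (simp add: nn_integral_add nn_integral_cmult nn_integral_sum P.emeasure_space_1)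
      also have "\<dots> \<le> ennreal W * (\<Sum>j\<in>F. 2 * ennreal e + 2 * ennreal e + 2 * (ennreal b * ennreal vT * ennreal E)) + ennreal t"
        unfolding vT(1) N1_def N2_def e_def
        by (intro add_mono mult_left_mono sum_mono order_refl noise EM Rem Reb) auto
      also have "2 * ennreal e + 2 * ennreal e + 2 * (ennreal b * ennreal vT * ennreal E) = ennreal (4 * e + 2 * (b * vT * E))"
      proof -
        have "ennreal (4 * e + 2 * (b * vT * E)) = ennreal (2 * e + 2 * e + 2 * (b * vT * E))" by simp
        also have "\<dots> = ennreal (2 * e) + ennreal (2 * e) + ennreal (2 * (b * vT * E))"
          using e b vT E by (subst ennreal_plus, simp, simp, subst ennreal_plus) auto
        moreover have "2 * ennreal e + 2 * ennreal e = 4 * ennreal e"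
          by (simp only: distrib_right[symmetric]) simp
        ultimately show ?thesis using e b vT(2) E by (simp add: ennreal_mult)
      qed
      also have "ennreal W * (\<Sum>j\<in>F. ennreal (4 * e + 2 * (b * vT * E))) + ennreal t = ennreal (W * (real (card F) * (4 * e + 2 * (b * vT * E))) + t)"
      proof -
        have "(\<Sum>j\<in>F. ennreal (4 * e + 2 * (b * vT * E))) = ennreal (\<Sum>j\<in>F. 4 * e + 2 * (b * vT * E))"
          using e b vT E by (intro sum_ennreal) simp
        then show ?thesis using W e b vT E t by (simp add: ennreal_mult ennreal_plus)
      qed
      finally show ?thesis by (simp add: e_def mult.assoc)
    qed
    interpret N: prob_space N using iid by (simp add: iid_copies_def)
    \<comment> \<open>The sample as an element of the product space, undefined outside I; the
      congruence lemmas for \<open>nbr_mass\<close> and \<open>avg_wgt\<close> identify its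
      statistics with those of the original sequences.\<close>
    define X where "X \<omega> = (\<lambda>i\<in>I. (Us i \<omega>, Zs i \<omega>))" for \<omega>
    have iv: "N.indep_vars (\<lambda>_. borel) (\<lambda>i \<omega>. (Us i \<omega>, Zs i \<omega>)) I" using iid by (simp add: iid_copies_def I_def)
    have rv: "(\<lambda>\<omega>. (Us i \<omega>, Zs i \<omega>)) \<in> measurable N borel" if "i \<in> I" for i
      using iv that unfolding N.indep_vars_def by blast
    have law: "distr N borel (\<lambda>\<omega>. (Us i \<omega>, Zs i \<omega>)) = \<mu>" if "i \<in> I" for i
      using iid that by (simp add: iid_copies_def I_def \<mu>_def obs_law_def)
    have dX: "distr N (PiM I (\<lambda>_. borel)) X = P"
    proof -
      have "distr N (PiM I (\<lambda>_. borel)) X = PiM I (\<lambda>i. distr N borel (\<lambda>\<omega>. (Us i \<omega>, Zs i \<omega>)))"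
        unfolding X_def using N.indep_vars_iff_distr_eq_PiM'[OF I(2), where M'="\<lambda>_. borel" and X="\<lambda>i \<omega>. (Us i \<omega>, Zs i \<omega>)"] rv iv by blast
      also have "\<dots> = P" unfolding P_def by (rule PiM_cong) (simp_all add: law)
      finally show ?thesis .
    qed
    have Xm: "X \<in> measurable N (PiM I (\<lambda>_. borel))" unfolding X_def by (rule measurable_restrict) (rule rv)
    have "AE p in distr N (PiM I (\<lambda>_. borel)) X. mass p < \<infinity> \<and> inj_on (w p) I"
      unfolding dX using fin inj by eventually_elim simp
    from AE_distrD[OF Xm this]
    have ptw: "AE \<omega> in N. (\<integral>\<^sup>+x\<in>cube. ennreal ((cmod (h_hat f\<delta> T n K L m (\<lambda>i. Us i \<omega>) (\<lambda>i. Zs i \<omega>) x - complex_of_real (h x)))\<^sup>2) \<partial>lborel) \<le> G (X \<omega>)"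
    proof eventually_elim
      case (elim \<omega>)
      define uu where "uu = (\<lambda>i. Us i \<omega>)"
      define ww where "ww = (\<lambda>i. Zs i \<omega>)"
      have ew: "w (X \<omega>) j = ww j" "u (X \<omega>) j = uu j" if "j \<in> {1..n}" for j using that by (simp_all add: w_def u_def X_def I_def ww_def uu_def)
      have ms: "mass (X \<omega>) = nbr_mass T n K L q ww" unfolding mass_def by (rule nbr_mass_cong[OF ew(1) K0])
      have ns: "noise T n K h (u (X \<omega>)) (w (X \<omega>)) \<psi> = noise T n K h uu ww \<psi>" for \<psi>
      proof -
        have "avg_wgt T n K L i (w (X \<omega>)) = avg_wgt T n K L i ww" for i by (rule avg_wgt_cong[OF ew(1) K0])
        then show ?thesis unfolding noise_def
          by (intro arg_cong[where f="\<lambda>t. ennreal (t\<^sup>2)"] sum.cong refl) (simp add: ew)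
      qed
      have f: "nbr_mass T n K L q ww < \<infinity>" using elim unfolding ms by (rule conjunct1)
      have i: "inj_on ww {1..n}"
        using elim[THEN conjunct2, unfolded I_def] inj_on_cong[of "{1..n}" "w (X \<omega>)" ww, OF ew(1)] by blast
      show ?case unfolding G_def ms ns W_def D_def F_def t_def x_def uu_def[symmetric] ww_def[symmetric]
      proof (rule h_hat_error[OF h(1)])
        fix j assume j: "j \<in> (freq_box m :: (int ^ 'd) set)"
        have "(Cb * (1 + lnorm j) ^ L)\<^sup>2 * real K / hn ^ (2 * L) \<le> b"
          unfolding b_def D_def x_def using lnorm_freq_box[OF j] Cb(1) hn(1) lnorm_nonneg[of j]
          by (intro divide_right_mono mult_right_mono power_mono mult_left_mono mult_nonneg_nonneg zero_le_power add_nonneg_nonneg) auto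
        then have bb: "ennreal ((Cb * (1 + lnorm j) ^ L)\<^sup>2 * real K / hn ^ (2 * L)) \<le> ennreal b" by (rule ennreal_leI)
        have "ennreal ((cmod (Psi_hat T n K L uu ww j - ft h j * ft f\<delta> (- j)))\<^sup>2)
          \<le> 2 * noise T n K h uu ww (\<lambda>z. Re (fchar j z)) + 2 * noise T n K h uu ww (\<lambda>z. Im (fchar j z))
           + 2 * (ennreal ((Cb * (1 + lnorm j) ^ L)\<^sup>2 * real K / hn ^ (2 * L)) * emeasure lborel T * nbr_mass T n K L q ww)"
          unfolding hn_def by (rule Psi_hat_error[OF T(1) Tb K0 n f i _ h Cb(1) Cb(2)[OF h(1)]]) (simp add: q_def)
        also have "\<dots> \<le> 2 * noise T n K h uu ww (\<lambda>z. Re (fchar j z)) + 2 * noise T n K h uu ww (\<lambda>z. Im (fchar j z))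
           + 2 * (ennreal b * emeasure lborel T * nbr_mass T n K L q ww)"
          by (intro add_left_mono mult_left_mono mult_right_mono bb) auto
        finally show "ennreal ((cmod (Psi_hat T n K L uu ww j - ft h j * ft f\<delta> (- j)))\<^sup>2) \<le> \<dots>" .
      qed
    qed
    have Gm': "G \<in> borel_measurable (PiM I (\<lambda>_. borel))"
      using Gm measurable_cong_sets[of P "PiM I (\<lambda>_. borel)" borel borel] dX sets_distr[of N "PiM I (\<lambda>_. borel)" X] by simp
    have "(\<integral>\<^sup>+\<omega>. (\<integral>\<^sup>+x\<in>cube. ennreal ((cmod (h_hat f\<delta> T n K L m (\<lambda>i. Us i \<omega>) (\<lambda>i. Zs i \<omega>) x - complex_of_real (h x)))\<^sup>2) \<partial>lborel) \<partial>N)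
      \<le> (\<integral>\<^sup>+\<omega>. G (X \<omega>) \<partial>N)" using ptw by (rule nn_integral_mono_AE)
    also have "\<dots> = (\<integral>\<^sup>+p. G p \<partial>P)" unfolding dX[symmetric] by (rule nn_integral_distr[OF Xm, symmetric]) (use Gm' in simp)
    also have "\<dots> \<le> ennreal (W * real (card F) * (4 * (s * (C3 / real n * E)) + 2 * (b * vT * E)) + t)" by (rule GI)
    also have "4 * (s * (C3 / real n * E)) + 2 * (b * vT * E) = a1 * (1 / real n) + a2 * (x ^ (2 * L) / hn ^ (2 * L))"
    proof -
      have e: "y ^ (2 * L) = (y ^ L)\<^sup>2" for y :: real unfolding power_mult[symmetric] by (simp only: mult.commute)
      have "b = Cb\<^sup>2 * D ^ (2 * L) * real K * (x ^ (2 * L) / hn ^ (2 * L))"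
        unfolding b_def e[of D] e[of x] by (simp add: power_mult_distrib)
      then show ?thesis unfolding a1_def a2_def by simp
    qed
    also have "ennreal (W * real (card F) * (a1 * (1 / real n) + a2 * (x ^ (2 * L) / hn ^ (2 * L))) + t)
      \<le> ennreal ((A * (a1 + a2) + C\<alpha>) * (x powr (2 * \<gamma> + real ?d) * (1 / real n + x ^ (2 * L) / hn ^ (2 * L)) + x powr (- 2 * \<alpha>)))"
      unfolding t_def
    proof (intro ennreal_leI rate_terms_le nonneg)
      have "W * real (card F) \<le> W * (2 ^ ?d * x ^ ?d)" unfolding F_def x_def using card_freq_box_le[of m, where 'd='d] W by (rule mult_left_mono)
      also have "\<dots> = A * x powr (2 * \<gamma> + real ?d)"
        using D x by (simp add: W_def A_def powr_mult powr_add powr_realpow)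
      finally show "W * real (card F) \<le> A * x powr (2 * \<gamma> + real ?d)" .
    qed (use hn x n0 in auto)
    finally show ?thesis unfolding x_def hn_def .
  qed
  show ?thesis
    by (rule exI[of _ "A * (a1 + a2) + C\<alpha>"], intro conjI allI impI, use nonneg in simp, rule main; blast)
qed

end

end

text \<open>With x = J n + 1 of order n^(1/\<tau>), the stochastic part x^(2\<gamma> + d) / n and
  the tail x^(-2\<alpha>) are both of the order of the rate. It remains to see that the polynomial
  bias is no larger than 1/n.\<close>

lemma rate_bound:
  fixes \<alpha> \<gamma> d \<tau> :: real and J :: "nat \<Rightarrow> nat"
  assumes \<tau>: "\<tau> = 2 * \<alpha> + 2 * \<gamma> + d" and pos: "\<alpha> > 0" "\<gamma> > 0" "d > 0"
    and L: "\<alpha> - 1 \<le> real L" and cond: "4 * (\<alpha> - 1) * (\<alpha> + \<gamma>) \<ge> d * \<tau>"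
    and J: "(\<lambda>n. real (J n)) \<in> \<Theta>(\<lambda>n. real n powr (1 / \<tau>))"
  shows "\<exists>C>0. \<forall>n\<ge>1. real (Suc (J n)) powr (2 * \<gamma> + d) *
      (1 / real n + real (Suc (J n)) ^ (2 * L) / (real n powr (1 / d)) ^ (2 * L)) + real (Suc (J n)) powr (- 2 * \<alpha>)
      \<le> C * real n powr (- 2 * \<alpha> / \<tau>)"
proof -
  have \<tau>0: "\<tau> > 0" using \<tau> pos by simp
  have "\<exists>c1>0. \<forall>\<^sub>F n in sequentially. norm (real (J n)) \<ge> c1 * norm (real n powr (1 / \<tau>))"
    using bigthetaD2[OF J] by (rule landau_omega.bigE) blast
  then obtain c1 where c1: "c1 > 0" "\<forall>\<^sub>F n in sequentially. norm (real (J n)) \<ge> c1 * norm (real n powr (1 / \<tau>))" by blast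
  have "\<exists>c2>0. \<forall>\<^sub>F n in sequentially. norm (real (J n)) \<le> c2 * norm (real n powr (1 / \<tau>))"
    using bigthetaD1[OF J] by (rule landau_o.bigE) blast
  then obtain c2 where c2: "c2 > 0" "\<forall>\<^sub>F n in sequentially. norm (real (J n)) \<le> c2 * norm (real n powr (1 / \<tau>))" by blast
  obtain n1 where n1: "\<And>n. n \<ge> n1 \<Longrightarrow> real (J n) \<ge> c1 * real n powr (1 / \<tau>)"
    using c1(2) unfolding eventually_sequentially by auto
  obtain n2 where n2: "\<And>n. n \<ge> n2 \<Longrightarrow> real (J n) \<le> c2 * real n powr (1 / \<tau>)"
    using c2(2) unfolding eventually_sequentially by auto
  define n0 where "n0 = max 1 (max n1 n2)"
  \<comment> \<open>The asymptotic bounds hold from some n0 on. The finitely many smaller n are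
    absorbed into a and b; below n0 the lower bound rests on \<open>Suc (J n)\<close> being at least
    1, even if J n = 0.\<close>
  define a where "a = min c1 (1 / real n0 powr (1 / \<tau>))"
  define s0 where "s0 = (\<Sum>i<n0. J i)"
  define b where "b = (c2 + 1) + real (Suc s0)"
  have a: "a > 0" using c1(1) by (simp add: a_def n0_def)
  have b: "b \<ge> 1" using c2(1) by (simp add: b_def)
  define C where "C = b powr (2 * \<gamma> + d) * (1 + b powr (2 * L)) + a powr (- 2 * \<alpha>)"
  have C: "C > 0" unfolding C_def using a b by (intro add_nonneg_pos mult_nonneg_nonneg) auto
  have "real (Suc (J n)) powr (2 * \<gamma> + d) *
      (1 / real n + real (Suc (J n)) ^ (2 * L) / (real n powr (1 / d)) ^ (2 * L)) + real (Suc (J n)) powr (- 2 * \<alpha>)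
      \<le> C * real n powr (- 2 * \<alpha> / \<tau>)" if n: "n \<ge> 1" for n
  proof -
    define x where "x = real (Suc (J n))"
    define y where "y = real n powr (1 / \<tau>)"
    have x1: "x \<ge> 1" by (simp add: x_def)
    have n': "real n \<ge> 1" using n by simp
    have y1: "y \<ge> 1" unfolding y_def using n' \<tau>0 by (intro ge_one_powr_ge_zero) auto
    have yp: "y powr e = real n powr (e / \<tau>)" for e by (simp add: y_def powr_powr)
    have lo: "a * y \<le> x"
    proof (cases "n \<ge> n0")
      case True
      have "a * y \<le> c1 * y" using y1 by (intro mult_right_mono) (auto simp: a_def)
      also have "\<dots> \<le> real (J n)" unfolding y_def by (rule n1) (use True in \<open>simp add: n0_def\<close>)
      finally show ?thesis by (simp add: x_def)
    next
      case False
      have "y \<le> real n0 powr (1 / \<tau>)" unfolding y_def using False \<tau>0 by (intro powr_mono2) auto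
      moreover have "real n0 powr (1 / \<tau>) > 0" by (simp add: n0_def)
      ultimately have "(1 / real n0 powr (1 / \<tau>)) * y \<le> 1" by (simp add: divide_le_eq)
      moreover have "a * y \<le> (1 / real n0 powr (1 / \<tau>)) * y" using y1 by (intro mult_right_mono) (auto simp: a_def)
      ultimately show ?thesis using x1 by linarith
    qed
    have hi: "x \<le> b * y"
    proof (cases "n \<ge> n0")
      case True
      have "real (J n) \<le> c2 * y" unfolding y_def by (rule n2) (use True in \<open>simp add: n0_def\<close>)
      then have "x \<le> (c2 + 1) * y" using y1 by (simp add: x_def algebra_simps)
      also have "\<dots> \<le> b * y" using y1 by (intro mult_right_mono) (auto simp: b_def)
      finally show ?thesis .
    next
      case False
      then have "J n \<le> s0" unfolding s0_def by (intro member_le_sum) auto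
      then have "x \<le> b" unfolding x_def b_def using c2(1) by simp
      also have "\<dots> \<le> b * y" using b y1 mult_left_mono[of 1 y b] by simp
      finally show ?thesis .
    qed
    have xp: "x powr e \<le> b powr e * real n powr (e / \<tau>)" if "e \<ge> 0" for e
    proof -
      have "x powr e \<le> (b * y) powr e" using hi x1 that by (intro powr_mono2) auto
      then show ?thesis using b y1 by (simp add: powr_mult yp)
    qed
    have t3: "x powr (- 2 * \<alpha>) \<le> a powr (- 2 * \<alpha>) * real n powr (- 2 * \<alpha> / \<tau>)"
    proof -
      have "x powr (- 2 * \<alpha>) \<le> (a * y) powr (- 2 * \<alpha>)" using lo a y1 pos by (intro powr_mono2') auto
      also have "\<dots> = a powr (- 2 * \<alpha>) * y powr (- 2 * \<alpha>)" using a y1 by (simp add: powr_mult)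
      finally show ?thesis unfolding yp .
    qed
    have t2: "x ^ (2 * L) / (real n powr (1 / d)) ^ (2 * L) \<le> b powr (2 * L) * (1 / real n)"
    proof -
      have "(real n powr (1 / d)) ^ (2 * L) = real n powr (real (2 * L) / d)"
        using n' by (subst powr_realpow[symmetric]) (auto simp: powr_powr)
      moreover have "x ^ (2 * L) = x powr (2 * L)" using x1 by (subst powr_realpow) auto
      moreover have "x powr (2 * L) / real n powr (real (2 * L) / d) \<le> b powr (2 * L) * real n powr (real (2 * L) / \<tau>) / real n powr (real (2 * L) / d)"
        by (intro divide_right_mono xp) auto
      moreover have "real n powr (real (2 * L) / \<tau>) / real n powr (real (2 * L) / d) = real n powr (real (2 * L) / \<tau> - real (2 * L) / d)"
        by (simp add: powr_diff)
      \<comment> \<open>The assumed inequality at work: with \<tau> - d = 2 * (\<alpha> + \<gamma>)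
        and L at least \<alpha> - 1 it gives d * \<tau> at most 2 * L * (\<tau> - d), which says
        that the exponent is at most -1.\<close>
      moreover have "real n powr (real (2 * L) / \<tau> - real (2 * L) / d) \<le> real n powr (- 1)"
      proof (rule powr_mono[OF _ n'])
        have "d * \<tau> \<le> 4 * (\<alpha> - 1) * (\<alpha> + \<gamma>)" by (rule cond)
        also have "\<dots> \<le> 4 * real L * (\<alpha> + \<gamma>)" using L pos by (intro mult_right_mono) auto
        also have "\<dots> = 2 * real L * (\<tau> - d)" by (simp add: \<tau> algebra_simps)
        finally show "real (2 * L) / \<tau> - real (2 * L) / d \<le> - 1" using \<tau>0 pos by (simp add: field_simps)
      qed
      moreover have "real n powr (- 1) = 1 / real n" using n' by (simp add: powr_minus_divide)
      ultimately show ?thesis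
        by (metis (no_types, lifting) mult_left_mono order_trans powr_ge_zero times_divide_eq_right)
    qed
    have "x powr (2 * \<gamma> + d) * (1 / real n + x ^ (2 * L) / (real n powr (1 / d)) ^ (2 * L))
       \<le> (b powr (2 * \<gamma> + d) * real n powr ((2 * \<gamma> + d) / \<tau>)) * (1 / real n + b powr (2 * L) * (1 / real n))"
      using t2 pos x1 by (intro mult_mono xp add_mono) auto
    also have "\<dots> = b powr (2 * \<gamma> + d) * (1 + b powr (2 * L)) * (real n powr ((2 * \<gamma> + d) / \<tau>) * (1 / real n))"
    proof -
      have "(p * r) * (i + q * i) = p * (1 + q) * (r * i)" for p q r i :: real by (simp add: algebra_simps)
      then show ?thesis .
    qed
    also have "real n powr ((2 * \<gamma> + d) / \<tau>) * (1 / real n) = real n powr ((2 * \<gamma> + d) / \<tau> - 1)"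
      using n' by (simp add: powr_diff)
    also have "(2 * \<gamma> + d) / \<tau> - 1 = - 2 * \<alpha> / \<tau>" 
    proof -
      have "2 * \<gamma> + d = \<tau> - 2 * \<alpha>" by (simp add: \<tau>)
      then show ?thesis using \<tau>0 by (simp add: diff_divide_distrib)
    qed
    finally show ?thesis using t3 unfolding C_def x_def[symmetric] by (simp add: distrib_right)
  qed
  then show ?thesis using C by blast
qed

text \<open>For d at least 2 the summand of index l is at least 2 * l, since its binomial
  coefficient is at least l + 1. This converts the assumed size of K into the multiple of L that the
  union bound needs.\<close>

lemma degree_sum_ge:
  assumes d: "d \<ge> 2"
  shows "L * (L + 1) \<le> degree_sum d L"
proof (induction L)
  case (Suc L)
  have "2 * Suc L \<le> Suc L * ((d + Suc L - 1) choose Suc L)"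
  proof -
    have "(Suc (Suc L)) choose Suc L \<le> (d + Suc L - 1) choose Suc L" using d by (intro binomial_right_mono) auto
    moreover have "(Suc (Suc L)) choose Suc L = Suc (Suc L)" using binomial_Suc_n[of "Suc L"] by simp
    ultimately have "2 \<le> (d + Suc L - 1) choose Suc L" by linarith
    then show ?thesis by (metis mult.commute mult_le_mono2)
  qed
  moreover have "degree_sum d (Suc L) = degree_sum d L + Suc L * ((d + Suc L - 1) choose Suc L)"
    by (simp add: degree_sum_def)
  ultimately show ?case using Suc.IH by (simp add: algebra_simps)
qed (simp add: degree_sum_def)

lemma card_multi_indices_ge_2:
  assumes "L \<ge> 1"
  shows "card (multi_indices L :: (nat ^ 'd) set) \<ge> 2"
proof -
  fix k :: 'd
  define e :: "nat ^ 'd" where "e = axis k 1"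
  have "e \<noteq> 0" by (simp add: e_def axis_eq_0_iff)
  moreover have "e \<in> multi_indices L"
    using assms by (simp add: multi_indices_def e_def axis_def if_distrib cong: if_cong)
  ultimately have "{0, e} \<subseteq> multi_indices L" "card {0, e} = 2"
    using zero_multi_indices by simp_all
  then show ?thesis using card_mono[OF finite_multi_indices, of "{0, e}" L] by simp
qed

lemma distributed_integrable_density:
  assumes M: "prob_space M" and f: "\<And>x. 0 \<le> f x" and d: "distributed M lborel X (\<lambda>x. ennreal (f x))"
  shows "integrable lborel f" "(LINT x|lborel. f x) = 1"
proof -
  interpret prob_space M by (rule M)
  have m: "(\<lambda>x. ennreal (f x)) \<in> borel_measurable lborel" using d by (simp add: distributed_def)
  have fm: "f \<in> borel_measurable lborel"
  proof -
    have "(\<lambda>x. enn2real (ennreal (f x))) \<in> borel_measurable lborel" using m by measurable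
    then show ?thesis by (simp add: f)
  qed
  have "X \<in> measurable M lborel" using d by (simp add: distributed_def)
  then have "prob_space (distr M lborel X)" by (rule prob_space_distr)
  then have "prob_space (density lborel (\<lambda>x. ennreal (f x)))" using d by (simp add: distributed_def)
  then have "emeasure (density lborel (\<lambda>x. ennreal (f x))) UNIV = 1"
    using prob_space.emeasure_space_1 by fastforce
  then have 1: "(\<integral>\<^sup>+x. ennreal (f x) \<partial>lborel) = 1" using m by (simp add: emeasure_density)
  show "integrable lborel f" by (rule integrableI_nonneg[OF fm]) (simp_all add: f 1)
  show "(LINT x|lborel. f x) = 1" using fm by (subst integral_eq_nn_integral) (simp_all add: f 1)
qed

theorem theorem4:
  fixes M :: "'a measure"
    and Z \<delta> :: "'a \<Rightarrow> real ^ 'd" and \<epsilon> :: "'a \<Rightarrow> real"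
    and fZ f\<delta> :: "real ^ 'd \<Rightarrow> real"
    and H S Sstar :: "(real ^ 'd) set"
    and \<alpha> C\<alpha> \<gamma> c\<delta> C\<delta> :: real
    and Jn :: "nat \<Rightarrow> nat" and K L :: nat
  assumes dim: "CARD('d) \<ge> 2"
    and model: "berkson_errors M Z \<delta> \<epsilon> fZ f\<delta>"
    and H: "compact H" "H \<subseteq> box (\<chi> k. - pi) (\<chi> k. pi)" "supp f\<delta> \<subseteq> H"
    and S: "supp fZ = S" "compact S" "convex S"
    and fZ_bounds: "\<exists>\<rho>>0. \<forall>z\<in>S. \<rho> \<le> fZ z" "\<exists>\<rho>. \<forall>z\<in>S. fZ z \<le> \<rho>"
    and Sstar: "compact Sstar" "Sstar \<subseteq> interior S" "\<exists>\<rho>>0. \<forall>z\<in>Sstar. ball z \<rho> \<subseteq> S"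
    and smooth: "0 < c\<delta>" "c\<delta> < C\<delta>" "\<gamma> > real CARD('d) / 2" "ordinary_smooth c\<delta> C\<delta> \<gamma> f\<delta>"
    and \<alpha>: "\<alpha> > 0" "C\<alpha> > 0"
      "4 * (\<alpha> - 1) * (\<alpha> + \<gamma>) \<ge> real CARD('d) * (2 * \<alpha> + 2 * \<gamma> + real CARD('d))"
    and Jn: "(\<lambda>n. real (Jn n)) \<in> \<Theta>(\<lambda>n. real n powr (1 / (2 * \<alpha> + 2 * \<gamma> + real CARD('d))))"
    and L: "L = nat (\<lceil>\<alpha>\<rceil> - 1)"
    and K: "K \<ge> 2 + (2 * degree_sum CARD('d) L + 1) * card (multi_indices L :: (nat ^ 'd) set)"
  shows "\<exists>C>0. \<forall>n\<ge>K. \<forall>h :: real ^ 'd \<Rightarrow> real.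
      integrable lborel h \<and> supp h \<subseteq> H \<and> supp (conv h (\<lambda>x. f\<delta> (- x))) \<subseteq> Sstar \<and> sobolev \<alpha> C\<alpha> h \<longrightarrow>
      (\<forall>(N :: 'b measure) Us Zs.
        iid_copies N n Us Zs M (\<lambda>\<omega>. h (Z \<omega> + \<delta> \<omega>) + \<epsilon> \<omega>) Z \<longrightarrow>
        (\<integral>\<^sup>+\<omega>. (\<integral>\<^sup>+x\<in>cbox (\<chi> k. - pi) (\<chi> k. pi).
            ennreal ((cmod (h_hat f\<delta> Sstar n K L (Jn n) (\<lambda>i. Us i \<omega>) (\<lambda>i. Zs i \<omega>) x
                             - complex_of_real (h x)))\<^sup>2) \<partial>lborel) \<partial>N)
          \<le> ennreal (C * real n powr (- 2 * \<alpha> / (2 * \<alpha> + 2 * \<gamma> + real CARD('d)))))"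
proof -
  define d where "d = real CARD('d)"
  have d: "d \<ge> 2" using dim by (simp add: d_def)
  note assms_\<alpha> = \<alpha>
  have \<gamma>: "\<gamma> > d / 2" using smooth(3) by (simp add: d_def)
  \<comment> \<open>Dropping d^2 from the condition and dividing by \<alpha> + \<gamma> leaves 4 *
    (\<alpha> - 1) > 2 * d.\<close>
  have \<alpha>2: "2 * \<alpha> > d + 2"
  proof -
    have p: "\<alpha> + \<gamma> > 0" using \<alpha>(1) \<gamma> d by simp
    have "2 * d * (\<alpha> + \<gamma>) + d * d \<le> 4 * (\<alpha> - 1) * (\<alpha> + \<gamma>)" using \<alpha>(3) by (simp add: d_def algebra_simps)
    moreover have "d * d > 0" using d by simp
    ultimately have "2 * d * (\<alpha> + \<gamma>) < 4 * (\<alpha> - 1) * (\<alpha> + \<gamma>)" by linarith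
    then have "2 * d < 4 * (\<alpha> - 1)" using p by (rule mult_right_less_imp_less[OF _ less_imp_le])
    then show ?thesis by simp
  qed
  have ceil: "\<lceil>\<alpha>\<rceil> \<ge> 3" using \<alpha>2 d by (simp add: le_ceiling_iff)
  have Lr: "real L = real_of_int \<lceil>\<alpha>\<rceil> - 1" using ceil by (simp add: L)
  have L2: "L \<ge> 2" using Lr ceil by linarith
  have L\<alpha>: "real L \<le> \<alpha>" "\<alpha> - 1 \<le> real L" using Lr ceiling_correct[of \<alpha>] by linarith+
  define Nc where "Nc = card (multi_indices L :: (nat ^ 'd) set)"
  have N2: "Nc \<ge> 2" unfolding Nc_def by (rule card_multi_indices_ge_2) (use L2 in simp)
  \<comment> \<open>L at least 2 gives 3 * L at most L * (L + 1), hence 6 * L at most twice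
    \<open>degree_sum\<close>.\<close>
  have K6: "K \<ge> 6 * L * Nc"
  proof -
    have "3 * L \<le> L * (L + 1)" using L2 by simp
    also have "\<dots> \<le> degree_sum CARD('d) L" by (rule degree_sum_ge[OF dim])
    finally have "6 * L * Nc \<le> (2 * degree_sum CARD('d) L + 1) * Nc" by (intro mult_right_mono) auto
    then show ?thesis using K by (simp add: Nc_def)
  qed
  have pM: "prob_space M" using model by (simp add: berkson_errors_def)
  have f\<delta>: "\<And>x. 0 \<le> f\<delta> x" "distributed M lborel \<delta> (\<lambda>x. ennreal (f\<delta> x))" using model by (simp_all add: berkson_errors_def)
  interpret berkson_fourier f\<delta> H \<alpha> C\<alpha> \<gamma> c\<delta> C\<delta> L
  proof
    show "integrable lborel f\<delta>" "(LINT x|lborel. f\<delta> x) = 1" by (rule distributed_integrable_density[OF pM f\<delta>])+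
  qed (use H smooth \<alpha> \<alpha>2 L\<alpha> L2 f\<delta>(1) in \<open>simp_all add: open_cube_def d_def\<close>)
  obtain ra where ra: "ra > 0" "\<And>z. z \<in> S \<Longrightarrow> ra \<le> fZ z" using fZ_bounds(1) by blast
  obtain r where r: "\<And>z. z \<in> S \<Longrightarrow> fZ z \<le> r" using fZ_bounds(2) by blast
  obtain \<rho> where \<rho>: "\<rho> > 0" "\<And>z. z \<in> Sstar \<Longrightarrow> ball z \<rho> \<subseteq> S" using Sstar(3) by blast
  have rb: "fZ x \<le> max r 0 * indicator S x" for x
  proof (cases "x \<in> S")
    case True
    then show ?thesis using r[OF True] by simp
  next
    case False
    then have "fZ x = 0" using S(1) closure_subset[of "{x. fZ x \<noteq> 0}"] unfolding supp_def by blast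
    then show ?thesis by simp
  qed
  have Ssets: "S \<in> sets borel" "Sstar \<in> sets borel" using S(2) Sstar(1) by (simp_all add: borel_compact)
  have sub: "Sstar \<subseteq> S" using Sstar(2) interior_subset by (rule order_trans)
  \<comment> \<open>The estimator integrates over \<open>Sstar\<close> only; that g vanishes outside
    it follows from the assumption on the support of the convolution.\<close>
  define vanish where "vanish h \<longleftrightarrow> (\<forall>z. z \<notin> Sstar \<longrightarrow> reg h z = 0)" for h
  obtain C where C: "C \<ge> 0" "\<And>n h m (N :: 'b measure) Us Zs. n \<ge> K \<Longrightarrow> hclass h \<Longrightarrow> vanish h \<Longrightarrow>
      iid_copies N n Us Zs M (\<lambda>\<omega>. h (Z \<omega> + \<delta> \<omega>) + \<epsilon> \<omega>) Z \<Longrightarrow>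
      (\<integral>\<^sup>+\<omega>. (\<integral>\<^sup>+x\<in>cube. ennreal ((cmod (h_hat f\<delta> Sstar n K L m (\<lambda>i. Us i \<omega>) (\<lambda>i. Zs i \<omega>) x - complex_of_real (h x)))\<^sup>2) \<partial>lborel) \<partial>N)
       \<le> ennreal (C * (real (Suc m) powr (2 * \<gamma> + real CARD('d)) *
            (1 / real n + real (Suc m) ^ (2 * L) / (real n powr (1 / real CARD('d))) ^ (2 * L)) + real (Suc m) powr (- 2 * \<alpha>)))"
  proof -
    from risk_bound[OF model K6[unfolded Nc_def] N2[unfolded Nc_def] _ rb ra Ssets(1) compact_imp_bounded[OF S(2)] Ssets(2) sub \<rho>, where 'b='b]
    have "\<exists>C\<ge>0. \<forall>n\<ge>K. \<forall>h m. hclass h \<longrightarrow> vanish h \<longrightarrow>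
      (\<forall>(N :: 'b measure) Us Zs. iid_copies N n Us Zs M (\<lambda>\<omega>. h (Z \<omega> + \<delta> \<omega>) + \<epsilon> \<omega>) Z \<longrightarrow>
      (\<integral>\<^sup>+\<omega>. (\<integral>\<^sup>+x\<in>cube. ennreal ((cmod (h_hat f\<delta> Sstar n K L m (\<lambda>i. Us i \<omega>) (\<lambda>i. Zs i \<omega>) x - complex_of_real (h x)))\<^sup>2) \<partial>lborel) \<partial>N)
       \<le> ennreal (C * (real (Suc m) powr (2 * \<gamma> + real CARD('d)) *
            (1 / real n + real (Suc m) ^ (2 * L) / (real n powr (1 / real CARD('d))) ^ (2 * L)) + real (Suc m) powr (- 2 * \<alpha>))))"
      unfolding vanish_def by simp
    then show thesis
      by (elim exE conjE) (rule that, assumption, elim allE impE, assumption+)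
  qed
  obtain C' where C': "C' > 0" "\<And>n. n \<ge> 1 \<Longrightarrow> real (Suc (Jn n)) powr (2 * \<gamma> + d) *
      (1 / real n + real (Suc (Jn n)) ^ (2 * L) / (real n powr (1 / d)) ^ (2 * L)) + real (Suc (Jn n)) powr (- 2 * \<alpha>)
      \<le> C' * real n powr (- 2 * \<alpha> / (2 * \<alpha> + 2 * \<gamma> + d))"
    using rate_bound[OF refl assms_\<alpha>(1) _ _ L\<alpha>(2), of \<gamma> d Jn] \<gamma> d assms_\<alpha>(3) Jn unfolding d_def by auto
  \<comment> \<open>C + 1 in place of C, since the risk bound provides only a nonnegative
    constant.\<close>
  show ?thesis
  proof (rule exI[of _ "(C + 1) * C'"], intro conjI allI impI)
    show "0 < (C + 1) * C'" using C(1) C'(1) by simp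
    fix n and h :: "real ^ 'd \<Rightarrow> real" and N :: "'b measure" and Us Zs
    assume n: "K \<le> n" and h: "integrable lborel h \<and> supp h \<subseteq> H \<and> supp (conv h (\<lambda>x. f\<delta> (- x))) \<subseteq> Sstar \<and> sobolev \<alpha> C\<alpha> h"
      and iid: "iid_copies N n Us Zs M (\<lambda>\<omega>. h (Z \<omega> + \<delta> \<omega>) + \<epsilon> \<omega>) Z"
    have n1: "n \<ge> 1" using n K by simp
    have hc: "hclass h" using h by (simp add: hclass_def)
    have hz: "vanish h"
      using h closure_subset[of "{x. conv h (\<lambda>x. f\<delta> (- x)) x \<noteq> 0}"] unfolding supp_def reg_def vanish_def by blast
    define R where "R = real (Suc (Jn n)) powr (2 * \<gamma> + d) *
      (1 / real n + real (Suc (Jn n)) ^ (2 * L) / (real n powr (1 / d)) ^ (2 * L)) + real (Suc (Jn n)) powr (- 2 * \<alpha>)"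
    have R: "R \<ge> 0" unfolding R_def by (intro add_nonneg_nonneg mult_nonneg_nonneg divide_nonneg_nonneg) auto
    have "C * R \<le> (C + 1) * (C' * real n powr (- 2 * \<alpha> / (2 * \<alpha> + 2 * \<gamma> + d)))"
      using C(1) R C'(2)[OF n1] unfolding R_def[symmetric] by (intro mult_mono) auto
    then have "ennreal (C * R) \<le> ennreal ((C + 1) * C' * real n powr (- 2 * \<alpha> / (2 * \<alpha> + 2 * \<gamma> + d)))"
      by (intro ennreal_leI) (simp add: mult.assoc)
    from order_trans[OF C(2)[OF n hc hz iid, of "Jn n"] this[unfolded R_def d_def]]
    show "(\<integral>\<^sup>+\<omega>. (\<integral>\<^sup>+x\<in>cbox (\<chi> k. - pi) (\<chi> k. pi).
            ennreal ((cmod (h_hat f\<delta> Sstar n K L (Jn n) (\<lambda>i. Us i \<omega>) (\<lambda>i. Zs i \<omega>) x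
                             - complex_of_real (h x)))\<^sup>2) \<partial>lborel) \<partial>N)
          \<le> ennreal ((C + 1) * C' * real n powr (- 2 * \<alpha> / (2 * \<alpha> + 2 * \<gamma> + real CARD('d))))"
      unfolding cube_def .
  qed
qed

end
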